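(* Let $n\ge 3$ and $1\le k\le n$, let $\Omega\subset\mathbb{R}^n$ be a bounded smooth domain, and let $u\in C^\infty(\Omega)$ be the (unique) solution of $\sigma_k(A(u))=(n-1)^k\binom{n}{k}e^{2ku}$ in $\Omega$, $u=\infty$ on $\partial\Omega$, with $A(u)\in\Gamma_k^+$ in $\Omega$. Then there exist smooth functions $c_1,\dots,c_{n-1}$ and $c_{n,1}$ on $\partial\Omega$ and positive constants $C$ and $\delta_2$, depending only on $\Omega$, $n$ and $k$, such that $$\left|u+\log d-c_1d-\cdots-c_{n-1}d^{n-1}-c_{n,1}d^n\log d\right|\le C d^n\quad\text{in } D_{\delta_2}.$$
   Context: For a $C^2$ function $u$ on $\Omega$, $A(u)$ is the symmetric $n\times n$ matrix $$A(u)=(n-2)\nabla^2u+\Delta u\, I_{n\times n}+(n-2)\left[|\nabla u|^2I_{n\times n}-\nabla u\otimes\nabla u\right],$$ which equals $-\mathrm{Ric}(e^{2u}g_0)$ for the Euclidean metric $g_0$. $\sigma_k(A)$ is the $k$-th elementary symmetric polynomial of the eigenvalues of the symmetric matrix $A$, and $\Gamma_k^+$ is the connected component of $\{\sigma_k>0\}$ containing the positive definite matrices. The condition $u=\infty$ on $\partial\Omega$ means $u(x)\to+\infty$ as $x\to\partial\Omega$. It is known (Gursky–Streets–Warren) that a unique solution $u\in C^\infty(\Omega)$ with $A(u)\in\Gamma_k^+$ exists. $d$ denotes the distance function to $\partial\Omega$ in $\Omega$, and $D_\delta=\{x\in\Omega: d(x)\le\delta\}$. For $\delta$ small, $d$ is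 smooth on $D_\delta$ and points of $D_\delta$ are written in principal coordinates $(x',d)$, where $x'\in\partial\Omega$ is the nearest boundary point; a function on $\partial\Omega$ is regarded as a function on $D_\delta$ depending only on $x'$. *)

theory Defs
  imports "HOL-Analysis.Analysis" "HOL-Computational_Algebra.Polynomial"
begin

section \<open>Smooth functions and smooth domains\<close>

definition partial_deriv :: "'n::finite \<Rightarrow> (real^'n \<Rightarrow> real) \<Rightarrow> real^'n \<Rightarrow> real" where
  "partial_deriv i f x = frechet_derivative f (at x) (axis i 1)"

text \<open>Only meant for open \<open>S\<close>.\<close>
primrec Ck_on :: "nat \<Rightarrow> (real^'n::finite \<Rightarrow> real) \<Rightarrow> (real^'n) set \<Rightarrow> bool" where
  "Ck_on 0 f S \<longleftrightarrow> continuous_on S f"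
| "Ck_on (Suc m) f S \<longleftrightarrow>
     (\<forall>x\<in>S. f differentiable (at x)) \<and> (\<forall>i. Ck_on m (partial_deriv i f) S)"

definition smooth_on_open :: "(real^'n::finite \<Rightarrow> real) \<Rightarrow> (real^'n) set \<Rightarrow> bool" where
  "smooth_on_open f S \<longleftrightarrow> open S \<and> (\<forall>m. Ck_on m f S)"

text \<open>Smoothness on an arbitrary subset of Euclidean space, used for the hypersurface
  \<open>frontier \<Omega>\<close>: locally the function is the restriction of a smooth function
  on an open set.\<close>
definition smooth_on_subset :: "(real^'n::finite \<Rightarrow> real) \<Rightarrow> (real^'n) set \<Rightarrow> bool" where
  "smooth_on_subset f S \<longleftrightarrow>
     (\<forall>p\<in>S. \<exists>U g. p \<in> U \<and> smooth_on_open g U \<and> (\<forall>x\<in>S \<inter> U. f x = g x))"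

definition grad :: "(real^'n::finite \<Rightarrow> real) \<Rightarrow> real^'n \<Rightarrow> real^'n" where
  "grad f x = (\<chi> i. partial_deriv i f x)"

text \<open>Smoothness of the boundary is expressed by local defining functions; since \<open>\<Omega>\<close> is
  open, the condition forces \<open>frontier \<Omega> \<inter> U = {x \<in> U. \<rho> x = 0}\<close>.\<close>
definition bounded_smooth_domain :: "(real^'n::finite) set \<Rightarrow> bool" where
  "bounded_smooth_domain \<Omega> \<longleftrightarrow>
     open \<Omega> \<and> connected \<Omega> \<and> \<Omega> \<noteq> {} \<and> bounded \<Omega> \<and>
     (\<forall>p\<in>frontier \<Omega>. \<exists>U \<rho>. p \<in> U \<and> smooth_on_open \<rho> U \<and>
        (\<forall>x\<in>U. grad \<rho> x \<noteq> 0) \<and> \<Omega> \<inter> U = {x \<in> U. \<rho> x < 0})"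

section \<open>Elementary symmetric functions of eigenvalues\<close>

definition charpoly :: "real^'n^'n::finite \<Rightarrow> real poly" where
  "charpoly A = det (\<chi> i j. (if i = j then [:0, 1:] else 0) - [:A $ i $ j:])"

text \<open>The real eigenvalues, repeated according to multiplicity. For symmetric \<open>A\<close> this
  list has length \<open>CARD('n)\<close>.\<close>
definition eigvals :: "real^'n^'n::finite \<Rightarrow> real list" where
  "eigvals A = sorted_list_of_multiset (proots (charpoly A))"

definition elem_sym :: "nat \<Rightarrow> real list \<Rightarrow> real" where
  "elem_sym k xs = (\<Sum>I | I \<subseteq> {..<length xs} \<and> card I = k. \<Prod>i\<in>I. xs ! i)"

definition sigma :: "nat \<Rightarrow> real^'n^'n::finite \<Rightarrow> real" where
  "sigma k A = elem_sym k (eigvals A)"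

definition sym_matrices :: "(real^'n^'n::finite) set" where
  "sym_matrices = {A. transpose A = A}"

definition posdef_matrices :: "(real^'n^'n::finite) set" where
  "posdef_matrices = {A \<in> sym_matrices. \<forall>v. v \<noteq> 0 \<longrightarrow> 0 < v \<bullet> (A *v v)}"

text \<open>Exactly one component contains the positive definite matrices, as these form a
  nonempty convex set on which \<open>sigma k\<close> is positive for \<open>k \<le> CARD('n)\<close>; the union
  merely selects that component.\<close>
definition Gamma_plus :: "nat \<Rightarrow> (real^'n^'n::finite) set" where
  "Gamma_plus k =
     \<Union> {C \<in> components {A \<in> sym_matrices. sigma k A > 0}. posdef_matrices \<subseteq> C}"

section \<open>The boundary value problem\<close>

definition hess :: "(real^'n::finite \<Rightarrow> real) \<Rightarrow> real^'n \<Rightarrow> real^'n^'n" where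
  "hess f x = (\<chi> i j. partial_deriv i (partial_deriv j f) x)"

definition laplacian :: "(real^'n::finite \<Rightarrow> real) \<Rightarrow> real^'n \<Rightarrow> real" where
  "laplacian f x = trace (hess f x)"

definition outer :: "real^'n::finite \<Rightarrow> real^'n \<Rightarrow> real^'n^'n" where
  "outer v w = (\<chi> i j. v $ i * w $ j)"

text \<open>This is \<open>- Ric (exp (2 u) g\<^sub>0)\<close> for the Euclidean metric \<open>g\<^sub>0\<close>.\<close>
definition A_of :: "(real^'n::finite \<Rightarrow> real) \<Rightarrow> real^'n \<Rightarrow> real^'n^'n" where
  "A_of u x =
     (real CARD('n) - 2) *\<^sub>R hess u x + laplacian u x *\<^sub>R mat 1
     + (real CARD('n) - 2) *\<^sub>R ((norm (grad u x))\<^sup>2 *\<^sub>R mat 1 - outer (grad u x) (grad u x))"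

definition is_solution :: "nat \<Rightarrow> (real^'n::finite) set \<Rightarrow> (real^'n \<Rightarrow> real) \<Rightarrow> bool" where
  "is_solution k \<Omega> u \<longleftrightarrow>
     smooth_on_open u \<Omega> \<and>
     (\<forall>x\<in>\<Omega>. A_of u x \<in> Gamma_plus k) \<and>
     (\<forall>x\<in>\<Omega>. sigma k (A_of u x) =
        (real CARD('n) - 1) ^ k * real (CARD('n) choose k) * exp (2 * real k * u x)) \<and>
     (\<forall>p\<in>frontier \<Omega>. filterlim u at_top (at p within \<Omega>))"

section \<open>Distance to the boundary\<close>

definition bdist :: "(real^'n::finite) set \<Rightarrow> real^'n \<Rightarrow> real" where
  "bdist \<Omega> x = infdist x (frontier \<Omega>)"

definition collar :: "(real^'n::finite) set \<Rightarrow> real \<Rightarrow> (real^'n) set" where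
  "collar \<Omega> \<delta> = {x \<in> \<Omega>. bdist \<Omega> x \<le> \<delta>}"

definition unique_nearest :: "(real^'n::finite) set \<Rightarrow> real^'n \<Rightarrow> bool" where
  "unique_nearest \<Omega> x \<longleftrightarrow> (\<exists>!y. y \<in> frontier \<Omega> \<and> dist x y = bdist \<Omega> x)"

text \<open>The coordinate \<open>x'\<close> in \<open>(x', d)\<close>; meaningful where \<open>unique_nearest \<Omega> x\<close> holds.\<close>
definition bproj :: "(real^'n::finite) set \<Rightarrow> real^'n \<Rightarrow> real^'n" where
  "bproj \<Omega> x = closest_point (frontier \<Omega>) x"

end

theory Submission
  imports Defs "HOL-Computational_Algebra.Fundamental_Theorem_Algebra"
begin

text \<open>Near the boundary write \<open>u = \<phi> - log s\<close> with \<open>s\<close> the (smooth) distance to the boundary. The matrix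
  \<open>s\<^sup>2 A(\<phi> - log s)\<close> is then \<open>(n - 1) I\<close> plus a term that is polynomial in the scaled 2-jet of \<open>\<phi>\<close>, and the
  linearised equation is the Fuchsian equation \<open>t\<^sup>2 g'' - (n - 2) t g' - n g = 0\<close> with indicial roots \<open>n\<close> and \<open>-1\<close>.
  So \<open>c\<^sub>1, \<dots>, c\<^sub>n\<^sub>-\<^sub>1\<close> are determined successively by the normal derivatives of the residual at the boundary, and at the
  resonant order \<open>n\<close> the residual is absorbed by \<open>d\<^sup>n log d\<close>. Adding \<open>\<plusminus> M (d\<^sup>n - d\<^sup>n\<^sup>+\<^sup>1\<^sup>/\<^sup>2)\<close> to the
  resulting approximate solution gives strict super- and subsolutions. Comparison with them is legitimate because every \<open>u\<close>
  satisfies \<open>|u + log d| \<le> C d\<close>, by comparison with the hyperbolic metrics of interior and exterior touching balls,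
  and because \<open>\<sigma>\<^sub>k\<close> is monotone on \<open>\<Gamma>\<^sub>k\<^sup>+\<close>.\<close>

subsection \<open>Calculus of smooth functions\<close>

text \<open>Membership in \<open>Gamma_plus\<close> becomes usable only once it is turned into
  inequalities. It is placed in the cone where \<open>\<sigma>_0, ..., \<sigma>_k\<close> are
  positive, and real-rootedness of the derivatives of det (X I + A) then gives monotonicity without
  differentiating eigenvalues. The distance is treated without an inverse function theorem: touching
  balls of uniform radius squeeze the signed distance between two radial functions, so its gradient
  is Lipschitz, and a bootstrap between it and the foot point gives smoothness. The sign matters
  because the scaled residual of a smooth function is then smooth across the boundary and has a
  normal Taylor expansion there. The resonant power d^n is annihilated by the linearised operator
  and cannot serve as a strict barrier alone; subtracting d^(n+1/2) creates a signed residual of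
  that order, which dominates the error d^(n+1) |log d|. On the inner edge d = \<delta> only the
  linear bound C d is known, so M must have size \<delta>^(1-n). The error constants are therefore
  fixed before M, under the sole restriction that M d^n = O(d).\<close>

lemma has_derivative_grad:
  fixes f :: "real^'n::finite \<Rightarrow> real"
  assumes "f differentiable (at x)"
  shows "(f has_derivative (\<lambda>h. grad f x \<bullet> h)) (at x)"
proof -
  let ?F = "frechet_derivative f (at x)"
  have F: "(f has_derivative ?F) (at x)"
    using assms frechet_derivative_works by blast
  have lin: "linear ?F" using assms linear_frechet_derivative by blast
  have "?F h = grad f x \<bullet> h" for h
  proof -
    have "?F h = ?F (\<Sum>i\<in>UNIV. (h $ i) *\<^sub>R axis i 1)"
      using basis_expansion[of h] by (simp add: scalar_mult_eq_scaleR)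
    also have "\<dots> = (\<Sum>i\<in>UNIV. h $ i * ?F (axis i 1))"
      by (simp add: linear_sum[OF lin] linear_scale[OF lin])
    finally show ?thesis
      by (simp add: grad_def partial_deriv_def inner_vec_def mult.commute)
  qed
  then have "?F = (\<lambda>h. grad f x \<bullet> h)" by auto
  then show ?thesis using F by metis
qed

lemma has_derivative_imp_partial_deriv:
  assumes "(f has_derivative f') (at x)"
  shows "partial_deriv i f x = f' (axis i 1)"
  unfolding partial_deriv_def using frechet_derivative_at[OF assms] by simp

lemma has_derivative_imp_grad:
  fixes f :: "real^'n::finite \<Rightarrow> real"
  assumes "(f has_derivative (\<lambda>h. p \<bullet> h)) (at x)"
  shows "grad f x = p"
  by (simp add: vec_eq_iff grad_def has_derivative_imp_partial_deriv[OF assms] inner_axis)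

lemma partial_deriv_cong_open:
  assumes "open S" "x \<in> S" "\<And>y. y \<in> S \<Longrightarrow> f y = g y"
  shows "partial_deriv i f x = partial_deriv i g x"
proof -
  have "(f has_derivative D) (at x) \<longleftrightarrow> (g has_derivative D) (at x)" for D
    using assms has_derivative_transform_within_open by (smt (verit, best))
  then show ?thesis by (simp add: partial_deriv_def frechet_derivative_def)
qed

lemma differentiable_cong_open:
  assumes "open S" "x \<in> S" "\<And>y. y \<in> S \<Longrightarrow> f y = g y"
  shows "f differentiable (at x) \<longleftrightarrow> g differentiable (at x)"
  unfolding differentiable_def
  using assms has_derivative_transform_within_open by (smt (verit, best))

text \<open>\<open>partial_deriv\<close> is total, but the rules for sums, products and compositions
  hold only at points of \<open>S\<close>. With this congruence an inductive step may replace a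
  partial derivative by its formula on the open set.\<close>

lemma Ck_on_cong:
  assumes "open S" "\<And>y. y \<in> S \<Longrightarrow> f y = g y"
  shows "Ck_on m f S \<longleftrightarrow> Ck_on m g S"
  using assms
proof (induction m arbitrary: f g)
  case 0 then show ?case by (simp cong: continuous_on_cong)
next
  case (Suc m)
  have "Ck_on m (partial_deriv i f) S = Ck_on m (partial_deriv i g) S" for i
    using partial_deriv_cong_open[OF Suc.prems(1) _ Suc.prems(2)] by (intro Suc.IH Suc.prems) auto
  then show ?case using differentiable_cong_open[OF Suc.prems(1) _ Suc.prems(2)] by simp
qed

lemma Ck_on_congI:
  assumes "open S" "Ck_on m g S" "\<And>y. y \<in> S \<Longrightarrow> f y = g y"
  shows "Ck_on m f S"
  using Ck_on_cong[OF assms(1,3)] assms(2) by simp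

lemma Ck_on_SucD: "Ck_on (Suc m) f S \<Longrightarrow> Ck_on m f S"
proof (induction m arbitrary: f)
  case 0 then show ?case
    by (auto intro!: continuous_at_imp_continuous_on differentiable_imp_continuous_within)
qed simp

lemma Ck_on_subset: "Ck_on m f S \<Longrightarrow> T \<subseteq> S \<Longrightarrow> Ck_on m f T"
  by (induction m arbitrary: f) (auto intro: continuous_on_subset)

lemma Ck_on_const: "Ck_on m (\<lambda>x. c) S"
proof (induction m arbitrary: c)
  case (Suc m)
  have "partial_deriv i (\<lambda>x. c) = (\<lambda>x. 0)" for i :: 'a
    by (auto simp: partial_deriv_def)
  then show ?case using Suc by simp
qed simp

lemma partial_deriv_nth:
  "partial_deriv i (\<lambda>x::real^'n::finite. x $ j) = (\<lambda>x. if i = j then 1 else 0)"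
proof
  fix x :: "real^'n"
  have "((\<lambda>x::real^'n. x $ j) has_derivative (\<lambda>h. h $ j)) (at x)"
    by (rule bounded_linear_imp_has_derivative[OF bounded_linear_vec_nth])
  from has_derivative_imp_partial_deriv[OF this, of i]
  show "partial_deriv i (\<lambda>x::real^'n. x $ j) x = (if i = j then 1 else 0)" by (simp add: axis_def eq_commute)
qed

lemma Ck_on_nth: "Ck_on m (\<lambda>x. x $ j) S"
proof (cases m)
  case (Suc l)
  have "(\<lambda>x. x $ j) differentiable (at x)" for x :: "real^'a"
    by (intro bounded_linear_imp_differentiable bounded_linear_vec_nth)
  then show ?thesis by (simp add: Suc partial_deriv_nth Ck_on_const)
qed (auto intro: continuous_intros)

context
  fixes f g :: "real^'n::finite \<Rightarrow> real" and x :: "real^'n"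
  assumes f: "f differentiable (at x)" and g: "g differentiable (at x)"
begin

lemma partial_deriv_add: "partial_deriv i (\<lambda>x. f x + g x) x = partial_deriv i f x + partial_deriv i g x"
  using has_derivative_imp_partial_deriv[OF has_derivative_add[OF has_derivative_grad[OF f] has_derivative_grad[OF g]]]
  by (simp add: inner_axis grad_def)

lemma partial_deriv_mult:
  "partial_deriv i (\<lambda>x. f x * g x) x = f x * partial_deriv i g x + partial_deriv i f x * g x"
  using has_derivative_imp_partial_deriv[OF has_derivative_mult[OF has_derivative_grad[OF f] has_derivative_grad[OF g]]]
  by (simp add: inner_axis grad_def)

end

lemma partial_deriv_comp_real:
  fixes f :: "real^'n::finite \<Rightarrow> real"
  assumes f: "f differentiable (at x)" and h: "(h has_real_derivative h') (at (f x))"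
  shows "partial_deriv i (\<lambda>x. h (f x)) x = h' * partial_deriv i f x"
    and "(\<lambda>x. h (f x)) differentiable (at x)"
proof -
  have D: "((\<lambda>x. h (f x)) has_derivative (\<lambda>k. h' * (grad f x \<bullet> k))) (at x)"
    using has_derivative_compose[OF has_derivative_grad[OF f] h[unfolded has_field_derivative_def]] .
  show "partial_deriv i (\<lambda>x. h (f x)) x = h' * partial_deriv i f x"
    using has_derivative_imp_partial_deriv[OF D] by (simp add: inner_axis grad_def)
  show "(\<lambda>x. h (f x)) differentiable (at x)" using D differentiableI by blast
qed

lemma Ck_on_add:
  assumes "open S" "Ck_on m f S" "Ck_on m g S"
  shows "Ck_on m (\<lambda>x. f x + g x) S"
  using assms
proof (induction m arbitrary: f g)
  case (Suc m)
  have "Ck_on m (partial_deriv i (\<lambda>x. f x + g x)) S" for i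
  proof -
    have "Ck_on m (\<lambda>x. partial_deriv i f x + partial_deriv i g x) S" using Suc by auto
    then show ?thesis
      by (rule Ck_on_congI[OF \<open>open S\<close>]) (use Suc.prems in \<open>auto intro: partial_deriv_add\<close>)
  qed
  then show ?case using Suc.prems by auto
qed (auto intro: continuous_intros)

lemma Ck_on_mult:
  assumes "open S" "Ck_on m f S" "Ck_on m g S"
  shows "Ck_on m (\<lambda>x. f x * g x) S"
  using assms
proof (induction m arbitrary: f g)
  case (Suc m)
  have "Ck_on m (partial_deriv i (\<lambda>x. f x * g x)) S" for i
  proof -
    \<comment> \<open>The undifferentiated factors reappear at one order lower; hence
      \<open>Ck_on_SucD\<close>.\<close>
    have "Ck_on m (\<lambda>x. f x * partial_deriv i g x + partial_deriv i f x * g x) S"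
      using Suc Ck_on_SucD[OF Suc.prems(2)] Ck_on_SucD[OF Suc.prems(3)]
      by (intro Ck_on_add Suc.IH) auto
    then show ?thesis
      by (rule Ck_on_congI[OF \<open>open S\<close>]) (use Suc.prems in \<open>auto intro: partial_deriv_mult\<close>)
  qed
  then show ?case using Suc.prems by auto
qed (auto intro: continuous_intros)

lemma Ck_on_exp:
  assumes "open S" "Ck_on m f S"
  shows "Ck_on m (\<lambda>x. exp (f x)) S"
  using assms
proof (induction m arbitrary: f)
  case (Suc m)
  have "Ck_on m (partial_deriv i (\<lambda>x. exp (f x))) S" for i
  proof -
    have "Ck_on m (\<lambda>x. exp (f x) * partial_deriv i f x) S"
      using Suc Ck_on_SucD[OF Suc.prems(2)] by (intro Ck_on_mult Suc.IH) auto
    then show ?thesis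
      by (rule Ck_on_congI[OF \<open>open S\<close>]) (use Suc.prems in \<open>auto intro: partial_deriv_comp_real(1)[OF _ DERIV_exp]\<close>)
  qed
  then show ?case using Suc.prems by (auto intro: partial_deriv_comp_real(2)[OF _ DERIV_exp])
qed (auto intro: continuous_intros)

lemma Ck_on_inverse:
  assumes "open S" "Ck_on m f S" and nz: "\<And>x. x \<in> S \<Longrightarrow> f x \<noteq> 0"
  shows "Ck_on m (\<lambda>x. inverse (f x)) S"
  using assms(1,2)
proof (induction m)
  case 0 then show ?case using nz by (auto intro!: continuous_intros)
next
  case (Suc m)
  have D: "(inverse has_real_derivative - (inverse (f x) * inverse (f x))) (at (f x))" if "x \<in> S" for x
    using nz[OF that] by (auto intro!: derivative_eq_intros)
  have "Ck_on m (partial_deriv i (\<lambda>x. inverse (f x))) S" for i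
  proof -
    have "Ck_on m (\<lambda>x. (-1) * (inverse (f x) * inverse (f x)) * partial_deriv i f x) S"
      using Suc Ck_on_SucD[OF Suc.prems(2)] by (intro Ck_on_mult Suc.IH Ck_on_const) auto
    then show ?thesis
      by (rule Ck_on_congI[OF \<open>open S\<close>]) (use Suc.prems in \<open>simp add: partial_deriv_comp_real(1)[OF _ D]\<close>)
  qed
  then show ?case using Suc.prems by (auto intro: partial_deriv_comp_real(2)[OF _ D])
qed

lemma Ck_on_ln:
  assumes "open S" "Ck_on m f S" and pos: "\<And>x. x \<in> S \<Longrightarrow> f x > 0"
  shows "Ck_on m (\<lambda>x. ln (f x)) S"
proof (cases m)
  case 0 then show ?thesis using assms by (auto intro!: continuous_intros dest: pos)
next
  case (Suc l)
  have D: "(ln has_real_derivative inverse (f x)) (at (f x))" if "x \<in> S" for x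
    using DERIV_ln[OF pos[OF that]] .
  have "Ck_on l (partial_deriv i (\<lambda>x. ln (f x))) S" for i
  proof -
    have "Ck_on l (\<lambda>x. inverse (f x) * partial_deriv i f x) S"
      using assms Suc Ck_on_SucD[of l f S] pos
      by (intro Ck_on_mult Ck_on_inverse) (auto, fastforce)
    then show ?thesis
      by (rule Ck_on_congI[OF \<open>open S\<close>]) (use assms Suc in \<open>simp add: partial_deriv_comp_real(1)[OF _ D]\<close>)
  qed
  then show ?thesis using assms Suc by (auto intro: partial_deriv_comp_real(2)[OF _ D])
qed

lemma continuous_on_nth_iff:
  fixes g :: "'a::topological_space \<Rightarrow> real^'n::finite"
  shows "continuous_on S g \<longleftrightarrow> (\<forall>j. continuous_on S (\<lambda>x. g x $ j))"
proof
  assume "\<forall>j. continuous_on S (\<lambda>x. g x $ j)"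
  then have "continuous_on S (\<lambda>x. \<chi> j. g x $ j)" by (intro continuous_on_vec_lambda) auto
  then show "continuous_on S g" by simp
qed (auto intro: continuous_intros)

lemma has_derivative_vec:
  fixes g :: "real^'n::finite \<Rightarrow> real^'m::finite"
  assumes "\<And>j. (\<lambda>x. g x $ j) differentiable (at x)"
  shows "(g has_derivative (\<lambda>h. \<chi> j. grad (\<lambda>x. g x $ j) x \<bullet> h)) (at x)"
  by (subst has_derivative_componentwise_within)
     (auto simp: Basis_vec_def inner_axis intro: has_derivative_grad[OF assms])

lemma partial_deriv_comp_map:
  fixes f :: "real^'m::finite \<Rightarrow> real" and g :: "real^'n::finite \<Rightarrow> real^'m"
  assumes f: "f differentiable (at (g x))" and g: "\<And>j. (\<lambda>x. g x $ j) differentiable (at x)"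
  shows "partial_deriv i (\<lambda>x. f (g x)) x = (\<Sum>j\<in>UNIV. partial_deriv j f (g x) * partial_deriv i (\<lambda>x. g x $ j) x)"
    and "(\<lambda>x. f (g x)) differentiable (at x)"
proof -
  have D: "((\<lambda>x. f (g x)) has_derivative (\<lambda>h. grad f (g x) \<bullet> (\<chi> j. grad (\<lambda>x. g x $ j) x \<bullet> h))) (at x)"
    using has_derivative_compose[OF has_derivative_vec[OF g] has_derivative_grad[OF f]] .
  show "partial_deriv i (\<lambda>x. f (g x)) x = (\<Sum>j\<in>UNIV. partial_deriv j f (g x) * partial_deriv i (\<lambda>x. g x $ j) x)"
    using has_derivative_imp_partial_deriv[OF D] by (simp add: inner_axis grad_def inner_vec_def[of "vec_lambda _"])
  show "(\<lambda>x. f (g x)) differentiable (at x)" using D differentiableI by blast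
qed

lemma Ck_on_sum:
  assumes "open S" "\<And>i. i \<in> I \<Longrightarrow> Ck_on m (f i) S"
  shows "Ck_on m (\<lambda>x. \<Sum>i\<in>I. f i x) S"
  using assms(2)
  by (induction I rule: infinite_finite_induct) (auto intro: Ck_on_const Ck_on_add assms(1))

lemma Ck_on_compose:
  fixes f :: "real^'m::finite \<Rightarrow> real" and g :: "real^'n::finite \<Rightarrow> real^'m"
  assumes "open S" "Ck_on m f T" "\<And>j. Ck_on m (\<lambda>x. g x $ j) S" "g ` S \<subseteq> T"
  shows "Ck_on m (\<lambda>x. f (g x)) S"
  using assms
proof (induction m arbitrary: f)
  case 0
  then have "continuous_on S g" by (auto simp: continuous_on_nth_iff)
  with 0 show ?case by (auto intro: continuous_on_compose2)
next
  case (Suc m)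
  have d: "f differentiable (at (g x))" "\<And>j. (\<lambda>x. g x $ j) differentiable (at x)" if "x \<in> S" for x
    using Suc.prems that by auto
  have "Ck_on m (partial_deriv i (\<lambda>x. f (g x))) S" for i
  proof -
    have 1: "Ck_on m (\<lambda>x. partial_deriv j f (g x)) S" for j
      by (rule Suc.IH) (use Suc.prems Ck_on_SucD[OF Suc.prems(3)] in auto)
    have 2: "Ck_on m (partial_deriv i (\<lambda>x. g x $ j)) S" for j
      using Suc.prems(3)[of j] by simp
    have "Ck_on m (\<lambda>x. \<Sum>j\<in>UNIV. partial_deriv j f (g x) * partial_deriv i (\<lambda>x. g x $ j) x) S"
      by (intro Ck_on_sum Ck_on_mult \<open>open S\<close> 1 2)
    then show ?thesis
      by (rule Ck_on_congI[OF \<open>open S\<close>]) (simp add: partial_deriv_comp_map(1)[OF d])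
  qed
  then show ?case using partial_deriv_comp_map(2)[OF d] by auto
qed

section \<open>Closure properties of smooth functions\<close>

lemma smooth_differentiable: "smooth_on_open f S \<Longrightarrow> x \<in> S \<Longrightarrow> f differentiable (at x)"
  unfolding smooth_on_open_def using Ck_on.simps(2) by blast

lemma smooth_continuous: "smooth_on_open f S \<Longrightarrow> continuous_on S f"
  unfolding smooth_on_open_def using Ck_on.simps(1) by blast

lemma smooth_partial: "smooth_on_open f S \<Longrightarrow> smooth_on_open (partial_deriv i f) S"
  unfolding smooth_on_open_def using Ck_on.simps(2) by blast

lemma smooth_grad: "smooth_on_open f S \<Longrightarrow> smooth_on_open (\<lambda>x. grad f x $ i) S"
  using smooth_partial[of f S i] by (simp add: grad_def)

lemma smooth_cong:
  assumes "\<And>y. y \<in> S \<Longrightarrow> f y = g y"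
  shows "smooth_on_open f S \<longleftrightarrow> smooth_on_open g S"
  unfolding smooth_on_open_def using Ck_on_cong[of S f g] assms by (metis (full_types))

lemma smooth_subset: "smooth_on_open f S \<Longrightarrow> open T \<Longrightarrow> T \<subseteq> S \<Longrightarrow> smooth_on_open f T"
  unfolding smooth_on_open_def using Ck_on_subset by blast

lemma smooth_const: "open S \<Longrightarrow> smooth_on_open (\<lambda>x. c) S"
  by (simp add: smooth_on_open_def Ck_on_const)

lemma smooth_nth: "open S \<Longrightarrow> smooth_on_open (\<lambda>x. x $ j) S"
  by (simp add: smooth_on_open_def Ck_on_nth)

lemma smooth_add: "smooth_on_open f S \<Longrightarrow> smooth_on_open g S \<Longrightarrow> smooth_on_open (\<lambda>x. f x + g x) S"
  by (simp add: smooth_on_open_def Ck_on_add)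

lemma smooth_mult: "smooth_on_open f S \<Longrightarrow> smooth_on_open g S \<Longrightarrow> smooth_on_open (\<lambda>x. f x * g x) S"
  by (simp add: smooth_on_open_def Ck_on_mult)

lemma smooth_uminus: "smooth_on_open f S \<Longrightarrow> smooth_on_open (\<lambda>x. - f x) S"
  using smooth_mult[of "\<lambda>x. -1" S f] smooth_const[of S "-1"] by (simp add: smooth_on_open_def)

lemma smooth_diff: "smooth_on_open f S \<Longrightarrow> smooth_on_open g S \<Longrightarrow> smooth_on_open (\<lambda>x. f x - g x) S"
  using smooth_add[OF _ smooth_uminus] by fastforce

lemma smooth_sum:
  "open S \<Longrightarrow> (\<And>i. i \<in> I \<Longrightarrow> smooth_on_open (f i) S) \<Longrightarrow> smooth_on_open (\<lambda>x. \<Sum>i\<in>I. f i x) S"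
  by (simp add: smooth_on_open_def Ck_on_sum)

lemma smooth_power: "smooth_on_open f S \<Longrightarrow> smooth_on_open (\<lambda>x. f x ^ m) S"
  by (induction m) (auto intro: smooth_const smooth_mult simp: smooth_on_open_def Ck_on_const Ck_on_mult)

lemma smooth_exp: "smooth_on_open f S \<Longrightarrow> smooth_on_open (\<lambda>x. exp (f x)) S"
  by (simp add: smooth_on_open_def Ck_on_exp)

lemma smooth_inverse:
  "smooth_on_open f S \<Longrightarrow> (\<And>x. x \<in> S \<Longrightarrow> f x \<noteq> 0) \<Longrightarrow> smooth_on_open (\<lambda>x. inverse (f x)) S"
  by (simp add: smooth_on_open_def Ck_on_inverse)

lemma smooth_divide:
  "smooth_on_open f S \<Longrightarrow> smooth_on_open g S \<Longrightarrow> (\<And>x. x \<in> S \<Longrightarrow> g x \<noteq> 0) \<Longrightarrow> smooth_on_open (\<lambda>x. f x / g x) S"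
  by (simp add: divide_inverse smooth_mult smooth_inverse)

lemma smooth_ln:
  "smooth_on_open f S \<Longrightarrow> (\<And>x. x \<in> S \<Longrightarrow> f x > 0) \<Longrightarrow> smooth_on_open (\<lambda>x. ln (f x)) S"
  by (simp add: smooth_on_open_def Ck_on_ln)

lemma smooth_powr:
  assumes "smooth_on_open f S" "\<And>x. x \<in> S \<Longrightarrow> f x > 0"
  shows "smooth_on_open (\<lambda>x. f x powr a) S"
proof -
  have "open S" using assms by (simp add: smooth_on_open_def)
  have "smooth_on_open (\<lambda>x. exp (a * ln (f x))) S"
    by (intro smooth_exp smooth_mult smooth_const smooth_ln assms \<open>open S\<close>)
  moreover have "f x powr a = exp (a * ln (f x))" if "x \<in> S" for x
    using assms(2)[OF that] by (simp add: powr_def)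
  ultimately show ?thesis using smooth_cong[of S "\<lambda>x. f x powr a" "\<lambda>x. exp (a * ln (f x))"] by blast
qed

lemma smooth_compose:
  fixes f :: "real^'m::finite \<Rightarrow> real" and g :: "real^'n::finite \<Rightarrow> real^'m"
  assumes "smooth_on_open f T" "open S" "\<And>j. smooth_on_open (\<lambda>x. g x $ j) S" "g ` S \<subseteq> T"
  shows "smooth_on_open (\<lambda>x. f (g x)) S"
  using assms Ck_on_compose[of S _ f T g] by (auto simp: smooth_on_open_def)

lemma smooth_inner:
  fixes f g :: "real^'n::finite \<Rightarrow> real^'m::finite"
  assumes "open S" "\<And>j. smooth_on_open (\<lambda>x. f x $ j) S" "\<And>j. smooth_on_open (\<lambda>x. g x $ j) S"
  shows "smooth_on_open (\<lambda>x. f x \<bullet> g x) S"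
  unfolding inner_vec_def inner_real_def using assms by (intro smooth_sum smooth_mult) auto

lemma Ck_on_det:
  fixes A :: "real^'n::finite \<Rightarrow> real^'m^'m::finite"
  assumes S: "open S" and A: "\<And>i j. Ck_on m (\<lambda>x. A x $ i $ j) S"
  shows "Ck_on m (\<lambda>x. det (A x)) S"
proof -
  have "Ck_on m (\<lambda>x. \<Prod>i\<in>I. A x $ i $ p i) S" for p :: "'m \<Rightarrow> 'm" and I
    by (induction I rule: infinite_finite_induct) (auto intro: Ck_on_const Ck_on_mult S A)
  then show ?thesis unfolding det_def using assms by (intro Ck_on_sum Ck_on_mult Ck_on_const) auto
qed

lemma smooth_hess: "smooth_on_open f S \<Longrightarrow> smooth_on_open (\<lambda>x. hess f x $ i $ j) S"
  using smooth_partial[OF smooth_partial] by (simp add: hess_def)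

lemma smooth_laplacian: "smooth_on_open f S \<Longrightarrow> smooth_on_open (laplacian f) S"
  using smooth_sum[of S UNIV "\<lambda>i x. hess f x $ i $ i"] smooth_hess[of f S]
  by (simp add: smooth_on_open_def laplacian_def[abs_def] trace_def)

section \<open>Restriction to lines, symmetry of the Hessian, and maxima\<close>

lemma line_derivative:
  fixes f :: "real^'n::finite \<Rightarrow> real"
  assumes "f differentiable (at (x + t *\<^sub>R v))"
  shows "((\<lambda>t. f (x + t *\<^sub>R v)) has_real_derivative (grad f (x + t *\<^sub>R v) \<bullet> v)) (at t)"
proof -
  have "((\<lambda>t. f (x + t *\<^sub>R v)) has_derivative (\<lambda>h. grad f (x + t *\<^sub>R v) \<bullet> (h *\<^sub>R v))) (at t)"
    by (rule has_derivative_compose[where f = "\<lambda>t. x + t *\<^sub>R v" and f' = "\<lambda>h. h *\<^sub>R v", OF _ has_derivative_grad[OF assms]])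
      (auto intro!: derivative_eq_intros)
  then show ?thesis by (simp add: has_field_derivative_def mult_commute_abs)
qed

text \<open>Schwarz's theorem by the second difference over a square of side \<open>t\<close>: two
  mean value steps, taken in either order, express the same number by either mixed derivative at
  some point near \<open>x\<close>, and both mixed derivatives are continuous there.\<close>

lemma partial_deriv_commute:
  fixes f :: "real^'n::finite \<Rightarrow> real"
  assumes f: "smooth_on_open f S" and x: "x \<in> S"
  shows "partial_deriv i (partial_deriv j f) x = partial_deriv j (partial_deriv i f) x"
proof -
  have "open S" using f by (simp add: smooth_on_open_def)
  then obtain r where r: "r > 0" "ball x r \<subseteq> S" using x openE by blast
  have key: "\<exists>a b. 0 < a \<and> a < t \<and> 0 < b \<and> b < t \<and>
      f (x + t *\<^sub>R axis i 1 + t *\<^sub>R axis j 1) - f (x + t *\<^sub>R axis i 1) - f (x + t *\<^sub>R axis j 1) + f x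
       = t * (t * partial_deriv j (partial_deriv i f) (x + a *\<^sub>R axis i 1 + b *\<^sub>R axis j 1))"
    if t: "0 < t" "t < r / 2" for t and i j :: 'n
  proof -
    have in_S: "x + a *\<^sub>R axis i 1 + b *\<^sub>R axis j 1 \<in> S" if "0 \<le> a" "a \<le> t" "0 \<le> b" "b \<le> t" for a b
    proof -
      have "norm (a *\<^sub>R axis i (1::real) + b *\<^sub>R axis j 1) \<le> a + b"
        using norm_triangle_ineq[of "a *\<^sub>R axis i (1::real)" "b *\<^sub>R axis j 1"] that by (simp add: norm_axis_1)
      then have "dist (x + a *\<^sub>R axis i 1 + b *\<^sub>R axis j 1) x < r" using that t
        by (simp add: dist_norm add.assoc)
      then show ?thesis using r by (auto simp: dist_commute)
    qed
    have "\<exists>a. 0 < a \<and> a < t \<and> (\<lambda>s. f ((x + t *\<^sub>R axis j 1) + s *\<^sub>R axis i 1) - f (x + s *\<^sub>R axis i 1)) t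
        - (\<lambda>s. f ((x + t *\<^sub>R axis j 1) + s *\<^sub>R axis i 1) - f (x + s *\<^sub>R axis i 1)) 0 = (t - 0) *
       (grad f ((x + t *\<^sub>R axis j 1) + a *\<^sub>R axis i 1) \<bullet> axis i 1 - grad f (x + a *\<^sub>R axis i 1) \<bullet> axis i 1)"
    proof (rule MVT2[OF t(1)])
      fix s assume s: "0 \<le> s" "s \<le> t"
      have "x + t *\<^sub>R axis j 1 + s *\<^sub>R axis i 1 \<in> S" "x + s *\<^sub>R axis i 1 \<in> S"
        using in_S[of s t] in_S[of s 0] s t by (auto simp: algebra_simps)
      then show "((\<lambda>s. f ((x + t *\<^sub>R axis j 1) + s *\<^sub>R axis i 1) - f (x + s *\<^sub>R axis i 1)) has_real_derivative
        (grad f ((x + t *\<^sub>R axis j 1) + s *\<^sub>R axis i 1) \<bullet> axis i 1 - grad f (x + s *\<^sub>R axis i 1) \<bullet> axis i 1)) (at s)"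
        by (intro DERIV_diff line_derivative smooth_differentiable[OF f])
    qed
    then obtain a where a: "0 < a" "a < t" and eq: "f (x + t *\<^sub>R axis i 1 + t *\<^sub>R axis j 1) - f (x + t *\<^sub>R axis i 1) - f (x + t *\<^sub>R axis j 1) + f x =
       t * (partial_deriv i f (x + a *\<^sub>R axis i 1 + t *\<^sub>R axis j 1) - partial_deriv i f (x + a *\<^sub>R axis i 1))"
      by (auto simp: inner_axis grad_def algebra_simps)
    have "\<exists>b. 0 < b \<and> b < t \<and> (\<lambda>s. partial_deriv i f ((x + a *\<^sub>R axis i 1) + s *\<^sub>R axis j 1)) t
        - (\<lambda>s. partial_deriv i f ((x + a *\<^sub>R axis i 1) + s *\<^sub>R axis j 1)) 0 = (t - 0) *
       (grad (partial_deriv i f) ((x + a *\<^sub>R axis i 1) + b *\<^sub>R axis j 1) \<bullet> axis j 1)"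
      using in_S a t by (intro MVT2 line_derivative smooth_differentiable[OF smooth_partial[OF f]]) auto
    then obtain b where b: "0 < b" "b < t" "partial_deriv i f (x + a *\<^sub>R axis i 1 + t *\<^sub>R axis j 1) - partial_deriv i f (x + a *\<^sub>R axis i 1)
       = t * partial_deriv j (partial_deriv i f) (x + a *\<^sub>R axis i 1 + b *\<^sub>R axis j 1)"
      by (auto simp: inner_axis grad_def)
    show ?thesis using a b eq by auto
  qed
  let ?F = "partial_deriv i (partial_deriv j f)" and ?G = "partial_deriv j (partial_deriv i f)"
  have "\<bar>?F x - ?G x\<bar> \<le> e" if e: "e > 0" for e
  proof -
    have "continuous_on S ?F" "continuous_on S ?G" using f by (auto intro!: smooth_continuous smooth_partial)
    then have "isCont ?F x" "isCont ?G x" using \<open>open S\<close> x continuous_on_eq_continuous_at by auto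
    then obtain d1 d2 where d: "d1 > 0" "\<And>y. dist y x < d1 \<Longrightarrow> dist (?F y) (?F x) < e/2"
         "d2 > 0" "\<And>y. dist y x < d2 \<Longrightarrow> dist (?G y) (?G x) < e/2"
      unfolding continuous_at_eps_delta using e by (metis half_gt_zero)
    \<comment> \<open>Every point produced by the mean value steps lies within \<open>2 * t\<close>
      of \<open>x\<close>, hence inside both continuity neighbourhoods.\<close>
    define t where "t = Min {r, d1, d2} / 4"
    have t: "0 < t" "t < r / 2" "2 * t < d1" "2 * t < d2" using r d by (auto simp: t_def)
    have near: "dist (x + a *\<^sub>R axis i 1 + b *\<^sub>R axis j 1) x \<le> 2 * t" if "0 \<le> a" "a \<le> t" "0 \<le> b" "b \<le> t" for a b and i j :: 'n
    proof -
      have "norm (a *\<^sub>R axis i (1::real) + b *\<^sub>R axis j 1) \<le> a + b"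
        using norm_triangle_ineq[of "a *\<^sub>R axis i (1::real)" "b *\<^sub>R axis j 1"] that by (simp add: norm_axis_1)
      then show ?thesis using that t by (simp add: dist_norm add.assoc)
    qed
    obtain a b where ab: "0 < a" "a < t" "0 < b" "b < t" 
      "f (x + t *\<^sub>R axis i 1 + t *\<^sub>R axis j 1) - f (x + t *\<^sub>R axis i 1) - f (x + t *\<^sub>R axis j 1) + f x
       = t * (t * ?G (x + a *\<^sub>R axis i 1 + b *\<^sub>R axis j 1))" using key[OF t(1,2)] by blast
    obtain a' b' where ab': "0 < a'" "a' < t" "0 < b'" "b' < t" 
      "f (x + t *\<^sub>R axis j 1 + t *\<^sub>R axis i 1) - f (x + t *\<^sub>R axis j 1) - f (x + t *\<^sub>R axis i 1) + f x
       = t * (t * ?F (x + a' *\<^sub>R axis j 1 + b' *\<^sub>R axis i 1))" using key[OF t(1,2), of j i] by blast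
    have "x + t *\<^sub>R axis j 1 + t *\<^sub>R axis i 1 = x + t *\<^sub>R axis i 1 + t *\<^sub>R axis j (1::real)"
      by (simp add: algebra_simps)
    then have "t * (t * ?G (x + a *\<^sub>R axis i 1 + b *\<^sub>R axis j 1)) = t * (t * ?F (x + a' *\<^sub>R axis j 1 + b' *\<^sub>R axis i 1))"
      using ab(5) ab'(5) by (simp only:)
    then have eq: "?G (x + a *\<^sub>R axis i 1 + b *\<^sub>R axis j 1) = ?F (x + a' *\<^sub>R axis j 1 + b' *\<^sub>R axis i 1)"
      using t by simp
    have "dist (?G (x + a *\<^sub>R axis i 1 + b *\<^sub>R axis j 1)) (?G x) < e/2"
      using near[of a b i j] ab t by (intro d) auto
    moreover have "dist (?F (x + a' *\<^sub>R axis j 1 + b' *\<^sub>R axis i 1)) (?F x) < e/2"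
      using near[of a' b' j i] ab' t by (intro d) auto
    ultimately show ?thesis using eq unfolding dist_real_def by linarith
  qed
  then have "\<bar>?F x - ?G x\<bar> \<le> 0" using field_le_epsilon[of "\<bar>?F x - ?G x\<bar>" 0] by simp
  then show ?thesis by simp
qed

lemma transpose_hess: "smooth_on_open f S \<Longrightarrow> x \<in> S \<Longrightarrow> transpose (hess f x) = hess f x"
  by (simp add: transpose_def hess_def vec_eq_iff partial_deriv_commute)

lemma line_second_derivative:
  fixes f :: "real^'n::finite \<Rightarrow> real"
  assumes f: "smooth_on_open f S" and x: "x + t *\<^sub>R v \<in> S"
  shows "((\<lambda>t. grad f (x + t *\<^sub>R v) \<bullet> v) has_real_derivative v \<bullet> (hess f (x + t *\<^sub>R v) *v v)) (at t)"
proof -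
  have "((\<lambda>t. \<Sum>j\<in>UNIV. partial_deriv j f (x + t *\<^sub>R v) * v $ j) has_real_derivative
      (\<Sum>j\<in>UNIV. (grad (partial_deriv j f) (x + t *\<^sub>R v) \<bullet> v) * v $ j)) (at t)"
    by (intro DERIV_sum DERIV_cmult_right line_derivative smooth_differentiable[OF smooth_partial[OF f] x])
  moreover have "(\<Sum>j\<in>UNIV. (grad (partial_deriv j f) (x + t *\<^sub>R v) \<bullet> v) * v $ j) = v \<bullet> (hess f (x + t *\<^sub>R v) *v v)"
    apply (simp add: grad_def hess_def inner_vec_def matrix_vector_mult_def sum_distrib_left sum_distrib_right)
    apply (subst sum.swap)
    apply (simp add: mult_ac)
    done
  ultimately show ?thesis by (simp add: inner_vec_def grad_def)
qed

lemma local_max_grad_hess: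
  fixes f :: "real^'n::finite \<Rightarrow> real"
  assumes f: "smooth_on_open f S" and x: "x \<in> S" and mx: "\<And>y. y \<in> S \<Longrightarrow> f y \<le> f x"
  shows "grad f x = 0" and "v \<bullet> (hess f x *v v) \<le> 0"
proof -
  have "open S" using f by (simp add: smooth_on_open_def)
  have ev: "\<exists>d>0. \<forall>t. \<bar>t\<bar> < d \<longrightarrow> x + t *\<^sub>R w \<in> S" for w
  proof -
    obtain r where r: "r > 0" "ball x r \<subseteq> S" using x \<open>open S\<close> openE by blast
    show ?thesis
    proof (intro exI[of _ "r / (norm w + 1)"] conjI allI impI)
      fix t assume "\<bar>t\<bar> < r / (norm w + 1)"
      then have "\<bar>t\<bar> * (norm w + 1) < r" by (simp add: pos_less_divide_eq add_nonneg_pos)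
      then have "\<bar>t\<bar> * norm w < r" by (simp add: distrib_left)
      then have "dist x (x + t *\<^sub>R w) < r" by (simp add: dist_norm)
      then show "x + t *\<^sub>R w \<in> S" using r by auto
    qed (use r norm_ge_zero[of w] in \<open>smt (verit) divide_pos_pos\<close>)
  qed
  have zero: "grad f x \<bullet> w = 0" for w
  proof -
    obtain d where d: "d > 0" "\<And>t. \<bar>t\<bar> < d \<Longrightarrow> x + t *\<^sub>R w \<in> S" using ev by blast
    have "((\<lambda>t. f (x + t *\<^sub>R w)) has_real_derivative (grad f (x + 0 *\<^sub>R w) \<bullet> w)) (at 0)"
      using x by (intro line_derivative smooth_differentiable[OF f]) auto
    from DERIV_local_max[OF this d(1)] show ?thesis using mx d by auto
  qed
  show "grad f x = 0" using zero[of "grad f x"] by simp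
  show "v \<bullet> (hess f x *v v) \<le> 0"
  proof (rule ccontr)
    \<comment> \<open>A positive second derivative makes the first one, which vanishes at 0,
      positive just to the right, so \<open>f\<close> would exceed its maximum along
      \<open>v\<close>.\<close>
    assume neg: "\<not> ?thesis"
    obtain d where d: "d > 0" "\<And>t. \<bar>t\<bar> < d \<Longrightarrow> x + t *\<^sub>R v \<in> S" using ev by blast
    have "((\<lambda>t. grad f (x + t *\<^sub>R v) \<bullet> v) has_real_derivative v \<bullet> (hess f (x + 0 *\<^sub>R v) *v v)) (at 0)"
      using x by (intro line_second_derivative[OF f]) auto
    from DERIV_pos_inc_right[OF this] neg
    obtain e where e: "e > 0" "\<And>h. h > 0 \<Longrightarrow> h < e \<Longrightarrow> grad f (x + 0 *\<^sub>R v) \<bullet> v < grad f (x + (0 + h) *\<^sub>R v) \<bullet> v"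
      by (auto simp: not_le)
    define t where "t = min d e / 2"
    have t: "0 < t" "t < d" "t < e" using d e by (auto simp: t_def)
    have "\<exists>s. 0 < s \<and> s < t \<and> f (x + t *\<^sub>R v) - f (x + 0 *\<^sub>R v) = (t - 0) * (grad f (x + s *\<^sub>R v) \<bullet> v)"
      using t d by (intro MVT2 line_derivative smooth_differentiable[OF f]) auto
    then obtain s where s: "0 < s" "s < t" "f (x + t *\<^sub>R v) - f x = t * (grad f (x + s *\<^sub>R v) \<bullet> v)" by auto
    have "grad f (x + s *\<^sub>R v) \<bullet> v > 0" using e(2)[of s] s t zero by auto
    then have "f (x + t *\<^sub>R v) > f x" using s t by (smt (verit) mult_pos_pos)
    then show False using mx[of "x + t *\<^sub>R v"] d t by auto
  qed
qed

section \<open>Gradients and Hessians of sums, products and compositions\<close>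

lemma partial_deriv_diff:
  assumes "f differentiable (at x)" "g differentiable (at x)"
  shows "partial_deriv i (\<lambda>x. f x - g x) x = partial_deriv i f x - partial_deriv i g x"
  using has_derivative_imp_partial_deriv[OF has_derivative_diff[OF has_derivative_grad[OF assms(1)] has_derivative_grad[OF assms(2)]]]
  by (simp add: inner_axis grad_def)

lemma grad_add: "smooth_on_open f S \<Longrightarrow> smooth_on_open g S \<Longrightarrow> x \<in> S \<Longrightarrow> grad (\<lambda>x. f x + g x) x = grad f x + grad g x"
  by (simp add: grad_def vec_eq_iff partial_deriv_add smooth_differentiable)

lemma grad_diff: "smooth_on_open f S \<Longrightarrow> smooth_on_open g S \<Longrightarrow> x \<in> S \<Longrightarrow> grad (\<lambda>x. f x - g x) x = grad f x - grad g x"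
  by (simp add: grad_def vec_eq_iff partial_deriv_diff smooth_differentiable)

lemma grad_mult:
  "smooth_on_open f S \<Longrightarrow> smooth_on_open g S \<Longrightarrow> x \<in> S \<Longrightarrow> grad (\<lambda>x. f x * g x) x = f x *\<^sub>R grad g x + g x *\<^sub>R grad f x"
  by (simp add: grad_def vec_eq_iff partial_deriv_mult smooth_differentiable)

lemma grad_comp_real:
  "smooth_on_open f S \<Longrightarrow> x \<in> S \<Longrightarrow> (h has_real_derivative h') (at (f x)) \<Longrightarrow> grad (\<lambda>x. h (f x)) x = h' *\<^sub>R grad f x"
  by (simp add: grad_def vec_eq_iff partial_deriv_comp_real(1) smooth_differentiable)

lemma hess_add:
  assumes "smooth_on_open f S" "smooth_on_open g S" "x \<in> S"
  shows "hess (\<lambda>x. f x + g x) x = hess f x + hess g x"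
proof -
  have "open S" using assms by (simp add: smooth_on_open_def)
  have "partial_deriv i (partial_deriv j (\<lambda>x. f x + g x)) x = partial_deriv i (\<lambda>x. partial_deriv j f x + partial_deriv j g x) x" for i j
    by (rule partial_deriv_cong_open[OF \<open>open S\<close> assms(3)]) (simp add: partial_deriv_add smooth_differentiable[OF assms(1)] smooth_differentiable[OF assms(2)])
  then show ?thesis using assms
    by (simp add: hess_def vec_eq_iff partial_deriv_add smooth_differentiable[OF smooth_partial])
qed

lemma hess_diff:
  assumes "smooth_on_open f S" "smooth_on_open g S" "x \<in> S"
  shows "hess (\<lambda>x. f x - g x) x = hess f x - hess g x"
proof -
  have "open S" using assms by (simp add: smooth_on_open_def)
  have "partial_deriv i (partial_deriv j (\<lambda>x. f x - g x)) x = partial_deriv i (\<lambda>x. partial_deriv j f x - partial_deriv j g x) x" for i j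
    by (rule partial_deriv_cong_open[OF \<open>open S\<close> assms(3)]) (simp add: partial_deriv_diff smooth_differentiable[OF assms(1)] smooth_differentiable[OF assms(2)])
  then show ?thesis using assms
    by (simp add: hess_def vec_eq_iff partial_deriv_diff smooth_differentiable[OF smooth_partial])
qed

lemma hess_mult:
  assumes f: "smooth_on_open f S" and g: "smooth_on_open g S" and x: "x \<in> S"
  shows "hess (\<lambda>x. f x * g x) x
    = f x *\<^sub>R hess g x + g x *\<^sub>R hess f x + outer (grad f x) (grad g x) + outer (grad g x) (grad f x)"
proof -
  have "open S" using f by (simp add: smooth_on_open_def)
  have "partial_deriv i (partial_deriv j (\<lambda>x. f x * g x)) x
      = partial_deriv i (\<lambda>x. f x * partial_deriv j g x + partial_deriv j f x * g x) x" for i j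
    by (rule partial_deriv_cong_open[OF \<open>open S\<close> x]) (simp add: partial_deriv_mult smooth_differentiable[OF f] smooth_differentiable[OF g])
  moreover have "partial_deriv i (\<lambda>x. f x * partial_deriv j g x + partial_deriv j f x * g x) x
     = partial_deriv i (\<lambda>x. f x * partial_deriv j g x) x + partial_deriv i (\<lambda>x. partial_deriv j f x * g x) x" for i j
    by (intro partial_deriv_add smooth_differentiable[OF _ x] smooth_mult f g smooth_partial)
  moreover have "partial_deriv i (\<lambda>x. f x * partial_deriv j g x) x = f x * partial_deriv i (partial_deriv j g) x + partial_deriv i f x * partial_deriv j g x"
    "partial_deriv i (\<lambda>x. partial_deriv j f x * g x) x = partial_deriv j f x * partial_deriv i g x + partial_deriv i (partial_deriv j f) x * g x" for i j
    by (intro partial_deriv_mult smooth_differentiable[OF _ x] f g smooth_partial)+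
  ultimately show ?thesis
    by (simp add: hess_def vec_eq_iff outer_def grad_def)
qed

text \<open>The formula for the first derivatives of \<open>h (f x)\<close> has to hold near
  \<open>x\<close> before it can be differentiated again, so the conditions on \<open>h\<close> are
  imposed on a set \<open>T\<close> containing the whole range of \<open>f\<close>.\<close>

lemma hess_comp_real:
  assumes f: "smooth_on_open f S" and x: "x \<in> S" and T: "f ` S \<subseteq> T"
    and h1: "\<And>t. t \<in> T \<Longrightarrow> (h has_real_derivative h1 t) (at t)"
    and h2: "\<And>t. t \<in> T \<Longrightarrow> (h1 has_real_derivative h2 t) (at t)"
  shows "hess (\<lambda>x. h (f x)) x = h1 (f x) *\<^sub>R hess f x + h2 (f x) *\<^sub>R outer (grad f x) (grad f x)"
proof -
  have "open S" using f by (simp add: smooth_on_open_def)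
  have fx: "f x \<in> T" using x T by auto
  have "partial_deriv i (partial_deriv j (\<lambda>x. h (f x))) x
      = partial_deriv i (\<lambda>x. h1 (f x) * partial_deriv j f x) x" for i j
    by (rule partial_deriv_cong_open[OF \<open>open S\<close> x], rule partial_deriv_comp_real[OF smooth_differentiable[OF f] h1]) (use T in auto)
  moreover have "partial_deriv i (\<lambda>x. h1 (f x) * partial_deriv j f x) x
      = h1 (f x) * partial_deriv i (partial_deriv j f) x + (h2 (f x) * partial_deriv i f x) * partial_deriv j f x" for i j
    using partial_deriv_mult[OF partial_deriv_comp_real(2)[OF smooth_differentiable[OF f x] h2[OF fx]] smooth_differentiable[OF smooth_partial[OF f] x]]
      partial_deriv_comp_real(1)[OF smooth_differentiable[OF f x] h2[OF fx]] by simp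
  ultimately show ?thesis by (simp add: hess_def vec_eq_iff outer_def grad_def)
qed

subsection \<open>Real-rooted polynomials\<close>

text \<open>The roots are the negatives of the entries, so that the coefficients are the elementary
  symmetric functions without alternating signs.\<close>

definition lin_prod :: "real list \<Rightarrow> real poly" where
  "lin_prod xs = (\<Prod>x\<leftarrow>xs. [:x, 1:])"

text \<open>Real-rooted polynomials with positive leading coefficient, a class stable under
  differentiation down to degree 0.\<close>

definition psplit :: "real poly \<Rightarrow> bool" where
  "psplit p \<longleftrightarrow> (\<exists>c>0. \<exists>xs. p = smult c (lin_prod xs))"

lemma lin_prod_simps [simp]: "lin_prod [] = 1" "lin_prod (x # xs) = [:x, 1:] * lin_prod xs"
  by (simp_all add: lin_prod_def)

lemma lin_prod_append: "lin_prod (xs @ ys) = lin_prod xs * lin_prod ys"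
  by (simp add: lin_prod_def)

lemma lin_prod_nonzero [simp]: "lin_prod xs \<noteq> 0"
  by (induction xs) (auto simp del: mult_pCons_left)

lemma degree_lin_prod [simp]: "degree (lin_prod xs) = length xs"
  by (induction xs) (auto simp: degree_mult_eq simp del: mult_pCons_left)

lemma lead_coeff_lin_prod [simp]: "coeff (lin_prod xs) (length xs) = 1"
proof -
  have "lead_coeff (lin_prod xs) = 1"
    by (induction xs) (auto simp: lead_coeff_mult simp del: mult_pCons_left)
  then show ?thesis by simp
qed

lemma poly_lin_prod: "poly (lin_prod xs) t = (\<Prod>x\<leftarrow>xs. t + x)"
  by (induction xs) (auto simp: algebra_simps)

abbreviation cpoly :: "real poly \<Rightarrow> complex \<Rightarrow> complex" where
  "cpoly p \<equiv> poly (map_poly complex_of_real p)"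

lemma cpoly_pCons [simp]: "cpoly (pCons a p) z = of_real a + z * cpoly p z"
  by (simp add: map_poly_pCons)

lemma cpoly_add [simp]: "cpoly (p + q) z = cpoly p z + cpoly q z"
proof -
  have "map_poly complex_of_real (p + q) = map_poly complex_of_real p + map_poly complex_of_real q"
    by (rule poly_eqI) (simp add: coeff_map_poly)
  then show ?thesis by simp
qed

lemma cpoly_smult [simp]: "cpoly (smult c p) z = of_real c * cpoly p z"
proof -
  have "map_poly complex_of_real (smult c p) = smult (of_real c) (map_poly complex_of_real p)"
    by (rule poly_eqI) (simp add: coeff_map_poly)
  then show ?thesis by simp
qed

lemma cpoly_mult [simp]: "cpoly (p * q) z = cpoly p z * cpoly q z"
  by (induction p) (simp_all add: algebra_simps)

lemma cpoly_of_real: "cpoly p (of_real x) = of_real (poly p x)"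
  by (induction p) simp_all

lemma degree_cpoly: "degree (map_poly complex_of_real p) = degree p"
  by (rule degree_map_poly) simp

text \<open>The fundamental theorem of algebra supplies a complex root, which the hypothesis makes
  real; its linear factor is split off and the degree drops by one.\<close>

lemma real_roots_imp_psplit:
  assumes "lead_coeff p > 0" "\<And>z. cpoly p z = 0 \<Longrightarrow> Im z = 0"
  shows "psplit p"
  using assms
proof (induction "degree p" arbitrary: p)
  case 0
  then obtain c where "p = [:c:]" using degree_eq_zeroE by metis
  then show ?case using 0 unfolding psplit_def by (auto intro!: exI[of _ c] exI[of _ "[]"])
next
  case (Suc d)
  have "\<not> constant (cpoly p)" using Suc.hyps(2) by (simp add: constant_degree degree_cpoly)
  then obtain z where z: "cpoly p z = 0" using fundamental_theorem_of_algebra by blast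
  define a where "a = Re z"
  have "z = of_real a" using Suc.prems(2)[OF z] by (simp add: a_def complex_eq_iff)
  then have "poly p a = 0" using z by (simp add: cpoly_of_real)
  then obtain q where q: "p = [:-a, 1:] * q" using poly_eq_0_iff_dvd dvdE by blast
  have "q \<noteq> 0" using Suc.hyps(2) q by auto
  then have "degree q = d" using Suc.hyps(2) q degree_mult_eq[of "[:-a, 1:]" q] by simp
  moreover have "lead_coeff q > 0" using Suc.prems(1) unfolding q lead_coeff_mult by simp
  moreover have "\<And>z. cpoly q z = 0 \<Longrightarrow> Im z = 0" using Suc.prems(2) unfolding q by (simp del: mult_pCons_left)
  ultimately obtain c xs where "c > 0" "q = smult c (lin_prod xs)"
    using Suc.hyps(1)[of q] by (auto simp: psplit_def)
  then have "p = smult c (lin_prod ((-a) # xs))" using q by (simp del: mult_pCons_left)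
  then show ?case using \<open>c > 0\<close> unfolding psplit_def by blast
qed

lemma cpoly_pderiv_lin_prod:
  assumes "Im z \<noteq> 0"
  shows "cpoly (pderiv (lin_prod xs)) z = cpoly (lin_prod xs) z * (\<Sum>x\<leftarrow>xs. 1 / (z + of_real x))"
    and "cpoly (lin_prod xs) z \<noteq> 0"
proof (induction xs)
  case (Cons x xs)
  have nz: "z + of_real x \<noteq> 0" using assms by (auto simp: complex_eq_iff)
  have c: "cpoly [:x, 1:] z = z + of_real x" by simp
  {
    case 1
    have "cpoly (pderiv (lin_prod (x # xs))) z = (z + of_real x) * cpoly (pderiv (lin_prod xs)) z + cpoly (lin_prod xs) z"
      by (simp only: lin_prod_simps pderiv_mult cpoly_add cpoly_mult c) (simp add: pderiv_pCons)
    also have "\<dots> = cpoly (lin_prod (x # xs)) z * (\<Sum>x\<leftarrow>x # xs. 1 / (z + of_real x))"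
      using nz by (simp only: lin_prod_simps cpoly_mult c Cons(1)) (simp add: field_simps)
    finally show ?case .
  next
    case 2
    show ?case using Cons nz by (simp only: lin_prod_simps cpoly_mult c) simp
  }
qed (use assms in auto)

text \<open>Each term 1 / (z + x) has imaginary part of the sign opposite to that of z. So the
  logarithmic derivative of a real-rooted polynomial has no zero off the real axis.\<close>

lemma Im_sum_inverse_neg:
  assumes "Im z \<noteq> 0" "xs \<noteq> []"
  shows "Im z * Im (\<Sum>x\<leftarrow>xs. 1 / (z + of_real x)) < 0"
proof -
  have neg: "Im z * Im (1 / (z + of_real x)) < 0" for x
  proof -
    have "Im (1 / (z + of_real x)) = - Im z / ((Re z + x)\<^sup>2 + (Im z)\<^sup>2)"
      by (simp add: Im_divide)
    moreover have "(Re z + x)\<^sup>2 + (Im z)\<^sup>2 > 0" using assms by (simp add: sum_power2_gt_zero_iff)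
    moreover have "Im z * Im z > 0" using assms by (auto simp: zero_less_mult_iff)
    ultimately show ?thesis by (simp add: divide_neg_pos)
  qed
  have "Im z * Im (\<Sum>x\<leftarrow>x # xs. 1 / (z + of_real x)) < 0" for x xs
    by (induction xs arbitrary: x) (use neg in \<open>auto simp: distrib_left intro: add_neg_neg\<close>)
  then show ?thesis using assms(2) by (cases xs) auto
qed

text \<open>The Gauss-Lucas argument for roots on the real line. Compared with Rolle's theorem it
  needs no bookkeeping of multiple roots.\<close>

lemma psplit_pderiv:
  assumes "psplit p" "degree p > 0"
  shows "psplit (pderiv p)"
proof -
  obtain c xs where p: "c > 0" "p = smult c (lin_prod xs)" using assms(1) psplit_def by auto
  then have xs: "xs \<noteq> []" using assms(2) by auto
  show ?thesis
  proof (rule real_roots_imp_psplit)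
    have "lead_coeff p > 0" using p by simp
    then show "lead_coeff (pderiv p) > 0" using assms(2) by (simp add: degree_pderiv coeff_pderiv)
    fix z assume z: "cpoly (pderiv p) z = 0"
    show "Im z = 0"
    proof (rule ccontr)
      assume nz: "Im z \<noteq> 0"
      have "(\<Sum>x\<leftarrow>xs. 1 / (z + of_real x)) = 0"
        using z p cpoly_pderiv_lin_prod[OF nz, of xs] by (simp add: pderiv_smult)
      then show False using Im_sum_inverse_neg[OF nz xs] by simp
    qed
  qed
qed

lemma psplit_higher_pderiv:
  assumes "psplit p" "m \<le> degree p"
  shows "psplit ((pderiv ^^ m) p)" "degree ((pderiv ^^ m) p) = degree p - m"
  using assms by (induction m) (auto intro: psplit_pderiv simp: degree_pderiv)

lemma poly_pderiv_lin_prod_pos: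
  assumes "\<And>x. x \<in> set xs \<Longrightarrow> t + x > 0"
  shows "poly (lin_prod xs) t > 0" "poly (pderiv (lin_prod xs)) t \<ge> 0"
    "xs \<noteq> [] \<Longrightarrow> poly (pderiv (lin_prod xs)) t > 0"
proof -
  have deriv_Cons: "poly (pderiv (lin_prod (y # ys))) t = (t + y) * poly (pderiv (lin_prod ys)) t + poly (lin_prod ys) t" for y ys
    by (simp only: lin_prod_simps pderiv_mult poly_add poly_mult) (simp add: pderiv_pCons add.commute)
  have val_Cons: "poly (lin_prod (y # ys)) t = (t + y) * poly (lin_prod ys) t" for y ys
    by (simp only: lin_prod_simps poly_mult) simp
  have *: "poly (lin_prod ys) t > 0 \<and> poly (pderiv (lin_prod ys)) t \<ge> 0" if "\<And>y. y \<in> set ys \<Longrightarrow> t + y > 0" for ys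
    using that
  proof (induction ys)
    case (Cons y ys)
    then have "t + y > 0" "poly (lin_prod ys) t > 0" "poly (pderiv (lin_prod ys)) t \<ge> 0" by auto
    then show ?case unfolding deriv_Cons val_Cons by auto
  qed simp
  then show "poly (lin_prod xs) t > 0" "poly (pderiv (lin_prod xs)) t \<ge> 0" using assms by auto
  assume "xs \<noteq> []"
  then obtain y ys where ys: "xs = y # ys" by (cases xs) auto
  then have "t + y > 0" "poly (lin_prod ys) t > 0" "poly (pderiv (lin_prod ys)) t \<ge> 0" using *[of ys] assms by auto
  then show "poly (pderiv (lin_prod xs)) t > 0" unfolding ys deriv_Cons by (simp add: add_nonneg_pos)
qed

lemma psplit_largest_root:
  assumes "psplit p" "degree p > 0"
  obtains r where "poly p r = 0" "\<And>x. x > r \<Longrightarrow> poly p x > 0" "\<And>x. x > r \<Longrightarrow> poly (pderiv p) x > 0"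
proof -
  obtain c xs where p: "c > 0" "p = smult c (lin_prod xs)" using assms(1) psplit_def by auto
  then have xs: "xs \<noteq> []" using assms(2) by auto
  define r where "r = - Min (set xs)"
  have "Min (set xs) \<in> set xs" using xs by (intro Min_in) auto
  then have "poly p r = 0" unfolding p r_def by (auto simp: poly_lin_prod prod_list_zero_iff)
  moreover have "x + y > 0" if "x > r" "y \<in> set xs" for x y
    using that Min_le[of "set xs" y] xs by (auto simp: r_def)
  then have "poly p x > 0" "poly (pderiv p) x > 0" if "x > r" for x
    using poly_pderiv_lin_prod_pos[of xs x] that p xs by (auto simp: pderiv_smult)
  ultimately show ?thesis using that by blast
qed

text \<open>Leibniz's rule, where all derivatives of the linear factor beyond the first vanish. At
  \<open>m = 0\<close> the truncated \<open>m - 1\<close> is harmless, its coefficient being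
  0.\<close>

lemma higher_pderiv_linear_mult:
  "(pderiv ^^ m) ([:a, 1:] * q) = [:a, 1:] * (pderiv ^^ m) q + smult (of_nat m) ((pderiv ^^ (m - 1)) q)"
proof (induction m)
  case (Suc m)
  have [simp]: "pderiv [:a, 1:] = 1" by (simp add: pderiv_pCons)
  have "(pderiv ^^ Suc m) ([:a, 1:] * q)
    = [:a, 1:] * (pderiv ^^ Suc m) q + (pderiv ^^ m) q + smult (of_nat m) (pderiv ((pderiv ^^ (m - 1)) q))"
    by (simp only: funpow.simps comp_def Suc pderiv_add pderiv_mult pderiv_smult) simp
  also have "smult (of_nat m) (pderiv ((pderiv ^^ (m - 1)) q)) = smult (of_nat m) ((pderiv ^^ m) q)"
    by (cases m) auto
  also have "[:a, 1:] * (pderiv ^^ Suc m) q + (pderiv ^^ m) q + smult (of_nat m) ((pderiv ^^ m) q)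
     = [:a, 1:] * (pderiv ^^ Suc m) q + smult (of_nat (Suc m)) ((pderiv ^^ m) q)"
    by (simp add: smult_add_left add.assoc)
  finally show ?case by simp
qed simp

text \<open>The largest root of \<open>q\<^sup>(\<^sup>m\<^sup>)\<close> does not exceed that of \<open>((X + a) q)\<^sup>(\<^sup>m\<^sup>)\<close>: at the former, \<open>q\<^sup>(\<^sup>m\<^sup>-\<^sup>1\<^sup>)\<close> is
  nonpositive since its largest root lies further to the right.\<close>
lemma pderiv_factor_pos:
  assumes m: "m \<le> length xs"
    and pos: "\<And>s. s \<ge> T \<Longrightarrow> poly ((pderiv ^^ m) ([:a, 1:] * lin_prod xs)) s > 0"
    and t: "t \<ge> T"
  shows "poly ((pderiv ^^ m) (lin_prod xs)) t > 0"
proof (rule ccontr)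
  assume neg: "\<not> ?thesis"
  let ?q = "lin_prod xs" let ?g = "(pderiv ^^ m) ?q"
  have "psplit ?q" unfolding psplit_def by (auto intro!: exI[of _ 1])
  then have g: "psplit ?g" "degree ?g = length xs - m" using psplit_higher_pderiv[of ?q m] m by auto
  have "degree ?g > 0"
  proof (rule ccontr)
    assume d: "\<not> degree ?g > 0"
    obtain c xs' where c: "c > 0" "?g = smult c (lin_prod xs')" using g psplit_def by auto
    then have "xs' = []" using d by auto
    then show False using neg c by auto
  qed
  then obtain s where s: "poly ?g s = 0" "\<And>x. x > s \<Longrightarrow> poly ?g x > 0" using psplit_largest_root g by blast
  \<comment> \<open>\<open>s\<close> is the largest root of the derivative, and the derivative is
    assumed nonpositive at \<open>t\<close>.\<close>
  have "s \<ge> t" using s(2)[of t] neg by linarith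
  then have ps: "poly ((pderiv ^^ m) ([:a, 1:] * ?q)) s > 0" using pos t by auto
  have eq: "poly ((pderiv ^^ m) ([:a, 1:] * ?q)) s = of_nat m * poly ((pderiv ^^ (m - 1)) ?q) s"
    unfolding higher_pderiv_linear_mult using s by simp
  show False
  proof (cases m)
    case 0 then show ?thesis using ps eq by simp
  next
    case (Suc m')
    let ?f = "(pderiv ^^ m') ?q"
    have f: "psplit ?f" "degree ?f = length xs - m'" using psplit_higher_pderiv[of ?q m'] m Suc \<open>psplit ?q\<close> by auto
    moreover have "length xs - m' > 0" using m Suc by simp
    ultimately obtain r where r: "poly ?f r = 0" "\<And>x. x > r \<Longrightarrow> poly (pderiv ?f) x > 0"
      using psplit_largest_root[of ?f] by metis
    have fg: "pderiv ?f = ?g" using Suc by simp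
    \<comment> \<open>The derivative of \<open>?f\<close> is \<open>?g\<close>, which is positive
      beyond \<open>r\<close>, so its root \<open>s\<close> cannot lie there. On [s, r]
      \<open>?g\<close> is nonnegative, hence \<open>?f\<close> is nondecreasing and its value at
      \<open>s\<close> is at most 0, against \<open>ps\<close> and \<open>eq\<close>.\<close>
    have "s \<le> r" using r(2)[of s] s(1) fg by force
    then have "poly ?f s \<le> poly ?f r"
    proof (rule DERIV_nonneg_imp_nondecreasing)
      fix x assume "s \<le> x" "x \<le> r"
      then have "poly ?g x \<ge> 0" using s by (cases "x = s") (auto intro: less_imp_le)
      then show "\<exists>y. (poly ?f has_real_derivative y) (at x) \<and> 0 \<le> y" using poly_DERIV[of ?f x] fg by auto
    qed
    then show False using ps eq r Suc by (simp add: mult_le_0_iff zero_less_mult_iff)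
  qed
qed

section \<open>The Garding cone and monotonicity of elementary symmetric functions\<close>

lemma poly_pos_of_coeffs:
  fixes p :: "real poly"
  assumes "\<And>i. coeff p i \<ge> 0" "coeff p 0 > 0" "s \<ge> 0"
  shows "poly p s > 0"
proof -
  have "poly p s = coeff p 0 + (\<Sum>i\<in>{..degree p} - {0}. coeff p i * s ^ i)"
    unfolding poly_altdef by (subst sum.remove[of _ 0]) auto
  moreover have "(\<Sum>i\<in>{..degree p} - {0}. coeff p i * s ^ i) \<ge> 0"
    using assms by (intro sum_nonneg) auto
  ultimately show ?thesis using assms by linarith
qed

text \<open>The Garding cone, described by positivity of the elementary symmetric functions of
  orders 0 to \<open>k\<close>; order j is the coefficient of degree n - j. Lists allow eigenvalues
  to be changed one at a time.\<close>

definition in_cone :: "nat \<Rightarrow> real list \<Rightarrow> bool" where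
  "in_cone k xs \<longleftrightarrow> (\<forall>j\<le>k. coeff (lin_prod xs) (length xs - j) > 0)"

lemma coeff_lin_prod_pos:
  assumes "\<And>x. x \<in> set xs \<Longrightarrow> x > 0" "i \<le> length xs"
  shows "coeff (lin_prod xs) i > 0"
  using assms
proof (induction xs arbitrary: i)
  case (Cons x xs)
  have "coeff (lin_prod xs) j \<ge> 0" for j
    using Cons.IH[of j] Cons.prems(1) coeff_eq_0[of "lin_prod xs" j] by (cases "j \<le> length xs") (auto intro: less_imp_le)
  then show ?case using Cons.IH[of "i - 1"] Cons.IH[of i] Cons.prems
    by (cases i) (auto intro!: add_nonneg_pos mult_nonneg_nonneg dest: less_imp_le)
qed (auto simp: coeff_1)

text \<open>Differentiating n - k times retains exactly the symmetric functions of orders 0 to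
  \<open>k\<close>, multiplied by positive Pochhammer factors, and puts the one of order
  \<open>k\<close> in the constant term.\<close>

lemma in_cone_higher_pderiv_pos:
  assumes nonneg: "\<And>j. j \<le> k \<Longrightarrow> coeff (lin_prod xs) (length xs - j) \<ge> 0"
    and pos: "coeff (lin_prod xs) (length xs - k) > 0" and k: "k \<le> length xs" and s: "s \<ge> 0"
  shows "poly ((pderiv ^^ (length xs - k)) (lin_prod xs)) s > 0"
proof (rule poly_pos_of_coeffs[OF _ _ s])
  let ?n = "length xs"
  show "coeff ((pderiv ^^ (?n - k)) (lin_prod xs)) i \<ge> 0" for i
  proof (cases "i \<le> k")
    case True
    then have "i + (?n - k) = ?n - (k - i)" using k by simp
    then show ?thesis unfolding coeff_higher_pderiv using nonneg[of "k - i"]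
      by (auto intro!: mult_nonneg_nonneg pochhammer_nonneg)
  next
    case False
    then show ?thesis unfolding coeff_higher_pderiv using k by (simp add: coeff_eq_0)
  qed
  show "coeff ((pderiv ^^ (?n - k)) (lin_prod xs)) 0 > 0"
    unfolding coeff_higher_pderiv using pos by (auto intro!: mult_pos_pos pochhammer_pos)
qed

text \<open>The derivative of order n - k is real-rooted of degree \<open>k\<close> and positive on
  the nonnegative half-line. Its roots are thus negative, which makes all its coefficients strictly
  positive. This is what makes the cone relatively closed in the set where \<open>\<sigma>_k\<close>
  is positive.\<close>

lemma in_cone_closed:
  assumes nonneg: "\<And>j. j \<le> k \<Longrightarrow> coeff (lin_prod xs) (length xs - j) \<ge> 0"
    and pos: "coeff (lin_prod xs) (length xs - k) > 0" and k: "k \<le> length xs"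
  shows "in_cone k xs"
proof -
  let ?n = "length xs" let ?f = "(pderiv ^^ (?n - k)) (lin_prod xs)"
  have "psplit (lin_prod xs)" unfolding psplit_def by (auto intro!: exI[of _ 1])
  then have f: "psplit ?f" "degree ?f = k" using psplit_higher_pderiv[of "lin_prod xs" "?n - k"] k by auto
  then obtain c zs where c: "c > 0" "?f = smult c (lin_prod zs)" using psplit_def by auto
  then have zs: "length zs = k" using f by simp
  have zpos: "z > 0" if "z \<in> set zs" for z
  proof (rule ccontr)
    assume "\<not> z > 0"
    then have "poly ?f (- z) > 0" by (intro in_cone_higher_pderiv_pos nonneg pos k) auto
    moreover have "poly ?f (- z) = 0" using that unfolding c by (auto simp: poly_lin_prod prod_list_zero_iff)
    ultimately show False by simp
  qed
  show ?thesis unfolding in_cone_def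
  proof (intro allI impI)
    fix j assume j: "j \<le> k"
    have "coeff ?f (k - j) > 0" unfolding c using c(1) coeff_lin_prod_pos[of zs "k - j"] zs zpos by auto
    moreover have "k - j + (?n - k) = ?n - j" using j k by simp
    ultimately have "pochhammer (of_nat (Suc (k - j))) (?n - k) * coeff (lin_prod xs) (?n - j) > 0"
      by (simp only: coeff_higher_pderiv)
    moreover have "pochhammer (of_nat (Suc (k - j))) (?n - k) > (0::real)" by (intro pochhammer_pos) auto
    ultimately show "coeff (lin_prod xs) (?n - j) > 0" by (simp add: zero_less_mult_iff)
  qed
qed

text \<open>Raising one entry from \<open>x\<close> to \<open>y\<close> adds y - x times the
  symmetric function of order j - 1 of the remaining entries. That one is positive because dropping
  a linear factor does not move the largest root of the derivative to the right
  (\<open>pderiv_factor_pos\<close>).\<close>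

lemma in_cone_raise:
  assumes cone: "in_cone k (xs @ x # ys)" and k: "k \<le> length (xs @ x # ys)" and xy: "x \<le> y" and j: "j \<le> k"
  shows "coeff (lin_prod (xs @ x # ys)) (length (xs @ x # ys) - j) \<le> coeff (lin_prod (xs @ y # ys)) (length (xs @ y # ys) - j)"
proof (cases "j = 0")
  case True
  then show ?thesis by (simp only: minus_nat.diff_0 lead_coeff_lin_prod)
next
  case False
  let ?n = "length (xs @ x # ys)" let ?zs = "xs @ ys"
  have split: "lin_prod (xs @ z # ys) = [:z, 1:] * lin_prod ?zs" for z
    by (simp add: lin_prod_append algebra_simps del: mult_pCons_left)
  have m: "?n - j \<le> length ?zs" using False by simp
  have nn: "coeff (lin_prod (xs @ x # ys)) (?n - i) > 0" if "i \<le> j" for i using cone that j by (auto simp: in_cone_def)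
  have "poly ((pderiv ^^ (?n - j)) (lin_prod ?zs)) 0 > 0"
  proof (rule pderiv_factor_pos[OF m _ order_refl])
    fix s :: real assume "s \<ge> 0"
    then show "poly ((pderiv ^^ (?n - j)) ([:x, 1:] * lin_prod ?zs)) s > 0"
      unfolding split[symmetric] using nn j k by (intro in_cone_higher_pderiv_pos) (auto intro: less_imp_le simp del: length_append)
  qed
  then have "coeff ((pderiv ^^ (?n - j)) (lin_prod ?zs)) 0 > 0" by (simp add: poly_0_coeff_0)
  then have "coeff (lin_prod ?zs) (?n - j) > 0"
    using pochhammer_pos[of "1::real" "?n - j"] by (simp add: coeff_higher_pderiv zero_less_mult_iff del: length_append)
  moreover have "lin_prod (xs @ y # ys) = lin_prod (xs @ x # ys) + smult (y - x) (lin_prod ?zs)"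
    unfolding split by (simp add: algebra_simps smult_diff_left)
  ultimately show ?thesis using xy by simp
qed

text \<open>Entries are replaced from left to right; every intermediate list stays in the cone, so
  that the single-entry lemma applies again.\<close>

lemma in_cone_mono:
  assumes len: "length ys = length xs" and le: "\<And>i. i < length xs \<Longrightarrow> xs ! i \<le> ys ! i"
    and cone: "in_cone k xs" and k: "k \<le> length xs"
  shows "coeff (lin_prod xs) (length xs - k) \<le> coeff (lin_prod ys) (length xs - k)"
proof -
  let ?n = "length xs" let ?z = "\<lambda>m. take m ys @ drop m xs"
  have "in_cone k (?z m) \<and> coeff (lin_prod xs) (?n - k) \<le> coeff (lin_prod (?z m)) (?n - k)" if "m \<le> ?n" for m
    using that
  proof (induction m)
    case 0 then show ?case using cone by simp
  next
    case (Suc m)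
    have z1: "?z m = take m ys @ xs ! m # drop (Suc m) xs" using Suc.prems by (simp add: Cons_nth_drop_Suc)
    have z2: "?z (Suc m) = take m ys @ ys ! m # drop (Suc m) xs" using Suc.prems len by (simp add: take_Suc_conv_app_nth)
    have l: "length (?z m) = ?n" "length (?z (Suc m)) = ?n" using Suc.prems len by auto
    have IH: "in_cone k (?z m)" "coeff (lin_prod xs) (?n - k) \<le> coeff (lin_prod (?z m)) (?n - k)"
      using Suc.IH Suc.prems by linarith+
    have raise: "coeff (lin_prod (?z m)) (length (?z m) - j) \<le> coeff (lin_prod (?z (Suc m))) (length (?z (Suc m)) - j)" if "j \<le> k" for j
      unfolding z1 z2
      by (rule in_cone_raise[of k]) (use IH(1) k l(1) le[of m] that Suc.prems in \<open>auto simp only: z1\<close>)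
    have "in_cone k (?z (Suc m))" unfolding in_cone_def
    proof (intro allI impI)
      fix j assume "j \<le> k"
      then show "coeff (lin_prod (?z (Suc m))) (length (?z (Suc m)) - j) > 0"
        using raise[of j] IH(1)[unfolded in_cone_def, rule_format, of j] by linarith
    qed
    moreover have "coeff (lin_prod xs) (?n - k) \<le> coeff (lin_prod (?z (Suc m))) (?n - k)"
      using raise[of k] IH(2) unfolding l by linarith
    ultimately show ?case by blast
  qed
  from this[of ?n] show ?thesis using len by simp
qed

section \<open>Elementary symmetric functions as coefficients\<close>

lemma coeff_prod_linear:
  fixes a :: "'i \<Rightarrow> real"
  assumes I: "finite I" and k: "k \<le> card I"
  shows "coeff (\<Prod>i\<in>I. [:a i, 1:]) (card I - k) = (\<Sum>S | S \<subseteq> I \<and> card S = k. \<Prod>i\<in>S. a i)"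
proof -
  have const: "(\<Prod>i\<in>S. [:a i:]) = [:\<Prod>i\<in>S. a i:]" for S
    by (induction S rule: infinite_finite_induct) (auto simp: one_pCons)
  have "(\<Prod>i\<in>I. [:a i, 1:]) = (\<Prod>i\<in>I. [:a i:] + monom 1 1)" by (simp add: monom_altdef)
  also have "\<dots> = (\<Sum>S\<in>Pow I. (\<Prod>i\<in>S. [:a i:]) * (\<Prod>i\<in>I - S. monom 1 1))" by (rule prod_add[OF I])
  also have "\<dots> = (\<Sum>S\<in>Pow I. monom (\<Prod>i\<in>S. a i) (card (I - S)))"
    by (intro sum.cong refl) (simp add: const monom_power smult_monom)
  finally have "coeff (\<Prod>i\<in>I. [:a i, 1:]) (card I - k) = (\<Sum>S\<in>Pow I. if card (I - S) = card I - k then \<Prod>i\<in>S. a i else 0)"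
    by (simp add: coeff_sum)
  also have "\<dots> = (\<Sum>S\<in>{S\<in>Pow I. card (I - S) = card I - k}. \<Prod>i\<in>S. a i)"
    by (rule sum.inter_filter[symmetric]) (use I in auto)
  also have "{S\<in>Pow I. card (I - S) = card I - k} = {S. S \<subseteq> I \<and> card S = k}"
  proof -
    have "card (I - S) = card I - k \<longleftrightarrow> card S = k" if "S \<subseteq> I" for S
      using card_Diff_subset[of S I] card_mono[OF I that] finite_subset[OF that I] that k by auto
    then show ?thesis by auto
  qed
  finally show ?thesis .
qed

lemma elem_sym_coeff:
  assumes "k \<le> length xs"
  shows "elem_sym k xs = coeff (lin_prod xs) (length xs - k)"
proof -
  have "lin_prod xs = (\<Prod>i<length xs. [:xs ! i, 1:])"
    unfolding lin_prod_def by (simp add: prod.list_conv_set_nth atLeast0LessThan)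
  then show ?thesis using coeff_prod_linear[of "{..<length xs}" k "\<lambda>i. xs ! i"] assms by (simp add: elem_sym_def)
qed

subsection \<open>Spectral theorem and the functions \<open>\<sigma>\<^sub>k\<close>\<close>

lemma symmetric_inner:
  fixes A :: "real^'n^'n::finite"
  assumes "transpose A = A"
  shows "x \<bullet> (A *v y) = (A *v x) \<bullet> y"
  by (metis assms dot_lmul_matrix vector_transpose_matrix)

text \<open>The quadratic form attains its maximum on the unit sphere of \<open>S\<close>, and a
  maximiser is an eigenvector. An invariant subspace is allowed so that the lemma can be iterated on
  orthogonal complements.\<close>

lemma symmetric_eigenvector:
  fixes A :: "real^'n^'n::finite"
  assumes sym: "transpose A = A" and S: "subspace S" and inv: "\<And>x. x \<in> S \<Longrightarrow> A *v x \<in> S" and nz: "S \<noteq> {0}"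
  obtains x l where "x \<in> S" "norm x = 1" "A *v x = l *\<^sub>R x"
proof -
  let ?K = "S \<inter> sphere 0 1"
  obtain y where y: "y \<in> S" "y \<noteq> 0" using nz subspace_0[OF S] by auto
  then have "y /\<^sub>R norm y \<in> ?K" using subspace_scale[OF S] by auto
  then have "?K \<noteq> {}" by blast
  moreover have "compact ?K" using closed_subspace[OF S] by (intro closed_Int_compact) auto
  moreover have "continuous_on ?K (\<lambda>x. x \<bullet> (A *v x))"
    by (intro continuous_intros linear_continuous_on matrix_vector_mul_bounded_linear)
  ultimately obtain x where x: "x \<in> ?K" and mx: "\<And>y. y \<in> ?K \<Longrightarrow> y \<bullet> (A *v y) \<le> x \<bullet> (A *v x)"
    using continuous_attains_sup[of ?K "\<lambda>x. x \<bullet> (A *v x)"] by blast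
  define l where "l = x \<bullet> (A *v x)"
  have quad: "z \<bullet> (A *v z) \<le> l * (z \<bullet> z)" if z: "z \<in> S" for z
  proof (cases "z = 0")
    case False
    have "z /\<^sub>R norm z \<in> ?K" using z False subspace_scale[OF S] by auto
    from mx[OF this] have "inverse (norm z) * (inverse (norm z) * (z \<bullet> (A *v z))) \<le> l"
      by (simp only: matrix_vector_mult_scaleR inner_scaleR_left inner_scaleR_right l_def)
    then have "(norm z)\<^sup>2 * (inverse (norm z) * (inverse (norm z) * (z \<bullet> (A *v z)))) \<le> (norm z)\<^sup>2 * l"
      by (intro mult_left_mono) auto
    moreover have "(norm z)\<^sup>2 * (inverse (norm z) * (inverse (norm z) * (z \<bullet> (A *v z)))) = z \<bullet> (A *v z)"
      using False by (simp add: power2_eq_square field_simps)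
    ultimately show ?thesis by (simp add: dot_square_norm mult.commute)
  qed simp
  define y where "y = A *v x - l *\<^sub>R x"
  have yS: "y \<in> S" using x inv S unfolding y_def by (auto intro: subspace_diff subspace_scale)
  have xx: "x \<bullet> x = 1" using x by (simp add: dot_square_norm)
  have "x \<bullet> y = x \<bullet> (A *v x) - l * (x \<bullet> x)" by (simp add: y_def inner_diff_right)
  then have yx: "y \<bullet> x = 0" by (simp add: xx l_def inner_commute)
  have "A *v x = y + l *\<^sub>R x" by (simp add: y_def)
  then have yAx: "y \<bullet> (A *v x) = y \<bullet> y" by (simp add: inner_add_right yx)
  define b where "b = y \<bullet> y" define c where "c = l * b - y \<bullet> (A *v y)"
  \<comment> \<open>Maximality is tested at x + t y, where y is the part of A x orthogonal to x: the
    gain 2 b t is linear in t, the loss quadratic.\<close>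
  have main: "2 * b * t \<le> c * t\<^sup>2" for t
  proof -
    have "x + t *\<^sub>R y \<in> S" using x yS S by (auto intro: subspace_add subspace_scale)
    from quad[OF this] have "(x + t *\<^sub>R y) \<bullet> (A *v (x + t *\<^sub>R y)) \<le> l * ((x + t *\<^sub>R y) \<bullet> (x + t *\<^sub>R y))" .
    moreover have "(x + t *\<^sub>R y) \<bullet> (A *v (x + t *\<^sub>R y)) = l + 2 * t * b + t\<^sup>2 * (y \<bullet> (A *v y))"
      using yAx symmetric_inner[OF sym, of x y]
      by (simp add: matrix_vector_right_distrib matrix_vector_mult_scaleR inner_add_left inner_add_right b_def l_def[symmetric]
          inner_commute power2_eq_square distrib_left)
    moreover have "(x + t *\<^sub>R y) \<bullet> (x + t *\<^sub>R y) = 1 + t\<^sup>2 * b"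
      using yx by (simp add: inner_add_left inner_add_right xx b_def inner_commute power2_eq_square)
    ultimately have "l + 2 * t * b + t\<^sup>2 * (y \<bullet> (A *v y)) \<le> l * (1 + t\<^sup>2 * b)" by (simp only:)
    then show ?thesis by (simp add: c_def algebra_simps)
  qed
  have "b \<le> 0"
  proof (rule ccontr)
    assume "\<not> b \<le> 0"
    then have b: "b > 0" by simp
    \<comment> \<open>With this \<open>t\<close> the quadratic term is at most b t, which is smaller
      than 2 b t.\<close>
    define t where "t = b / (\<bar>c\<bar> + 1)"
    have t: "t > 0" using b by (simp add: t_def add_nonneg_pos)
    have "2 * b * t \<le> c * t * t" using main[of t] by (simp add: power2_eq_square)
    then have "2 * b \<le> c * t" using t by simp
    also have "c * t \<le> \<bar>c\<bar> * t" using t by (simp add: mult_right_mono)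
    also have "\<dots> \<le> (\<bar>c\<bar> + 1) * t" using t by (simp add: mult_right_mono)
    also have "\<dots> = b" by (simp add: t_def)
    finally show False using b by simp
  qed
  then have "y \<bullet> y = 0" using inner_ge_zero[of y] unfolding b_def by linarith
  then have "y = 0" by simp
  then show ?thesis using that[of x l] x by (auto simp: y_def)
qed

text \<open>Symmetry makes the orthogonal complement of an eigenvector in \<open>S\<close> invariant
  again, so induction on the dimension applies.\<close>

lemma symmetric_eigenbasis_subspace:
  fixes A :: "real^'n^'n::finite"
  assumes sym: "transpose A = A"
  shows "subspace S \<Longrightarrow> (\<And>x. x \<in> S \<Longrightarrow> A *v x \<in> S) \<Longrightarrow> dim S = d \<Longrightarrow>
    \<exists>B\<subseteq>S. finite B \<and> card B = d \<and> pairwise orthogonal B \<and> (\<forall>x\<in>B. norm x = 1 \<and> (\<exists>l. A *v x = l *\<^sub>R x))"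
proof (induction d arbitrary: S)
  case 0
  then show ?case by (intro exI[of _ "{}"]) auto
next
  case (Suc d)
  have "S \<noteq> {0}" using Suc.prems(3) by auto
  then obtain x l where x: "x \<in> S" "norm x = 1" "A *v x = l *\<^sub>R x"
    using symmetric_eigenvector[OF sym Suc.prems(1,2)] by metis
  define T where "T = {y \<in> S. \<forall>z\<in>span {x}. orthogonal z y}"
  have T_iff: "y \<in> T \<longleftrightarrow> y \<in> S \<and> x \<bullet> y = 0" for y
    by (auto simp: T_def span_singleton orthogonal_def)
  have "dim T + dim (span {x}) = dim S" unfolding T_def
    using x(1) Suc.prems(1) by (intro dim_subspace_orthogonal_to_vectors) (auto simp: span_minimal)
  moreover have "dim (span {x}) = 1" using x(2) by (simp add: dim_singleton) (metis norm_zero zero_neq_one)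
  ultimately have "dim T = d" using Suc.prems(3) by simp
  moreover have "subspace T" using Suc.prems(1) unfolding subspace_def by (auto simp: T_iff inner_add_right)
  moreover have "A *v y \<in> T" if "y \<in> T" for y
    using that Suc.prems(2) symmetric_inner[OF sym, of x y] x by (auto simp: T_iff)
  ultimately obtain B where B: "B \<subseteq> T" "finite B" "card B = d" "pairwise orthogonal B"
    "\<forall>x\<in>B. norm x = 1 \<and> (\<exists>l. A *v x = l *\<^sub>R x)" using Suc.IH by metis
  have "x \<notin> B" using B(1) x(2) by (auto simp: T_iff dot_square_norm)
  moreover have "pairwise orthogonal (insert x B)"
    using B by (auto simp: pairwise_insert orthogonal_def T_iff inner_commute subset_iff)
  ultimately show ?case using B x by (intro exI[of _ "insert x B"]) (auto simp: T_iff)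
qed

lemma symmetric_eigenbasis:
  fixes A :: "real^'n^'n::finite"
  assumes sym: "transpose A = A"
  obtains v :: "'n \<Rightarrow> real^'n" and l where "\<And>i. A *v v i = l i *\<^sub>R v i" "\<And>i j. v i \<bullet> v j = (if i = j then 1 else 0)"
proof -
  obtain B :: "(real^'n) set" where B: "finite B" "card B = CARD('n)" "pairwise orthogonal B"
    "\<forall>x\<in>B. norm x = 1 \<and> (\<exists>l. A *v x = l *\<^sub>R x)"
    using symmetric_eigenbasis_subspace[OF sym subspace_UNIV] by (auto simp: dim_UNIV)
  obtain v where v: "bij_betw v (UNIV :: 'n set) B" using B finite_same_card_bij[of "UNIV :: 'n set" B] by auto
  have vB: "v i \<in> B" for i using v bij_betwE by blast
  define l where "l i = (SOME l. A *v v i = l *\<^sub>R v i)" for i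
  have "A *v v i = l i *\<^sub>R v i" for i unfolding l_def by (rule someI_ex) (use B vB in auto)
  moreover have "v i \<bullet> v j = (if i = j then 1 else 0)" for i j
  proof (cases "i = j")
    case False
    then have "v i \<noteq> v j" using v by (auto simp: bij_betw_def inj_on_def)
    then show ?thesis using B(3) vB False by (auto simp: pairwise_def orthogonal_def)
  qed (use B(4) vB in \<open>simp add: dot_square_norm\<close>)
  ultimately show ?thesis using that by blast
qed

text \<open>The polynomial det (X I + A), a sign-free version of \<open>charpoly\<close>. Its
  coefficients are polynomial in the entries of \<open>A\<close>, and for symmetric \<open>A\<close>
  they are the \<open>\<sigma>_k\<close>.\<close>

definition detp :: "real^'n^'n::finite \<Rightarrow> real poly" where
  "detp A = det (\<chi> i j. (if i = j then [:0, 1:] else 0) + [:A $ i $ j:])"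

lemma poly_det: "poly (det M) t = det (\<chi> i j. poly (M $ i $ j) t)"
  by (simp add: det_def poly_sum poly_prod)

lemma orthonormal_expansion:
  fixes v :: "'n::finite \<Rightarrow> real^'n"
  assumes v: "\<And>i j. v i \<bullet> v j = (if i = j then 1 else 0)"
  shows "x = (\<Sum>i\<in>UNIV. (x \<bullet> v i) *\<^sub>R v i)"
proof -
  define P :: "real^'n^'n" where "P = (\<chi> i. v i)"
  have "P ** transpose P = mat 1"
    using v by (simp add: P_def matrix_matrix_mult_def transpose_def mat_def vec_eq_iff inner_vec_def)
  then have "transpose P ** P = mat 1" using matrix_left_right_inverse by blast
  then have "x = transpose P *v (P *v x)" by (simp add: matrix_vector_mul_assoc)
  also have "\<dots> = (\<Sum>i\<in>UNIV. (x \<bullet> v i) *\<^sub>R v i)"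
    by (simp add: vec_eq_iff matrix_vector_mult_def transpose_def P_def inner_vec_def mult.commute)
  finally show ?thesis .
qed

text \<open>With the eigenvectors as rows of \<open>P\<close> and the eigenvalues in
  \<open>D\<close>, A times the transpose of P equals that transpose times D; the factor det P
  cancels since its square is 1.\<close>

lemma det_eigenbasis:
  fixes A :: "real^'n^'n::finite" and v :: "'n \<Rightarrow> real^'n"
  assumes A: "\<And>i. A *v v i = l i *\<^sub>R v i" and v: "\<And>i j. v i \<bullet> v j = (if i = j then 1 else 0)"
  shows "det A = (\<Prod>i\<in>UNIV. l i)"
proof -
  define P :: "real^'n^'n" where "P = (\<chi> i. v i)"
  define D :: "real^'n^'n" where "D = (\<chi> i j. if i = j then l i else 0)"
  have PP: "P ** transpose P = mat 1"
    using v by (simp add: P_def matrix_matrix_mult_def transpose_def mat_def vec_eq_iff inner_vec_def)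
  have "A ** transpose P = transpose P ** D"
  proof -
    have "(A ** transpose P) $ i $ j = (A *v v j) $ i" for i j
      by (simp add: matrix_matrix_mult_def transpose_def P_def matrix_vector_mult_def)
    moreover have "(transpose P ** D) $ i $ j = l j * v j $ i" for i j
      by (simp add: matrix_matrix_mult_def transpose_def P_def D_def if_distrib cong: if_cong)
    ultimately show ?thesis by (simp add: vec_eq_iff A)
  qed
  then have "det A * det P = det P * det D" by (metis det_mul det_transpose)
  moreover have "det P * det P = 1" using PP by (metis det_I det_mul det_transpose)
  moreover have "det D = (\<Prod>i\<in>UNIV. l i)" unfolding D_def by (subst det_diagonal) auto
  ultimately show ?thesis by (metis mult.commute mult_cancel_right mult_zero_right zero_neq_one)
qed

lemma matrix_add_scalar_vector: "(t *\<^sub>R mat 1 + A) *v x = t *\<^sub>R x + A *v (x :: real^'n::finite)"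
  by (simp add: matrix_vector_mult_add_rdistrib scaleR_matrix_vector_assoc[symmetric])

lemma detp_eigenbasis:
  fixes A :: "real^'n^'n::finite" and v :: "'n \<Rightarrow> real^'n"
  assumes A: "\<And>i. A *v v i = l i *\<^sub>R v i" and v: "\<And>i j. v i \<bullet> v j = (if i = j then 1 else 0)"
  shows "detp A = (\<Prod>i\<in>UNIV. [:l i, 1:])" "charpoly A = (\<Prod>i\<in>UNIV. [:- l i, 1:])"
proof -
  have 1: "det (t *\<^sub>R mat 1 + A) = (\<Prod>i\<in>UNIV. t + l i)" for t
    by (rule det_eigenbasis[OF _ v]) (simp add: matrix_add_scalar_vector A scaleR_add_left)
  have 2: "det (t *\<^sub>R mat 1 - A) = (\<Prod>i\<in>UNIV. t - l i)" for t
    by (rule det_eigenbasis[OF _ v])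
       (simp add: matrix_vector_mult_diff_rdistrib scaleR_matrix_vector_assoc[symmetric] A scaleR_diff_left)
  have "poly (detp A) t = poly (\<Prod>i\<in>UNIV. [:l i, 1:]) t" for t
  proof -
    have "(\<chi> i j. poly ((if i = j then [:0, 1:] else 0) + [:A $ i $ j:]) t) = t *\<^sub>R mat 1 + A"
      by (simp add: vec_eq_iff mat_def)
    then show ?thesis using 1[of t] by (simp add: detp_def poly_det poly_prod algebra_simps)
  qed
  then have "poly (detp A) = poly (\<Prod>i\<in>UNIV. [:l i, 1:])" by (rule ext)
  then show "detp A = (\<Prod>i\<in>UNIV. [:l i, 1:])" by (simp only: poly_eq_poly_eq_iff)
  have "poly (charpoly A) t = poly (\<Prod>i\<in>UNIV. [:- l i, 1:]) t" for t
  proof -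
    have "(\<chi> i j. poly ((if i = j then [:0, 1:] else 0) - [:A $ i $ j:]) t) = t *\<^sub>R mat 1 - A"
      by (simp add: vec_eq_iff mat_def)
    then show ?thesis using 2[of t] by (simp add: charpoly_def poly_det poly_prod del: poly_diff)
  qed
  then have "poly (charpoly A) = poly (\<Prod>i\<in>UNIV. [:- l i, 1:])" by (rule ext)
  then show "charpoly A = (\<Prod>i\<in>UNIV. [:- l i, 1:])" by (simp only: poly_eq_poly_eq_iff)
qed

lemma mset_eigvals:
  fixes A :: "real^'n^'n::finite" and v :: "'n \<Rightarrow> real^'n"
  assumes A: "\<And>i. A *v v i = l i *\<^sub>R v i" and v: "\<And>i j. v i \<bullet> v j = (if i = j then 1 else 0)"
  shows "mset (eigvals A) = image_mset l (mset_set UNIV)"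
proof -
  have "proots (charpoly A) = (\<Sum>i\<in>UNIV. {#l i#})"
    unfolding detp_eigenbasis(2)[OF A v] by (subst proots_prod) auto
  also have "\<dots> = image_mset l (mset_set UNIV)"
    by (simp add: sum_unfold_sum_mset)
  finally show ?thesis by (simp add: eigvals_def)
qed

lemma
  fixes A :: "real^'n^'n::finite"
  assumes sym: "transpose A = A"
  shows length_eigvals: "length (eigvals A) = CARD('n)" and detp_eigvals: "detp A = lin_prod (eigvals A)"
proof -
  obtain v :: "'n \<Rightarrow> real^'n" and l where A: "\<And>i. A *v v i = l i *\<^sub>R v i" and v: "\<And>i j. v i \<bullet> v j = (if i = j then 1 else 0)"
    by (rule symmetric_eigenbasis[OF sym]) blast
  note m = mset_eigvals[OF A v]
  show "length (eigvals A) = CARD('n)" using arg_cong[OF m, of size] by simp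
  have "lin_prod (eigvals A) = prod_mset (image_mset (\<lambda>x. [:x, 1:]) (mset (eigvals A)))"
    by (simp add: lin_prod_def prod_mset_prod_list[symmetric])
  also have "\<dots> = (\<Prod>i\<in>UNIV. [:l i, 1:])" by (simp add: m prod_unfold_prod_mset image_mset.compositionality comp_def)
  finally show "detp A = lin_prod (eigvals A)" by (simp add: detp_eigenbasis(1)[OF A v])
qed

text \<open>Trades the list of eigenvalues for a polynomial in the matrix entries, from which
  continuity, smoothness and the first-order expansion of \<open>sigma\<close> are read off.\<close>

lemma sigma_eq_coeff:
  fixes A :: "real^'n^'n::finite"
  assumes "transpose A = A" "k \<le> CARD('n)"
  shows "sigma k A = coeff (detp A) (CARD('n) - k)"
  using assms by (simp add: sigma_def elem_sym_coeff length_eigvals detp_eigvals)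

section \<open>Monotonicity of eigenvalues under the order of quadratic forms\<close>

lemma quadratic_form_eigenbasis:
  fixes A :: "real^'n^'n::finite" and v :: "'n \<Rightarrow> real^'n"
  assumes A: "\<And>i. A *v v i = l i *\<^sub>R v i" and v: "\<And>i j. v i \<bullet> v j = (if i = j then 1 else 0)"
  shows "x \<bullet> (A *v x) = (\<Sum>i\<in>UNIV. l i * (x \<bullet> v i)\<^sup>2)" "x \<bullet> x = (\<Sum>i\<in>UNIV. (x \<bullet> v i)\<^sup>2)"
proof -
  have e: "x = (\<Sum>i\<in>UNIV. (x \<bullet> v i) *\<^sub>R v i)" by (rule orthonormal_expansion[OF v])
  have "A *v x = (\<Sum>i\<in>UNIV. (x \<bullet> v i) *\<^sub>R (l i *\<^sub>R v i))"
    by (subst e) (simp add: linear_sum[OF matrix_vector_mul_linear] matrix_vector_mult_scaleR A)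
  then have "x \<bullet> (A *v x) = (\<Sum>i\<in>UNIV. (x \<bullet> v i) * (l i * (x \<bullet> v i)))" by (simp add: inner_sum_right mult.assoc)
  then show "x \<bullet> (A *v x) = (\<Sum>i\<in>UNIV. l i * (x \<bullet> v i)\<^sup>2)" by (simp add: power2_eq_square mult_ac)
  have "x \<bullet> x = x \<bullet> (\<Sum>i\<in>UNIV. (x \<bullet> v i) *\<^sub>R v i)" using e by simp
  then show "x \<bullet> x = (\<Sum>i\<in>UNIV. (x \<bullet> v i)\<^sup>2)" by (simp add: inner_sum_right power2_eq_square)
qed

lemma dim_span_orthonormal:
  fixes v :: "'n::finite \<Rightarrow> real^'n"
  assumes v: "\<And>i j. v i \<bullet> v j = (if i = j then 1 else 0)"
  shows "dim (span (v ` I)) = card I" "x \<in> span (v ` I) \<Longrightarrow> i \<notin> I \<Longrightarrow> x \<bullet> v i = 0"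
proof -
  have inj: "inj v" by (metis injI v zero_neq_one)
  have "independent (v ` I)"
    by (rule pairwise_orthogonal_independent) (use v in \<open>auto simp: pairwise_def orthogonal_def, metis inner_zero_left zero_neq_one\<close>)
  then show "dim (span (v ` I)) = card I" using inj
    by (simp add: dim_span_eq_card_independent card_image inj_on_subset del: dim_span)
  assume "x \<in> span (v ` I)" "i \<notin> I"
  then show "x \<bullet> v i = 0"
    using orthogonal_to_span[of x "v ` I" "v i"] v by (force simp: orthogonal_def inner_commute)
qed

text \<open>Otherwise the span of the eigenvectors of \<open>A\<close> with eigenvalue above
  \<open>t\<close> and that of the eigenvectors of \<open>B\<close> with eigenvalue at most
  \<open>t\<close> have dimensions adding up to more than n. A common nonzero vector then has a
  larger form under \<open>A\<close> than under \<open>B\<close>.\<close>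

lemma count_eigenvalues_mono:
  fixes A B :: "real^'n^'n::finite" and v w :: "'n \<Rightarrow> real^'n"
  assumes le: "\<And>x. x \<bullet> (A *v x) \<le> x \<bullet> (B *v x)"
    and A: "\<And>i. A *v v i = l i *\<^sub>R v i" and v: "\<And>i j. v i \<bullet> v j = (if i = j then 1 else 0)"
    and B: "\<And>i. B *v w i = m i *\<^sub>R w i" and w: "\<And>i j. w i \<bullet> w j = (if i = j then 1 else 0)"
  shows "card {i. l i > t} \<le> card {i. m i > t}"
proof (rule ccontr)
  assume neg: "\<not> ?thesis"
  let ?V = "span (v ` {i. l i > t})" and ?W = "span (w ` {i. m i \<le> t})"
  have "{i. m i \<le> t} = UNIV - {i. m i > t}" by auto
  then have "card {i. m i \<le> t} = CARD('n) - card {i. m i > t}" using card_Diff_subset[of "{i. m i > t}" UNIV] by simp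
  moreover have "card {i. m i > t} \<le> CARD('n)" by (simp add: card_mono)
  ultimately have "dim ?V + dim ?W > CARD('n)"
    using neg by (simp add: dim_span_orthonormal(1)[OF v] dim_span_orthonormal(1)[OF w] del: dim_span)
  moreover have "dim {x + y |x y. x \<in> ?V \<and> y \<in> ?W} + dim (?V \<inter> ?W) = dim ?V + dim ?W"
    by (rule dim_sums_Int) auto
  moreover have "dim {x + y |x y. x \<in> ?V \<and> y \<in> ?W} \<le> CARD('n)" using dim_subset_UNIV[where 'a = "real^'n"] by simp
  ultimately have "dim (?V \<inter> ?W) \<noteq> 0" by linarith
  then obtain x where x: "x \<in> ?V" "x \<in> ?W" "x \<noteq> 0" by (auto simp: dim_eq_0)
  note qA = quadratic_form_eigenbasis[OF A v, of x] and qB = quadratic_form_eigenbasis[OF B w, of x]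
  have xv: "x \<bullet> v i = 0" if "l i \<le> t" for i using dim_span_orthonormal(2)[OF v x(1)] that by auto
  have xw: "x \<bullet> w i = 0" if "m i > t" for i using dim_span_orthonormal(2)[OF w x(2)] that by auto
  have "\<exists>i. x \<bullet> v i \<noteq> 0"
  proof (rule ccontr)
    assume "\<not> ?thesis"
    then have "(\<Sum>i\<in>UNIV. (x \<bullet> v i) *\<^sub>R v i) = 0" by simp
    then show False using orthonormal_expansion[OF v, of x] x(3) by simp
  qed
  then obtain i0 where i0: "x \<bullet> v i0 \<noteq> 0" by blast
  have "(\<Sum>i\<in>UNIV. t * (x \<bullet> v i)\<^sup>2) < (\<Sum>i\<in>UNIV. l i * (x \<bullet> v i)\<^sup>2)"
  proof (rule sum_strict_mono_ex1)
    show "\<forall>i\<in>UNIV. t * (x \<bullet> v i)\<^sup>2 \<le> l i * (x \<bullet> v i)\<^sup>2"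
      using xv by (metis linorder_le_cases mult_right_mono mult_zero_right order_refl power_zero_numeral zero_le_power2)
    show "\<exists>i\<in>UNIV. t * (x \<bullet> v i)\<^sup>2 < l i * (x \<bullet> v i)\<^sup>2"
    proof (rule bexI[of _ i0])
      have "t < l i0" using i0 xv[of i0] not_le by blast
      then show "t * (x \<bullet> v i0)\<^sup>2 < l i0 * (x \<bullet> v i0)\<^sup>2" using i0 by simp
    qed simp
  qed simp
  moreover have "(\<Sum>i\<in>UNIV. m i * (x \<bullet> w i)\<^sup>2) \<le> (\<Sum>i\<in>UNIV. t * (x \<bullet> w i)\<^sup>2)"
  proof (rule sum_mono)
    fix i show "m i * (x \<bullet> w i)\<^sup>2 \<le> t * (x \<bullet> w i)\<^sup>2"
      using xw[of i] by (cases "m i > t") (auto intro: mult_right_mono)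
  qed
  ultimately have "x \<bullet> (B *v x) < x \<bullet> (A *v x)"
    using qA qB by (simp add: sum_distrib_left[symmetric])
  then show False using le[of x] by simp
qed

lemma eigvals_mono:
  fixes A B :: "real^'n^'n::finite"
  assumes symA: "transpose A = A" and symB: "transpose B = B" and le: "\<And>x. x \<bullet> (A *v x) \<le> x \<bullet> (B *v x)"
    and i: "i < CARD('n)"
  shows "eigvals A ! i \<le> eigvals B ! i"
proof (rule ccontr)
  assume neg: "\<not> ?thesis"
  obtain v :: "'n \<Rightarrow> real^'n" and l where A: "\<And>i. A *v v i = l i *\<^sub>R v i" and v: "\<And>i j. v i \<bullet> v j = (if i = j then 1 else 0)"
    by (rule symmetric_eigenbasis[OF symA]) blast
  obtain w :: "'n \<Rightarrow> real^'n" and m where B: "\<And>i. B *v w i = m i *\<^sub>R w i" and w: "\<And>i j. w i \<bullet> w j = (if i = j then 1 else 0)"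
    by (rule symmetric_eigenbasis[OF symB]) blast
  define t where "t = eigvals B ! i"
  have cnt: "length (filter (\<lambda>x. x > t) (eigvals C)) = card {i. g i > t}"
    if "mset (eigvals C) = image_mset g (mset_set UNIV)" for C :: "real^'n^'n" and g :: "'n \<Rightarrow> real"
  proof -
    have "length (filter (\<lambda>x. x > t) (eigvals C)) = size (filter_mset (\<lambda>x. x > t) (mset (eigvals C)))"
      by (metis mset_filter size_mset)
    also have "\<dots> = card {i. g i > t}" unfolding that by (simp add: filter_mset_image_mset)
    finally show ?thesis .
  qed
  have sorted: "sorted (eigvals C)" for C :: "real^'n^'n" by (simp add: eigvals_def)
  \<comment> \<open>The lists are sorted upwards: if entry \<open>i\<close> of \<open>A\<close>
    exceeds entry \<open>i\<close> of \<open>B\<close>, taken as \<open>t\<close>, then at least n -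
    i eigenvalues of \<open>A\<close> but at most n - i - 1 of \<open>B\<close> exceed
    \<open>t\<close>.\<close>
  have "{i..<CARD('n)} \<subseteq> {j. j < CARD('n) \<and> eigvals A ! j > t}"
    using sorted_nth_mono[OF sorted[of A], of i] neg length_eigvals[OF symA] by (force simp: t_def)
  from card_mono[OF _ this] have a: "CARD('n) - i \<le> length (filter (\<lambda>x. x > t) (eigvals A))"
    by (simp add: length_filter_conv_card length_eigvals[OF symA])
  have "{j. j < CARD('n) \<and> eigvals B ! j > t} \<subseteq> {Suc i..<CARD('n)}"
    using sorted_nth_mono[OF sorted[of B], of _ i] i length_eigvals[OF symB] by (force simp: t_def not_less_eq_eq)
  from card_mono[OF _ this] have b: "length (filter (\<lambda>x. x > t) (eigvals B)) \<le> CARD('n) - Suc i"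
    by (simp add: length_filter_conv_card length_eigvals[OF symB])
  show False using count_eigenvalues_mono[OF le A v B w, of t] cnt[OF mset_eigvals[OF A v]] cnt[OF mset_eigvals[OF B w]] a b i
    by linarith
qed

text \<open>Ellipticity of the equation. The cone condition sits on the smaller matrix: in the
  comparison with an upper barrier this is the matrix of the solution, with a lower barrier it is
  that of the barrier, which must then be shown admissible.\<close>

lemma sigma_mono:
  fixes A B :: "real^'n^'n::finite"
  assumes symA: "transpose A = A" and symB: "transpose B = B" and le: "\<And>x. x \<bullet> (A *v x) \<le> x \<bullet> (B *v x)"
    and k: "k \<le> CARD('n)" and cone: "in_cone k (eigvals A)"
  shows "sigma k A \<le> sigma k B"
proof -
  have "coeff (lin_prod (eigvals A)) (length (eigvals A) - k) \<le> coeff (lin_prod (eigvals B)) (length (eigvals A) - k)"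
    using cone k eigvals_mono[OF symA symB le] by (intro in_cone_mono) (auto simp: length_eigvals symA symB)
  then show ?thesis using k by (simp add: sigma_eq_coeff symA symB detp_eigvals length_eigvals)
qed

section \<open>From the connected component to the cone\<close>

lemma in_cone_posdef:
  assumes A: "A \<in> posdef_matrices" and k: "k \<le> CARD('n)"
  shows "in_cone k (eigvals (A :: real^'n^'n::finite))"
proof -
  have sym: "transpose A = A" using A by (simp add: posdef_matrices_def sym_matrices_def)
  obtain v :: "'n \<Rightarrow> real^'n" and l where e: "\<And>i. A *v v i = l i *\<^sub>R v i" and v: "\<And>i j. v i \<bullet> v j = (if i = j then 1 else 0)"
    by (rule symmetric_eigenbasis[OF sym]) blast
  have "l i > 0" for i
  proof -
    have "v i \<noteq> 0" using v[of i i] by auto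
    then have "0 < v i \<bullet> (A *v v i)" using A by (auto simp: posdef_matrices_def)
    then show ?thesis using v[of i i] by (simp add: e)
  qed
  then have "x > 0" if "x \<in> set (eigvals A)" for x
    using that arg_cong[OF mset_eigvals[OF e v], of set_mset] by auto
  then show ?thesis using k coeff_lin_prod_pos[of "eigvals A"] by (auto simp: in_cone_def)
qed

text \<open>One argument for three properties: \<open>P\<close> will be continuity, smoothness, and
  possession of a quantitative first-order expansion, all stable under sums and products.\<close>

lemma coeff_det_closure:
  fixes P :: "('a \<Rightarrow> real) \<Rightarrow> bool" and M :: "'a \<Rightarrow> real poly^'n^'n::finite"
  assumes const: "\<And>c. P (\<lambda>x. c)" and add: "\<And>f g. P f \<Longrightarrow> P g \<Longrightarrow> P (\<lambda>x. f x + g x)"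
    and mult: "\<And>f g. P f \<Longrightarrow> P g \<Longrightarrow> P (\<lambda>x. f x * g x)"
    and M: "\<And>i j m. P (\<lambda>x. coeff (M x $ i $ j) m)"
  shows "P (\<lambda>x. coeff (det (M x)) m)"
proof -
  have sum: "P (\<lambda>x. \<Sum>i\<in>I. f i x)" if "\<And>i. i \<in> I \<Longrightarrow> P (f i)" for I :: "'b set" and f
    using that by (induction I rule: infinite_finite_induct) (auto intro: const add)
  have sum': "P (\<lambda>x. \<Sum>i\<in>I. f i x)" if "\<And>i. i \<in> I \<Longrightarrow> P (f i)" for I :: "nat set" and f
    using that by (induction I rule: infinite_finite_induct) (auto intro: const add)
  have prod: "P (\<lambda>x. coeff (\<Prod>i\<in>I. M x $ i $ p i) m)" for I p m
  proof (induction I arbitrary: m rule: infinite_finite_induct)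
    case (insert i I)
    then show ?case by (simp add: coeff_mult) (intro sum' mult M, auto)
  qed (auto intro: const)
  have "P (\<lambda>x. \<Sum>p | p permutes UNIV. of_int (sign p) * coeff (\<Prod>i\<in>UNIV. M x $ i $ p i) m)" 
    by (rule sum) (intro mult const prod)
  moreover have "coeff (of_int (sign p) * q) m = of_int (sign p) * coeff q m" for p :: "'n \<Rightarrow> 'n" and q :: "real poly"
    by (simp add: of_int_poly)
  ultimately show ?thesis by (simp only: det_def coeff_sum)
qed


lemma coeff_detp_closure:
  fixes P :: "('a \<Rightarrow> real) \<Rightarrow> bool" and A :: "'a \<Rightarrow> real^'n^'n::finite"
  assumes const: "\<And>c. P (\<lambda>x. c)" and add: "\<And>f g. P f \<Longrightarrow> P g \<Longrightarrow> P (\<lambda>x. f x + g x)"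
    and mult: "\<And>f g. P f \<Longrightarrow> P g \<Longrightarrow> P (\<lambda>x. f x * g x)"
    and A: "\<And>i j. P (\<lambda>x. A x $ i $ j)"
  shows "P (\<lambda>x. coeff (detp (A x)) m)"
  unfolding detp_def
proof (rule coeff_det_closure[of P, OF const add mult])
  fix i j m
  have "P (\<lambda>x. coeff (if i = j then [:0, 1:] else 0) m + (if m = 0 then 1 else 0) * A x $ i $ j)"
    by (intro add mult const A)
  moreover have "coeff [:a:] m = (if m = 0 then 1 else 0) * a" for a :: real
    by (simp add: coeff_pCons split: nat.split)
  ultimately show "P (\<lambda>x. coeff ((\<chi> i j. (if i = j then [:0, 1:] else 0) + [:A x $ i $ j:]) $ i $ j) m)"
    by simp
qed

lemma continuous_coeff_detp: "continuous_on UNIV (\<lambda>A :: real^'n^'n::finite. coeff (detp A) m)"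
  by (rule coeff_detp_closure) (auto intro!: continuous_intros)

lemma mat_1_posdef: "(mat 1 :: real^'n^'n::finite) \<in> posdef_matrices"
  by (auto simp: posdef_matrices_def sym_matrices_def)

text \<open>The set on which \<open>\<sigma>\<^sub>0, \<dots>, \<sigma>\<^sub>k\<close> are all positive is open and, relative to \<open>{\<sigma>\<^sub>k > 0}\<close>, closed.\<close>
lemma Gamma_plus_in_cone:
  fixes A :: "real^'n^'n::finite"
  assumes A: "A \<in> Gamma_plus k" and k: "k \<le> CARD('n)"
  shows "transpose A = A" "in_cone k (eigvals A)"
proof -
  let ?n = "CARD('n)"
  obtain C where C: "C \<in> components {A \<in> sym_matrices. sigma k A > 0}" "posdef_matrices \<subseteq> C" "A \<in> C"
    using A by (auto simp: Gamma_plus_def)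
  have sub: "B \<in> sym_matrices \<and> sigma k B > 0" if "B \<in> C" for B using in_components_subset[OF C(1)] that by auto
  have tr: "transpose B = B" if "B \<in> C" for B using sub[OF that] by (simp add: sym_matrices_def)
  show "transpose A = A" using tr C(3) by simp
  \<comment> \<open>\<open>U\<close> is the cone condition and \<open>V\<close> says that some
    symmetric function is negative. By \<open>in_cone_closed\<close> these disjoint open sets cover
    the component, and the identity matrix lies in \<open>U\<close>.\<close>
  define U where "U = (\<Inter>j\<in>{..k}. {B :: real^'n^'n. coeff (detp B) (?n - j) > 0})"
  define V where "V = (\<Union>j\<in>{..k}. {B :: real^'n^'n. coeff (detp B) (?n - j) < 0})"
  have "open U" unfolding U_def
    by (intro open_INT ballI open_Collect_less continuous_coeff_detp continuous_on_const) auto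
  moreover have "open V" unfolding V_def
    by (intro open_UN ballI open_Collect_less continuous_coeff_detp continuous_on_const)
  moreover have U_iff: "B \<in> U \<longleftrightarrow> in_cone k (eigvals B)" if "B \<in> C" for B
    using tr[OF that] by (auto simp: U_def in_cone_def detp_eigvals length_eigvals)
  moreover have "C \<subseteq> U \<union> V"
  proof
    fix B assume B: "B \<in> C"
    show "B \<in> U \<union> V"
    proof (cases "B \<in> V")
      case False
      then have "in_cone k (eigvals B)"
        using sub[OF B] tr[OF B] k
        by (intro in_cone_closed) (auto simp: V_def length_eigvals detp_eigvals sigma_eq_coeff not_less)
      then show ?thesis using U_iff[OF B] by simp
    qed simp
  qed
  moreover have "U \<inter> V = {}" by (force simp: U_def V_def)
  moreover have "connected C" using C(1) in_components_connected by blast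
  moreover have "mat 1 \<in> U \<inter> C" using U_iff[of "mat 1"] mat_1_posdef C(2) in_cone_posdef[OF mat_1_posdef k] by auto
  ultimately have "V \<inter> C = {}" using connectedD[of C U V] by auto
  then have "A \<in> U" using \<open>C \<subseteq> U \<union> V\<close> C(3) by auto
  then show "in_cone k (eigvals A)" using U_iff C(3) by simp
qed

text \<open>\<open>L\<close> is the derivative of \<open>f\<close> at 0, but the increment is taken
  at a moving base point \<open>E\<close>. The error bound (|E| + |D|) |D| is what a quadratic
  remainder gives, and this form passes through products.\<close>

definition lin_approx :: "('a::real_normed_vector \<Rightarrow> real) \<Rightarrow> ('a \<Rightarrow> real) \<Rightarrow> bool" where
  "lin_approx f L \<longleftrightarrow> bounded_linear L \<and> (\<forall>B. \<exists>K\<ge>0. \<forall>E D. norm E \<le> B \<longrightarrow> norm D \<le> B \<longrightarrow>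
     \<bar>f (E + D) - f E - L D\<bar> \<le> K * (norm E + norm D) * norm D)"

lemma lin_approx_const: "lin_approx (\<lambda>x. c) (\<lambda>x. 0)"
  unfolding lin_approx_def by (auto intro: exI[of _ 0])

lemma lin_approx_linear: "bounded_linear L \<Longrightarrow> lin_approx L L"
  unfolding lin_approx_def by (auto intro!: exI[of _ 0] simp: linear_add[OF bounded_linear.linear])

lemma lin_approx_add:
  fixes f g :: "'a::real_normed_vector \<Rightarrow> real"
  assumes "lin_approx f L" "lin_approx g M"
  shows "lin_approx (\<lambda>x. f x + g x) (\<lambda>x. L x + M x)"
  unfolding lin_approx_def
proof (intro conjI allI)
  show "bounded_linear (\<lambda>x. L x + M x)" using assms by (simp add: lin_approx_def bounded_linear_add)
  fix B
  obtain K1 where K1: "K1 \<ge> 0" "\<And>E D. norm E \<le> B \<Longrightarrow> norm D \<le> B \<Longrightarrow> \<bar>f (E + D) - f E - L D\<bar> \<le> K1 * (norm E + norm D) * norm D"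
    using assms(1) unfolding lin_approx_def by metis
  obtain K2 where K2: "K2 \<ge> 0" "\<And>E D. norm E \<le> B \<Longrightarrow> norm D \<le> B \<Longrightarrow> \<bar>g (E + D) - g E - M D\<bar> \<le> K2 * (norm E + norm D) * norm D"
    using assms(2) unfolding lin_approx_def by metis
  show "\<exists>K\<ge>0. \<forall>E D. norm E \<le> B \<longrightarrow> norm D \<le> B \<longrightarrow>
     \<bar>f (E + D) + g (E + D) - (f E + g E) - (L D + M D)\<bar> \<le> K * (norm E + norm D) * norm D"
  proof (intro exI[of _ "K1 + K2"] conjI allI impI)
    fix E D :: 'a assume ED: "norm E \<le> B" "norm D \<le> B"
    show "\<bar>f (E + D) + g (E + D) - (f E + g E) - (L D + M D)\<bar> \<le> (K1 + K2) * (norm E + norm D) * norm D"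
      unfolding distrib_right using K1(2)[OF ED] K2(2)[OF ED] by (simp add: distrib_right)
  qed (use K1 K2 in auto)
qed

lemma lin_approx_mult:
  fixes f g :: "'a::real_normed_vector \<Rightarrow> real"
  assumes "lin_approx f L" "lin_approx g M"
  shows "lin_approx (\<lambda>x. f x * g x) (\<lambda>x. g 0 * L x + f 0 * M x)"
  unfolding lin_approx_def
proof (intro conjI allI)
  have bl: "bounded_linear L" "bounded_linear M" using assms by (auto simp: lin_approx_def)
  then show "bounded_linear (\<lambda>x. g 0 * L x + f 0 * M x)" by (intro bounded_linear_add bounded_linear_const_mult)
  fix B0 :: real
  \<comment> \<open>A nonnegative radius makes 0 an admissible base point, so that the increments
    from 0 can be bounded as well.\<close>
  define B where "B = max B0 0"
  have B: "B \<ge> 0" "B0 \<le> B" by (auto simp: B_def)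
  obtain c1 c2 where c: "c1 \<ge> 0" "\<And>D. \<bar>L D\<bar> \<le> c1 * norm D" "c2 \<ge> 0" "\<And>D. \<bar>M D\<bar> \<le> c2 * norm D"
    using bounded_linear.nonneg_bounded[OF bl(1)] bounded_linear.nonneg_bounded[OF bl(2)] by (auto simp: mult.commute)
  obtain K1 where K1: "K1 \<ge> 0" "\<And>E D. norm E \<le> B \<Longrightarrow> norm D \<le> B \<Longrightarrow> \<bar>f (E + D) - f E - L D\<bar> \<le> K1 * (norm E + norm D) * norm D"
    using assms(1) unfolding lin_approx_def by metis
  obtain K2 where K2: "K2 \<ge> 0" "\<And>E D. norm E \<le> B \<Longrightarrow> norm D \<le> B \<Longrightarrow> \<bar>g (E + D) - g E - M D\<bar> \<le> K2 * (norm E + norm D) * norm D"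
    using assms(2) unfolding lin_approx_def by metis
  define M1 where "M1 = c1 + 2 * K1 * B"
  define M2 where "M2 = c2 + 2 * K2 * B"
  have nn: "M1 \<ge> 0" "M2 \<ge> 0" using B K1 K2 c by (auto simp: M1_def M2_def)
  have lip: "\<bar>h (E + D) - h E\<bar> \<le> (c + 2 * K * B) * norm D"
    if "\<And>E D. norm E \<le> B \<Longrightarrow> norm D \<le> B \<Longrightarrow> \<bar>h (E + D) - h E - N D\<bar> \<le> K * (norm E + norm D) * norm D"
      "\<And>D. \<bar>N D\<bar> \<le> c * norm D" "K \<ge> 0" "norm E \<le> B" "norm D \<le> B" for h N :: "'a \<Rightarrow> real" and c K E D
  proof -
    have "K * (norm E + norm D) * norm D \<le> K * (2 * B) * norm D"
      using that by (intro mult_right_mono mult_left_mono) auto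
    then show ?thesis using that(1)[OF that(4,5)] that(2)[of D] by (simp add: algebra_simps)
  qed
  have f1: "\<bar>f E - f 0\<bar> \<le> M1 * norm E" if "norm E \<le> B" for E
    using lip[of f L K1 c1 0 E, OF K1(2) c(2) K1(1)] that B by (simp add: M1_def)
  have g1: "\<bar>g E - g 0\<bar> \<le> M2 * norm E" if "norm E \<le> B" for E
    using lip[of g M K2 c2 0 E, OF K2(2) c(4) K2(1)] that B by (simp add: M2_def)
  have g2: "\<bar>g (E + D) - g 0\<bar> \<le> M2 * (norm E + norm D)" if "norm E \<le> B" "norm D \<le> B" for E D
    using lip[of g M K2 c2 E D, OF K2(2) c(4) K2(1) that] g1[OF that(1)] by (simp add: M2_def distrib_left)
  define K where "K = c1 * M2 + K1 * (\<bar>g 0\<bar> + 2 * M2 * B) + M1 * c2 + (\<bar>f 0\<bar> + M1 * B) * K2"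
  show "\<exists>K\<ge>0. \<forall>E D. norm E \<le> B0 \<longrightarrow> norm D \<le> B0 \<longrightarrow>
     \<bar>f (E + D) * g (E + D) - f E * g E - (g 0 * L D + f 0 * M D)\<bar> \<le> K * (norm E + norm D) * norm D"
  proof (intro exI[of _ K] conjI allI impI)
    show "K \<ge> 0" using B K1 K2 c nn by (auto simp: K_def)
    fix E D :: 'a assume "norm E \<le> B0" "norm D \<le> B0"
    then have ED: "norm E \<le> B" "norm D \<le> B" using B by auto
    let ?s = "norm E + norm D"
    have s: "?s \<ge> 0" "norm E \<le> ?s" "?s \<le> 2 * B" using ED by auto
    define r1 where "r1 = f (E + D) - f E - L D" define r2 where "r2 = g (E + D) - g E - M D"
    have r: "\<bar>r1\<bar> \<le> K1 * ?s * norm D" "\<bar>r2\<bar> \<le> K2 * ?s * norm D" using K1(2)[OF ED] K2(2)[OF ED] by (auto simp: r1_def r2_def)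
    have gb: "\<bar>g (E + D)\<bar> \<le> \<bar>g 0\<bar> + 2 * M2 * B"
    proof -
      have "M2 * ?s \<le> M2 * (2 * B)" using s nn by (intro mult_left_mono) auto
      then show ?thesis using g2[OF ED] by linarith
    qed
    have fb: "\<bar>f E\<bar> \<le> \<bar>f 0\<bar> + M1 * B"
    proof -
      have "M1 * norm E \<le> M1 * B" using ED nn by (intro mult_left_mono) auto
      then show ?thesis using f1[OF ED(1)] by linarith
    qed
    \<comment> \<open>Each of the four terms contains one factor of size |D| and a second one of
      size |E| + |D|, the latter sometimes inside the remainders r1 and r2.\<close>
    have "f (E + D) * g (E + D) - f E * g E - (g 0 * L D + f 0 * M D)
       = L D * (g (E + D) - g 0) + r1 * g (E + D) + (f E - f 0) * M D + f E * r2"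
      by (simp add: r1_def r2_def algebra_simps)
    also have "\<bar>\<dots>\<bar> \<le> \<bar>L D * (g (E + D) - g 0)\<bar> + \<bar>r1 * g (E + D)\<bar> + \<bar>(f E - f 0) * M D\<bar> + \<bar>f E * r2\<bar>"
      by linarith
    also have "\<bar>L D * (g (E + D) - g 0)\<bar> \<le> (c1 * norm D) * (M2 * ?s)"
      unfolding abs_mult using c g2[OF ED] by (intro mult_mono) auto
    also have "\<bar>r1 * g (E + D)\<bar> \<le> (K1 * ?s * norm D) * (\<bar>g 0\<bar> + 2 * M2 * B)"
      unfolding abs_mult using r gb K1 s by (intro mult_mono) auto
    also have "\<bar>(f E - f 0) * M D\<bar> \<le> (M1 * ?s) * (c2 * norm D)"
    proof -
      have "\<bar>f E - f 0\<bar> \<le> M1 * ?s" using f1[OF ED(1)] mult_left_mono[OF s(2) nn(1)] by linarith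
      then show ?thesis unfolding abs_mult using c nn s by (intro mult_mono) auto
    qed
    also have "\<bar>f E * r2\<bar> \<le> (\<bar>f 0\<bar> + M1 * B) * (K2 * ?s * norm D)"
      unfolding abs_mult using r fb nn B by (intro mult_mono) auto
    finally show "\<bar>f (E + D) * g (E + D) - f E * g E - (g 0 * L D + f 0 * M D)\<bar> \<le> K * ?s * norm D"
      by (simp add: K_def algebra_simps)
  qed
qed

text \<open>At s = 0 all factors are X + c, so differentiating the i-th one contributes l_i times
  the power with one factor fewer. For empty \<open>I\<close> the truncated exponent is harmless
  because the sum vanishes.\<close>

lemma coeff_prod_linear_derivative:
  fixes c :: real
  assumes "finite I"
  shows "((\<lambda>s. coeff (\<Prod>i\<in>I. [:c + s * l i, 1:]) m) has_real_derivative
     (\<Sum>i\<in>I. l i) * coeff ([:c, 1:] ^ (card I - 1)) m) (at 0)"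
  using assms
proof (induction I arbitrary: m)
  case (insert x I)
  have rec: "coeff ([:a, 1:] * p) m = a * coeff p m + (if m = 0 then 0 else coeff p (m - 1))" for a :: real and p
    by (cases m) auto
  define p where "p s = (\<Prod>i\<in>I. [:c + s * l i, 1:])" for s
  define q where "q = [:c, 1:] ^ (card I - 1)"
  have p0: "p 0 = [:c, 1:] ^ card I" by (simp add: p_def)
  have "((\<lambda>s. (c + s * l x) * coeff (p s) m + (if m = 0 then 0 else coeff (p s) (m - 1))) has_real_derivative
      (l x * coeff (p 0) m + (sum l I * coeff q m) * (c + 0 * l x))
      + (if m = 0 then 0 else sum l I * coeff q (m - 1))) (at 0)"
    using insert.IH[of m] insert.IH[of "m - 1"] unfolding p_def[symmetric] q_def[symmetric]
    by (intro DERIV_add DERIV_mult) (auto intro!: derivative_eq_intros)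
  moreover have "(\<Prod>i\<in>insert x I. [:c + s * l i, 1:]) = [:c + s * l x, 1:] * p s" for s
    using insert by (simp add: p_def)
  moreover have "l x * coeff (p 0) m + (sum l I * coeff q m) * (c + 0 * l x) + (if m = 0 then 0 else sum l I * coeff q (m - 1))
     = (\<Sum>i\<in>insert x I. l i) * coeff ([:c, 1:] ^ (card (insert x I) - 1)) m"
  proof (cases "I = {}")
    case False
    then have "card I > 0" using insert by (simp add: card_gt_0_iff)
    then have "[:c, 1:] ^ card I = [:c, 1:] * q" by (simp add: q_def power_eq_if)
    then have "coeff ([:c, 1:] ^ card I) m = c * coeff q m + (if m = 0 then 0 else coeff q (m - 1))" by (simp only: rec)
    then show ?thesis using insert by (simp add: p0 algebra_simps)
  qed (simp add: p0)
  ultimately show ?case by (simp only: rec)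
qed simp

lemma trace_eigenbasis:
  fixes A :: "real^'n^'n::finite" and v :: "'n \<Rightarrow> real^'n"
  assumes A: "\<And>i. A *v v i = l i *\<^sub>R v i" and v: "\<And>i j. v i \<bullet> v j = (if i = j then 1 else 0)"
  shows "trace A = (\<Sum>i\<in>UNIV. l i)"
proof -
  have "A $ j $ j = (\<Sum>i\<in>UNIV. l i * (v i $ j)\<^sup>2)" for j
    using quadratic_form_eigenbasis(1)[OF A v, of "axis j 1"] by (simp add: inner_axis' matrix_vector_mult_basis column_def)
  then have "trace A = (\<Sum>i\<in>UNIV. l i * (v i \<bullet> v i))"
    unfolding trace_def by (simp add: inner_vec_def sum_distrib_left power2_eq_square) (rule sum.swap)
  then show ?thesis by (simp add: v)
qed

text \<open>The differential of \<open>\<sigma>_k\<close> at c I is a multiple of the trace. The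
  point is the error: with \<open>E\<close> and \<open>D\<close> both small it is smaller than the
  linear term by the factor |E| + |D|.\<close>

lemma sigma_perturb:
  assumes k: "1 \<le> k" "k \<le> CARD('n::finite)"
  shows "\<exists>K\<ge>0. \<forall>E D :: real^'n^'n. transpose E = E \<longrightarrow> transpose D = D \<longrightarrow> norm E \<le> B \<longrightarrow> norm D \<le> B \<longrightarrow>
     \<bar>sigma k (c *\<^sub>R mat 1 + E + D) - sigma k (c *\<^sub>R mat 1 + E)
        - real (CARD('n) - 1 choose (CARD('n) - k)) * c ^ (k - 1) * trace D\<bar> \<le> K * (norm E + norm D) * norm D"
proof -
  let ?n = "CARD('n)"
  define f where "f E = coeff (detp (c *\<^sub>R mat 1 + E)) (?n - k)" for E :: "real^'n^'n"
  define \<kappa> where "\<kappa> = real (?n - 1 choose (?n - k)) * c ^ (k - 1)"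
  have "\<exists>L. lin_approx f L" unfolding f_def
  proof (rule coeff_detp_closure[of "\<lambda>f. \<exists>L. lin_approx f L"])
    fix i j
    have "bounded_linear (\<lambda>E :: real^'n^'n. E $ i $ j)"
      by (intro bounded_linear_compose[OF bounded_linear_vec_nth bounded_linear_vec_nth])
    then have "lin_approx (\<lambda>E :: real^'n^'n. (c *\<^sub>R mat 1 :: real^'n^'n) $ i $ j + E $ i $ j) (\<lambda>E. 0 + E $ i $ j)"
      by (intro lin_approx_add lin_approx_const lin_approx_linear)
    then show "\<exists>L. lin_approx (\<lambda>E :: real^'n^'n. (c *\<^sub>R mat 1 + E) $ i $ j) L" by auto
  qed (blast intro: lin_approx_const lin_approx_add lin_approx_mult)+
  then obtain L where L: "lin_approx f L" by blast
  then have bl: "bounded_linear L" by (simp add: lin_approx_def)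
  have sig: "sigma k (c *\<^sub>R mat 1 + E) = f E" if "transpose E = E" for E
  proof -
    have "transpose (c *\<^sub>R mat 1 + E) = c *\<^sub>R mat 1 + E"
      using that by (simp add: vec_eq_iff transpose_def mat_def)
    then show ?thesis using k by (simp add: f_def sigma_eq_coeff)
  qed
  \<comment> \<open>So far only the existence of a linear part is known. It is identified by
    diagonalising \<open>D\<close> and differentiating along the ray
    \<open>s *\<^sub>R D\<close>.\<close>
  have LD: "L D = \<kappa> * trace D" if D: "transpose D = D" for D
  proof -
    obtain v :: "'n \<Rightarrow> real^'n" and l where e: "\<And>i. D *v v i = l i *\<^sub>R v i" and v: "\<And>i j. v i \<bullet> v j = (if i = j then 1 else 0)"
      by (rule symmetric_eigenbasis[OF D]) blast
    have "f (s *\<^sub>R D) = coeff (\<Prod>i\<in>UNIV. [:c + s * l i, 1:]) (?n - k)" for s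
    proof -
      have "(c *\<^sub>R mat 1 + s *\<^sub>R D) *v v i = (c + s * l i) *\<^sub>R v i" for i
        by (simp add: matrix_add_scalar_vector scaleR_matrix_vector_assoc[symmetric] e scaleR_add_left)
      from detp_eigenbasis(1)[OF this v] show ?thesis by (simp add: f_def)
    qed
    moreover have "coeff ([:c, 1:] ^ (?n - 1)) (?n - k) = \<kappa>"
    proof -
      have "?n - 1 - (?n - k) = k - 1" using k by simp
      then show ?thesis using k by (simp add: coeff_linear_poly_power \<kappa>_def)
    qed
    ultimately have d1: "((\<lambda>s. f (s *\<^sub>R D)) has_real_derivative trace D * \<kappa>) (at 0)"
      using coeff_prod_linear_derivative[of "UNIV :: 'n set" c l "?n - k"] by (simp add: trace_eigenbasis[OF e v])
    obtain K where K: "K \<ge> 0" "\<And>E F. norm E \<le> norm D \<Longrightarrow> norm F \<le> norm D \<Longrightarrow> \<bar>f (E + F) - f E - L F\<bar> \<le> K * (norm E + norm F) * norm F"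
      using L unfolding lin_approx_def by metis
    have "((\<lambda>s. (f (s *\<^sub>R D) - f 0) / s - L D) \<longlongrightarrow> 0) (at 0)"
    proof (rule Lim_null_comparison[where g = "\<lambda>s. K * (norm D)\<^sup>2 * \<bar>s\<bar>"])
      have "eventually (\<lambda>s::real. s \<noteq> 0 \<and> \<bar>s\<bar> < 1) (at 0)"
        by (auto simp: eventually_at dist_real_def intro!: exI[of _ 1])
      then show "\<forall>\<^sub>F s in at 0. norm ((f (s *\<^sub>R D) - f 0) / s - L D) \<le> K * (norm D)\<^sup>2 * \<bar>s\<bar>"
      proof eventually_elim
        case (elim s)
        have "norm (s *\<^sub>R D) \<le> norm D" using elim by (simp add: mult_left_le_one_le)
        from K(2)[OF _ this, of 0] have "\<bar>f (s *\<^sub>R D) - f 0 - s * L D\<bar> \<le> K * (\<bar>s\<bar> * norm D) * (\<bar>s\<bar> * norm D)"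
          using linear_scale[OF bounded_linear.linear[OF bl]] by simp
        then have "\<bar>f (s *\<^sub>R D) - f 0 - s * L D\<bar> / \<bar>s\<bar> \<le> K * (norm D)\<^sup>2 * \<bar>s\<bar>"
          using elim by (simp add: pos_divide_le_eq power2_eq_square mult_ac)
        moreover have "(f (s *\<^sub>R D) - f 0) / s - L D = (f (s *\<^sub>R D) - f 0 - s * L D) / s" using elim by (simp add: field_simps)
        ultimately show ?case by simp
      qed
    qed (auto intro!: tendsto_eq_intros)
    then have "((\<lambda>s. (f (s *\<^sub>R D) - f 0) / s) \<longlongrightarrow> L D) (at 0)" by (simp add: LIM_zero_iff)
    then have "((\<lambda>s. f (s *\<^sub>R D)) has_real_derivative L D) (at 0)" by (simp add: DERIV_def)
    from DERIV_unique[OF this d1] show ?thesis by simp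
  qed
  obtain K where K: "K \<ge> 0" "\<And>E D. norm E \<le> B \<Longrightarrow> norm D \<le> B \<Longrightarrow> \<bar>f (E + D) - f E - L D\<bar> \<le> K * (norm E + norm D) * norm D"
    using L unfolding lin_approx_def by metis
  show ?thesis unfolding \<kappa>_def[symmetric]
  proof (intro exI[of _ K] conjI allI impI)
    fix E D :: "real^'n^'n" assume *: "transpose E = E" "transpose D = D" "norm E \<le> B" "norm D \<le> B"
    have "transpose (E + D) = E + D" using * by (simp add: vec_eq_iff transpose_def)
    then show "\<bar>sigma k (c *\<^sub>R mat 1 + E + D) - sigma k (c *\<^sub>R mat 1 + E) - \<kappa> * trace D\<bar> \<le> K * (norm E + norm D) * norm D"
      using K(2)[OF *(3,4)] sig[of "E + D"] sig[OF *(1)] LD[OF *(2)] by (simp add: add.assoc)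
  qed (rule K)
qed

lemma smooth_sigma:
  fixes A :: "real^'m::finite \<Rightarrow> real^'n^'n::finite"
  assumes S: "open S" and A: "\<And>i j. smooth_on_open (\<lambda>x. A x $ i $ j) S" and sym: "\<And>x. x \<in> S \<Longrightarrow> transpose (A x) = A x"
    and k: "k \<le> CARD('n)"
  shows "smooth_on_open (\<lambda>x. sigma k (A x)) S"
proof -
  have "smooth_on_open (\<lambda>x. coeff (detp (A x)) (CARD('n) - k)) S"
    by (rule coeff_detp_closure[of "\<lambda>f. smooth_on_open f S", OF smooth_const[OF S] smooth_add smooth_mult A])
  then show ?thesis by (subst smooth_cong[of S _ "\<lambda>x. coeff (detp (A x)) (CARD('n) - k)"]) (simp_all add: sym sigma_eq_coeff k)
qed

lemma sigma_scalar:
  assumes "k \<le> CARD('n::finite)"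
  shows "sigma k (c *\<^sub>R mat 1 :: real^'n^'n) = real (CARD('n) choose k) * c ^ k"
proof -
  define v :: "'n \<Rightarrow> real^'n" where "v = (\<lambda>i. axis i 1)"
  have "(c *\<^sub>R mat 1) *v v i = c *\<^sub>R v i" for i by (simp add: scaleR_matrix_vector_assoc[symmetric])
  moreover have "v i \<bullet> v j = (if i = j then 1 else 0)" for i j by (simp add: v_def inner_axis_axis)
  ultimately have "detp (c *\<^sub>R mat 1 :: real^'n^'n) = [:c, 1:] ^ CARD('n)" using detp_eigenbasis(1) by fastforce
  moreover have "transpose (c *\<^sub>R mat 1 :: real^'n^'n) = c *\<^sub>R mat 1" by (simp add: vec_eq_iff transpose_def mat_def)
  ultimately show ?thesis using assms by (simp add: sigma_eq_coeff coeff_linear_poly_power binomial_symmetric[symmetric])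
qed

lemma sigma_scale:
  fixes A :: "real^'n^'n::finite"
  assumes sym: "transpose A = A" and k: "k \<le> CARD('n)"
  shows "sigma k (c *\<^sub>R A) = c ^ k * sigma k A"
proof -
  obtain v :: "'n \<Rightarrow> real^'n" and l where e: "\<And>i. A *v v i = l i *\<^sub>R v i" and v: "\<And>i j. v i \<bullet> v j = (if i = j then 1 else 0)"
    by (rule symmetric_eigenbasis[OF sym]) blast
  have e': "(c *\<^sub>R A) *v v i = (c * l i) *\<^sub>R v i" for i by (simp add: scaleR_matrix_vector_assoc[symmetric] e)
  have "transpose (c *\<^sub>R A) = c *\<^sub>R A" using sym by (simp add: vec_eq_iff transpose_def)
  then have "sigma k (c *\<^sub>R A) = (\<Sum>S | S \<subseteq> UNIV \<and> card S = k. \<Prod>i\<in>S. c * l i)"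
    using k coeff_prod_linear[of "UNIV :: 'n set" k "\<lambda>i. c * l i"] by (simp add: sigma_eq_coeff detp_eigenbasis(1)[OF e' v])
  also have "\<dots> = (\<Sum>S | S \<subseteq> UNIV \<and> card S = k. c ^ k * (\<Prod>i\<in>S. l i))"
    by (intro sum.cong refl) (auto simp: prod.distrib)
  also have "\<dots> = c ^ k * sigma k A"
    using k coeff_prod_linear[of "UNIV :: 'n set" k l] by (simp add: sigma_eq_coeff sym detp_eigenbasis(1)[OF e v] sum_distrib_left)
  finally show ?thesis .
qed

subsection \<open>Second-order Taylor estimates\<close>

lemma norm_matrix_vector_le: "norm ((A :: real^'n::finite^'m::finite) *v x) \<le> norm A * norm x"
proof -
  have "norm (A *v x) = L2_set (\<lambda>i. \<bar>A $ i \<bullet> x\<bar>) UNIV"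
    by (simp add: norm_vec_def matrix_vector_mult_def inner_vec_def L2_set_def)
  also have "\<dots> \<le> L2_set (\<lambda>i. norm (A $ i) * norm x) UNIV"
    by (intro L2_set_mono Cauchy_Schwarz_ineq2) auto
  also have "\<dots> = norm A * norm x" by (simp add: L2_set_left_distrib[symmetric] norm_vec_def)
  finally show ?thesis .
qed

lemma quadratic_form_bound: "\<bar>x \<bullet> ((A :: real^'n::finite^'n) *v x)\<bar> \<le> norm A * (norm x)\<^sup>2"
proof -
  have "\<bar>x \<bullet> (A *v x)\<bar> \<le> norm x * norm (A *v x)" by (rule Cauchy_Schwarz_ineq2)
  also have "\<dots> \<le> norm x * (norm A * norm x)" by (intro mult_left_mono norm_matrix_vector_le) auto
  finally show ?thesis by (simp add: power2_eq_square mult_ac)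
qed

lemma continuous_on_matrix:
  fixes A :: "'a::topological_space \<Rightarrow> real^'n::finite^'m::finite"
  assumes "\<And>i j. continuous_on S (\<lambda>x. A x $ i $ j)"
  shows "continuous_on S A"
proof -
  have "continuous_on S (\<lambda>x. \<chi> i. \<chi> j. A x $ i $ j)" by (intro continuous_on_vec_lambda assms)
  then show ?thesis by simp
qed

lemma compact_bound:
  fixes f :: "'a::topological_space \<Rightarrow> 'b::real_normed_vector"
  assumes "compact S" "continuous_on S f"
  obtains K where "K \<ge> 0" "\<And>x. x \<in> S \<Longrightarrow> norm (f x) \<le> K"
proof -
  have "bounded (f ` S)" using assms compact_continuous_image compact_imp_bounded by blast
  then obtain K where "\<And>x. x \<in> S \<Longrightarrow> norm (f x) \<le> K" unfolding bounded_iff by blast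
  then show ?thesis using that[of "max K 0"] by (meson le_max_iff_disj max.cobounded2)
qed

lemma taylor2:
  fixes f :: "real^'n::finite \<Rightarrow> real"
  assumes f: "smooth_on_open f S" and seg: "\<And>t. 0 \<le> t \<Longrightarrow> t \<le> 1 \<Longrightarrow> y + t *\<^sub>R h \<in> S"
  shows "\<exists>t. 0 < t \<and> t < 1 \<and> f (y + h) = f y + grad f y \<bullet> h + (h \<bullet> (hess f (y + t *\<^sub>R h) *v h)) / 2"
proof -
  define diff where "diff m t = (if m = 0 then f (y + t *\<^sub>R h) else if m = 1 then grad f (y + t *\<^sub>R h) \<bullet> h
     else h \<bullet> (hess f (y + t *\<^sub>R h) *v h))" for m :: nat and t
  have "\<exists>t>0. t < 1 \<and> f (y + 1 *\<^sub>R h) = (\<Sum>m<2. diff m 0 / fact m * 1 ^ m) + diff 2 t / fact 2 * 1 ^ 2"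
  proof (rule Maclaurin)
    show "\<forall>m t. m < 2 \<and> 0 \<le> t \<and> t \<le> 1 \<longrightarrow> DERIV (diff m) t :> diff (Suc m) t"
    proof (intro allI impI)
      fix m :: nat and t :: real assume mt: "m < 2 \<and> 0 \<le> t \<and> t \<le> 1"
      then have S: "y + t *\<^sub>R h \<in> S" using seg by auto
      show "DERIV (diff m) t :> diff (Suc m) t"
      proof (cases "m = 0")
        case True
        then show ?thesis using line_derivative[OF smooth_differentiable[OF f S]] unfolding diff_def by simp
      next
        case False
        then have "m = 1" using mt by simp
        then show ?thesis using line_second_derivative[OF f S] unfolding diff_def by simp
      qed
    qed
  qed (auto simp: diff_def)
  then show ?thesis by (auto simp: diff_def numeral_2_eq_2)
qed

lemma taylor2_bound:
  fixes f :: "real^'n::finite \<Rightarrow> real"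
  assumes f: "smooth_on_open f S" and seg: "\<And>t. 0 \<le> t \<Longrightarrow> t \<le> 1 \<Longrightarrow> y + t *\<^sub>R h \<in> S \<and> norm (hess f (y + t *\<^sub>R h)) \<le> K"
  shows "\<bar>f (y + h) - f y - grad f y \<bullet> h\<bar> \<le> K * (norm h)\<^sup>2"
proof -
  obtain t where t: "0 < t" "t < 1" "f (y + h) = f y + grad f y \<bullet> h + (h \<bullet> (hess f (y + t *\<^sub>R h) *v h)) / 2"
    using taylor2[OF f] seg by metis
  have "\<bar>h \<bullet> (hess f (y + t *\<^sub>R h) *v h)\<bar> \<le> norm (hess f (y + t *\<^sub>R h)) * (norm h)\<^sup>2"
    by (rule quadratic_form_bound)
  also have "\<dots> \<le> K * (norm h)\<^sup>2" using seg[of t] t by (intro mult_right_mono) auto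
  finally show ?thesis using t(3) by (simp add: abs_if split: if_splits)
qed

lemma taylor2_local:
  fixes f :: "real^'n::finite \<Rightarrow> real"
  assumes f: "smooth_on_open f S" and y: "y \<in> S"
  obtains K e where "e > 0" "K \<ge> 0" "\<And>h. norm h < e \<Longrightarrow> \<bar>f (y + h) - f y - grad f y \<bullet> h\<bar> \<le> K * (norm h)\<^sup>2"
proof -
  have "open S" using f by (simp add: smooth_on_open_def)
  then obtain e where e: "e > 0" "cball y e \<subseteq> S" using y open_contains_cball by blast
  have "continuous_on (cball y e) (hess f)"
    by (rule continuous_on_subset[OF continuous_on_matrix e(2)]) (intro smooth_continuous smooth_hess f)
  then obtain K where K: "K \<ge> 0" "\<And>x. x \<in> cball y e \<Longrightarrow> norm (hess f x) \<le> K"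
    using compact_bound[OF compact_cball] by blast
  have "\<bar>f (y + h) - f y - grad f y \<bullet> h\<bar> \<le> K * (norm h)\<^sup>2" if h: "norm h < e" for h
  proof (rule taylor2_bound[OF f])
    fix t :: real assume "0 \<le> t" "t \<le> 1"
    then have "norm (t *\<^sub>R h) \<le> e" using h mult_right_mono[of t 1 "norm h"] by auto
    then have "y + t *\<^sub>R h \<in> cball y e" by (simp add: dist_norm)
    then show "y + t *\<^sub>R h \<in> S \<and> norm (hess f (y + t *\<^sub>R h)) \<le> K" using K e by auto
  qed
  then show ?thesis using that e K by blast
qed

lemma has_derivative_quadratic_bound:
  fixes f :: "'a::real_normed_vector \<Rightarrow> 'b::real_normed_vector"
  assumes L: "bounded_linear L" and e: "e > 0"
    and bnd: "\<And>h. norm h < e \<Longrightarrow> norm (f (x + h) - f x - L h) \<le> K * (norm h)\<^sup>2"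
  shows "(f has_derivative L) (at x)"
  unfolding has_derivative_at
proof (rule conjI[OF L], rule Lim_null_comparison[where g = "\<lambda>h. K * norm h"])
  have "\<forall>\<^sub>F h in at (0::'a). norm h < e" using e by (auto simp: eventually_at intro!: exI[of _ e])
  then show "\<forall>\<^sub>F h in at 0. norm (norm (f (x + h) - f x - L h) / norm h) \<le> K * norm h"
  proof eventually_elim
    case (elim h)
    then show ?case using bnd[of h] by (cases "h = 0") (auto simp: pos_divide_le_eq power2_eq_square mult.assoc)
  qed
qed (auto intro!: tendsto_eq_intros)

definition jac :: "(real^'n::finite \<Rightarrow> real^'m::finite) \<Rightarrow> real^'n \<Rightarrow> real^'n^'m" where
  "jac g x = (\<chi> i j. partial_deriv j (\<lambda>x. g x $ i) x)"

lemma jac_mult: "(jac g x *v h) $ i = grad (\<lambda>x. g x $ i) x \<bullet> h"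
  by (simp add: jac_def matrix_vector_mult_def grad_def inner_vec_def)

lemma taylor2_local_vec:
  fixes g :: "real^'n::finite \<Rightarrow> real^'m::finite"
  assumes g: "\<And>j. smooth_on_open (\<lambda>x. g x $ j) S" and y: "y \<in> S"
  obtains K e where "e > 0" "K \<ge> 0" "\<And>h :: real^'n. norm h < e \<Longrightarrow> norm (g (y + h) - g y - jac g y *v h) \<le> K * (norm h)\<^sup>2"
proof -
  have "\<exists>K e. e > 0 \<and> K \<ge> 0 \<and> (\<forall>h :: real^'n. norm h < e \<longrightarrow> \<bar>g (y + h) $ j - g y $ j - grad (\<lambda>x. g x $ j) y \<bullet> h\<bar> \<le> K * (norm h)\<^sup>2)" for j
    using taylor2_local[OF g[of j] y] by metis
  then obtain K e where Ke: "\<And>j. e j > (0::real)" "\<And>j. K j \<ge> (0::real)"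
    "\<And>j (h :: real^'n). norm h < e j \<Longrightarrow> \<bar>g (y + h) $ j - g y $ j - grad (\<lambda>x. g x $ j) y \<bullet> h\<bar> \<le> K j * (norm h)\<^sup>2" by metis
  show ?thesis
  proof (rule that[of "Min (range e)" "sum K UNIV"])
    show "Min (range e) > 0" using Ke by simp
    show "sum K UNIV \<ge> 0" using Ke by (simp add: sum_nonneg)
    fix h :: "real^'n" assume h: "norm h < Min (range e)"
    have "norm (g (y + h) - g y - jac g y *v h) \<le> (\<Sum>j\<in>UNIV. \<bar>(g (y + h) - g y - jac g y *v h) $ j\<bar>)" by (rule norm_le_l1_cart)
    also have "\<dots> \<le> (\<Sum>j\<in>UNIV. K j * (norm h)\<^sup>2)"
    proof (rule sum_mono)
      fix j
      have "norm h < e j" using h by simp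
      then show "\<bar>(g (y + h) - g y - jac g y *v h) $ j\<bar> \<le> K j * (norm h)\<^sup>2" using Ke(3)[of h j] by (simp add: jac_mult)
    qed
    finally show "norm (g (y + h) - g y - jac g y *v h) \<le> sum K UNIV * (norm h)\<^sup>2" by (simp add: sum_distrib_right)
  qed
qed

subsection \<open>Uniform touching balls\<close>

text \<open>\<open>n\<close> is the inward unit normal, characterised by an interior and an exterior
  ball of radius \<open>r\<close> touching at \<open>y\<close> instead of by derivatives.\<close>

definition touching_normal :: "(real^'n::finite) set \<Rightarrow> real \<Rightarrow> real^'n \<Rightarrow> real^'n \<Rightarrow> bool" where
  "touching_normal \<Omega> r y n \<longleftrightarrow> norm n = 1 \<and> ball (y + r *\<^sub>R n) r \<subseteq> \<Omega> \<and> ball (y - r *\<^sub>R n) r \<inter> \<Omega> = {}"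

lemma touching_normal_mono:
  assumes "touching_normal \<Omega> r y n" "0 < r'" "r' \<le> r"
  shows "touching_normal \<Omega> r' y n"
proof -
  have n: "norm n = 1" using assms by (simp add: touching_normal_def)
  have d: "norm ((r' - r) *\<^sub>R n) = r - r'" "norm ((r - r') *\<^sub>R n) = r - r'" using assms n by auto
  have "ball (y + r' *\<^sub>R n) r' \<subseteq> ball (y + r *\<^sub>R n) r"
  proof
    fix z assume "z \<in> ball (y + r' *\<^sub>R n) r'"
    moreover have "dist (y + r *\<^sub>R n) z \<le> dist (y + r *\<^sub>R n) (y + r' *\<^sub>R n) + dist (y + r' *\<^sub>R n) z" by (rule dist_triangle)
    moreover have "dist (y + r *\<^sub>R n) (y + r' *\<^sub>R n) = r - r'" using d by (simp add: dist_norm scaleR_diff_left[symmetric])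
    ultimately show "z \<in> ball (y + r *\<^sub>R n) r" by simp
  qed
  moreover have "ball (y - r' *\<^sub>R n) r' \<subseteq> ball (y - r *\<^sub>R n) r"
  proof
    fix z assume "z \<in> ball (y - r' *\<^sub>R n) r'"
    moreover have "dist (y - r *\<^sub>R n) z \<le> dist (y - r *\<^sub>R n) (y - r' *\<^sub>R n) + dist (y - r' *\<^sub>R n) z" by (rule dist_triangle)
    moreover have "dist (y - r *\<^sub>R n) (y - r' *\<^sub>R n) = r - r'" using d by (simp add: dist_norm scaleR_diff_left[symmetric])
    ultimately show "z \<in> ball (y - r *\<^sub>R n) r" by simp
  qed
  ultimately show ?thesis using assms unfolding touching_normal_def by blast
qed

text \<open>The equality case of the triangle inequality, by expanding the square. It is the source
  of all statements placing nearest points on normals.\<close>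

lemma norm_eq_of_norm_add:
  fixes a b :: "'a::real_inner"
  assumes a: "norm a = d" and b: "norm b = 1" and r: "r > 0" and le: "norm (a + r *\<^sub>R b) \<ge> d + r"
  shows "a = d *\<^sub>R b"
proof -
  have aa: "a \<bullet> a = d\<^sup>2" and bb: "b \<bullet> b = 1" using a b by (simp_all add: dot_square_norm)
  have "d \<ge> 0" using a by auto
  then have "(d + r)\<^sup>2 \<le> (norm (a + r *\<^sub>R b))\<^sup>2" using le r by (intro power_mono) auto
  also have "\<dots> = d\<^sup>2 + 2 * r * (a \<bullet> b) + r\<^sup>2"
    unfolding power2_norm_eq_inner by (simp add: inner_add_left inner_add_right aa bb inner_commute power2_eq_square)
  finally have "r * d \<le> r * (a \<bullet> b)" by (simp add: power2_sum mult.commute)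
  then have ab: "d \<le> a \<bullet> b" using r by simp
  have "(norm (a - d *\<^sub>R b))\<^sup>2 = 2 * d * (d - a \<bullet> b)"
    unfolding power2_norm_eq_inner
    by (simp add: inner_diff_left inner_diff_right aa bb inner_commute power2_eq_square algebra_simps)
  also have "\<dots> \<le> 0" using ab \<open>d \<ge> 0\<close> by (simp add: mult_nonneg_nonpos)
  finally show ?thesis by simp
qed

lemma touching_normal_unique:
  assumes n: "touching_normal \<Omega> r y n" and m: "touching_normal \<Omega> r y m" and r: "r > 0"
  shows "n = m"
proof -
  have nm: "norm n = 1" "norm m = 1" using n m by (auto simp: touching_normal_def)
  have disj: "ball (y + r *\<^sub>R n) r \<inter> ball (y - r *\<^sub>R m) r = {}" using n m by (auto simp: touching_normal_def)
  have "norm (n + 1 *\<^sub>R m) \<ge> 1 + 1"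
  proof (rule ccontr)
    assume "\<not> ?thesis"
    then have lt: "norm (n + m) < 2" by simp
    \<comment> \<open>The midpoint of the centre of the inner ball for \<open>n\<close> and the
      centre of the outer ball for \<open>m\<close>; it would lie in both balls.\<close>
    define z where "z = y + (r / 2) *\<^sub>R (n - m)"
    have "y + r *\<^sub>R n - z = (r / 2) *\<^sub>R (n + m)" "y - r *\<^sub>R m - z = - ((r / 2) *\<^sub>R (n + m))"
      by (simp_all add: z_def vec_eq_iff field_simps)
    then have "dist (y + r *\<^sub>R n) z < r" "dist (y - r *\<^sub>R m) z < r" using lt r by (auto simp: dist_norm)
    then show False using disj by auto
  qed
  from norm_eq_of_norm_add[OF nm(1) nm(2) zero_less_one this] show ?thesis by simp
qed

text \<open>Points of either ball are y + h with h = r (w + \<epsilon> n) and |w| < 1. Put q = 1 +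
  \<epsilon> (w . n). Then |h|^2 < 2 r^2 q, while the linear part of \<open>f\<close> has size |grad
  f| r q; so 2 K r at most |grad f| lets the linear part decide the sign of
  \<open>f\<close>.\<close>

lemma defining_function_balls:
  fixes f :: "real^'n::finite \<Rightarrow> real"
  assumes f: "smooth_on_open f U" and sub: "ball y (2 * r) \<subseteq> U" and r: "r > 0"
    and K: "K > 0" "\<And>x. x \<in> ball y (2 * r) \<Longrightarrow> norm (hess f x) \<le> K"
    and g: "2 * K * r \<le> norm (grad f y)" and fy: "f y = 0" and \<Omega>: "\<Omega> \<inter> U = {x \<in> U. f x < 0}"
  shows "touching_normal \<Omega> r y (- grad f y /\<^sub>R norm (grad f y))"
proof -
  let ?g = "grad f y" 
  have gpos: "norm ?g > 0" using g K r by (smt (verit) mult_pos_pos)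
  \<comment> \<open>Within this proof \<open>n\<close> points outward, opposite to the normal in the
    conclusion.\<close>
  define n where "n = ?g /\<^sub>R norm ?g"
  have n1: "norm n = 1" using gpos by (simp add: n_def)
  have gn: "?g = norm ?g *\<^sub>R n" using gpos by (simp add: n_def)
  have main: "f (y + h) * \<epsilon> > 0" and inU: "y + h \<in> U"
    if h: "h = r *\<^sub>R (w + \<epsilon> *\<^sub>R n)" and w: "norm w < 1" and \<epsilon>: "\<epsilon> = 1 \<or> \<epsilon> = -1" for h w \<epsilon>
  proof -
    have nn: "n \<bullet> n = 1" using n1 by (simp add: dot_square_norm)
    have \<epsilon>2: "\<epsilon> * \<epsilon> = 1" using \<epsilon> by auto
    define q where "q = 1 + \<epsilon> * (w \<bullet> n)"
    have "\<bar>w \<bullet> n\<bar> \<le> norm w" using Cauchy_Schwarz_ineq2[of w n] n1 by simp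
    then have q: "q > 0" using w \<epsilon> by (auto simp: q_def)
    have "h \<bullet> h = r\<^sup>2 * (w \<bullet> w + 2 * \<epsilon> * (w \<bullet> n) + 1)"
      using nn \<epsilon>2 by (simp add: h inner_add_left inner_add_right inner_commute power2_eq_square algebra_simps)
    also have "\<dots> < r\<^sup>2 * (2 * q)"
    proof -
      have "w \<bullet> w < 1" using w by (simp add: dot_square_norm power_less_one_iff abs_square_less_1)
      then show ?thesis using r by (simp add: q_def)
    qed
    finally have hh: "(norm h)\<^sup>2 < r\<^sup>2 * (2 * q)" by (simp add: power2_norm_eq_inner)
    have "norm (w + \<epsilon> *\<^sub>R n) < 2" using norm_triangle_ineq[of w "\<epsilon> *\<^sub>R n"] w n1 \<epsilon> by auto
    then have hn: "norm h < 2 * r" using r by (simp add: h)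
    then show "y + h \<in> U" using sub by (auto simp: dist_norm)
    have "\<bar>f (y + h) - f y - ?g \<bullet> h\<bar> \<le> K * (norm h)\<^sup>2"
    proof (rule taylor2_bound[OF f])
      fix t :: real assume "0 \<le> t" "t \<le> 1"
      then have "norm (t *\<^sub>R h) < 2 * r" using hn mult_right_mono[of t 1 "norm h"] by auto
      then have "y + t *\<^sub>R h \<in> ball y (2 * r)" by (simp add: dist_norm)
      then show "y + t *\<^sub>R h \<in> U \<and> norm (hess f (y + t *\<^sub>R h)) \<le> K" using K sub by auto
    qed
    also have "\<dots> < K * (r\<^sup>2 * (2 * q))" using hh K by simp
    also have "\<dots> = (2 * K * r) * (r * q)" by (simp add: power2_eq_square)
    also have "\<dots> \<le> norm ?g * (r * q)" using g r q by (intro mult_right_mono) auto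
    finally have 1: "\<bar>f (y + h) - f y - ?g \<bullet> h\<bar> < norm ?g * (r * q)" .
    have "\<epsilon> * (?g \<bullet> h) = norm ?g * (r * q)"
    proof -
      have "?g \<bullet> h = norm ?g * (n \<bullet> h)" by (subst gn) simp
      also have "n \<bullet> h = r * (w \<bullet> n + \<epsilon>)" by (simp add: h inner_add_right nn inner_commute)
      finally show ?thesis using \<epsilon>2 by (simp add: q_def algebra_simps)
    qed
    then show "f (y + h) * \<epsilon> > 0" using 1 fy \<epsilon> by auto
  qed
  show ?thesis unfolding touching_normal_def
  proof (intro conjI subsetI equals0I)
    show "norm (- grad f y /\<^sub>R norm (grad f y)) = 1" using gpos by simp
    fix z assume "z \<in> ball (y + r *\<^sub>R (- ?g /\<^sub>R norm ?g)) r"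
    then have z: "norm (z - (y - r *\<^sub>R n)) < r" by (simp add: dist_norm norm_minus_commute n_def)
    define w where "w = (z - (y - r *\<^sub>R n)) /\<^sub>R r"
    have "inverse r * norm (z - (y - r *\<^sub>R n)) < inverse r * r" using z r by (intro mult_strict_left_mono) auto
    then have w: "norm w < 1" using r by (simp add: w_def)
    have "z = y + r *\<^sub>R (w + (-1) *\<^sub>R n)" using r by (simp add: w_def algebra_simps)
    then show "z \<in> \<Omega>" using main[OF refl w, of "-1"] inU[OF refl w, of "-1"] \<Omega> by auto
  next
    fix z assume "z \<in> ball (y - r *\<^sub>R (- ?g /\<^sub>R norm ?g)) r \<inter> \<Omega>"
    then have z: "norm (z - (y + r *\<^sub>R n)) < r" "z \<in> \<Omega>" by (simp_all add: dist_norm norm_minus_commute n_def)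
    define w where "w = (z - (y + r *\<^sub>R n)) /\<^sub>R r"
    have "inverse r * norm (z - (y + r *\<^sub>R n)) < inverse r * r" using z(1) r by (intro mult_strict_left_mono) auto
    then have w: "norm w < 1" using r by (simp add: w_def)
    have "z = y + r *\<^sub>R (w + 1 *\<^sub>R n)" using r by (simp add: w_def algebra_simps)
    then show False using main[OF refl w, of "1"] inU[OF refl w, of "1"] \<Omega> z(2) by force
  qed
qed

lemma boundary_chart:
  fixes \<Omega> :: "(real^'n::finite) set"
  assumes \<Omega>: "bounded_smooth_domain \<Omega>" and p: "p \<in> frontier \<Omega>"
  shows "\<exists>e r K n. e > 0 \<and> r > 0 \<and> K \<ge> 0 \<and> (\<forall>j. smooth_on_open (\<lambda>x. n x $ j) (ball p e)) \<and>
    (\<forall>z\<in>ball p e. norm (jac n z) \<le> K) \<and> (\<forall>y\<in>frontier \<Omega> \<inter> ball p e. touching_normal \<Omega> r y (n y))"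
proof -
  have op: "open \<Omega>" using \<Omega> by (simp add: bounded_smooth_domain_def)
  obtain U f where U: "p \<in> U" "smooth_on_open f U" "\<And>x. x \<in> U \<Longrightarrow> grad f x \<noteq> 0" "\<Omega> \<inter> U = {x \<in> U. f x < 0}"
    using \<Omega> p unfolding bounded_smooth_domain_def by blast
  have oU: "open U" using U(2) by (simp add: smooth_on_open_def)
  then obtain e where e: "e > 0" "cball p (3 * e) \<subseteq> U"
    using U(1) open_contains_cball[of U] by (metis mult.commute mult_pos_pos nonzero_mult_div_cancel_left times_divide_eq_right zero_less_divide_iff zero_less_numeral zero_neq_numeral)
  \<comment> \<open>A frontier point lies outside the open \<open>\<Omega>\<close>, so f is
    nonnegative there, and in its closure, so f is not positive there.\<close>
  have f0: "f y = 0" if y: "y \<in> frontier \<Omega> \<inter> U" for y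
  proof -
    have "y \<notin> \<Omega>" using y op frontier_disjoint_eq by blast
    then have "f y \<ge> 0" using y U(4) by force
    moreover have "f y \<le> 0"
    proof (rule ccontr)
      assume "\<not> f y \<le> 0"
      have "open {x \<in> U. f x > 0}" 
        using continuous_open_preimage[OF smooth_continuous[OF U(2)] oU, of "{0<..}"] by (auto simp: vimage_def Int_def)
      moreover have "y \<in> {x \<in> U. f x > 0}" using y \<open>\<not> f y \<le> 0\<close> by auto
      moreover have "y \<in> closure \<Omega>" using y by (simp add: frontier_def)
      ultimately have "\<Omega> \<inter> {x \<in> U. f x > 0} \<noteq> {}" by (meson closure_iff_nhds_not_empty disjoint_iff_not_equal order_refl Int_commute)
      then show False using U(4) by force
    qed
    ultimately show ?thesis by simp
  qed
  \<comment> \<open>The normalisation is written with a real power so that the closure lemmas for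
    smooth functions apply.\<close>
  define n where "n x = (\<chi> j. - (grad f x $ j) * (grad f x \<bullet> grad f x) powr (-1/2))" for x
  have n_eq: "n x = - grad f x /\<^sub>R norm (grad f x)" if "x \<in> U" for x
  proof -
    have "(grad f x \<bullet> grad f x) powr (-1/2) = inverse (norm (grad f x))"
      using U(3)[OF that] by (simp add: norm_eq_sqrt_inner powr_minus powr_half_sqrt)
    then show ?thesis by (simp add: vec_eq_iff n_def)
  qed
  have sn: "smooth_on_open (\<lambda>x. n x $ j) U" for j
    unfolding n_def vec_lambda_beta using U(3)
    by (intro smooth_mult smooth_uminus smooth_grad U(2) smooth_powr smooth_inner oU) auto
  have "continuous_on U (jac n)"
    by (rule continuous_on_matrix) (auto simp: jac_def intro!: smooth_continuous smooth_partial sn)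
  then obtain K where K: "K \<ge> 0" "\<And>x. x \<in> cball p (3 * e) \<Longrightarrow> norm (jac n x) \<le> K"
    using compact_bound[OF compact_cball] continuous_on_subset e(2) by metis
  have "continuous_on U (hess f)"
    by (rule continuous_on_matrix) (intro smooth_continuous smooth_hess U(2))
  then obtain K2 where K2: "K2 \<ge> 0" "\<And>x. x \<in> cball p (3 * e) \<Longrightarrow> norm (hess f x) \<le> K2"
    using compact_bound[OF compact_cball] continuous_on_subset e(2) by metis
  have "continuous_on U (grad f)" by (simp add: continuous_on_nth_iff smooth_continuous smooth_grad U(2))
  then have "continuous_on (cball p (3 * e)) (\<lambda>x. inverse (norm (grad f x)))"
    using continuous_on_subset[OF _ e(2), of "grad f"] U(3) e(2) by (intro continuous_on_inverse continuous_on_norm) auto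
  then obtain G where G: "G \<ge> 0" "\<And>x. x \<in> cball p (3 * e) \<Longrightarrow> norm (inverse (norm (grad f x))) \<le> G"
    using compact_bound[OF compact_cball] by blast
  \<comment> \<open>The bound \<open>e\<close> keeps the doubled balls inside the compact ball of
    radius 3 e; the other one gives 2 (K2 + 1) r at most 1 / (G + 1), a lower bound for the
    gradient.\<close>
  define r where "r = min e (1 / (2 * (K2 + 1) * (G + 1)))"
  have r: "r > 0" "r \<le> e" using e K2 G by (auto simp: r_def)
  show ?thesis
  proof (intro exI conjI ballI allI)
    show "e > 0" "r > 0" "K \<ge> 0" by fact+
    show "smooth_on_open (\<lambda>x. n x $ j) (ball p e)" for j
      using smooth_subset[OF sn open_ball] e by (meson ball_subset_cball order_trans subset_cball mult_le_cancel_right1 order_less_imp_le one_le_numeral subset_ball cball_subset_cball_iff) 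
    show "norm (jac n z) \<le> K" if "z \<in> ball p e" for z using that K(2)[of z] e by auto
    fix y assume y: "y \<in> frontier \<Omega> \<inter> ball p e"
    have yc: "ball y (2 * r) \<subseteq> cball p (3 * e)"
    proof
      fix z assume "z \<in> ball y (2 * r)"
      then show "z \<in> cball p (3 * e)" using y r dist_triangle[of p z y] by auto
    qed
    then have yU: "y \<in> U" using r e by (meson centre_in_ball mult_pos_pos subsetD zero_less_numeral)
    have "touching_normal \<Omega> r y (- grad f y /\<^sub>R norm (grad f y))"
    proof (rule defining_function_balls[OF U(2) _ r(1), of _ "K2 + 1"])
      show "ball y (2 * r) \<subseteq> U" using yc e by auto
      show "norm (hess f x) \<le> K2 + 1" if "x \<in> ball y (2 * r)" for x using K2(2)[of x] yc that by auto
      have "2 * (K2 + 1) * r \<le> 2 * (K2 + 1) * (1 / (2 * (K2 + 1) * (G + 1)))"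
        using K2 by (intro mult_left_mono) (auto simp: r_def)
      also have "\<dots> = 1 / (G + 1)"
      proof -
        have "2 * a * (1 / (2 * a * b)) = 1 / b" if "a > 0" for a b :: real using that by simp
        then show ?thesis using K2(1) by (simp add: add_nonneg_pos)
      qed
      also have "\<dots> \<le> norm (grad f y)"
      proof -
        have "y \<in> cball p (3 * e)" using y e by auto
        then have "inverse (norm (grad f y)) \<le> G + 1" using G(2)[of y] by simp
        moreover have "norm (grad f y) > 0" using U(3)[OF yU] by simp
        ultimately show ?thesis using G(1) by (simp add: field_simps)
      qed
      finally show "2 * (K2 + 1) * r \<le> norm (grad f y)" .
      show "f y = 0" using f0 y yU by auto
    qed (use K2 U(4) in auto)
    then show "touching_normal \<Omega> r y (n y)" using n_eq[OF yU] by simp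
  qed
qed

text \<open>Compactness of the frontier: a finite subcover, the smallest of its radii and the
  largest of its Jacobian bounds.\<close>

lemma uniform_boundary_charts:
  fixes \<Omega> :: "(real^'n::finite) set"
  assumes \<Omega>: "bounded_smooth_domain \<Omega>"
  obtains r K where "r > 0" "K \<ge> 0"
    "\<And>y. y \<in> frontier \<Omega> \<Longrightarrow> \<exists>U n. open U \<and> y \<in> U \<and> (\<forall>j. smooth_on_open (\<lambda>x. n x $ j) U) \<and>
       (\<forall>z\<in>U. norm (jac n z) \<le> K) \<and> (\<forall>y\<in>frontier \<Omega> \<inter> U. touching_normal \<Omega> r y (n y))"
proof -
  let ?F = "frontier \<Omega>"
  have "compact ?F" using \<Omega> by (auto simp: bounded_smooth_domain_def intro: compact_frontier_bounded)
  have "\<forall>p\<in>?F. \<exists>e r K n. e > 0 \<and> r > 0 \<and> K \<ge> 0 \<and> (\<forall>j. smooth_on_open (\<lambda>x. n x $ j) (ball p e)) \<and>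
    (\<forall>z\<in>ball p e. norm (jac n z) \<le> K) \<and> (\<forall>y\<in>?F \<inter> ball p e. touching_normal \<Omega> r y (n y))"
    using boundary_chart[OF \<Omega>] by blast
  then obtain e r K n where ch: "\<And>p. p \<in> ?F \<Longrightarrow> e p > (0::real) \<and> r p > (0::real) \<and> K p \<ge> (0::real) \<and> (\<forall>j. smooth_on_open (\<lambda>x. n p x $ j) (ball p (e p))) \<and>
    (\<forall>z\<in>ball p (e p). norm (jac (n p) z) \<le> K p) \<and> (\<forall>y\<in>?F \<inter> ball p (e p). touching_normal \<Omega> (r p) y (n p y))"
    by metis
  have "?F \<subseteq> (\<Union>p\<in>?F. ball p (e p))" using ch by force
  then obtain C where C: "C \<subseteq> ?F" "finite C" "?F \<subseteq> (\<Union>p\<in>C. ball p (e p))"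
    using compactE_image[OF \<open>compact ?F\<close>, of ?F "\<lambda>p. ball p (e p)"] by auto
  define r0 where "r0 = Min (insert 1 (r ` C))" define K0 where "K0 = Max (insert 0 (K ` C))"
  have r0: "r0 > 0" "\<And>p. p \<in> C \<Longrightarrow> r0 \<le> r p" using C ch by (auto simp: r0_def)
  have K0: "K0 \<ge> 0" "\<And>p. p \<in> C \<Longrightarrow> K p \<le> K0" using C by (auto simp: K0_def)
  show ?thesis
  proof (rule that[OF r0(1) K0(1)])
    fix y assume "y \<in> ?F"
    then obtain p where p: "p \<in> C" "y \<in> ball p (e p)" using C by auto
    then have c: "(\<forall>j. smooth_on_open (\<lambda>x. n p x $ j) (ball p (e p)))"
      "(\<forall>z\<in>ball p (e p). norm (jac (n p) z) \<le> K p)" "(\<forall>y\<in>?F \<inter> ball p (e p). touching_normal \<Omega> (r p) y (n p y))"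
      using ch C by blast+
    have "\<forall>z\<in>ball p (e p). norm (jac (n p) z) \<le> K0" using c(2) K0(2)[OF p(1)] by fastforce
    moreover have "\<forall>y\<in>?F \<inter> ball p (e p). touching_normal \<Omega> r0 y (n p y)"
      using c(3) touching_normal_mono[OF _ r0(1) r0(2)[OF p(1)]] by blast
    ultimately show "\<exists>U n. open U \<and> y \<in> U \<and> (\<forall>j. smooth_on_open (\<lambda>x. n x $ j) U) \<and>
       (\<forall>z\<in>U. norm (jac n z) \<le> K0) \<and> (\<forall>y\<in>?F \<inter> U. touching_normal \<Omega> r0 y (n y))"
      using p c(1) by (intro exI[of _ "ball p (e p)"] exI[of _ "n p"]) auto
  qed
qed

subsection \<open>The signed distance\<close>

lemma matrix_inv_inverse:
  assumes "invertible A"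
  shows "A ** matrix_inv A = mat 1" "matrix_inv A ** A = mat 1"
  using someI_ex[OF assms[unfolded invertible_def]] by (auto simp: matrix_inv_def)

text \<open>Positive inside. The sign removes the kink of the distance at the frontier, so that
  Taylor expansions may start on the frontier itself.\<close>

definition sdist :: "(real^'n::finite) set \<Rightarrow> real^'n \<Rightarrow> real" where
  "sdist \<Omega> x = (if x \<in> \<Omega> then infdist x (frontier \<Omega>) else - infdist x (frontier \<Omega>))"

text \<open>Collects what follows from the uniform two-sided ball condition alone: \<open>s\<close>
  has Lipschitz gradient near the frontier and nearest points are unique. \<open>N\<close> is the
  inward normal, as yet without regularity.\<close>

locale touching_domain =
  fixes \<Omega> :: "(real^'n::finite) set" and r :: real and N :: "real^'n \<Rightarrow> real^'n"
  assumes op: "open \<Omega>" and ne: "frontier \<Omega> \<noteq> {}" and r: "r > 0"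
    and touch: "y \<in> frontier \<Omega> \<Longrightarrow> touching_normal \<Omega> r y (N y)"
begin

abbreviation "s \<equiv> sdist \<Omega>"
abbreviation "F \<equiv> frontier \<Omega>"

lemma disj: "F \<inter> \<Omega> = {}"
  using op frontier_disjoint_eq by blast

lemma norm_N: "y \<in> F \<Longrightarrow> norm (N y) = 1" using touch by (simp add: touching_normal_def)

lemma nearest: obtains y where "y \<in> F" "dist x y = \<bar>s x\<bar>"
proof -
  obtain y where "y \<in> F" "infdist x F = dist x y" using infdist_attains_inf[OF frontier_closed ne] by metis
  then show ?thesis using that[of y] infdist_nonneg[of x F] by (auto simp: sdist_def)
qed

lemma s_pos: "x \<in> \<Omega> \<Longrightarrow> s x > 0"
  using infdist_pos_not_in_closed[OF frontier_closed ne, of x] disj by (auto simp: sdist_def)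

lemma s_nonpos: "x \<notin> \<Omega> \<Longrightarrow> s x \<le> 0" using infdist_nonneg[of x F] by (simp add: sdist_def)

lemma s_F: "y \<in> F \<Longrightarrow> s y = 0" using disj by (auto simp: sdist_def)

text \<open>Segments joining a point of \<open>\<Omega>\<close> to a point of the complement meet the frontier.\<close>
lemma crossing:
  assumes c: "\<And>w. w \<in> F \<Longrightarrow> r \<le> dist c w" and xor: "c \<in> \<Omega> \<longleftrightarrow> z \<notin> \<Omega>"
  shows "infdist z F \<le> dist z c - r"
proof -
  have "closed_segment c z \<inter> F \<noteq> {}" using xor by (intro connected_Int_frontier) auto
  then obtain w where w: "w \<in> closed_segment c z" "w \<in> F" by blast
  then have "dist c z = dist c w + dist w z" using between between_mem_segment by blast
  then show ?thesis using c[OF w(2)] infdist_le[OF w(2), of z] by (simp add: dist_commute)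
qed

text \<open>The two touching balls at \<open>y\<close> squeeze \<open>s\<close> between radial
  functions. These coincide along the normal through \<open>y\<close> as far as both centres, so
  \<open>s\<close> is known there exactly and elsewhere up to a quadratic error.\<close>

lemma
  assumes y: "y \<in> F"
  shows s_lower: "r - dist z (y + r *\<^sub>R N y) \<le> s z" and s_upper: "s z \<le> dist z (y - r *\<^sub>R N y) - r"
proof -
  have t: "ball (y + r *\<^sub>R N y) r \<subseteq> \<Omega>" "ball (y - r *\<^sub>R N y) r \<inter> \<Omega> = {}"
    using touch[OF y] by (auto simp: touching_normal_def)
  have cin: "y + r *\<^sub>R N y \<in> \<Omega>" using t(1) r by (meson centre_in_ball subsetD)
  have cex: "y - r *\<^sub>R N y \<notin> \<Omega>" using t(2) r by (metis centre_in_ball disjoint_iff)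
  have Fin: "r \<le> dist (y + r *\<^sub>R N y) w" if "w \<in> F" for w using t(1) that disj by (meson disjoint_iff linorder_not_less mem_ball subsetD)
  have Fex: "r \<le> dist (y - r *\<^sub>R N y) w" if "w \<in> F" for w
  proof -
    have "ball (y - r *\<^sub>R N y) r \<inter> closure \<Omega> = {}" using t(2) by (simp add: open_Int_closure_eq_empty)
    then show ?thesis using that by (auto simp: frontier_def disjoint_iff not_less)
  qed
  have away: "r - dist z c \<le> infdist z F" if "\<And>w. w \<in> F \<Longrightarrow> r \<le> dist c w" for c
  proof -
    obtain w where "w \<in> F" "infdist z F = dist z w" using infdist_attains_inf[OF frontier_closed ne] by metis
    then show ?thesis using that[of w] dist_triangle[of c w z] by (simp add: dist_commute)
  qed
  show "r - dist z (y + r *\<^sub>R N y) \<le> s z"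
  proof (cases "z \<in> \<Omega>")
    case True then show ?thesis using away[OF Fin] by (simp add: sdist_def)
  next
    case False then show ?thesis using crossing[OF Fin, of z] cin by (simp add: sdist_def)
  qed
  show "s z \<le> dist z (y - r *\<^sub>R N y) - r"
  proof (cases "z \<in> \<Omega>")
    case False then show ?thesis using away[OF Fex] by (simp add: sdist_def)
  next
    case True then show ?thesis using crossing[OF Fex, of z] cex by (simp add: sdist_def)
  qed
qed

text \<open>The distance from \<open>x\<close> to the centre of the touching ball on the other side
  of the frontier is at least |s x| + r, which is equality in the triangle inequality via
  \<open>y\<close>; hence \<open>x\<close> lies on the normal line.\<close>

lemma nearest_eq:
  assumes y: "y \<in> F" "dist x y = \<bar>s x\<bar>"
  shows "x = y + s x *\<^sub>R N y"
proof (cases "s x \<ge> 0")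
  case True
  have "x - y = s x *\<^sub>R N y"
  proof (rule norm_eq_of_norm_add[OF _ norm_N[OF y(1)] r])
    show "norm (x - y) = s x" using y True by (simp add: dist_norm)
    show "s x + r \<le> norm (x - y + r *\<^sub>R N y)" using s_upper[OF y(1), of x] by (simp add: dist_norm algebra_simps)
  qed
  then show ?thesis by (simp add: algebra_simps)
next
  case False
  have "x - y = (- s x) *\<^sub>R (- N y)"
  proof (rule norm_eq_of_norm_add[OF _ _ r])
    show "norm (x - y) = - s x" using y False by (simp add: dist_norm)
    show "norm (- N y) = 1" using norm_N[OF y(1)] by simp
    show "- s x + r \<le> norm (x - y + r *\<^sub>R (- N y))" using s_lower[OF y(1), of x] by (simp add: dist_norm algebra_simps)
  qed
  then show ?thesis by (simp add: algebra_simps)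
qed

lemma s_normal:
  assumes y: "y \<in> F" and t: "\<bar>t\<bar> \<le> r"
  shows "s (y + t *\<^sub>R N y) = t"
proof (rule antisym)
  have "y + t *\<^sub>R N y - (y - r *\<^sub>R N y) = (t + r) *\<^sub>R N y" by (simp add: algebra_simps)
  then show "s (y + t *\<^sub>R N y) \<le> t" using s_upper[OF y, of "y + t *\<^sub>R N y"] t norm_N[OF y] by (simp add: dist_norm)
  have "y + t *\<^sub>R N y - (y + r *\<^sub>R N y) = (t - r) *\<^sub>R N y" by (simp add: algebra_simps)
  then show "t \<le> s (y + t *\<^sub>R N y)" using s_lower[OF y, of "y + t *\<^sub>R N y"] t norm_N[OF y] by (simp add: dist_norm)
qed

text \<open>Any frontier point has distance at least \<open>r\<close> from the inner centre of
  \<open>y\<close>, while passing through \<open>x\<close> costs exactly s x + (r - s x). Equality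
  in the triangle inequality fixes the direction from \<open>x\<close>.\<close>

lemma nearest_unique:
  assumes x: "0 \<le> s x" "s x < r" and y: "y \<in> F" "dist x y = \<bar>s x\<bar>" and y': "y' \<in> F" "dist x y' = \<bar>s x\<bar>"
  shows "y' = y"
proof -
  let ?d = "s x"
  have eq: "x = y + ?d *\<^sub>R N y" by (rule nearest_eq[OF y])
  have "y' \<notin> \<Omega>" using y' disj by auto
  have "y' - x = ?d *\<^sub>R (- N y)"
  proof (rule norm_eq_of_norm_add[where r = "r - ?d"])
    show "norm (y' - x) = ?d" using y' x by (simp add: dist_norm norm_minus_commute)
    show "norm (- N y) = 1" using norm_N[OF y(1)] by simp
    have "dist y' (y + r *\<^sub>R N y) \<ge> r" using s_lower[OF y(1), of y'] s_F[OF y'(1)] by simp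
    moreover have "y' - x + (r - ?d) *\<^sub>R (- N y) = y' - (y + r *\<^sub>R N y)" by (subst eq) (simp add: algebra_simps)
    ultimately show "?d + (r - ?d) \<le> norm (y' - x + (r - ?d) *\<^sub>R (- N y))" by (metis add.commute diff_add_cancel dist_norm)
  qed (use x in auto)
  moreover have "y - x = ?d *\<^sub>R (- N y)" by (subst eq) simp
  ultimately show ?thesis by (metis add_diff_cancel_right' diff_add_cancel)
qed

text \<open>The arithmetic-geometric mean inequality for q and |q n + h|; it turns distances to the
  centres into a linear plus a quadratic term.\<close>

lemma norm_add_upper:
  fixes a h :: "real^'n"
  assumes n: "norm n = 1" and q: "q > 0"
  shows "norm (q *\<^sub>R n + h) \<le> q + n \<bullet> h + (norm h)\<^sup>2 / (2 * q)"
proof (rule power2_le_imp_le)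
  have nn: "n \<bullet> n = 1" using n by (simp add: dot_square_norm)
  have eq: "q + n \<bullet> h + (norm h)\<^sup>2 / (2 * q) = (q\<^sup>2 + (norm (q *\<^sub>R n + h))\<^sup>2) / (2 * q)"
    unfolding power2_norm_eq_inner using q by (simp add: inner_add_left inner_add_right nn inner_commute power2_eq_square field_simps)
  show "0 \<le> q + n \<bullet> h + (norm h)\<^sup>2 / (2 * q)" unfolding eq using q by simp
  have "norm (q *\<^sub>R n + h) \<le> (q\<^sup>2 + (norm (q *\<^sub>R n + h))\<^sup>2) / (2 * q)"
    using sum_squares_bound[of q "norm (q *\<^sub>R n + h)"] q by (simp add: pos_le_divide_eq mult_ac)
  then show "(norm (q *\<^sub>R n + h))\<^sup>2 \<le> (q + n \<bullet> h + (norm h)\<^sup>2 / (2 * q))\<^sup>2" unfolding eq by (intro power_mono) auto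
qed

text \<open>The lower and the upper radial bound have the same linear part. Both centres are at
  distance at least r / 2 from \<open>x\<close>, whence the constant 1 / r.\<close>

lemma s_quadratic:
  assumes x: "\<bar>s x\<bar> \<le> r / 2" and y: "y \<in> F" "dist x y = \<bar>s x\<bar>"
  shows "\<bar>s (x + h) - s x - N y \<bullet> h\<bar> \<le> (norm h)\<^sup>2 / r"
proof -
  have eq: "x = y + s x *\<^sub>R N y" by (rule nearest_eq[OF y])
  note n = norm_N[OF y(1)]
  have mono: "(norm h)\<^sup>2 / (2 * q) \<le> (norm h)\<^sup>2 / r" if "q \<ge> r / 2" for q
    using that r by (intro divide_left_mono) auto
  have "x + h - (y + r *\<^sub>R N y) = - ((r - s x) *\<^sub>R N y + (- h))" by (subst eq) (simp add: algebra_simps)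
  then have "dist (x + h) (y + r *\<^sub>R N y) = norm ((r - s x) *\<^sub>R N y + (- h))" by (simp only: dist_norm norm_minus_cancel)
  then have 1: "dist (x + h) (y + r *\<^sub>R N y) \<le> (r - s x) - N y \<bullet> h + (norm h)\<^sup>2 / (2 * (r - s x))"
    using norm_add_upper[OF n, of "r - s x" "- h"] x r by simp
  have "x + h - (y - r *\<^sub>R N y) = (r + s x) *\<^sub>R N y + h" by (subst eq) (simp add: algebra_simps)
  then have "dist (x + h) (y - r *\<^sub>R N y) = norm ((r + s x) *\<^sub>R N y + h)" by (simp only: dist_norm)
  then have 2: "dist (x + h) (y - r *\<^sub>R N y) \<le> (r + s x) + N y \<bullet> h + (norm h)\<^sup>2 / (2 * (r + s x))"
    using norm_add_upper[OF n, of "r + s x" "h"] x r by simp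
  have "(norm h)\<^sup>2 / (2 * (r - s x)) \<le> (norm h)\<^sup>2 / r" "(norm h)\<^sup>2 / (2 * (r + s x)) \<le> (norm h)\<^sup>2 / r"
    by (rule mono, use x in linarith)+
  then show ?thesis using s_lower[OF y(1), of "x + h"] s_upper[OF y(1), of "x + h"] 1 2
    unfolding abs_le_iff by linarith
qed

lemma s_has_derivative:
  assumes x: "\<bar>s x\<bar> \<le> r / 2" and y: "y \<in> F" "dist x y = \<bar>s x\<bar>"
  shows "(s has_derivative (\<lambda>h. N y \<bullet> h)) (at x)" "grad s x = N y"
proof -
  show "(s has_derivative (\<lambda>h. N y \<bullet> h)) (at x)"
    by (rule has_derivative_quadratic_bound[of _ 1 _ _ "1 / r"]) (use s_quadratic[OF assms] in \<open>auto intro: bounded_linear_inner_right\<close>)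
  then show "grad s x = N y" by (rule has_derivative_imp_grad)
qed

lemma s_quadratic_grad: "\<bar>s x\<bar> \<le> r / 2 \<Longrightarrow> \<bar>s (x + h) - s x - grad s x \<bullet> h\<bar> \<le> (norm h)\<^sup>2 / r"
  by (metis nearest s_quadratic s_has_derivative(2))

lemma norm_grad_s: "\<bar>s x\<bar> \<le> r / 2 \<Longrightarrow> norm (grad s x) = 1"
  by (metis nearest s_has_derivative(2) norm_N)

text \<open>The foot point given by a formula instead of a choice, so that it inherits regularity
  from \<open>s\<close>.\<close>

definition "proj x = x - s x *\<^sub>R grad s x"

lemma proj:
  assumes x: "\<bar>s x\<bar> \<le> r / 2"
  shows "proj x \<in> F" "dist x (proj x) = \<bar>s x\<bar>" "grad s x = N (proj x)" "x = proj x + s x *\<^sub>R N (proj x)"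
proof -
  obtain y where y: "y \<in> F" "dist x y = \<bar>s x\<bar>" by (rule nearest)
  have "proj x = y" using nearest_eq[OF y] s_has_derivative(2)[OF x y] by (simp add: proj_def algebra_simps)
  then show "proj x \<in> F" "dist x (proj x) = \<bar>s x\<bar>" "grad s x = N (proj x)" "x = proj x + s x *\<^sub>R N (proj x)"
    using y s_has_derivative(2)[OF x y] nearest_eq[OF y] by auto
qed

lemma s_lipschitz: "\<bar>s x - s z\<bar> \<le> dist x z"
proof -
  have 1: "s x \<le> s z + dist x z" for x z
  proof -
    obtain y where y: "y \<in> F" "dist z y = \<bar>s z\<bar>" by (rule nearest)
    have eq: "z = y + s z *\<^sub>R N y" by (rule nearest_eq[OF y])
    show ?thesis
    proof (cases "s z \<ge> - r")
      case True
      have "z - (y - r *\<^sub>R N y) = (s z + r) *\<^sub>R N y" by (subst eq) (simp add: algebra_simps)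
      then have "dist z (y - r *\<^sub>R N y) = s z + r" using True norm_N[OF y(1)] by (simp add: dist_norm)
      then show ?thesis using s_upper[OF y(1), of x] dist_triangle[of x "y - r *\<^sub>R N y" z] by linarith
    next
      case False
      have "s z \<le> 0" "z \<notin> \<Omega>" using False r s_pos[of z] by auto
      show ?thesis
      proof (cases "x \<in> \<Omega>")
        case True
        have "closed_segment x z \<inter> F \<noteq> {}" using \<open>z \<notin> \<Omega>\<close> True by (intro connected_Int_frontier) auto
        then obtain w where w: "w \<in> closed_segment x z" "w \<in> F" by blast
        then have "dist x z = dist x w + dist w z" using between between_mem_segment by blast
        then show ?thesis using infdist_le[OF w(2), of x] infdist_le[OF w(2), of z] True \<open>z \<notin> \<Omega>\<close>
          by (simp add: sdist_def dist_commute)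
      next
        case False
        then show ?thesis using infdist_triangle[of z F x] \<open>z \<notin> \<Omega>\<close> by (simp add: sdist_def dist_commute)
      qed
    qed
  qed
  show ?thesis using 1[of x z] 1[of z x] by (simp add: dist_commute abs_le_iff)
qed

lemma continuous_s: "continuous_on UNIV s"
  unfolding continuous_on_iff using s_lipschitz by (auto simp: dist_real_def intro: le_less_trans)

lemma open_collar: "open {x. \<bar>s x\<bar> < q}"
  by (intro open_Collect_less continuous_intros continuous_s)

lemma grad_s_lipschitz:
  assumes x: "\<bar>s x\<bar> \<le> r / 2" and z: "\<bar>s z\<bar> \<le> r / 2"
  shows "norm (grad s x - grad s z) \<le> 6 / r * dist x z"
proof (cases "grad s x = grad s z \<or> x = z")
  case False
  define \<delta> where "\<delta> = dist x z"
  have \<delta>: "\<delta> > 0" using False by (simp add: \<delta>_def)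
  let ?D = "grad s x - grad s z"
  \<comment> \<open>\<open>s\<close> at z + h is expanded both from \<open>z\<close> and from
    \<open>x\<close>, with h along the difference of the gradients. The three quadratic errors have
    weights 1, 4 and 1, which gives the 6.\<close>
  define h where "h = (\<delta> / norm ?D) *\<^sub>R ?D"
  have nh: "norm h = \<delta>" using False \<delta> by (simp add: h_def)
  have k: "norm (z - x) = \<delta>" by (simp add: \<delta>_def dist_norm norm_minus_commute)
  have "norm (z - x + h) \<le> 2 * \<delta>" using norm_triangle_ineq[of "z - x" h] k nh by simp
  then have "(norm (z - x + h))\<^sup>2 \<le> (2 * \<delta>)\<^sup>2" by (intro power_mono) auto
  then have "(norm (z - x + h))\<^sup>2 / r \<le> 4 * \<delta>\<^sup>2 / r" using r by (simp add: divide_right_mono power_mult_distrib)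
  moreover have "\<bar>s (z + h) - s z - grad s z \<bullet> h\<bar> \<le> \<delta>\<^sup>2 / r" using s_quadratic_grad[OF z, of h] nh by simp
  moreover have "\<bar>s (z + h) - s x - grad s x \<bullet> (z - x + h)\<bar> \<le> (norm (z - x + h))\<^sup>2 / r"
    using s_quadratic_grad[OF x, of "z - x + h"] by simp
  moreover have "\<bar>s z - s x - grad s x \<bullet> (z - x)\<bar> \<le> \<delta>\<^sup>2 / r" using s_quadratic_grad[OF x, of "z - x"] k by simp
  ultimately have "grad s x \<bullet> h - grad s z \<bullet> h \<le> \<delta>\<^sup>2 / r + 4 * \<delta>\<^sup>2 / r + \<delta>\<^sup>2 / r"
    by (simp add: inner_add_right abs_le_iff)
  also have "grad s x \<bullet> h - grad s z \<bullet> h = ?D \<bullet> h" by (simp add: inner_diff_left)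
  also have "?D \<bullet> h = \<delta> * norm ?D" using False by (simp add: h_def dot_square_norm power2_eq_square)
  finally have "\<delta> * norm ?D \<le> \<delta> * (6 / r * \<delta>)" by (simp add: power2_eq_square algebra_simps add_divide_distrib)
  then have "norm ?D \<le> 6 / r * \<delta>" using \<delta> by (rule mult_left_le_imp_le)
  then show ?thesis by (simp add: \<delta>_def)
qed (use r in auto)

lemma proj_lipschitz:
  assumes x: "\<bar>s x\<bar> \<le> r / 2" and z: "\<bar>s z\<bar> \<le> r / 2"
  shows "norm (proj x - proj z) \<le> 5 * dist x z"
proof -
  have "proj x - proj z = (x - z) - (s x - s z) *\<^sub>R grad s x - s z *\<^sub>R (grad s x - grad s z)"
    by (simp add: proj_def algebra_simps)
  also have "norm \<dots> \<le> norm (x - z) + \<bar>s x - s z\<bar> * norm (grad s x) + \<bar>s z\<bar> * norm (grad s x - grad s z)"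
    by (rule order_trans[OF norm_triangle_ineq4 add_mono[OF order_trans[OF norm_triangle_ineq4]]]) auto
  \<comment> \<open>The 5 is 1 + 1 + 3, the last summand using that |s z| is at most r / 2.\<close>
  also have "\<dots> \<le> dist x z + dist x z + (r / 2) * (6 / r * dist x z)"
    using s_lipschitz[of x z] norm_grad_s[OF x] z r
    by (intro add_mono mult_mono grad_s_lipschitz x z) (auto simp: dist_norm)
  also have "\<dots> = 5 * dist x z" using r by (simp add: field_simps)
  finally show ?thesis .
qed

text \<open>Differentiates the identity x = proj x + s x N (proj x), in which N is the smooth chart
  normal n. The known Lipschitz bound on \<open>proj\<close> makes all remainders quadratic in h, so
  inverting the linear part \<open>M\<close> is enough.\<close>

lemma proj_has_derivative:
  assumes V: "open V" "x \<in> V" and sm: "\<And>z. z \<in> V \<Longrightarrow> \<bar>s z\<bar> \<le> r / 2"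
    and U: "\<And>z. z \<in> V \<Longrightarrow> proj z \<in> U" and n: "\<And>j. smooth_on_open (\<lambda>x. n x $ j) U"
    and Nn: "\<And>y. y \<in> F \<inter> U \<Longrightarrow> N y = n y"
    and M: "M = mat 1 + s x *\<^sub>R jac n (proj x)" and inv: "invertible M"
  shows "(proj has_derivative (\<lambda>h. matrix_inv M *v (h - (N (proj x) \<bullet> h) *\<^sub>R N (proj x)))) (at x)"
proof -
  let ?\<pi> = "proj x" let ?J = "jac n ?\<pi>" let ?N = "N ?\<pi>"
  let ?L = "\<lambda>h. matrix_inv M *v (h - (?N \<bullet> h) *\<^sub>R ?N)"
  note sx = sm[OF V(2)]
  obtain e where e: "e > 0" "ball x e \<subseteq> V" using V openE by blast
  obtain K1 e1 where K1: "e1 > 0" "K1 \<ge> 0" "\<And>h. norm h < e1 \<Longrightarrow> norm (n (?\<pi> + h) - n ?\<pi> - ?J *v h) \<le> K1 * (norm h)\<^sup>2"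
    using taylor2_local_vec[OF n U[OF V(2)]] by metis
  define C where "C = 1 / r + 6 / r + r / 2 * (25 * K1)"
  have inv1: "matrix_inv M ** M = mat 1" using matrix_inv_inverse[OF inv] by simp
  have bnd: "norm (proj (x + h) - proj x - ?L h) \<le> norm (matrix_inv M) * C * (norm h)\<^sup>2" if h: "norm h < min e (e1 / 6)" for h
  proof -
    have xh: "x + h \<in> V" using e h by (auto simp: dist_norm)
    note sxh = sm[OF xh]
    define \<Delta> where "\<Delta> = proj (x + h) - ?\<pi>"
    have \<Delta>: "norm \<Delta> \<le> 5 * norm h" using proj_lipschitz[OF sxh sx] by (simp add: \<Delta>_def dist_norm)
    define n' where "n' = N (proj (x + h))"
    have n': "n' = n (?\<pi> + \<Delta>)" using Nn[of "proj (x + h)"] proj(1)[OF sxh] U[OF xh] by (simp add: n'_def \<Delta>_def)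
    have nN: "?N = n ?\<pi>" using Nn[of ?\<pi>] proj(1)[OF sx] U[OF V(2)] by simp
    have norms: "norm n' = 1" "norm ?N = 1" using norm_N proj(1) sx sxh by (auto simp: n'_def)
    have d1: "norm (n' - ?N) \<le> 6 / r * norm h"
      using grad_s_lipschitz[OF sxh sx] proj(3)[OF sx] proj(3)[OF sxh] by (simp add: n'_def dist_norm)
    have d2: "norm (n' - ?N - ?J *v \<Delta>) \<le> 25 * K1 * (norm h)\<^sup>2"
    proof -
      have "norm \<Delta> < e1" using \<Delta> h K1(1) by auto
      then have "norm (n' - ?N - ?J *v \<Delta>) \<le> K1 * (norm \<Delta>)\<^sup>2" using K1(3)[of \<Delta>] by (simp add: n' nN)
      also have "\<dots> \<le> K1 * (5 * norm h)\<^sup>2" using \<Delta> K1 by (intro mult_left_mono power_mono) auto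
      finally show ?thesis by (simp add: power_mult_distrib)
    qed
    \<comment> \<open>The defect of the linearised identity. It splits into the Taylor remainder of
      \<open>s\<close>, a product of two first-order quantities, and the Taylor remainder of the
      normal field.\<close>
    define R where "R = h - (?N \<bullet> h) *\<^sub>R ?N - M *v \<Delta>"
    have heq: "h = \<Delta> + s (x + h) *\<^sub>R n' - s x *\<^sub>R ?N"
      using proj(4)[OF sx] proj(4)[OF sxh] by (simp add: \<Delta>_def n'_def algebra_simps)
    have "M *v \<Delta> = \<Delta> + s x *\<^sub>R (?J *v \<Delta>)"
      by (simp add: M matrix_vector_mult_add_rdistrib scaleR_matrix_vector_assoc[symmetric])
    then have "R = (s (x + h) - s x - ?N \<bullet> h) *\<^sub>R n' + (?N \<bullet> h) *\<^sub>R (n' - ?N) + s x *\<^sub>R (n' - ?N - ?J *v \<Delta>)"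
      unfolding R_def by (subst (1) heq) (simp add: algebra_simps)
    also have "norm \<dots> \<le> \<bar>s (x + h) - s x - ?N \<bullet> h\<bar> * norm n' + \<bar>?N \<bullet> h\<bar> * norm (n' - ?N) + \<bar>s x\<bar> * norm (n' - ?N - ?J *v \<Delta>)"
      by (rule order_trans[OF norm_triangle_ineq add_mono[OF order_trans[OF norm_triangle_ineq]]]) auto
    also have "\<dots> \<le> (norm h)\<^sup>2 / r * 1 + norm h * (6 / r * norm h) + r / 2 * (25 * K1 * (norm h)\<^sup>2)"
      using s_quadratic_grad[OF sx, of h] proj(3)[OF sx] Cauchy_Schwarz_ineq2[of ?N h] norms d1 d2 sx r
      by (intro add_mono mult_mono) auto
    also have "\<dots> = C * (norm h)\<^sup>2" by (simp add: C_def power2_eq_square algebra_simps)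
    finally have R: "norm R \<le> C * (norm h)\<^sup>2" .
    have "matrix_inv M *v R = ?L h - \<Delta>"
      by (simp add: R_def matrix_vector_mult_diff_distrib matrix_vector_mul_assoc inv1)
    then have "norm (?L h - \<Delta>) \<le> norm (matrix_inv M) * norm R" using norm_matrix_vector_le[of "matrix_inv M" R] by simp
    also have "\<dots> \<le> norm (matrix_inv M) * (C * (norm h)\<^sup>2)" using R by (rule mult_left_mono) simp
    finally have "norm (?L h - \<Delta>) \<le> norm (matrix_inv M) * (C * (norm h)\<^sup>2)" .
    then show ?thesis by (simp add: \<Delta>_def norm_minus_commute mult.assoc)
  qed
  have "bounded_linear ?L"
    by (intro bounded_linear_compose[OF matrix_vector_mul_bounded_linear] bounded_linear_sub bounded_linear_ident
        bounded_linear_scaleR_const bounded_linear_inner_right)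
  moreover have "min e (e1 / 6) > 0" using e K1 by auto
  ultimately show ?thesis by (rule has_derivative_quadratic_bound[OF _ _ bnd])
qed

text \<open>A bootstrap: the gradient of \<open>s\<close> is n at the foot point, and the derivative
  of the foot point is built from \<open>s\<close>, n and its Jacobian at the foot point. Hence m
  continuous derivatives of \<open>s\<close> and \<open>proj\<close> yield m + 1. The bound
  \<open>q * K < 1\<close> keeps the matrix to be inverted nonsingular.\<close>

lemma s_locally_smooth:
  assumes q: "q \<le> r / 2" "q * K < 1" and x0: "\<bar>s x0\<bar> < q"
    and U: "open U" "proj x0 \<in> U" and n: "\<And>j. smooth_on_open (\<lambda>x. n x $ j) U"
    and K: "K \<ge> 0" "\<And>z. z \<in> U \<Longrightarrow> norm (jac n z) \<le> K" and Nn: "\<And>y. y \<in> F \<inter> U \<Longrightarrow> N y = n y"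
  obtains V where "open V" "x0 \<in> V" "\<And>m. Ck_on m s V"
proof -
  let ?W = "{x. \<bar>s x\<bar> < q}"
  define V where "V = ?W \<inter> proj -` U"
  have cW: "continuous_on ?W proj" unfolding continuous_on_iff
  proof (intro ballI allI impI)
    fix x and e :: real assume x: "x \<in> ?W" and e: "e > 0"
    have "dist (proj z) (proj x) < e" if "z \<in> ?W" "dist z x < e / 5" for z
      using proj_lipschitz[of z x] that x q e by (simp add: dist_norm)
    then show "\<exists>d>0. \<forall>z\<in>?W. dist z x < d \<longrightarrow> dist (proj z) (proj x) < e" using e by (intro exI[of _ "e / 5"]) auto
  qed
  have oV: "open V" unfolding V_def by (rule continuous_open_preimage[OF cW open_collar U(1)])
  have V: "\<bar>s x\<bar> < q" "\<bar>s x\<bar> \<le> r / 2" "proj x \<in> U" if "x \<in> V" for x using that q by (auto simp: V_def)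
  have gradN: "grad s x = n (proj x)" "N (proj x) = n (proj x)" if "x \<in> V" for x
    using proj(1,3)[OF V(2)[OF that]] Nn V(3)[OF that] by auto
  define M where "M x = mat 1 + s x *\<^sub>R jac n (proj x)" for x
  have inv: "invertible (M x)" if x: "x \<in> V" for x
  proof -
    have "v = 0" if v: "M x *v v = 0" for v
    proof (rule ccontr)
      assume "v \<noteq> 0"
      have "v = - (s x *\<^sub>R (jac n (proj x) *v v))"
        using v by (simp add: M_def matrix_vector_mult_add_rdistrib scaleR_matrix_vector_assoc[symmetric] add_eq_0_iff2)
      then have "norm v = \<bar>s x\<bar> * norm (jac n (proj x) *v v)" by (metis norm_minus_cancel norm_scaleR)
      also have "\<dots> \<le> q * (K * norm v)"
        using V[OF x] K(2)[OF V(3)[OF x]] K(1) norm_matrix_vector_le[of "jac n (proj x)" v]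
        by (intro mult_mono order_trans[OF norm_matrix_vector_le] mult_right_mono) auto
      also have "\<dots> < 1 * norm v" using q \<open>v \<noteq> 0\<close> by (simp add: mult.assoc[symmetric] del: mult_1)
      finally show False by simp
    qed
    then show ?thesis using matrix_left_invertible_ker[of "M x"] invertible_left_inverse by blast
  qed
  have det: "det (M x) \<noteq> 0" if "x \<in> V" for x using inv[OF that] by (simp add: invertible_det_nz)
  have dproj: "(proj has_derivative (\<lambda>h. matrix_inv (M x) *v (h - (n (proj x) \<bullet> h) *\<^sub>R n (proj x)))) (at x)" if "x \<in> V" for x
    using proj_has_derivative[OF oV that V(2,3) n Nn M_def inv[OF that]] gradN(2)[OF that] by simp
  define b where "b i x = axis i 1 - (n (proj x) $ i) *\<^sub>R n (proj x)" for i x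
  have dcomp: "((\<lambda>x. proj x $ k) has_derivative (\<lambda>h. (matrix_inv (M x) *v (h - (n (proj x) \<bullet> h) *\<^sub>R n (proj x))) $ k)) (at x)"
    if "x \<in> V" for x k
    by (rule bounded_linear.has_derivative[OF bounded_linear_vec_nth dproj[OF that]])
  \<comment> \<open>Cramer's rule writes the inverse matrix as a quotient of determinants, to which
    the closure properties of \<open>Ck_on\<close> apply.\<close>
  have pd: "partial_deriv i (\<lambda>x. proj x $ k) x
      = det (\<chi> a c. if c = k then b i x $ a else M x $ a $ c) * inverse (det (M x))" if x: "x \<in> V" for x i k
  proof -
    define w where "w = matrix_inv (M x) *v b i x"
    have "M x *v w = b i x" using inv[OF x] by (simp add: w_def matrix_vector_mul_assoc matrix_inv_inverse)
    then have "w = (\<chi> k. det (\<chi> a c. if c = k then b i x $ a else M x $ a $ c) / det (M x))"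
      using cramer[OF det[OF x]] by blast
    moreover have "partial_deriv i (\<lambda>x. proj x $ k) x = w $ k"
      using has_derivative_imp_partial_deriv[OF dcomp[OF x]] by (simp add: w_def b_def inner_axis)
    ultimately show ?thesis by (simp add: divide_inverse)
  qed
  have Ck: "Ck_on m s V \<and> (\<forall>k. Ck_on m (\<lambda>x. proj x $ k) V)" for m
  proof (induction m)
    case 0
    have "continuous_on V proj" using cW continuous_on_subset V(1) by blast
    moreover have "continuous_on V s" using continuous_s continuous_on_subset by blast
    ultimately show ?case by (simp add: continuous_on_nth_iff)
  next
    case (Suc m)
    have comp: "Ck_on m (\<lambda>x. f (proj x)) V" if "smooth_on_open f U" for f
    proof (rule Ck_on_compose[OF oV])
      show "Ck_on m f U" using that by (simp add: smooth_on_open_def)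
      show "\<And>j. Ck_on m (\<lambda>x. proj x $ j) V" using Suc by simp
      show "proj ` V \<subseteq> U" using V(3) by auto
    qed
    have Cn: "Ck_on m (\<lambda>x. n (proj x) $ i) V" for i by (rule comp[OF n])
    have CJ: "Ck_on m (\<lambda>x. jac n (proj x) $ i $ j) V" for i j
      using comp[OF smooth_partial[OF n]] by (simp add: jac_def)
    have "Ck_on m (partial_deriv i s) V" for i
      by (rule Ck_on_congI[OF oV Cn[of i]]) (use gradN(1) in \<open>auto simp: grad_def vec_eq_iff\<close>)
    moreover have "s differentiable (at x)" if "x \<in> V" for x
      using s_has_derivative(1)[OF V(2)[OF that] proj(1,2)[OF V(2)[OF that]]] differentiableI by blast
    moreover have "(\<lambda>x. proj x $ k) differentiable (at x)" if "x \<in> V" for x k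
      using dcomp[OF that] differentiableI by blast
    moreover have "Ck_on m (partial_deriv i (\<lambda>x. proj x $ k)) V" for i k
    proof (rule Ck_on_congI[OF oV _ pd])
      have CM: "Ck_on m (\<lambda>x. M x $ a $ c) V" for a c
        unfolding M_def using Suc by (simp, intro Ck_on_add Ck_on_mult Ck_on_const oV CJ) auto
      have Cb: "Ck_on m (\<lambda>x. b i x $ a) V" for a
      proof -
        have "Ck_on m (\<lambda>x. axis i 1 $ a + (-1) * (n (proj x) $ i * n (proj x) $ a)) V"
          by (intro Ck_on_add Ck_on_mult Ck_on_const oV Cn)
        then show ?thesis by (simp add: b_def)
      qed
      show "Ck_on m (\<lambda>x. det (\<chi> a c. if c = k then b i x $ a else M x $ a $ c) * inverse (det (M x))) V"
      proof (intro Ck_on_mult Ck_on_inverse Ck_on_det oV det CM)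
        fix a c
        show "Ck_on m (\<lambda>x. (\<chi> a c. if c = k then b i x $ a else M x $ a $ c) $ a $ c) V"
          using CM Cb by (cases "c = k") auto
      qed
    qed
    ultimately show ?case by auto
  qed
  show ?thesis using that[OF oV] Ck x0 U(2) by (auto simp: V_def)
qed

end

lemma Ck_on_local:
  assumes "\<And>x. x \<in> S \<Longrightarrow> \<exists>V. open V \<and> x \<in> V \<and> Ck_on m f V"
  shows "Ck_on m f S"
  using assms
proof (induction m arbitrary: f)
  case 0
  have "isCont f x" if x: "x \<in> S" for x
  proof -
    obtain V where "open V" "x \<in> V" "continuous_on V f" using 0[OF x] by auto
    then show ?thesis using continuous_on_eq_continuous_at by blast
  qed
  then show ?case by (simp add: continuous_at_imp_continuous_on)
next
  case (Suc m)
  have "f differentiable (at x)" if "x \<in> S" for x using Suc.prems[OF that] by auto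
  moreover have "Ck_on m (partial_deriv i f) S" for i
    by (rule Suc.IH) (use Suc.prems in fastforce)
  ultimately show ?case by simp
qed

theorem signed_distance_smooth:
  fixes \<Omega> :: "(real^'n::finite) set"
  assumes \<Omega>: "bounded_smooth_domain \<Omega>"
  obtains r N q where "touching_domain \<Omega> r N" "0 < q" "q \<le> r / 2" "smooth_on_open (sdist \<Omega>) {x. \<bar>sdist \<Omega> x\<bar> < q}"
proof -
  obtain r K where r: "r > 0" and K: "K \<ge> 0" and ch:
    "\<And>y. y \<in> frontier \<Omega> \<Longrightarrow> \<exists>U n. open U \<and> y \<in> U \<and> (\<forall>j. smooth_on_open (\<lambda>x. n x $ j) U) \<and>
       (\<forall>z\<in>U. norm (jac n z) \<le> K) \<and> (\<forall>y\<in>frontier \<Omega> \<inter> U. touching_normal \<Omega> r y (n y))"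
    using uniform_boundary_charts[OF \<Omega>] by metis
  \<comment> \<open>A pointwise choice; uniqueness of touching normals will identify it with the
    smooth normal of every chart.\<close>
  define N where "N y = (SOME n. touching_normal \<Omega> r y n)" for y
  have N: "touching_normal \<Omega> r y (N y)" if "y \<in> frontier \<Omega>" for y
    unfolding N_def using ch[OF that] that by (metis IntI someI)
  have ne: "\<Omega> \<noteq> {}" "bounded \<Omega>" "open \<Omega>" using \<Omega> by (auto simp: bounded_smooth_domain_def)
  then have "\<Omega> \<noteq> UNIV" using not_bounded_UNIV by blast
  then have "frontier \<Omega> \<noteq> {}" using ne frontier_eq_empty by blast
  then interpret touching_domain \<Omega> r N using ne r N by unfold_locales auto
  \<comment> \<open>The first bound keeps to the region where \<open>s\<close> is differentiable,
    the second makes the identity plus \<open>s\<close> times a Jacobian invertible.\<close>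
  define q where "q = min (r / 2) (1 / (K + 1))"
  have q: "q > 0" "q \<le> r / 2" "q * K < 1"
  proof -
    show "q > 0" "q \<le> r / 2" using r K by (auto simp: q_def)
    have "q * K \<le> 1 / (K + 1) * K" using K by (intro mult_right_mono) (auto simp: q_def)
    also have "\<dots> < 1" using K by (simp add: field_simps)
    finally show "q * K < 1" .
  qed
  have "Ck_on m s {x. \<bar>s x\<bar> < q}" for m
  proof (rule Ck_on_local)
    fix x assume "x \<in> {x. \<bar>s x\<bar> < q}"
    then have x: "\<bar>s x\<bar> < q" by simp
    then have y: "proj x \<in> F" using proj(1) q by auto
    obtain U n where U: "open U" "proj x \<in> U" "\<And>j. smooth_on_open (\<lambda>x. n x $ j) U"
       "\<And>z. z \<in> U \<Longrightarrow> norm (jac n z) \<le> K" "\<And>y. y \<in> F \<inter> U \<Longrightarrow> touching_normal \<Omega> r y (n y)" using ch[OF y] by blast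
    have "N y = n y" if "y \<in> F \<inter> U" for y using touching_normal_unique[OF N U(5)[OF that] r] that by auto
    from s_locally_smooth[OF q(2,3) x U(1,2,3) K U(4) this] show "\<exists>V. open V \<and> x \<in> V \<and> Ck_on m s V" by metis
  qed
  then have "smooth_on_open s {x. \<bar>s x\<bar> < q}" using open_collar by (simp add: smooth_on_open_def)
  then show ?thesis using that[OF touching_domain_axioms q(1,2)] by blast
qed

subsection \<open>The operator in a collar\<close>

lemma trace_scaleR [simp]: "trace (c *\<^sub>R (A :: real^'n^'n::finite)) = c * trace A"
  by (simp add: trace_def sum_distrib_left)

lemma trace_uminus [simp]: "trace (- (A :: real^'n^'n::finite)) = - trace A"
  by (simp add: trace_def sum_negf)

lemma trace_outer [simp]: "trace (outer v w) = v \<bullet> w"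
  by (simp add: trace_def outer_def inner_vec_def)

lemma trace_mat_1 [simp]: "trace (mat 1 :: real^'n^'n::finite) = CARD('n)"
  by (simp add: trace_I)

lemma norm_outer: "norm (outer v w) = norm v * norm (w :: real^'n::finite)"
proof -
  have "outer v w = (\<chi> i. (v $ i) *\<^sub>R w)" by (simp add: outer_def vec_eq_iff)
  moreover have "norm (\<chi> i. (v $ i) *\<^sub>R w) = norm v * norm w"
    by (simp add: norm_vec_def[of "vec_lambda _"] norm_vec_def[of v] L2_set_left_distrib)
  ultimately show ?thesis by simp
qed

lemma abs_trace_le: "\<bar>trace (A :: real^'n^'n::finite)\<bar> \<le> CARD('n) * norm A"
proof -
  have "\<bar>trace A\<bar> \<le> (\<Sum>i\<in>UNIV. \<bar>A $ i $ i\<bar>)" unfolding trace_def by (rule sum_abs)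
  also have "\<dots> \<le> (\<Sum>i\<in>(UNIV :: 'n set). norm A)"
    by (intro sum_mono) (metis component_le_norm_cart Finite_Cartesian_Product.norm_nth_le order_trans)
  finally show ?thesis by simp
qed

text \<open>With \<open>\<rho>\<close> the distance, \<open>\<nu> = \<nabla>\<rho>\<close>, \<open>H = \<nabla>\<^sup>2\<rho>\<close>, \<open>p = \<nabla>\<phi>\<close> and \<open>M = \<nabla>\<^sup>2\<phi>\<close>, this is \<open>\<rho>\<^sup>2 A(\<phi> - log \<rho>) - (n - 1) I\<close>.\<close>
definition Emat :: "real \<Rightarrow> real^'n::finite \<Rightarrow> real^'n^'n \<Rightarrow> real^'n \<Rightarrow> real^'n^'n \<Rightarrow> real^'n^'n" where
  "Emat \<rho> \<nu> H p M =
     (real CARD('n) - 2) *\<^sub>R (\<rho>\<^sup>2 *\<^sub>R M - \<rho> *\<^sub>R H + (\<rho>\<^sup>2 * (p \<bullet> p) - 2 * \<rho> * (\<nu> \<bullet> p)) *\<^sub>R mat 1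
       + \<rho> *\<^sub>R (outer \<nu> p + outer p \<nu>) - \<rho>\<^sup>2 *\<^sub>R outer p p)
     + (\<rho>\<^sup>2 * trace M - \<rho> * trace H) *\<^sub>R mat 1"

lemma A_of_log:
  fixes \<phi> \<rho> :: "real^'n::finite \<Rightarrow> real"
  assumes \<phi>: "smooth_on_open \<phi> S" and \<rho>: "smooth_on_open \<rho> S" and x: "x \<in> S"
    and pos: "\<And>x. x \<in> S \<Longrightarrow> \<rho> x > 0" and unit: "norm (grad \<rho> x) = 1"
  shows "A_of (\<lambda>x. \<phi> x - ln (\<rho> x)) x
    = inverse ((\<rho> x)\<^sup>2) *\<^sub>R ((real CARD('n) - 1) *\<^sub>R mat 1 + Emat (\<rho> x) (grad \<rho> x) (hess \<rho> x) (grad \<phi> x) (hess \<phi> x))"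
proof -
  define a where "a = inverse (\<rho> x)"
  define \<nu> where "\<nu> = grad \<rho> x" define H where "H = hess \<rho> x"
  define p where "p = grad \<phi> x" define M where "M = hess \<phi> x"
  have a\<rho>: "a * \<rho> x = 1" using pos[OF x] by (simp add: a_def)
  have \<nu>\<nu>: "\<nu> \<bullet> \<nu> = 1" using unit by (simp add: \<nu>_def dot_square_norm)
  have ln: "smooth_on_open (\<lambda>x. ln (\<rho> x)) S" by (rule smooth_ln[OF \<rho> pos])
  have gl: "grad (\<lambda>x. ln (\<rho> x)) x = a *\<^sub>R \<nu>"
    unfolding \<nu>_def by (rule grad_comp_real[OF \<rho> x]) (use DERIV_ln[OF pos[OF x]] in \<open>simp add: a_def\<close>)
  have hl: "hess (\<lambda>x. ln (\<rho> x)) x = a *\<^sub>R H + (- (a * a)) *\<^sub>R outer \<nu> \<nu>"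
    unfolding \<nu>_def H_def a_def
  proof (rule hess_comp_real[OF \<rho> x, where T = "{0<..}" and ?h1.0 = inverse and ?h2.0 = "\<lambda>t. - (inverse t * inverse t)"])
    show "\<rho> ` S \<subseteq> {0<..}" using pos by auto
    show "(ln has_real_derivative inverse t) (at t)" if "t \<in> {0<..}" for t using DERIV_ln that by simp
    show "(inverse has_real_derivative - (inverse t * inverse t)) (at t)" if "t \<in> {0<..}" for t
      using that by (auto intro!: derivative_eq_intros)
  qed
  have g: "grad (\<lambda>x. \<phi> x - ln (\<rho> x)) x = p - a *\<^sub>R \<nu>" using grad_diff[OF \<phi> ln x] gl by (simp add: p_def)
  have h: "hess (\<lambda>x. \<phi> x - ln (\<rho> x)) x = M - a *\<^sub>R H + (a * a) *\<^sub>R outer \<nu> \<nu>"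
    using hess_diff[OF \<phi> ln x] hl by (simp add: M_def)
  have l: "laplacian (\<lambda>x. \<phi> x - ln (\<rho> x)) x = trace M - a * trace H + a * a"
    by (simp add: laplacian_def h trace_add trace_sub \<nu>\<nu>)
  have n2: "(norm (p - a *\<^sub>R \<nu>))\<^sup>2 = p \<bullet> p - 2 * a * (\<nu> \<bullet> p) + a * a"
    unfolding power2_norm_eq_inner by (simp add: inner_diff_left inner_diff_right \<nu>\<nu> inner_commute algebra_simps)
  define c where "c = real CARD('n) - 2"
  have n1: "real CARD('n) - 1 = c + 1" by (simp add: c_def)
  \<comment> \<open>The claim for one matrix entry, a polynomial identity modulo a d = 1. The unit
    gradient has already been used to cancel the singular rank-one terms.\<close>
  have key: "c * (Mij - a * Hij + a * a * (ni * nj)) + (tM - a * tH + a * a) * \<delta> + c * ((pp - 2 * a * np + a * a) * \<delta> - (pi - a * ni) * (pj - a * nj))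
     = (a * a) * ((c + 1) * \<delta> + (c * (d * d * Mij - d * Hij + (d * d * pp - 2 * d * np) * \<delta> + d * (ni * pj + pi * nj) - d * d * (pi * pj)) + (d * d * tM - d * tH) * \<delta>))"
    if "a * d = 1" for Mij Hij ni nj pi pj tM tH pp np \<delta> d :: real
    using that by algebra
  have "inverse ((\<rho> x)\<^sup>2) = a * a" by (simp add: a_def power2_eq_square)
  then show ?thesis
    unfolding A_of_def g h l n2 Emat_def \<nu>_def[symmetric] H_def[symmetric] p_def[symmetric] M_def[symmetric] c_def[symmetric] n1 vec_eq_iff
    using key[OF a\<rho>] by (auto simp: outer_def mat_def power2_eq_square)
qed

lemma transpose_add: "transpose (A + B) = transpose A + transpose (B :: real^'n::finite^'m::finite)"
  by (simp add: vec_eq_iff transpose_def)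

lemma transpose_scaleR: "transpose (c *\<^sub>R (A :: real^'n::finite^'m::finite)) = c *\<^sub>R transpose A"
  by (simp add: vec_eq_iff transpose_def)

lemma transpose_Emat:
  assumes "transpose H = H" "transpose M = M"
  shows "transpose (Emat \<rho> \<nu> H p M) = Emat \<rho> \<nu> H p M"
proof -
  have "H $ j $ i = H $ i $ j" "M $ j $ i = M $ i $ j" for i j using assms by (simp_all add: vec_eq_iff transpose_def)
  then show ?thesis by (simp add: vec_eq_iff transpose_def Emat_def outer_def mat_def mult_ac add_ac)
qed

section \<open>Linearisation of the scaled equation\<close>

lemma exp_minus_one_bound: "\<bar>exp a - 1\<bar> \<le> exp \<bar>a\<bar> * \<bar>a :: real\<bar>"
proof -
  have "exp a - 1 \<le> a * exp a" using exp_ge_add_one_self[of "- a"] by (simp add: exp_minus field_simps)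
  moreover have "a * exp a \<le> \<bar>a\<bar> * exp \<bar>a\<bar>" by (intro mult_mono) auto
  moreover have "1 - exp a \<le> - a" using exp_ge_add_one_self[of a] by linarith
  moreover have "- a \<le> exp \<bar>a\<bar> * \<bar>a\<bar>" using mult_right_mono[of 1 "exp \<bar>a\<bar>" "\<bar>a\<bar>"] by auto
  ultimately show ?thesis by (simp add: abs_le_iff mult.commute)
qed

lemma exp_minus_linear_bound: "\<bar>exp b - 1 - b\<bar> \<le> exp \<bar>b\<bar> * (b :: real)\<^sup>2"
proof -
  have "exp b - 1 - b \<ge> 0" using exp_ge_add_one_self[of b] by linarith
  moreover have "exp b - 1 - b \<le> b * (exp b - 1)" using exp_ge_add_one_self[of "- b"] by (simp add: exp_minus field_simps)
  moreover have "b * (exp b - 1) \<le> \<bar>b\<bar> * (exp \<bar>b\<bar> * \<bar>b\<bar>)"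
    using abs_ge_self[of "b * (exp b - 1)"] mult_left_mono[OF exp_minus_one_bound[of b], of "\<bar>b\<bar>"] by (simp add: abs_mult)
  ultimately show ?thesis by (simp add: power2_eq_square mult_ac)
qed

text \<open>Both \<phi> and the perturbation are O(\<rho>), so replacing the exponential by its
  linear part at 0 costs an extra factor \<rho>.\<close>

lemma exp_perturb:
  assumes c: "c \<ge> 0" and K: "K \<ge> 0"
  shows "\<exists>C\<ge>0. \<forall>\<rho> \<phi> \<eta> \<sigma>. 0 < \<rho> \<longrightarrow> \<rho> \<le> 1 \<longrightarrow> \<bar>\<phi>\<bar> \<le> K * \<rho> \<longrightarrow> \<bar>\<eta>\<bar> \<le> \<sigma> \<longrightarrow> \<sigma> \<le> K * \<rho> \<longrightarrow>
    \<bar>exp (c * (\<phi> + \<eta>)) - exp (c * \<phi>) - c * \<eta>\<bar> \<le> C * \<rho> * (\<sigma> :: real)"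
proof -
  define e where "e = exp (c * K)"
  have e: "e > 0" by (simp add: e_def)
  show ?thesis
  proof (intro exI[of _ "e * (e * (c * c * K)) + e * (c * K) * c"] conjI allI impI)
    fix \<rho> \<phi> \<eta> \<sigma> :: real
    assume h: "0 < \<rho>" "\<rho> \<le> 1" "\<bar>\<phi>\<bar> \<le> K * \<rho>" "\<bar>\<eta>\<bar> \<le> \<sigma>" "\<sigma> \<le> K * \<rho>"
    have K\<rho>: "K * \<rho> \<le> K" using h K by (simp add: mult_left_le)
    have \<sigma>: "\<sigma> \<ge> 0" using h by linarith
    have a: "\<bar>c * \<phi>\<bar> \<le> c * (K * \<rho>)" "\<bar>c * \<phi>\<bar> \<le> c * K" "\<bar>c * \<eta>\<bar> \<le> c * \<sigma>" "\<bar>c * \<eta>\<bar> \<le> c * K"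
      using h K\<rho> c by (auto simp: abs_mult intro!: mult_left_mono)
    have "exp (c * (\<phi> + \<eta>)) - exp (c * \<phi>) - c * \<eta> = exp (c * \<phi>) * (exp (c * \<eta>) - 1 - c * \<eta>) + (exp (c * \<phi>) - 1) * (c * \<eta>)"
      by (simp add: exp_add algebra_simps)
    also have "\<bar>\<dots>\<bar> \<le> exp (c * \<phi>) * \<bar>exp (c * \<eta>) - 1 - c * \<eta>\<bar> + \<bar>exp (c * \<phi>) - 1\<bar> * \<bar>c * \<eta>\<bar>"
      by (rule order_trans[OF abs_triangle_ineq]) (simp add: abs_mult)
    also have "\<dots> \<le> e * (e * (c * c * K * \<rho> * \<sigma>)) + (e * (c * (K * \<rho>))) * (c * \<sigma>)"
    proof (intro add_mono mult_mono)
      show "exp (c * \<phi>) \<le> e" using a by (simp add: e_def)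
      have "(c * \<eta>)\<^sup>2 \<le> (c * (K * \<rho>)) * (c * \<sigma>)"
      proof -
        have "\<bar>c * \<eta>\<bar> * \<bar>c * \<eta>\<bar> \<le> (c * (K * \<rho>)) * (c * \<sigma>)"
          using a(3) h c \<sigma> by (intro mult_mono order_trans[OF a(3)] mult_left_mono) auto
        then show ?thesis by (simp add: power2_eq_square)
      qed
      moreover have "exp \<bar>c * \<eta>\<bar> \<le> e" using a by (simp add: e_def)
      ultimately have "exp \<bar>c * \<eta>\<bar> * (c * \<eta>)\<^sup>2 \<le> e * ((c * (K * \<rho>)) * (c * \<sigma>))" using e by (intro mult_mono) auto
      then show "\<bar>exp (c * \<eta>) - 1 - c * \<eta>\<bar> \<le> e * (c * c * K * \<rho> * \<sigma>)"
        using exp_minus_linear_bound[of "c * \<eta>"] by (simp add: mult_ac)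
      have "exp \<bar>c * \<phi>\<bar> * \<bar>c * \<phi>\<bar> \<le> e * (c * (K * \<rho>))" using a e by (intro mult_mono) (auto simp: e_def)
      then show "\<bar>exp (c * \<phi>) - 1\<bar> \<le> e * (c * (K * \<rho>))" using exp_minus_one_bound[of "c * \<phi>"] by linarith
      show "\<bar>c * \<eta>\<bar> \<le> c * \<sigma>" by fact
    qed (use e c K h \<sigma> in auto)
    also have "\<dots> = (e * (e * (c * c * K)) + e * (c * K) * c) * \<rho> * \<sigma>" by (simp add: algebra_simps)
    finally show "\<bar>exp (c * (\<phi> + \<eta>)) - exp (c * \<phi>) - c * \<eta>\<bar> \<le> (e * (e * (c * c * K)) + e * (c * K) * c) * \<rho> * \<sigma>" .
  qed (use e c K in auto)
qed

text \<open>The value of \<open>\<sigma>_k\<close> at (n - 1) I, which is the matrix of the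
  hyperbolic model after scaling.\<close>

definition Qzero :: "nat \<Rightarrow> nat \<Rightarrow> real" where
  "Qzero n k = (real n - 1) ^ k * real (n choose k)"

text \<open>The common factor of the linearised operator: the derivative of
  \<open>\<sigma>_k\<close> at (n - 1) I times 2 (n - 1), the latter coming from the trace of the
  perturbed matrix.\<close>

definition kap :: "nat \<Rightarrow> nat \<Rightarrow> real" where
  "kap n k = 2 * (real n - 1) ^ k * real (n - 1 choose (n - k))"

lemma kap_pos: "2 \<le> n \<Longrightarrow> 1 \<le> k \<Longrightarrow> k \<le> n \<Longrightarrow> kap n k > 0"
  by (simp add: kap_def)

text \<open>The left side is the derivative of the exponential term. Its being n times
  \<open>kap\<close> gives the zeroth-order coefficient - n, hence the integer indicial roots and
  the resonance at order n.\<close>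

lemma kap_Qzero: "1 \<le> k \<Longrightarrow> k \<le> n \<Longrightarrow> 2 * real k * Qzero n k = kap n k * real n"
proof -
  assume k: "1 \<le> k" "k \<le> n"
  have "n - 1 choose (n - k) = n - 1 choose (k - 1)"
    using binomial_symmetric[of "k - 1" "n - 1"] k by simp
  moreover have "k * (n choose k) = n * (n - 1 choose (k - 1))" using times_binomial_minus1_eq[of k n] k by simp
  then have "real k * real (n choose k) = real n * real (n - 1 choose (k - 1))" by (metis of_nat_mult)
  ultimately show ?thesis by (simp add: Qzero_def kap_def)
qed

text \<open>The defect of the equation for \<phi> - log \<rho>, multiplied by \<rho>^(2k) and read
  as a function of the 2-jets; nothing singular at \<rho> = 0 is left.\<close>

definition Res :: "nat \<Rightarrow> real \<Rightarrow> real^'n::finite \<Rightarrow> real^'n^'n \<Rightarrow> real \<Rightarrow> real^'n \<Rightarrow> real^'n^'n \<Rightarrow> real" where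
  "Res k \<rho> \<nu> H \<phi> p M = sigma k ((real CARD('n) - 1) *\<^sub>R mat 1 + Emat \<rho> \<nu> H p M)
     - Qzero CARD('n) k * exp (2 * real k * \<phi>)"

text \<open>Every term of \<open>Emat\<close> carries a factor \<rho> once p and \<rho> M are
  bounded. The explicit constant adds up the terms one by one.\<close>

lemma Emat_bound:
  assumes \<rho>: "0 < \<rho>" "\<rho> \<le> 1" and \<nu>: "norm \<nu> = 1" and H: "norm H \<le> KH" and K: "0 \<le> K"
    and p: "norm p \<le> K" and M: "\<rho> * norm M \<le> K"
  shows "norm (Emat \<rho> \<nu> H p (M :: real^'n::finite^'n)) \<le>
     ((real CARD('n) + 2) * (K + KH + (K\<^sup>2 + 2 * K) * norm (mat 1 :: real^'n^'n) + 2 * K + K\<^sup>2)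
       + real CARD('n) * (K + KH) * norm (mat 1 :: real^'n^'n)) * \<rho>"
proof -
  let ?I = "mat 1 :: real^'n^'n" let ?n = "real CARD('n)"
  have KH: "KH \<ge> 0" using H norm_ge_zero[of H] by linarith
  have 1: "norm (\<rho>\<^sup>2 *\<^sub>R M) \<le> K * \<rho>" using mult_left_mono[OF M, of \<rho>] \<rho> by (simp add: power2_eq_square mult_ac)
  have 2: "norm (\<rho> *\<^sub>R H) \<le> KH * \<rho>" using mult_left_mono[OF H, of \<rho>] \<rho> by (simp add: mult_ac)
  have pp: "p \<bullet> p \<le> K\<^sup>2" using p by (simp add: dot_square_norm power_mono)
  have \<nu>p: "\<bar>\<nu> \<bullet> p\<bar> \<le> K" using Cauchy_Schwarz_ineq2[of \<nu> p] \<nu> p by simp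
  have r2: "\<rho>\<^sup>2 \<le> \<rho>" using \<rho> by (simp add: power2_eq_square mult_left_le)
  have "\<bar>\<rho>\<^sup>2 * (p \<bullet> p) - 2 * \<rho> * (\<nu> \<bullet> p)\<bar> \<le> \<rho>\<^sup>2 * (p \<bullet> p) + 2 * \<rho> * \<bar>\<nu> \<bullet> p\<bar>"
    by (rule order_trans[OF abs_triangle_ineq4]) (use \<rho> in \<open>simp add: abs_mult\<close>)
  also have "\<dots> \<le> \<rho> * K\<^sup>2 + 2 * \<rho> * K" using pp \<nu>p r2 \<rho> by (intro add_mono mult_mono) auto
  finally have "norm ((\<rho>\<^sup>2 * (p \<bullet> p) - 2 * \<rho> * (\<nu> \<bullet> p)) *\<^sub>R ?I) \<le> (\<rho> * K\<^sup>2 + 2 * \<rho> * K) * norm ?I"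
    by (simp only: norm_scaleR) (intro mult_right_mono, auto)
  then have 3: "norm ((\<rho>\<^sup>2 * (p \<bullet> p) - 2 * \<rho> * (\<nu> \<bullet> p)) *\<^sub>R ?I) \<le> (K\<^sup>2 + 2 * K) * norm ?I * \<rho>"
    by (simp add: algebra_simps)
  have "norm (outer \<nu> p + outer p \<nu>) \<le> 2 * K"
    using norm_triangle_ineq[of "outer \<nu> p" "outer p \<nu>"] \<nu> p by (simp add: norm_outer)
  then have 4: "norm (\<rho> *\<^sub>R (outer \<nu> p + outer p \<nu>)) \<le> 2 * K * \<rho>" using mult_left_mono[of _ "2 * K" \<rho>] \<rho> by (simp add: mult_ac)
  have "norm (outer p p) \<le> K\<^sup>2" using pp by (simp add: norm_outer dot_square_norm power2_eq_square)
  then have 5: "norm (\<rho>\<^sup>2 *\<^sub>R outer p p) \<le> K\<^sup>2 * \<rho>" using mult_mono[OF r2, of _ "K\<^sup>2"] \<rho> by (simp add: mult_ac)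
  have "\<bar>trace M\<bar> * \<rho>\<^sup>2 \<le> ?n * norm M * \<rho>\<^sup>2" by (rule mult_right_mono[OF abs_trace_le]) simp
  also have "\<dots> = ?n * norm (\<rho>\<^sup>2 *\<^sub>R M)" by simp
  also have "\<dots> \<le> ?n * (K * \<rho>)" by (rule mult_left_mono[OF 1]) simp
  finally have "\<bar>trace M\<bar> * \<rho>\<^sup>2 \<le> ?n * (K * \<rho>)" .
  moreover have "\<bar>trace H\<bar> * \<rho> \<le> ?n * (KH * \<rho>)"
  proof -
    have "\<bar>trace H\<bar> * \<rho> \<le> ?n * norm H * \<rho>" by (rule mult_right_mono[OF abs_trace_le]) (use \<rho> in simp)
    also have "\<dots> = ?n * norm (\<rho> *\<^sub>R H)" using \<rho> by simp
    also have "\<dots> \<le> ?n * (KH * \<rho>)" by (rule mult_left_mono[OF 2]) simp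
    finally show ?thesis .
  qed
  moreover have "\<bar>\<rho>\<^sup>2 * trace M - \<rho> * trace H\<bar> \<le> \<bar>trace M\<bar> * \<rho>\<^sup>2 + \<bar>trace H\<bar> * \<rho>"
    by (rule order_trans[OF abs_triangle_ineq4]) (use \<rho> in \<open>simp add: abs_mult\<close>)
  ultimately have "\<bar>\<rho>\<^sup>2 * trace M - \<rho> * trace H\<bar> \<le> ?n * (K + KH) * \<rho>" by (simp add: algebra_simps)
  then have 6: "norm ((\<rho>\<^sup>2 * trace M - \<rho> * trace H) *\<^sub>R ?I) \<le> ?n * (K + KH) * norm ?I * \<rho>"
  proof -
    assume "\<bar>\<rho>\<^sup>2 * trace M - \<rho> * trace H\<bar> \<le> ?n * (K + KH) * \<rho>"
    then have "\<bar>\<rho>\<^sup>2 * trace M - \<rho> * trace H\<bar> * norm ?I \<le> ?n * (K + KH) * \<rho> * norm ?I" by (rule mult_right_mono) simp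
    then show ?thesis by (simp only: norm_scaleR real_norm_def) (simp only: mult_ac)
  qed
  let ?B = "\<rho>\<^sup>2 *\<^sub>R M - \<rho> *\<^sub>R H + (\<rho>\<^sup>2 * (p \<bullet> p) - 2 * \<rho> * (\<nu> \<bullet> p)) *\<^sub>R ?I
       + \<rho> *\<^sub>R (outer \<nu> p + outer p \<nu>) - \<rho>\<^sup>2 *\<^sub>R outer p p"
  have "norm ?B \<le> K * \<rho> + KH * \<rho> + (K\<^sup>2 + 2 * K) * norm ?I * \<rho> + 2 * K * \<rho> + K\<^sup>2 * \<rho>"
    by (intro order_trans[OF norm_triangle_ineq4] order_trans[OF norm_triangle_ineq] add_mono 1 2 3 4 5)
  then have 7: "norm ?B \<le> (K + KH + (K\<^sup>2 + 2 * K) * norm ?I + 2 * K + K\<^sup>2) * \<rho>" by (simp add: algebra_simps)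
  have "norm ((?n - 2) *\<^sub>R ?B) = \<bar>?n - 2\<bar> * norm ?B" by (rule norm_scaleR)
  also have "\<dots> \<le> (?n + 2) * ((K + KH + (K\<^sup>2 + 2 * K) * norm ?I + 2 * K + K\<^sup>2) * \<rho>)"
    by (intro mult_mono 7) auto
  finally have 8: "norm ((?n - 2) *\<^sub>R ?B) \<le> (?n + 2) * ((K + KH + (K\<^sup>2 + 2 * K) * norm ?I + 2 * K + K\<^sup>2) * \<rho>)" .
  show ?thesis unfolding Emat_def
    by (rule order_trans[OF norm_triangle_ineq order_trans[OF add_mono[OF 8 6] eq_refl]]) (simp add: algebra_simps)
qed

lemma Emat_diff:
  fixes p q \<nu> :: "real^'n::finite"
  shows "Emat \<rho> \<nu> H (p + q) (M + m) - Emat \<rho> \<nu> H p M =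
    (real CARD('n) - 2) *\<^sub>R (\<rho>\<^sup>2 *\<^sub>R m + (\<rho>\<^sup>2 * (2 * (p \<bullet> q) + q \<bullet> q) - 2 * \<rho> * (\<nu> \<bullet> q)) *\<^sub>R mat 1
       + \<rho> *\<^sub>R (outer \<nu> q + outer q \<nu>) - \<rho>\<^sup>2 *\<^sub>R (outer p q + outer q p + outer q q))
     + (\<rho>\<^sup>2 * trace m) *\<^sub>R mat 1"
proof -
  have o: "outer (a + b) c = outer a c + outer b c" "outer c (a + b) = outer c a + outer c b" for a b c :: "real^'n"
    by (simp_all add: outer_def vec_eq_iff algebra_simps)
  show ?thesis
    unfolding Emat_def by (simp add: o trace_add inner_add_left inner_add_right inner_commute algebra_simps)
qed

text \<open>The perturbation is measured by the scaled jet (\<eta>, \<rho> q, \<rho>^2 m), of size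
  at most \<sigma>. The background matrix is O(\<rho>) and \<sigma> is O(\<rho>), so all nonlinear
  effects are O(\<rho> \<sigma>), one order below the linear part.\<close>

lemma Res_perturb:
  assumes n: "2 \<le> CARD('n::finite)" and k: "1 \<le> k" "k \<le> CARD('n)" and K: "0 \<le> K" and KH: "0 \<le> KH"
  shows "\<exists>C\<ge>0. \<forall>\<rho> \<nu> (H :: real^'n^'n) \<phi> p M \<eta> q m \<sigma>. 0 < \<rho> \<longrightarrow> \<rho> \<le> 1 \<longrightarrow> norm \<nu> = 1 \<longrightarrow> norm H \<le> KH \<longrightarrow>
     transpose H = H \<longrightarrow> transpose M = M \<longrightarrow> transpose m = m \<longrightarrow>
     \<bar>\<phi>\<bar> \<le> K * \<rho> \<longrightarrow> norm p \<le> K \<longrightarrow> \<rho> * norm M \<le> K \<longrightarrow>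
     \<bar>\<eta>\<bar> \<le> \<sigma> \<longrightarrow> \<rho> * norm q \<le> \<sigma> \<longrightarrow> \<rho>\<^sup>2 * norm m \<le> \<sigma> \<longrightarrow> \<sigma> \<le> K * \<rho> \<longrightarrow>
     \<bar>Res k \<rho> \<nu> H (\<phi> + \<eta>) (p + q) (M + m) - Res k \<rho> \<nu> H \<phi> p M
       - kap CARD('n) k * (\<rho>\<^sup>2 * trace m - (real CARD('n) - 2) * (\<rho> * (\<nu> \<bullet> q)) - real CARD('n) * \<eta>)\<bar> \<le> C * \<rho> * \<sigma>"
proof -
  let ?I = "mat 1 :: real^'n^'n" let ?n = "real CARD('n)"
  define c where "c = ?n - 2"
  have c: "c \<ge> 0" "c \<le> ?n" using n by (auto simp: c_def)
  define C1 where "C1 = (?n + 2) * (K + KH + (K\<^sup>2 + 2 * K) * norm ?I + 2 * K + K\<^sup>2) + ?n * (K + KH) * norm ?I"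
  define C2 where "C2 = ?n * (1 + (3 * K + 2) * norm ?I + 2 + 3 * K) + ?n * norm ?I"
  have C12: "C1 \<ge> 0" "C2 \<ge> 0" using K KH by (auto simp: C1_def C2_def)
  define \<kappa>' where "\<kappa>' = real (CARD('n) - 1 choose (CARD('n) - k)) * (?n - 1) ^ (k - 1)"
  have \<kappa>': "kap CARD('n) k = 2 * (?n - 1) * \<kappa>'"
    using power_eq_if[of "?n - 1" k] k by (simp add: kap_def \<kappa>'_def)
  obtain K3 where K3: "K3 \<ge> 0" "\<And>E D :: real^'n^'n. transpose E = E \<Longrightarrow> transpose D = D \<Longrightarrow> norm E \<le> max C1 (C2 * K) \<Longrightarrow> norm D \<le> max C1 (C2 * K) \<Longrightarrow>
     \<bar>sigma k ((?n - 1) *\<^sub>R ?I + E + D) - sigma k ((?n - 1) *\<^sub>R ?I + E) - \<kappa>' * trace D\<bar> \<le> K3 * (norm E + norm D) * norm D"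
    using sigma_perturb[OF k, of "max C1 (C2 * K)" "?n - 1"] unfolding \<kappa>'_def by blast
  obtain C4 where C4: "C4 \<ge> 0" "\<And>\<rho> \<phi> \<eta> \<sigma>. 0 < \<rho> \<Longrightarrow> \<rho> \<le> 1 \<Longrightarrow> \<bar>\<phi>\<bar> \<le> K * \<rho> \<Longrightarrow> \<bar>\<eta>\<bar> \<le> \<sigma> \<Longrightarrow> \<sigma> \<le> K * \<rho> \<Longrightarrow>
    \<bar>exp (2 * real k * (\<phi> + \<eta>)) - exp (2 * real k * \<phi>) - 2 * real k * \<eta>\<bar> \<le> C4 * \<rho> * \<sigma>"
    using exp_perturb[of "2 * real k", OF _ K] by auto
  define C where "C = K3 * (C1 + C2 * K) * C2 + \<bar>\<kappa>'\<bar> * (?n * ?n * (3 * K)) + \<bar>Qzero CARD('n) k\<bar> * C4"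
  show ?thesis
  proof (intro exI[of _ C] conjI allI impI)
    show "C \<ge> 0" using K3 C12 K C4 by (auto simp: C_def)
    fix \<rho> \<phi> \<eta> \<sigma> :: real and \<nu> p q :: "real^'n" and H M m :: "real^'n^'n"
    assume \<rho>: "0 < \<rho>" "\<rho> \<le> 1" and \<nu>: "norm \<nu> = 1" and H: "norm H \<le> KH"
      and tr: "transpose H = H" "transpose M = M" "transpose m = m"
      and \<phi>: "\<bar>\<phi>\<bar> \<le> K * \<rho>" and p: "norm p \<le> K" and M: "\<rho> * norm M \<le> K"
      and \<eta>: "\<bar>\<eta>\<bar> \<le> \<sigma>" and q: "\<rho> * norm q \<le> \<sigma>" and m: "\<rho>\<^sup>2 * norm m \<le> \<sigma>" and \<sigma>: "\<sigma> \<le> K * \<rho>"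
    have \<sigma>0: "\<sigma> \<ge> 0" using \<eta> by linarith
    have \<rho>\<sigma>: "\<rho> * \<sigma> \<le> \<sigma>" using \<rho> \<sigma>0 by (simp add: mult_left_le_one_le)
    define E where "E = Emat \<rho> \<nu> H p M"
    define D where "D = Emat \<rho> \<nu> H (p + q) (M + m) - E"
    define \<beta> where "\<beta> = \<rho>\<^sup>2 * (2 * (p \<bullet> q) + q \<bullet> q)"
    have tM: "transpose (M + m) = M + m" using tr by (simp add: transpose_add)
    have tE: "transpose E = E" unfolding E_def using tr by (intro transpose_Emat)
    have tD: "transpose D = D"
    proof -
      have "transpose (E + D) = E + D" unfolding D_def using transpose_Emat[OF tr(1) tM] by simp
      then show ?thesis using tE by (simp add: transpose_add)
    qed
    have E: "norm E \<le> C1 * \<rho>" unfolding E_def C1_def by (rule Emat_bound[OF \<rho> \<nu> H K p M])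
    have q2: "(\<rho> * norm q) * (\<rho> * norm q) \<le> \<sigma> * (K * \<rho>)" by (rule mult_mono[OF q order_trans[OF q \<sigma>] \<sigma>0]) (use \<rho> in auto)
    have pq: "\<rho>\<^sup>2 * (norm p * norm q) \<le> K * (\<rho> * \<sigma>)"
    proof -
      have "\<rho> * (norm p * (\<rho> * norm q)) \<le> \<rho> * (K * \<sigma>)" using \<rho> p q K by (intro mult_left_mono mult_mono) auto
      then show ?thesis by (simp add: power2_eq_square mult_ac)
    qed
    have \<beta>: "\<bar>\<beta>\<bar> \<le> 3 * K * (\<rho> * \<sigma>)"
    proof -
      have "\<bar>\<beta>\<bar> \<le> 2 * (\<rho>\<^sup>2 * \<bar>p \<bullet> q\<bar>) + \<rho>\<^sup>2 * (q \<bullet> q)"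
        unfolding \<beta>_def distrib_left by (rule order_trans[OF abs_triangle_ineq]) (simp add: abs_mult)
      also have "\<rho>\<^sup>2 * \<bar>p \<bullet> q\<bar> \<le> \<rho>\<^sup>2 * (norm p * norm q)" by (intro mult_left_mono Cauchy_Schwarz_ineq2) auto
      also note pq
      also have "\<rho>\<^sup>2 * (q \<bullet> q) \<le> K * (\<rho> * \<sigma>)" using q2 by (simp add: dot_square_norm power2_eq_square mult_ac)
      finally show ?thesis by simp
    qed
    have \<nu>q: "\<bar>\<rho> * (\<nu> \<bullet> q)\<bar> \<le> \<sigma>"
    proof -
      have "\<bar>\<rho> * (\<nu> \<bullet> q)\<bar> = \<rho> * \<bar>\<nu> \<bullet> q\<bar>" using \<rho> by (simp add: abs_mult)
      also have "\<dots> \<le> \<rho> * norm q" using Cauchy_Schwarz_ineq2[of \<nu> q] \<nu> \<rho> by (intro mult_left_mono) auto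
      finally show ?thesis using q by simp
    qed
    let ?B = "\<rho>\<^sup>2 *\<^sub>R m + (\<beta> - 2 * \<rho> * (\<nu> \<bullet> q)) *\<^sub>R ?I + \<rho> *\<^sub>R (outer \<nu> q + outer q \<nu>) - \<rho>\<^sup>2 *\<^sub>R (outer p q + outer q p + outer q q)"
    have Deq: "D = c *\<^sub>R ?B + (\<rho>\<^sup>2 * trace m) *\<^sub>R ?I"
      unfolding D_def E_def c_def \<beta>_def by (rule Emat_diff)
    have D: "norm D \<le> C2 * \<sigma>"
    proof -
      have 1: "norm (\<rho>\<^sup>2 *\<^sub>R m) \<le> \<sigma>" using m by simp
      have "\<bar>\<beta> - 2 * \<rho> * (\<nu> \<bullet> q)\<bar> \<le> 3 * K * \<sigma> + 2 * \<sigma>" using \<beta> \<nu>q mult_left_mono[OF \<rho>\<sigma>, of "3 * K"] K by (simp add: abs_le_iff)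
      then have 2: "norm ((\<beta> - 2 * \<rho> * (\<nu> \<bullet> q)) *\<^sub>R ?I) \<le> (3 * K + 2) * norm ?I * \<sigma>"
      proof -
        assume "\<bar>\<beta> - 2 * \<rho> * (\<nu> \<bullet> q)\<bar> \<le> 3 * K * \<sigma> + 2 * \<sigma>"
        then have "\<bar>\<beta> - 2 * \<rho> * (\<nu> \<bullet> q)\<bar> * norm ?I \<le> (3 * K * \<sigma> + 2 * \<sigma>) * norm ?I" by (rule mult_right_mono) simp
        also have "\<dots> = (3 * K + 2) * norm ?I * \<sigma>" by (simp add: algebra_simps)
        finally show ?thesis by (simp only: norm_scaleR real_norm_def)
      qed
      have "norm (outer \<nu> q + outer q \<nu>) \<le> 2 * norm q"
        using norm_triangle_ineq[of "outer \<nu> q" "outer q \<nu>"] \<nu> by (simp add: norm_outer)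
      then have "\<rho> * norm (outer \<nu> q + outer q \<nu>) \<le> \<rho> * (2 * norm q)" using \<rho> by (intro mult_left_mono) auto
      moreover have "norm (\<rho> *\<^sub>R (outer \<nu> q + outer q \<nu>)) = \<rho> * norm (outer \<nu> q + outer q \<nu>)" using \<rho> by simp
      ultimately have 3: "norm (\<rho> *\<^sub>R (outer \<nu> q + outer q \<nu>)) \<le> 2 * \<sigma>" using q by linarith
      have "norm (outer p q + outer q p + outer q q) \<le> 2 * (norm p * norm q) + norm q * norm q"
        by (rule order_trans[OF norm_triangle_ineq], rule order_trans[OF add_right_mono[OF norm_triangle_ineq]]) (simp add: norm_outer)
      then have "\<rho>\<^sup>2 * norm (outer p q + outer q p + outer q q) \<le> 2 * (\<rho>\<^sup>2 * (norm p * norm q)) + (\<rho> * norm q) * (\<rho> * norm q)"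
        using mult_left_mono[of _ _ "\<rho>\<^sup>2"] by (fastforce simp: power2_eq_square algebra_simps)
      also have "\<dots> \<le> 3 * K * \<sigma>" using pq q2 mult_left_mono[OF \<rho>\<sigma> K] by (simp add: mult_ac)
      finally have 4: "norm (\<rho>\<^sup>2 *\<^sub>R (outer p q + outer q p + outer q q)) \<le> 3 * K * \<sigma>" by simp
      have "norm ?B \<le> \<sigma> + (3 * K + 2) * norm ?I * \<sigma> + 2 * \<sigma> + 3 * K * \<sigma>"
        by (intro order_trans[OF norm_triangle_ineq4] order_trans[OF norm_triangle_ineq] add_mono 1 2 3 4)
      then have "norm (c *\<^sub>R ?B) \<le> ?n * ((1 + (3 * K + 2) * norm ?I + 2 + 3 * K) * \<sigma>)"
        unfolding norm_scaleR using c by (intro mult_mono) (auto simp: algebra_simps)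
      moreover have "norm ((\<rho>\<^sup>2 * trace m) *\<^sub>R ?I) \<le> ?n * norm ?I * \<sigma>"
      proof -
        have "\<bar>trace m\<bar> * \<rho>\<^sup>2 \<le> ?n * norm m * \<rho>\<^sup>2" by (rule mult_right_mono[OF abs_trace_le]) simp
        also have "\<dots> \<le> ?n * \<sigma>" using mult_left_mono[OF m, of ?n] by (simp add: mult_ac)
        finally have "\<bar>trace m\<bar> * \<rho>\<^sup>2 * norm ?I \<le> ?n * \<sigma> * norm ?I" by (rule mult_right_mono) simp
        then show ?thesis by (simp add: abs_mult mult_ac)
      qed
      ultimately show ?thesis unfolding Deq C2_def using norm_triangle_ineq[of "c *\<^sub>R ?B" "(\<rho>\<^sup>2 * trace m) *\<^sub>R ?I"]
        by (simp add: algebra_simps)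
    qed
    \<comment> \<open>Taking the trace produces the linear operator with factor 2 (n - 1); \<beta>
      collects what is quadratic in gradients and is already O(\<rho> \<sigma>).\<close>
    have trD: "trace D = 2 * (?n - 1) * (\<rho>\<^sup>2 * trace m - c * (\<rho> * (\<nu> \<bullet> q))) + c * (?n - 1) * \<beta>"
      unfolding Deq by (simp add: trace_add trace_sub inner_commute \<beta>_def c_def algebra_simps)
    have "norm D \<le> C2 * K"
    proof -
      have "\<sigma> \<le> K" using \<sigma> mult_left_mono[OF \<rho>(2) K] by simp
      then show ?thesis using D mult_left_mono[of \<sigma> K C2] C12 by linarith
    qed
    moreover have "norm E \<le> C1" using E mult_left_mono[OF \<rho>(2) C12(1)] by simp
    ultimately have s1: "\<bar>sigma k ((?n - 1) *\<^sub>R ?I + E + D) - sigma k ((?n - 1) *\<^sub>R ?I + E) - \<kappa>' * trace D\<bar> \<le> K3 * (norm E + norm D) * norm D"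
      using tE tD by (intro K3(2)) auto
    also have "\<dots> \<le> K3 * (C1 * \<rho> + C2 * (K * \<rho>)) * (C2 * \<sigma>)"
      using E D K3(1) C12 \<sigma>0 \<rho> K mult_left_mono[OF \<sigma> C12(2)] by (intro mult_mono add_mono mult_left_mono) auto
    finally have s1: "\<bar>sigma k ((?n - 1) *\<^sub>R ?I + E + D) - sigma k ((?n - 1) *\<^sub>R ?I + E) - \<kappa>' * trace D\<bar> \<le> K3 * (C1 + C2 * K) * C2 * (\<rho> * \<sigma>)"
      by (simp add: algebra_simps)
    have s2: "\<bar>exp (2 * real k * (\<phi> + \<eta>)) - exp (2 * real k * \<phi>) - 2 * real k * \<eta>\<bar> \<le> C4 * (\<rho> * \<sigma>)"
      using C4(2)[OF \<rho> \<phi> \<eta> \<sigma>] by (simp add: mult.assoc)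
    have s3: "\<bar>c * (?n - 1) * \<beta>\<bar> \<le> ?n * ?n * (3 * K) * (\<rho> * \<sigma>)"
    proof -
      have "\<bar>c * (?n - 1)\<bar> \<le> ?n * ?n" unfolding abs_mult using c by (intro mult_mono) auto
      then have "\<bar>c * (?n - 1)\<bar> * \<bar>\<beta>\<bar> \<le> ?n * ?n * (3 * K * (\<rho> * \<sigma>))" using \<beta> by (intro mult_mono) auto
      then show ?thesis by (simp add: abs_mult mult.assoc)
    qed
    have ED: "Emat \<rho> \<nu> H (p + q) (M + m) = E + D" by (simp add: D_def)
    have kQ: "kap CARD('n) k * (?n * \<eta>) = Qzero CARD('n) k * (2 * real k * \<eta>)" using kap_Qzero[OF k] by (simp add: mult_ac)
    have "Res k \<rho> \<nu> H (\<phi> + \<eta>) (p + q) (M + m) - Res k \<rho> \<nu> H \<phi> p M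
       - kap CARD('n) k * (\<rho>\<^sup>2 * trace m - (?n - 2) * (\<rho> * (\<nu> \<bullet> q)) - ?n * \<eta>)
      = (sigma k ((?n - 1) *\<^sub>R ?I + E + D) - sigma k ((?n - 1) *\<^sub>R ?I + E) - \<kappa>' * trace D) + \<kappa>' * (c * (?n - 1) * \<beta>)
       - Qzero CARD('n) k * (exp (2 * real k * (\<phi> + \<eta>)) - exp (2 * real k * \<phi>) - 2 * real k * \<eta>)"
    proof -
      define Y where "Y = \<rho>\<^sup>2 * trace m - c * (\<rho> * (\<nu> \<bullet> q))"
      have A: "kap CARD('n) k * (Y - ?n * \<eta>) = 2 * (?n - 1) * \<kappa>' * Y - Qzero CARD('n) k * (2 * real k * \<eta>)"
        unfolding right_diff_distrib[of "kap CARD('n) k"] kQ by (simp only: \<kappa>')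
      have B: "\<kappa>' * trace D = 2 * (?n - 1) * \<kappa>' * Y + \<kappa>' * (c * (?n - 1) * \<beta>)"
        unfolding trD Y_def[symmetric] by (simp add: distrib_left)
      have C: "Qzero CARD('n) k * (x - y - z) = Qzero CARD('n) k * x - Qzero CARD('n) k * y - Qzero CARD('n) k * z" for x y z
        by (simp only: right_diff_distrib)
      show ?thesis unfolding Res_def ED E_def[symmetric] c_def[symmetric] Y_def[symmetric] A B C add.assoc[of "(?n - 1) *\<^sub>R ?I" E D]
        by linarith
    qed
    also have "\<bar>\<dots>\<bar> \<le> K3 * (C1 + C2 * K) * C2 * (\<rho> * \<sigma>) + \<bar>\<kappa>'\<bar> * (?n * ?n * (3 * K) * (\<rho> * \<sigma>)) + \<bar>Qzero CARD('n) k\<bar> * (C4 * (\<rho> * \<sigma>))"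
      by (intro order_trans[OF abs_triangle_ineq4] order_trans[OF abs_triangle_ineq] add_mono s1)
         (simp_all only: abs_mult[of \<kappa>'] abs_mult[of "Qzero _ _"], intro mult_left_mono s3, simp, intro mult_left_mono s2, simp)
    also have "\<dots> = C * \<rho> * \<sigma>" by (simp add: C_def algebra_simps)
    finally show "\<bar>Res k \<rho> \<nu> H (\<phi> + \<eta>) (p + q) (M + m) - Res k \<rho> \<nu> H \<phi> p M
       - kap CARD('n) k * (\<rho>\<^sup>2 * trace m - (?n - 2) * (\<rho> * (\<nu> \<bullet> q)) - ?n * \<eta>)\<bar> \<le> C * \<rho> * \<sigma>" .
  qed
qed

text \<open>The start of the expansion: for \<phi> = 0 the matrix is (n - 1) I + O(\<rho>), and
  \<open>Qzero\<close> cancels the value at (n - 1) I.\<close>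

lemma Res_zero:
  assumes n: "2 \<le> CARD('n::finite)" and k: "1 \<le> k" "k \<le> CARD('n)" and KH: "0 \<le> KH"
  shows "\<exists>C\<ge>0. \<forall>\<rho> \<nu> (H :: real^'n^'n). 0 < \<rho> \<longrightarrow> \<rho> \<le> 1 \<longrightarrow> norm \<nu> = 1 \<longrightarrow> norm H \<le> KH \<longrightarrow>
     transpose H = H \<longrightarrow> \<bar>Res k \<rho> \<nu> H 0 0 0\<bar> \<le> C * \<rho>"
proof -
  let ?I = "mat 1 :: real^'n^'n" let ?n = "real CARD('n)"
  define C1 where "C1 = (?n + 2) * (0 + KH + (0\<^sup>2 + 2 * 0) * norm ?I + 2 * 0 + 0\<^sup>2) + ?n * (0 + KH) * norm ?I"
  have C1: "C1 \<ge> 0" using KH by (simp add: C1_def)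
  define \<kappa>' where "\<kappa>' = real (CARD('n) - 1 choose (CARD('n) - k)) * (?n - 1) ^ (k - 1)"
  obtain K3 where K3: "K3 \<ge> 0" "\<And>E D :: real^'n^'n. transpose E = E \<Longrightarrow> transpose D = D \<Longrightarrow> norm E \<le> C1 \<Longrightarrow> norm D \<le> C1 \<Longrightarrow>
     \<bar>sigma k ((?n - 1) *\<^sub>R ?I + E + D) - sigma k ((?n - 1) *\<^sub>R ?I + E) - \<kappa>' * trace D\<bar> \<le> K3 * (norm E + norm D) * norm D"
    using sigma_perturb[OF k, of C1 "?n - 1"] unfolding \<kappa>'_def by blast
  have t0: "transpose (0 :: real^'n^'n) = 0" by (simp add: vec_eq_iff transpose_def)
  show ?thesis
  proof (intro exI[of _ "(K3 * C1 + \<bar>\<kappa>'\<bar> * ?n) * C1"] conjI allI impI)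
    show "0 \<le> (K3 * C1 + \<bar>\<kappa>'\<bar> * ?n) * C1" using K3 C1 by auto
    fix \<rho> :: real and \<nu> :: "real^'n" and H :: "real^'n^'n"
    assume \<rho>: "0 < \<rho>" "\<rho> \<le> 1" and \<nu>: "norm \<nu> = 1" and H: "norm H \<le> KH" "transpose H = H"
    define E where "E = Emat \<rho> \<nu> H 0 0"
    have E: "norm E \<le> C1 * \<rho>" unfolding E_def C1_def by (rule Emat_bound[OF \<rho> \<nu> H(1)]) auto
    have E1: "norm E \<le> C1" using E mult_left_mono[OF \<rho>(2) C1] by simp
    have tE: "transpose E = E" unfolding E_def by (rule transpose_Emat[OF H(2) t0])
    have "\<bar>sigma k ((?n - 1) *\<^sub>R ?I + E) - sigma k ((?n - 1) *\<^sub>R ?I) - \<kappa>' * trace E\<bar> \<le> K3 * norm E * norm E"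
      using K3(2)[OF t0 tE _ E1] C1 by simp
    moreover have "sigma k ((?n - 1) *\<^sub>R ?I) = Qzero CARD('n) k" using k by (simp add: sigma_scalar Qzero_def mult.commute)
    ultimately have "\<bar>Res k \<rho> \<nu> H 0 0 0\<bar> \<le> K3 * norm E * norm E + \<bar>\<kappa>' * trace E\<bar>"
      unfolding Res_def E_def[symmetric] by simp
    also have "\<bar>\<kappa>' * trace E\<bar> \<le> \<bar>\<kappa>'\<bar> * (?n * norm E)" unfolding abs_mult by (intro mult_left_mono abs_trace_le) auto
    also have "K3 * norm E * norm E + \<bar>\<kappa>'\<bar> * (?n * norm E) \<le> K3 * C1 * norm E + \<bar>\<kappa>'\<bar> * (?n * norm E)"
      using E1 K3(1) C1 by (intro add_mono mult_mono mult_left_mono) auto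
    also have "\<dots> = (K3 * C1 + \<bar>\<kappa>'\<bar> * ?n) * norm E" by (simp add: algebra_simps)
    also have "\<dots> \<le> (K3 * C1 + \<bar>\<kappa>'\<bar> * ?n) * (C1 * \<rho>)" using E K3 C1 by (intro mult_left_mono) auto
    finally show "\<bar>Res k \<rho> \<nu> H 0 0 0\<bar> \<le> (K3 * C1 + \<bar>\<kappa>'\<bar> * ?n) * C1 * \<rho>" by (simp add: mult_ac)
  qed
qed

subsection \<open>Residuals and formal expansion\<close>

locale smooth_collar = touching_domain \<Omega> r N for \<Omega> :: "(real^'n::finite) set" and r N +
  fixes q :: real and k :: nat
  assumes q0: "0 < q" and qr: "q \<le> r / 2" and smooth_s: "smooth_on_open s {x. \<bar>s x\<bar> < q}" and bounded: "bounded \<Omega>"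
    and n3: "3 \<le> CARD('n)" and k1: "1 \<le> k" and kn: "k \<le> CARD('n)"
begin

text \<open>\<open>W\<close> is a two-sided collar where \<open>s\<close> is smooth and
  \<open>S\<close> its inner half, where log s makes sense. \<open>Tc\<close> is compact in
  \<open>W\<close> and provides uniform bounds; estimates are stated on \<open>T\<close>.\<close>

definition "W = {x. \<bar>s x\<bar> < q}"
definition "S = {x. 0 < s x \<and> s x < q}"
definition "q1 = min (q / 2) (1 / 4)"
definition "T = {x. 0 < s x \<and> s x \<le> q1}"
definition "Tc = {x. \<bar>s x\<bar> \<le> q1}"

definition R :: "(real^'n \<Rightarrow> real) \<Rightarrow> real^'n \<Rightarrow> real" where
  "R \<phi> x = Res k (s x) (grad s x) (hess s x) (\<phi> x) (grad \<phi> x) (hess \<phi> x)"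

lemma q1: "0 < q1" "q1 < q" "q1 \<le> 1 / 4" "q1 \<le> r / 2" using q0 qr by (auto simp: q1_def)

lemma sW: "smooth_on_open s W" using smooth_s by (simp add: W_def)

lemma open_W: "open W" unfolding W_def by (rule open_collar)

lemma open_S: "open S"
  unfolding S_def by (intro open_Collect_conj open_Collect_less continuous_intros continuous_s)

lemma subs: "S \<subseteq> W" "T \<subseteq> S" "T \<subseteq> Tc" "Tc \<subseteq> W" "T \<subseteq> W"
  using q1 by (auto simp: S_def W_def T_def Tc_def)

lemma compact_Tc: "compact Tc"
proof -
  have "closed Tc" unfolding Tc_def by (intro closed_Collect_le continuous_intros continuous_s)
  moreover have "bounded F" using bounded bounded_closure frontier_def bounded_subset Diff_subset by metis
  then obtain B where B: "\<And>y. y \<in> F \<Longrightarrow> norm y \<le> B" unfolding bounded_iff by blast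
  have "norm x \<le> B + q1" if "x \<in> Tc" for x
  proof -
    obtain y where y: "y \<in> F" "dist x y = \<bar>s x\<bar>" by (rule nearest)
    then have "norm (x - y) \<le> q1" using that by (simp add: Tc_def dist_norm)
    then show ?thesis using norm_triangle_ineq[of "x - y" y] B[OF y(1)] by simp
  qed
  then have "bounded Tc" unfolding bounded_iff by blast
  ultimately show ?thesis by (simp add: compact_eq_bounded_closed)
qed

lemma W_half: "x \<in> W \<Longrightarrow> \<bar>s x\<bar> \<le> r / 2" using qr by (auto simp: W_def)

lemma norm_grad_W: "x \<in> W \<Longrightarrow> norm (grad s x) = 1" using norm_grad_s W_half by blast

lemma F_W: "F \<subseteq> W" using s_F q0 by (auto simp: W_def)

lemma proj_F: "x \<in> W \<Longrightarrow> proj x \<in> F" using proj(1) W_half by blast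

lemma smooth_proj: "smooth_on_open (\<lambda>x. proj x $ i) W"
proof -
  have "smooth_on_open (\<lambda>x. x $ i - s x * grad s x $ i) W"
    by (intro smooth_diff smooth_mult smooth_nth smooth_grad sW open_W)
  then show ?thesis by (simp add: proj_def)
qed

lemma smooth_comp_proj: "smooth_on_open c W \<Longrightarrow> smooth_on_open (\<lambda>x. c (proj x)) W"
  by (rule smooth_compose[OF _ open_W smooth_proj]) (use proj_F F_W in auto)

lemma smooth_W_bound:
  fixes f :: "real^'n \<Rightarrow> real"
  assumes f: "smooth_on_open f W"
  obtains B where "B \<ge> 0" "\<And>x. x \<in> Tc \<Longrightarrow> \<bar>f x\<bar> \<le> B" "\<And>x. x \<in> Tc \<Longrightarrow> norm (grad f x) \<le> B" "\<And>x. x \<in> Tc \<Longrightarrow> norm (hess f x) \<le> B"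
proof -
  have "continuous_on W f" by (rule smooth_continuous[OF f])
  then obtain B1 where B1: "B1 \<ge> 0" "\<And>x. x \<in> Tc \<Longrightarrow> norm (f x) \<le> B1"
    using compact_bound[OF compact_Tc] continuous_on_subset subs(4) by metis
  have "continuous_on W (grad f)" by (simp add: continuous_on_nth_iff smooth_continuous smooth_grad f)
  then obtain B2 where B2: "B2 \<ge> 0" "\<And>x. x \<in> Tc \<Longrightarrow> norm (grad f x) \<le> B2"
    using compact_bound[OF compact_Tc] continuous_on_subset subs(4) by metis
  have "continuous_on W (hess f)" by (rule continuous_on_matrix) (intro smooth_continuous smooth_hess f)
  then obtain B3 where B3: "B3 \<ge> 0" "\<And>x. x \<in> Tc \<Longrightarrow> norm (hess f x) \<le> B3"
    using compact_bound[OF compact_Tc] continuous_on_subset subs(4) by metis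
  show ?thesis
    by (rule that[of "B1 + B2 + B3"]) (use B1 B2 B3 in \<open>auto intro: order_trans[OF B1(2)[unfolded real_norm_def]] order_trans[OF B2(2)] order_trans[OF B3(2)]\<close>)
qed

text \<open>Smoothness on all of \<open>W\<close>, across the frontier and not only inside, is what
  gives the residual a Taylor expansion at the frontier.\<close>

lemma smooth_R:
  assumes \<phi>: "smooth_on_open \<phi> W"
  shows "smooth_on_open (R \<phi>) W"
proof -
  have gg: "smooth_on_open (\<lambda>x. grad f x \<bullet> grad g x) W" if "smooth_on_open f W" "smooth_on_open g W" for f g :: "real^'n \<Rightarrow> real"
    using that by (intro smooth_inner open_W smooth_grad)
  have tr: "smooth_on_open (\<lambda>x. trace (hess f x)) W" if "smooth_on_open f W" for f :: "real^'n \<Rightarrow> real"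
    using smooth_laplacian[OF that] by (simp add: laplacian_def[abs_def])
  have E: "smooth_on_open (\<lambda>x. Emat (s x) (grad s x) (hess s x) (grad \<phi> x) (hess \<phi> x) $ i $ j) W" for i j
    unfolding Emat_def outer_def
    by (simp, intro smooth_add smooth_diff smooth_mult smooth_const smooth_power smooth_hess smooth_grad gg tr sW \<phi> open_W)
  have "smooth_on_open (\<lambda>x. sigma k ((real CARD('n) - 1) *\<^sub>R mat 1 + Emat (s x) (grad s x) (hess s x) (grad \<phi> x) (hess \<phi> x))) W"
  proof (rule smooth_sigma[OF open_W _ _ kn])
    show "smooth_on_open (\<lambda>x. ((real CARD('n) - 1) *\<^sub>R mat 1 + Emat (s x) (grad s x) (hess s x) (grad \<phi> x) (hess \<phi> x)) $ i $ j) W" for i j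
      by (simp, intro smooth_add smooth_const open_W E)
    show "transpose ((real CARD('n) - 1) *\<^sub>R mat 1 + Emat (s x) (grad s x) (hess s x) (grad \<phi> x) (hess \<phi> x)) =
        (real CARD('n) - 1) *\<^sub>R mat 1 + Emat (s x) (grad s x) (hess s x) (grad \<phi> x) (hess \<phi> x)" if "x \<in> W" for x
      using transpose_Emat[OF transpose_hess[OF sW that] transpose_hess[OF \<phi> that]]
      by (simp add: transpose_add transpose_scaleR)
  qed
  then have "smooth_on_open (\<lambda>x. sigma k ((real CARD('n) - 1) *\<^sub>R mat 1 + Emat (s x) (grad s x) (hess s x) (grad \<phi> x) (hess \<phi> x))
     - Qzero CARD('n) k * exp (2 * real k * \<phi> x)) W"
    by (intro smooth_diff smooth_mult smooth_const smooth_exp \<phi> open_W)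
  then show ?thesis by (simp add: R_def[abs_def] Res_def)
qed

text \<open>The weights are those under which \<open>Emat\<close> and the exponent are O(s); the
  Hessian may grow like 1 / s, which leaves room for barriers with large coefficients.\<close>

definition jet_bound :: "real \<Rightarrow> (real^'n \<Rightarrow> real) \<Rightarrow> real^'n \<Rightarrow> bool" where
  "jet_bound K \<phi> x \<longleftrightarrow> \<bar>\<phi> x\<bar> \<le> K * s x \<and> norm (grad \<phi> x) \<le> K \<and> s x * norm (hess \<phi> x) \<le> K"

text \<open>Effect on the residual of adding a term \<open>b g(s)\<close>: the radial operator
  \<open>g \<mapsto> t\<^sup>2 g'' - (n - 2) t g' - n g\<close> is the leading part, with indicial roots \<open>n\<close> and \<open>-1\<close>.\<close>
lemma residual_add:
  assumes b: "smooth_on_open b W" and K: "0 \<le> K"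
  shows "\<exists>C\<ge>0. \<forall>\<phi> g g1 g2 x \<sigma>. x \<in> T \<longrightarrow> smooth_on_open \<phi> S \<longrightarrow> jet_bound K \<phi> x \<longrightarrow>
     smooth_on_open (\<lambda>x. g (s x)) S \<longrightarrow> (\<forall>t. 0 < t \<longrightarrow> (g has_real_derivative g1 t) (at t)) \<longrightarrow>
     (\<forall>t. 0 < t \<longrightarrow> (g1 has_real_derivative g2 t) (at t)) \<longrightarrow>
     \<bar>g (s x)\<bar> \<le> \<sigma> \<longrightarrow> s x * \<bar>g1 (s x)\<bar> \<le> \<sigma> \<longrightarrow> (s x)\<^sup>2 * \<bar>g2 (s x)\<bar> \<le> \<sigma> \<longrightarrow> \<sigma> \<le> K * s x \<longrightarrow>
     jet_bound C (\<lambda>x. \<phi> x + b x * g (s x)) x \<and>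
     \<bar>R (\<lambda>x. \<phi> x + b x * g (s x)) x - R \<phi> x
       - kap CARD('n) k * (b x * ((s x)\<^sup>2 * g2 (s x) - (real CARD('n) - 2) * (s x * g1 (s x)) - real CARD('n) * g (s x)))\<bar> \<le> C * s x * \<sigma>"
proof -
  obtain B where B: "B \<ge> 0" "\<And>x. x \<in> Tc \<Longrightarrow> \<bar>b x\<bar> \<le> B" "\<And>x. x \<in> Tc \<Longrightarrow> norm (grad b x) \<le> B" "\<And>x. x \<in> Tc \<Longrightarrow> norm (hess b x) \<le> B"
    by (rule smooth_W_bound[OF b]) blast
  obtain KH where KH: "KH \<ge> 0" "\<And>x. x \<in> Tc \<Longrightarrow> norm (hess s x) \<le> KH"
    by (rule smooth_W_bound[OF sW]) blast
  \<comment> \<open>Counts the terms in the Hessian of the product b g(s): one with the Hessian of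
    \<open>s\<close> and four others, each at most B \<sigma> after scaling.\<close>
  define C0 where "C0 = B * (KH + 4)"
  have C0: "C0 \<ge> 0" using B KH by (simp add: C0_def)
  define K' where "K' = K + C0 * K"
  have K': "K' \<ge> 0" "K \<le> K'" "C0 * K \<le> K'" using K C0 by (auto simp: K'_def)
  have n2: "2 \<le> CARD('n)" using n3 by simp
  obtain C1 where C1: "C1 \<ge> 0" "\<And>\<rho> \<nu> (H :: real^'n^'n) \<phi> p M \<eta> q m \<sigma>. 0 < \<rho> \<Longrightarrow> \<rho> \<le> 1 \<Longrightarrow> norm \<nu> = 1 \<Longrightarrow> norm H \<le> KH \<Longrightarrow>
     transpose H = H \<Longrightarrow> transpose M = M \<Longrightarrow> transpose m = m \<Longrightarrow>
     \<bar>\<phi>\<bar> \<le> K' * \<rho> \<Longrightarrow> norm p \<le> K' \<Longrightarrow> \<rho> * norm M \<le> K' \<Longrightarrow>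
     \<bar>\<eta>\<bar> \<le> \<sigma> \<Longrightarrow> \<rho> * norm q \<le> \<sigma> \<Longrightarrow> \<rho>\<^sup>2 * norm m \<le> \<sigma> \<Longrightarrow> \<sigma> \<le> K' * \<rho> \<Longrightarrow>
     \<bar>Res k \<rho> \<nu> H (\<phi> + \<eta>) (p + q) (M + m) - Res k \<rho> \<nu> H \<phi> p M
       - kap CARD('n) k * (\<rho>\<^sup>2 * trace m - (real CARD('n) - 2) * (\<rho> * (\<nu> \<bullet> q)) - real CARD('n) * \<eta>)\<bar> \<le> C1 * \<rho> * \<sigma>"
    using Res_perturb[OF n2 k1 kn K'(1) KH(1)] by blast
  define C2 where "C2 = B * (real CARD('n) * KH) + real CARD('n) * B + 2 * B"
  have C2: "C2 \<ge> 0" using B KH by (auto simp: C2_def)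
  have kp: "kap CARD('n) k > 0" using kap_pos[OF n2 k1 kn] .
  define C where "C = C1 * C0 + kap CARD('n) k * (C2 + real CARD('n) * B) + K'"
  have C: "C \<ge> 0" "K' \<le> C" "C1 * C0 + kap CARD('n) k * (C2 + real CARD('n) * B) \<le> C" using C1 C0 kp C2 B K' by (auto simp: C_def)
  show ?thesis
  proof (intro exI[of _ C] conjI[OF C(1)] allI impI)
    fix \<phi> g g1 g2 x \<sigma>
    assume x: "x \<in> T" and \<phi>: "smooth_on_open \<phi> S" and jet: "jet_bound K \<phi> x" and gs: "smooth_on_open (\<lambda>x. g (s x)) S"
      and d1: "\<forall>t. 0 < t \<longrightarrow> (g has_real_derivative g1 t) (at t)" and d2: "\<forall>t. 0 < t \<longrightarrow> (g1 has_real_derivative g2 t) (at t)"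
      and g: "\<bar>g (s x)\<bar> \<le> \<sigma>" "s x * \<bar>g1 (s x)\<bar> \<le> \<sigma>" "(s x)\<^sup>2 * \<bar>g2 (s x)\<bar> \<le> \<sigma>" and \<sigma>: "\<sigma> \<le> K * s x"
    have xS: "x \<in> S" and xW: "x \<in> W" and xc: "x \<in> Tc" using x subs by auto
    define \<rho> where "\<rho> = s x" define \<nu> where "\<nu> = grad s x" define H where "H = hess s x"
    define G0 where "G0 = g \<rho>" define G1 where "G1 = g1 \<rho>" define G2 where "G2 = g2 \<rho>"
    define \<eta> where "\<eta> x = b x * g (s x)" for x
    have \<rho>: "0 < \<rho>" "\<rho> \<le> 1" using x q1 by (auto simp: T_def \<rho>_def)
    note g = g[folded \<rho>_def, folded G0_def G1_def G2_def] and \<sigma> = \<sigma>[folded \<rho>_def]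
    have \<sigma>0: "\<sigma> \<ge> 0" using g(1) by linarith
    have \<nu>: "norm \<nu> = 1" using norm_grad_W[OF xW] by (simp add: \<nu>_def)
    have sS: "smooth_on_open s S" and bS: "smooth_on_open b S"
      using smooth_subset[OF sW open_S subs(1)] smooth_subset[OF b open_S subs(1)] by auto
    have \<eta>S: "smooth_on_open \<eta> S" unfolding \<eta>_def by (intro smooth_mult bS gs)
    have d1': "(g has_real_derivative G1) (at (s x))" using d1 \<rho> by (simp add: G1_def \<rho>_def)
    have gradg: "grad (\<lambda>x. g (s x)) x = G1 *\<^sub>R \<nu>" unfolding \<nu>_def by (rule grad_comp_real[OF sS xS d1'])
    have hessg: "hess (\<lambda>x. g (s x)) x = G1 *\<^sub>R H + G2 *\<^sub>R outer \<nu> \<nu>"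
      unfolding H_def \<nu>_def G1_def G2_def \<rho>_def
      by (rule hess_comp_real[OF sS xS, where T = "{0<..}" and ?h1.0 = g1 and ?h2.0 = g2])
         (use d1 d2 in \<open>auto simp: S_def\<close>)
    define p where "p = grad \<eta> x" define m where "m = hess \<eta> x"
    have p: "p = (b x * G1) *\<^sub>R \<nu> + G0 *\<^sub>R grad b x"
      unfolding p_def \<eta>_def grad_mult[OF bS gs xS] gradg by (simp add: G0_def \<rho>_def)
    have m: "m = (b x * G1) *\<^sub>R H + (b x * G2) *\<^sub>R outer \<nu> \<nu> + G0 *\<^sub>R hess b x + G1 *\<^sub>R outer (grad b x) \<nu> + G1 *\<^sub>R outer \<nu> (grad b x)"
    proof -
      have "outer v (c *\<^sub>R w) = c *\<^sub>R outer v w" "outer (c *\<^sub>R v) w = c *\<^sub>R outer v w" for v w :: "real^'n" and c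
        by (simp_all add: outer_def vec_eq_iff)
      then show ?thesis unfolding m_def \<eta>_def hess_mult[OF bS gs xS] gradg hessg
        by (simp add: G0_def \<rho>_def scaleR_add_right)
    qed
    note Bx = B(2-4)[OF xc] and Hx = KH(2)[OF xc, folded H_def]
    have \<rho>\<sigma>: "\<rho> * \<sigma> \<le> \<sigma>" using \<rho> \<sigma>0 by (simp add: mult_left_le_one_le)
    have b0: "\<bar>b x * G0\<bar> \<le> B * \<sigma>" "\<bar>b x\<bar> * (\<rho> * \<bar>G1\<bar>) \<le> B * \<sigma>" "\<bar>b x\<bar> * (\<rho>\<^sup>2 * \<bar>G2\<bar>) \<le> B * \<sigma>"
      unfolding abs_mult using Bx(1) g B(1) \<rho> by (auto intro!: mult_mono)
    have gb: "\<bar>G0\<bar> * norm (grad b x) \<le> B * \<sigma>" "\<bar>G0\<bar> * norm (hess b x) \<le> B * \<sigma>" "(\<rho> * \<bar>G1\<bar>) * norm (grad b x) \<le> B * \<sigma>"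
      using mult_mono[OF g(1) Bx(2)] mult_mono[OF g(1) Bx(3)] mult_mono[OF g(2) Bx(2)] \<sigma>0 by (simp_all add: mult.commute)
    have gH: "(\<bar>b x\<bar> * (\<rho> * \<bar>G1\<bar>)) * norm H \<le> B * \<sigma> * KH" using mult_mono[OF b0(2) Hx] B \<sigma>0 by simp
    have \<rho>B: "\<rho> * y \<le> z" if "y \<le> z" "0 \<le> z" for y z :: real
    proof -
      have "\<rho> * y \<le> \<rho> * z" using that(1) \<rho> by (intro mult_left_mono) auto
      also have "\<dots> \<le> 1 * z" by (rule mult_right_mono[OF \<rho>(2) that(2)])
      finally show ?thesis by simp
    qed
    have nn: "0 \<le> B * \<sigma>" "0 \<le> B * \<sigma> * KH" using B KH \<sigma>0 by auto
    have j0: "\<bar>\<eta> x\<bar> \<le> C0 * \<sigma>"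
    proof -
      have "\<bar>\<eta> x\<bar> \<le> B * \<sigma>" using b0(1) by (simp add: \<eta>_def G0_def \<rho>_def)
      moreover have "C0 * \<sigma> = B * \<sigma> * KH + 4 * (B * \<sigma>)" by (simp add: C0_def algebra_simps)
      ultimately show ?thesis using nn by linarith
    qed
    have j1: "\<rho> * norm p \<le> C0 * \<sigma>"
    proof -
      have "norm p \<le> \<bar>b x * G1\<bar> + \<bar>G0\<bar> * norm (grad b x)" unfolding p by (rule order_trans[OF norm_triangle_ineq]) (simp add: \<nu>)
      then have "\<rho> * norm p \<le> \<rho> * (\<bar>b x * G1\<bar> + \<bar>G0\<bar> * norm (grad b x))" using \<rho> by (intro mult_left_mono) auto
      also have "\<dots> = \<bar>b x\<bar> * (\<rho> * \<bar>G1\<bar>) + \<rho> * (\<bar>G0\<bar> * norm (grad b x))" by (simp add: abs_mult algebra_simps)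
      also have "\<dots> \<le> B * \<sigma> + B * \<sigma>" by (intro add_mono b0(2) \<rho>B gb(1) nn)
      also have "\<dots> \<le> C0 * \<sigma>" using nn by (simp add: C0_def algebra_simps)
      finally show ?thesis .
    qed
    have j2: "\<rho>\<^sup>2 * norm m \<le> C0 * \<sigma>"
    proof -
      have "norm m \<le> \<bar>b x * G1\<bar> * norm H + \<bar>b x * G2\<bar> + \<bar>G0\<bar> * norm (hess b x) + \<bar>G1\<bar> * norm (grad b x) + \<bar>G1\<bar> * norm (grad b x)"
        unfolding m by (intro order_trans[OF norm_triangle_ineq] add_mono) (simp_all add: norm_outer \<nu>)
      then have "\<rho>\<^sup>2 * norm m \<le> \<rho>\<^sup>2 * (\<bar>b x * G1\<bar> * norm H + \<bar>b x * G2\<bar> + \<bar>G0\<bar> * norm (hess b x) + \<bar>G1\<bar> * norm (grad b x) + \<bar>G1\<bar> * norm (grad b x))"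
        by (intro mult_left_mono) auto
      also have "\<dots> = \<rho> * ((\<bar>b x\<bar> * (\<rho> * \<bar>G1\<bar>)) * norm H) + \<bar>b x\<bar> * (\<rho>\<^sup>2 * \<bar>G2\<bar>) + \<rho> * (\<rho> * (\<bar>G0\<bar> * norm (hess b x)))
          + \<rho> * ((\<rho> * \<bar>G1\<bar>) * norm (grad b x)) + \<rho> * ((\<rho> * \<bar>G1\<bar>) * norm (grad b x))"
        by (simp add: abs_mult power2_eq_square algebra_simps)
      also have "\<dots> \<le> B * \<sigma> * KH + B * \<sigma> + B * \<sigma> + B * \<sigma> + B * \<sigma>"
        by (intro add_mono \<rho>B gH b0(3) gb nn)
      also have "\<dots> = C0 * \<sigma>" by (simp add: C0_def algebra_simps)
      finally show ?thesis .
    qed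
    have s'K: "C0 * \<sigma> \<le> C0 * K * \<rho>" using mult_left_mono[OF \<sigma> C0] by (simp add: mult.assoc)
    then have s'K': "C0 * \<sigma> \<le> K' * \<rho>" using mult_right_mono[OF K'(3), of \<rho>] \<rho> by linarith
    have jet': "\<bar>\<phi> x\<bar> \<le> K * \<rho>" "norm (grad \<phi> x) \<le> K" "\<rho> * norm (hess \<phi> x) \<le> K"
      using jet by (auto simp: jet_bound_def \<rho>_def)
    have gsum: "grad (\<lambda>x. \<phi> x + b x * g (s x)) x = grad \<phi> x + p"
      using grad_add[OF \<phi> \<eta>S xS] by (simp add: p_def \<eta>_def)
    have hsum: "hess (\<lambda>x. \<phi> x + b x * g (s x)) x = hess \<phi> x + m"
      using hess_add[OF \<phi> \<eta>S xS] by (simp add: m_def \<eta>_def)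
    have pK: "norm p \<le> C0 * K"
    proof -
      have "\<rho> * norm p \<le> \<rho> * (C0 * K)" using j1 s'K by (simp add: mult_ac)
      then show ?thesis using \<rho> by simp
    qed
    have mK: "\<rho> * norm m \<le> C0 * K"
    proof -
      have "\<rho> * (\<rho> * norm m) \<le> \<rho> * (C0 * K)" using j2 s'K by (simp add: mult_ac power2_eq_square)
      then show ?thesis using \<rho> by simp
    qed
    have jb: "jet_bound C (\<lambda>x. \<phi> x + b x * g (s x)) x"
    proof -
      have "\<bar>\<phi> x + \<eta> x\<bar> \<le> K' * \<rho>" using jet'(1) j0 s'K abs_triangle_ineq[of "\<phi> x" "\<eta> x"] by (simp add: K'_def algebra_simps)
      moreover have "K' * \<rho> \<le> C * \<rho>" using C \<rho> by (intro mult_right_mono) auto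
      moreover have "norm (grad \<phi> x + p) \<le> K'" using jet'(2) pK norm_triangle_ineq[of "grad \<phi> x" p] by (simp add: K'_def)
      moreover have "\<rho> * norm (hess \<phi> x + m) \<le> K'"
      proof -
        have "\<rho> * norm (hess \<phi> x + m) \<le> \<rho> * (norm (hess \<phi> x) + norm m)" using \<rho> by (intro mult_left_mono norm_triangle_ineq) auto
        then show ?thesis using jet'(3) mK by (simp add: K'_def distrib_left)
      qed
      ultimately show ?thesis using C unfolding jet_bound_def gsum hsum by (auto simp: \<eta>_def \<rho>_def)
    qed
    have tH: "transpose H = H" unfolding H_def by (rule transpose_hess[OF sS xS])
    have main: "\<bar>Res k \<rho> \<nu> H (\<phi> x + \<eta> x) (grad \<phi> x + p) (hess \<phi> x + m) - Res k \<rho> \<nu> H (\<phi> x) (grad \<phi> x) (hess \<phi> x)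
       - kap CARD('n) k * (\<rho>\<^sup>2 * trace m - (real CARD('n) - 2) * (\<rho> * (\<nu> \<bullet> p)) - real CARD('n) * \<eta> x)\<bar> \<le> C1 * \<rho> * (C0 * \<sigma>)"
    proof (rule C1(2)[OF \<rho> \<nu> Hx tH])
      show "transpose (hess \<phi> x) = hess \<phi> x" "transpose m = m"
        using transpose_hess[OF \<phi> xS] transpose_hess[OF \<eta>S xS] by (auto simp: m_def)
      show "\<bar>\<phi> x\<bar> \<le> K' * \<rho>" using jet'(1) mult_right_mono[OF K'(2), of \<rho>] \<rho> by linarith
    qed (use jet' K' j0 j1 j2 s'K' in auto)
    define L where "L = b x * (\<rho>\<^sup>2 * G2 - (real CARD('n) - 2) * (\<rho> * G1) - real CARD('n) * G0)"
    have \<nu>\<nu>: "\<nu> \<bullet> \<nu> = 1" using \<nu> by (simp add: dot_square_norm)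
    \<comment> \<open>What distinguishes the full linear operator from the radial one involves
      derivatives of b or the Hessian of \<open>s\<close>, and always has a spare factor
      \<rho>.\<close>
    have "\<rho>\<^sup>2 * trace m - (real CARD('n) - 2) * (\<rho> * (\<nu> \<bullet> p)) - real CARD('n) * \<eta> x - L
      = \<rho> * ((b x * (\<rho> * G1)) * trace H) + \<rho> * (\<rho> * (G0 * trace (hess b x))) + \<rho> * (2 * ((\<rho> * G1) * (\<nu> \<bullet> grad b x)))
         - \<rho> * ((real CARD('n) - 2) * (G0 * (\<nu> \<bullet> grad b x)))"
      unfolding m p L_def \<eta>_def
      by (simp add: trace_add inner_add_right \<nu>\<nu> inner_commute G0_def \<rho>_def power2_eq_square algebra_simps)
    also have "\<bar>\<dots>\<bar> \<le> \<rho> * (B * (real CARD('n) * KH) * \<sigma>) + \<rho> * (real CARD('n) * B * \<sigma>) + \<rho> * (2 * B * \<sigma>) + \<rho> * (real CARD('n) * B * \<sigma>)"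
    proof (intro order_trans[OF abs_triangle_ineq4] order_trans[OF abs_triangle_ineq] add_mono)
      have \<rho>m: "\<bar>\<rho> * y\<bar> \<le> \<rho> * z" if "\<bar>y\<bar> \<le> z" for y z using that \<rho> by (simp add: abs_mult)
      have tHb: "\<bar>trace H\<bar> \<le> real CARD('n) * KH" using abs_trace_le[of H] mult_left_mono[OF Hx, of "real CARD('n)"] by linarith
      have "\<bar>b x * (\<rho> * G1)\<bar> \<le> B * \<sigma>" using b0(2) \<rho> by (simp add: abs_mult)
      then have "\<bar>(b x * (\<rho> * G1)) * trace H\<bar> \<le> (B * \<sigma>) * (real CARD('n) * KH)"
        unfolding abs_mult[of "b x * (\<rho> * G1)"] using tHb nn by (intro mult_mono) auto
      then show "\<bar>\<rho> * ((b x * (\<rho> * G1)) * trace H)\<bar> \<le> \<rho> * (B * (real CARD('n) * KH) * \<sigma>)" by (intro \<rho>m) (simp add: mult_ac)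
      have "\<bar>trace (hess b x)\<bar> \<le> real CARD('n) * B" using abs_trace_le[of "hess b x"] mult_left_mono[OF Bx(3), of "real CARD('n)"] by linarith
      then have "\<bar>G0 * trace (hess b x)\<bar> \<le> \<sigma> * (real CARD('n) * B)"
        unfolding abs_mult using g(1) \<sigma>0 by (intro mult_mono) auto
      then have "\<bar>G0 * trace (hess b x)\<bar> \<le> real CARD('n) * B * \<sigma>" by (simp add: mult_ac)
      then have "\<bar>\<rho> * (G0 * trace (hess b x))\<bar> \<le> real CARD('n) * B * \<sigma>"
        using \<rho>B[of "\<bar>G0 * trace (hess b x)\<bar>" "real CARD('n) * B * \<sigma>"] \<rho> B(1) \<sigma>0 by (simp add: abs_mult[of \<rho>])
      then show "\<bar>\<rho> * (\<rho> * (G0 * trace (hess b x)))\<bar> \<le> \<rho> * (real CARD('n) * B * \<sigma>)" by (rule \<rho>m)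
      have \<nu>b: "\<bar>\<nu> \<bullet> grad b x\<bar> \<le> B" using Cauchy_Schwarz_ineq2[of \<nu> "grad b x"] \<nu> Bx(2) by simp
      have "\<bar>\<rho> * G1\<bar> \<le> \<sigma>" using g(2) \<rho> by (simp add: abs_mult)
      then have "\<bar>(\<rho> * G1) * (\<nu> \<bullet> grad b x)\<bar> \<le> \<sigma> * B" unfolding abs_mult[of "\<rho> * G1"] using \<nu>b \<sigma>0 by (intro mult_mono) auto
      then show "\<bar>\<rho> * (2 * ((\<rho> * G1) * (\<nu> \<bullet> grad b x)))\<bar> \<le> \<rho> * (2 * B * \<sigma>)" by (intro \<rho>m) (simp add: abs_mult mult_ac)
      have "\<bar>G0 * (\<nu> \<bullet> grad b x)\<bar> \<le> \<sigma> * B" unfolding abs_mult using \<nu>b g(1) \<sigma>0 by (intro mult_mono) auto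
      then have "\<bar>real CARD('n) - 2\<bar> * \<bar>G0 * (\<nu> \<bullet> grad b x)\<bar> \<le> real CARD('n) * (\<sigma> * B)" using n3 by (intro mult_mono) auto
      then show "\<bar>\<rho> * ((real CARD('n) - 2) * (G0 * (\<nu> \<bullet> grad b x)))\<bar> \<le> \<rho> * (real CARD('n) * B * \<sigma>)"
        by (intro \<rho>m) (subst abs_mult, simp only: mult_ac)
    qed
    also have "\<dots> = (C2 + real CARD('n) * B) * (\<rho> * \<sigma>)" by (simp add: C2_def algebra_simps)
    finally have lin: "\<bar>\<rho>\<^sup>2 * trace m - (real CARD('n) - 2) * (\<rho> * (\<nu> \<bullet> p)) - real CARD('n) * \<eta> x - L\<bar> \<le> (C2 + real CARD('n) * B) * (\<rho> * \<sigma>)" .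
    define Y where "Y = \<rho>\<^sup>2 * trace m - (real CARD('n) - 2) * (\<rho> * (\<nu> \<bullet> p)) - real CARD('n) * \<eta> x"
    have "\<bar>kap CARD('n) k * Y - kap CARD('n) k * L\<bar> \<le> kap CARD('n) k * ((C2 + real CARD('n) * B) * (\<rho> * \<sigma>))"
      using mult_left_mono[OF lin[folded Y_def], of "kap CARD('n) k"] kp by (simp add: abs_mult right_diff_distrib[symmetric])
    moreover have "R (\<lambda>x. \<phi> x + b x * g (s x)) x = Res k \<rho> \<nu> H (\<phi> x + \<eta> x) (grad \<phi> x + p) (hess \<phi> x + m)"
      unfolding R_def gsum hsum by (simp add: \<rho>_def \<nu>_def H_def \<eta>_def)
    moreover have "R \<phi> x = Res k \<rho> \<nu> H (\<phi> x) (grad \<phi> x) (hess \<phi> x)" by (simp add: R_def \<rho>_def \<nu>_def H_def)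
    ultimately have "\<bar>R (\<lambda>x. \<phi> x + b x * g (s x)) x - R \<phi> x - kap CARD('n) k * L\<bar> \<le> C1 * \<rho> * (C0 * \<sigma>) + kap CARD('n) k * ((C2 + real CARD('n) * B) * (\<rho> * \<sigma>))"
      using main[folded Y_def] by linarith
    also have "\<dots> = (C1 * C0 + kap CARD('n) k * (C2 + real CARD('n) * B)) * (\<rho> * \<sigma>)" by (simp add: algebra_simps)
    also have "\<dots> \<le> C * (\<rho> * \<sigma>)" using C \<rho> \<sigma>0 by (intro mult_right_mono) auto
    finally have "\<bar>R (\<lambda>x. \<phi> x + b x * g (s x)) x - R \<phi> x - kap CARD('n) k * L\<bar> \<le> C * \<rho> * \<sigma>" by (simp add: mult.assoc)
    then show "jet_bound C (\<lambda>x. \<phi> x + b x * g (s x)) x \<and>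
     \<bar>R (\<lambda>x. \<phi> x + b x * g (s x)) x - R \<phi> x
       - kap CARD('n) k * (b x * ((s x)\<^sup>2 * g2 (s x) - (real CARD('n) - 2) * (s x * g1 (s x)) - real CARD('n) * g (s x)))\<bar> \<le> C * s x * \<sigma>"
      using jb by (simp add: L_def \<rho>_def G0_def G1_def G2_def)
  qed
qed

end

section \<open>Solving for the coefficients order by order\<close>

lemma poly_low_coeffs:
  fixes a :: "nat \<Rightarrow> real"
  assumes "d > 0" "\<And>t. 0 < t \<Longrightarrow> t \<le> d \<Longrightarrow> \<bar>\<Sum>j\<le>m. a j * t ^ j\<bar> \<le> K * t ^ m" "i < m"
  shows "a i = 0"
  using assms(2,3)
proof (induction m arbitrary: a i)
  case (Suc m)
  have "((\<lambda>t. \<Sum>j\<le>Suc m. a j * t ^ j) \<longlongrightarrow> (\<Sum>j\<le>Suc m. a j * 0 ^ j)) (at_right 0)"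
    by (intro tendsto_intros)
  moreover have "(\<Sum>j\<le>Suc m. a j * 0 ^ j) = a 0" by (subst sum.atMost_Suc_shift) simp
  moreover have "((\<lambda>t. \<Sum>j\<le>Suc m. a j * t ^ j) \<longlongrightarrow> 0) (at_right 0)"
  proof (rule Lim_null_comparison[where g = "\<lambda>t. K * t ^ Suc m"])
    have "\<forall>\<^sub>F t in at_right (0::real). 0 < t \<and> t < d" 
      using eventually_at_right_real[OF assms(1)] by eventually_elim auto
    then show "\<forall>\<^sub>F t in at_right 0. norm (\<Sum>j\<le>Suc m. a j * t ^ j) \<le> K * t ^ Suc m"
      by eventually_elim (use Suc.prems(1) in auto)
    have "((\<lambda>t. K * t ^ Suc m) \<longlongrightarrow> K * 0 ^ Suc m) (at_right 0)" by (intro tendsto_intros)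
    then show "((\<lambda>t. K * t ^ Suc m) \<longlongrightarrow> 0) (at_right 0)" by simp
  qed
  \<comment> \<open>Letting t tend to 0 removes the constant term; the rest is divided by t.\<close>
  ultimately have a0: "a 0 = 0" using tendsto_unique[OF trivial_limit_at_right_real] by metis
  note IH = Suc.IH and prems = Suc.prems
  show ?case
  proof (cases i)
    case (Suc j)
    have "a (Suc j) = 0"
    proof (rule IH[of "\<lambda>j. a (Suc j)" j])
      fix t :: real assume t: "0 < t" "t \<le> d"
      have "(\<Sum>j\<le>Suc m. a j * t ^ j) = t * (\<Sum>j\<le>m. a (Suc j) * t ^ j)"
        by (subst sum.atMost_Suc_shift) (simp add: a0 sum_distrib_left mult_ac)
      then have "t * \<bar>\<Sum>j\<le>m. a (Suc j) * t ^ j\<bar> \<le> t * (K * t ^ m)"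
        using prems(1)[OF t] t by (simp add: abs_mult mult_ac)
      then show "\<bar>\<Sum>j\<le>m. a (Suc j) * t ^ j\<bar> \<le> K * t ^ m" using t by simp
    qed (use Suc prems in auto)
    then show ?thesis using Suc by simp
  qed (use a0 in simp)
qed simp

lemma power_log_derivative:
  assumes "0 < t"
  shows "((\<lambda>t. t ^ Suc j * ln t) has_real_derivative (real (Suc j) * t ^ j * ln t + t ^ j)) (at t)"
proof -
  have "((\<lambda>t. t ^ Suc j * ln t) has_real_derivative (real (Suc j) * t ^ j) * ln t + inverse t * t ^ Suc j) (at t)"
    using DERIV_mult[OF DERIV_pow[of "Suc j" t] DERIV_ln[OF assms]] by simp
  moreover have "inverse t * t ^ Suc j = t ^ j" using assms by simp
  ultimately show ?thesis by (simp only:)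
qed

lemma t_abs_ln_le: "0 < t \<Longrightarrow> t \<le> 1 \<Longrightarrow> t * \<bar>ln t\<bar> \<le> (1::real)"
proof -
  assume t: "0 < t" "t \<le> 1"
  have "ln (1 / t) \<le> 1 / t - 1" using t by (intro ln_le_minus_one) auto
  then have "- ln t \<le> 1 / t" using t by (simp add: ln_div)
  then have "t * (- ln t) \<le> t * (1 / t)" using t by (intro mult_left_mono) auto
  moreover have "\<bar>ln t\<bar> = - ln t" using t ln_le_zero_iff[of t] by auto
  ultimately show ?thesis using t by simp
qed

context smooth_collar
begin

lemma jet_bound_mono: "jet_bound K \<phi> x \<Longrightarrow> K \<le> K' \<Longrightarrow> x \<in> T \<Longrightarrow> jet_bound K' \<phi> x"
  unfolding jet_bound_def T_def by (auto intro: order_trans mult_right_mono)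

lemma normal_path:
  assumes y: "y \<in> F" and t: "\<bar>t\<bar> \<le> q1"
  shows "s (y + t *\<^sub>R N y) = t" "y + t *\<^sub>R N y \<in> Tc" "y + t *\<^sub>R N y \<in> W" "grad s (y + t *\<^sub>R N y) = N y" "proj (y + t *\<^sub>R N y) = y"
proof -
  let ?z = "y + t *\<^sub>R N y"
  show sz: "s ?z = t" using s_normal[OF y, of t] t q1 r by auto
  then show "?z \<in> Tc" using t by (simp add: Tc_def)
  then show "?z \<in> W" using subs by auto
  have "dist ?z y = \<bar>s ?z\<bar>" using sz norm_N[OF y] by (simp add: dist_norm)
  then show "grad s ?z = N y" using s_has_derivative(2)[of ?z y] y sz t q1 by auto
  then show "proj ?z = y" by (simp add: proj_def sz)
qed

lemma proj_T:
  assumes x: "x \<in> T"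
  shows "proj x \<in> F" "x = proj x + s x *\<^sub>R N (proj x)" "0 < s x" "s x \<le> q1" "s x \<le> 1"
  using x proj_F[of x] proj(4)[of x] W_half[of x] subs q1 by (auto simp: T_def)

text \<open>Taylor's formula along the normals. The assumed decay kills the coefficients below order
  \<open>m\<close>, and the coefficient at \<open>m\<close> is a normal derivative, hence smooth on
  a full neighbourhood of the frontier.\<close>

lemma taylor_normal:
  assumes f: "smooth_on_open f W" and bnd: "\<And>x. x \<in> T \<Longrightarrow> \<bar>f x\<bar> \<le> K * s x ^ m" and K: "K \<ge> 0"
  shows "\<exists>g. smooth_on_open g W \<and> (\<exists>K'\<ge>0. \<forall>x\<in>T. \<bar>f x - g (proj x) * s x ^ m\<bar> \<le> K' * s x ^ Suc m)"
proof -
  \<comment> \<open>On a normal line the gradient of \<open>s\<close> is the constant N y, so the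
    iterates of \<open>dn\<close> restrict to the successive one-variable derivatives.\<close>
  define dn where "dn h x = grad h x \<bullet> grad s x" for h x
  define D where "D j = (dn ^^ j) f" for j
  have D: "smooth_on_open (D j) W" for j
  proof (induction j)
    case (Suc j)
    have "smooth_on_open (dn (D j)) W" unfolding dn_def by (intro smooth_inner open_W smooth_grad Suc sW)
    then show ?case by (simp add: D_def)
  qed (simp add: D_def f)
  obtain B where B: "B \<ge> 0" "\<And>x. x \<in> Tc \<Longrightarrow> \<bar>D (Suc m) x\<bar> \<le> B" by (rule smooth_W_bound[OF D[of "Suc m"]]) blast
  define a where "a y j = D j y / fact j" for y j
  have taylor: "\<bar>f (y + t *\<^sub>R N y) - (\<Sum>j\<le>m. a y j * t ^ j)\<bar> \<le> B * t ^ Suc m" if y: "y \<in> F" and t: "0 < t" "t \<le> q1" for y t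
  proof -
    have "\<exists>\<tau>>0. \<tau> < t \<and> f (y + t *\<^sub>R N y) = (\<Sum>j<Suc m. D j (y + 0 *\<^sub>R N y) / fact j * t ^ j) + D (Suc m) (y + \<tau> *\<^sub>R N y) / fact (Suc m) * t ^ Suc m"
    proof (rule Maclaurin[OF t(1), where diff = "\<lambda>j t. D j (y + t *\<^sub>R N y)"])
      show "\<forall>j \<tau>. j < Suc m \<and> 0 \<le> \<tau> \<and> \<tau> \<le> t \<longrightarrow>
         DERIV (\<lambda>t. D j (y + t *\<^sub>R N y)) \<tau> :> D (Suc j) (y + \<tau> *\<^sub>R N y)"
      proof (intro allI impI)
        fix j \<tau> assume "j < Suc m \<and> 0 \<le> \<tau> \<and> \<tau> \<le> t"
        then have np: "y + \<tau> *\<^sub>R N y \<in> W" "grad s (y + \<tau> *\<^sub>R N y) = N y" using normal_path[OF y, of \<tau>] t by auto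
        have "D (Suc j) (y + \<tau> *\<^sub>R N y) = grad (D j) (y + \<tau> *\<^sub>R N y) \<bullet> N y" by (simp add: D_def dn_def np(2))
        then show "DERIV (\<lambda>t. D j (y + t *\<^sub>R N y)) \<tau> :> D (Suc j) (y + \<tau> *\<^sub>R N y)"
          using line_derivative[OF smooth_differentiable[OF D np(1)]] by simp
      qed
    qed (auto simp: D_def)
    then obtain \<tau> where \<tau>: "0 < \<tau>" "\<tau> < t" and eq: "f (y + t *\<^sub>R N y) = (\<Sum>j\<le>m. a y j * t ^ j) + D (Suc m) (y + \<tau> *\<^sub>R N y) / fact (Suc m) * t ^ Suc m"
      by (auto simp: a_def lessThan_Suc_atMost)
    have "\<bar>D (Suc m) (y + \<tau> *\<^sub>R N y)\<bar> \<le> B" using B(2) normal_path(2)[OF y, of \<tau>] \<tau> t by auto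
    moreover have "(1::real) \<le> fact (Suc m)" by (rule fact_ge_1)
    ultimately have "\<bar>D (Suc m) (y + \<tau> *\<^sub>R N y) / fact (Suc m)\<bar> \<le> B / 1" unfolding abs_divide by (intro frac_le) auto
    then have "\<bar>D (Suc m) (y + \<tau> *\<^sub>R N y) / fact (Suc m)\<bar> * t ^ Suc m \<le> B * t ^ Suc m" using t by (intro mult_right_mono) auto
    then show ?thesis using eq t by (simp add: abs_mult)
  qed
  have low: "a y i = 0" if y: "y \<in> F" and i: "i < m" for y i
  proof (rule poly_low_coeffs[OF q1(1) _ i])
    fix t assume t: "0 < t" "t \<le> q1"
    have "y + t *\<^sub>R N y \<in> T" using normal_path(1)[OF y, of t] t by (auto simp: T_def)
    then have "\<bar>f (y + t *\<^sub>R N y)\<bar> \<le> K * t ^ m" using bnd[of "y + t *\<^sub>R N y"] normal_path(1)[OF y, of t] t by simp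
    moreover have "B * t ^ Suc m \<le> B * t ^ m" using B t q1 by (intro mult_left_mono power_decreasing) auto
    ultimately show "\<bar>\<Sum>j\<le>m. a y j * t ^ j\<bar> \<le> (K + B) * t ^ m" using taylor[OF y t] by (simp add: distrib_right)
  qed
  show ?thesis
  proof (intro exI[of _ "\<lambda>x. a x m"] conjI exI[of _ B] ballI)
    show "smooth_on_open (\<lambda>x. a x m) W" unfolding a_def by (intro smooth_divide D smooth_const open_W) auto
    fix x assume x: "x \<in> T"
    note px = proj_T[OF x]
    have "(\<Sum>j\<le>m. a (proj x) j * s x ^ j) = a (proj x) m * s x ^ m + (\<Sum>j\<in>{..m} - {m}. a (proj x) j * s x ^ j)"
      by (subst sum.remove[of _ m]) auto
    moreover have "(\<Sum>j\<in>{..m} - {m}. a (proj x) j * s x ^ j) = 0" using low[OF px(1)] by (intro sum.neutral) auto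
    ultimately show "\<bar>f x - a (proj x) m * s x ^ m\<bar> \<le> B * s x ^ Suc m"
      using taylor[OF px(1,3,4)] px(2)[symmetric] by simp
  qed (rule B)
qed

text \<open>Functions on the frontier are represented by smooth functions on \<open>W\<close>
  evaluated at the foot point.\<close>

definition expand :: "(nat \<Rightarrow> real^'n \<Rightarrow> real) \<Rightarrow> nat \<Rightarrow> real^'n \<Rightarrow> real" where
  "expand c m x = (\<Sum>i=1..m. c i (proj x) * s x ^ i)"

lemma smooth_expand: "(\<And>i. smooth_on_open (c i) W) \<Longrightarrow> smooth_on_open (expand c m) W"
  unfolding expand_def[abs_def] by (intro smooth_sum smooth_mult smooth_comp_proj smooth_power sW open_W) auto

lemma n2: "2 \<le> CARD('n)" using n3 by simp

lemma kap0: "kap CARD('n) k > 0" using kap_pos[OF n2 k1 kn] .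

lemma hess_zero: "grad (\<lambda>x. 0) x = 0" "hess (\<lambda>x :: real^'n. 0) x = 0"
proof -
  have "partial_deriv i (\<lambda>x :: real^'n. 0) = (\<lambda>x. 0)" for i by (auto simp: partial_deriv_def)
  then show "grad (\<lambda>x. 0) x = 0" "hess (\<lambda>x :: real^'n. 0) x = 0" by (simp_all add: grad_def hess_def vec_eq_iff)
qed

text \<open>Adding b s^(m+1) changes the leading residual by \<open>kap\<close> times the indicial
  polynomial at m + 1, which is nonzero below order n; b is chosen to cancel the normal Taylor
  coefficient of the current residual.\<close>

lemma expansion_exists:
  "m < CARD('n) \<Longrightarrow> \<exists>c. (\<forall>i. smooth_on_open (c i) W) \<and>
     (\<exists>K\<ge>0. \<forall>x\<in>T. jet_bound K (expand c m) x \<and> \<bar>R (expand c m) x\<bar> \<le> K * s x ^ Suc m)"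
proof (induction m)
  case 0
  obtain KH where KH: "KH \<ge> 0" "\<And>x. x \<in> Tc \<Longrightarrow> norm (hess s x) \<le> KH" by (rule smooth_W_bound[OF sW]) blast
  obtain C where C: "C \<ge> 0" "\<And>\<rho> \<nu> (H :: real^'n^'n). 0 < \<rho> \<Longrightarrow> \<rho> \<le> 1 \<Longrightarrow> norm \<nu> = 1 \<Longrightarrow> norm H \<le> KH \<Longrightarrow>
     transpose H = H \<Longrightarrow> \<bar>Res k \<rho> \<nu> H 0 0 0\<bar> \<le> C * \<rho>"
    using Res_zero[OF n2 k1 kn KH(1)] by blast
  have e: "expand (\<lambda>_ _. 0) 0 = (\<lambda>x. 0)" by (simp add: expand_def[abs_def])
  show ?case
  proof (intro exI[of _ "\<lambda>_ _. 0"] conjI exI[of _ C] ballI allI)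
    fix x assume x: "x \<in> T"
    then have xW: "x \<in> W" using subs by auto
    show "jet_bound C (expand (\<lambda>_ _. 0) 0) x" unfolding e jet_bound_def hess_zero using C x by (auto simp: T_def)
    show "\<bar>R (expand (\<lambda>_ _. 0) 0) x\<bar> \<le> C * s x ^ Suc 0"
      unfolding e R_def hess_zero using C(2)[of "s x" "grad s x" "hess s x"] proj_T[OF x] norm_grad_W[OF xW] KH(2)[of x]
        transpose_hess[OF sW xW] x subs by auto
  qed (use C smooth_const open_W in auto)
next
  case (Suc m)
  then obtain c K where c: "\<And>i. smooth_on_open (c i) W" and K: "K \<ge> 0"
    "\<And>x. x \<in> T \<Longrightarrow> jet_bound K (expand c m) x" "\<And>x. x \<in> T \<Longrightarrow> \<bar>R (expand c m) x\<bar> \<le> K * s x ^ Suc m"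
    by (metis Suc_lessD)
  obtain g K1 where g: "smooth_on_open g W" and K1: "K1 \<ge> 0"
    "\<And>x. x \<in> T \<Longrightarrow> \<bar>R (expand c m) x - g (proj x) * s x ^ Suc m\<bar> \<le> K1 * s x ^ Suc (Suc m)"
    using taylor_normal[OF smooth_R[OF smooth_expand[OF c]] K(3) K(1)] by blast
  \<comment> \<open>The indicial polynomial (a - n) (a + 1) at a = m + 1.\<close>
  define l where "l = kap CARD('n) k * ((real (Suc m) - real CARD('n)) * (real m + 2))"
  have l: "l \<noteq> 0" using kap0 Suc.prems by (simp add: l_def)
  define b where "b x = - g x / l" for x
  have b: "smooth_on_open b W" unfolding b_def by (intro smooth_divide smooth_uminus g smooth_const open_W) (use l in auto)
  define c' where "c' = c(Suc m := b)"
  have c': "smooth_on_open (c' i) W" for i by (simp add: c'_def c b)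
  have eq: "expand c' (Suc m) = (\<lambda>x. expand c m x + b (proj x) * s x ^ Suc m)"
    by (rule ext) (simp add: expand_def c'_def)
  \<comment> \<open>Dominates 1, m + 1 and (m + 1) m, the factors in t^(m+1) and its scaled
    derivatives.\<close>
  define \<Lambda> where "\<Lambda> = real (Suc m) * (real m + 2)"
  define K2 where "K2 = max K \<Lambda>"
  have K2: "K2 \<ge> 0" "K \<le> K2" "\<Lambda> \<le> K2" using K by (auto simp: K2_def)
  obtain C where C: "C \<ge> 0" "\<And>\<phi> g g1 g2 x \<sigma>. x \<in> T \<Longrightarrow> smooth_on_open \<phi> S \<Longrightarrow> jet_bound K2 \<phi> x \<Longrightarrow>
     smooth_on_open (\<lambda>x. g (s x)) S \<Longrightarrow> (\<forall>t. 0 < t \<longrightarrow> (g has_real_derivative g1 t) (at t)) \<Longrightarrow>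
     (\<forall>t. 0 < t \<longrightarrow> (g1 has_real_derivative g2 t) (at t)) \<Longrightarrow>
     \<bar>g (s x)\<bar> \<le> \<sigma> \<Longrightarrow> s x * \<bar>g1 (s x)\<bar> \<le> \<sigma> \<Longrightarrow> (s x)\<^sup>2 * \<bar>g2 (s x)\<bar> \<le> \<sigma> \<Longrightarrow> \<sigma> \<le> K2 * s x \<Longrightarrow>
     jet_bound C (\<lambda>x. \<phi> x + b (proj x) * g (s x)) x \<and>
     \<bar>R (\<lambda>x. \<phi> x + b (proj x) * g (s x)) x - R \<phi> x
       - kap CARD('n) k * (b (proj x) * ((s x)\<^sup>2 * g2 (s x) - (real CARD('n) - 2) * (s x * g1 (s x)) - real CARD('n) * g (s x)))\<bar> \<le> C * s x * \<sigma>"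
    using residual_add[OF smooth_comp_proj[OF b] K2(1)] by blast
  show ?case
  proof (intro exI[of _ c'] conjI exI[of _ "C + K1 + C * \<Lambda>"] ballI allI)
    show "0 \<le> C + K1 + C * \<Lambda>" using C K1 by (auto simp: \<Lambda>_def)
    show "smooth_on_open (c' i) W" for i by (rule c')
    fix x assume x: "x \<in> T"
    note px = proj_T[OF x]
    define t where "t = s x"
    have t: "0 < t" "t \<le> 1" using px by (auto simp: t_def)
    \<comment> \<open>At m = 0 the exponent is truncated, but the factor m vanishes.\<close>
    have sq: "t\<^sup>2 * (real m * t ^ (m - 1)) = real m * t ^ Suc m" by (cases m) (auto simp: power2_eq_square)
    have r2: "t\<^sup>2 * (real (Suc m) * (real m * t ^ (m - 1))) = real (Suc m) * real m * t ^ Suc m"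
      using arg_cong[OF sq, of "\<lambda>z. real (Suc m) * z"] by (simp add: mult_ac)
    have tp: "0 \<le> t ^ Suc m" using t by simp
    have main: "jet_bound C (\<lambda>x. expand c m x + b (proj x) * s x ^ Suc m) x \<and>
     \<bar>R (\<lambda>x. expand c m x + b (proj x) * s x ^ Suc m) x - R (expand c m) x
       - kap CARD('n) k * (b (proj x) * ((s x)\<^sup>2 * (real (Suc m) * (real m * s x ^ (m - 1))) - (real CARD('n) - 2) * (s x * (real (Suc m) * s x ^ m)) - real CARD('n) * s x ^ Suc m))\<bar> \<le> C * s x * (\<Lambda> * s x ^ Suc m)"
    proof (rule C(2)[OF x])
      show "smooth_on_open (expand c m) S" by (rule smooth_subset[OF smooth_expand[OF c] open_S subs(1)])
      show "jet_bound K2 (expand c m) x" using jet_bound_mono[OF K(2)[OF x] K2(2) x] .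
      show "smooth_on_open (\<lambda>x. s x ^ Suc m) S" by (intro smooth_power smooth_subset[OF sW open_S subs(1)])
      show "\<forall>t. 0 < t \<longrightarrow> ((\<lambda>t. t ^ Suc m) has_real_derivative real (Suc m) * t ^ m) (at t)"
        using DERIV_pow[of "Suc m"] by simp
      show "\<forall>t. 0 < t \<longrightarrow> ((\<lambda>t. real (Suc m) * t ^ m) has_real_derivative real (Suc m) * (real m * t ^ (m - 1))) (at t)"
        using DERIV_cmult[OF DERIV_pow[of m]] by simp
      have \<Lambda>s: "1 \<le> \<Lambda>" "real (Suc m) \<le> \<Lambda>" "real (Suc m) * real m \<le> \<Lambda>" by (auto simp: \<Lambda>_def algebra_simps)
      have "1 * t ^ Suc m \<le> \<Lambda> * t ^ Suc m" "real (Suc m) * t ^ Suc m \<le> \<Lambda> * t ^ Suc m" "real (Suc m) * real m * t ^ Suc m \<le> \<Lambda> * t ^ Suc m"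
        by (rule mult_right_mono[OF _ tp], rule \<Lambda>s)+
      then show "\<bar>s x ^ Suc m\<bar> \<le> \<Lambda> * s x ^ Suc m" "s x * \<bar>real (Suc m) * s x ^ m\<bar> \<le> \<Lambda> * s x ^ Suc m"
        "(s x)\<^sup>2 * \<bar>real (Suc m) * (real m * s x ^ (m - 1))\<bar> \<le> \<Lambda> * s x ^ Suc m"
        using r2 t unfolding t_def[symmetric] by (auto simp: abs_mult mult_ac)
      have "t ^ Suc m \<le> t ^ 1" using t by (intro power_decreasing) auto
      then have "\<Lambda> * t ^ Suc m \<le> \<Lambda> * t" by (intro mult_left_mono) (auto simp: \<Lambda>_def)
      also have "\<dots> \<le> K2 * t" using K2 t by (intro mult_right_mono) auto
      finally show "\<Lambda> * s x ^ Suc m \<le> K2 * s x" by (simp add: t_def)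
    qed
    have "t\<^sup>2 * (real (Suc m) * (real m * t ^ (m - 1))) - (real CARD('n) - 2) * (t * (real (Suc m) * t ^ m)) - real CARD('n) * t ^ Suc m
        = ((real (Suc m) - real CARD('n)) * (real m + 2)) * t ^ Suc m"
      unfolding r2 by (simp add: algebra_simps)
    then have "kap CARD('n) k * (b (proj x) * (t\<^sup>2 * (real (Suc m) * (real m * t ^ (m - 1))) - (real CARD('n) - 2) * (t * (real (Suc m) * t ^ m)) - real CARD('n) * t ^ Suc m))
       = - (g (proj x) * t ^ Suc m)"
      using l by (simp add: b_def l_def[symmetric] mult.assoc[symmetric]) (simp add: l_def field_simps)
    with main have jb: "jet_bound C (expand c' (Suc m)) x" and "\<bar>R (expand c' (Suc m)) x - R (expand c m) x + g (proj x) * s x ^ Suc m\<bar> \<le> C * \<Lambda> * s x ^ Suc (Suc m)"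
      unfolding eq by (auto simp: t_def mult_ac)
    then have "\<bar>R (expand c' (Suc m)) x\<bar> \<le> (C * \<Lambda> + K1) * s x ^ Suc (Suc m)" using K1(2)[OF x] by (simp add: distrib_right)
    also have "\<dots> \<le> (C + K1 + C * \<Lambda>) * s x ^ Suc (Suc m)" using C px by (intro mult_right_mono) auto
    finally show "\<bar>R (expand c' (Suc m)) x\<bar> \<le> (C + K1 + C * \<Lambda>) * s x ^ Suc (Suc m)" .
    show "jet_bound (C + K1 + C * \<Lambda>) (expand c' (Suc m)) x"
      by (rule jet_bound_mono[OF jb _ x]) (use C K1 in \<open>auto simp: \<Lambda>_def\<close>)
  qed
qed

lemma smooth_s_S: "smooth_on_open s S"
  by (rule smooth_subset[OF sW open_S subs(1)])

text \<open>At order n the indicial polynomial vanishes, so s^n cannot correct the residual; on s^n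
  log s the radial operator leaves the derivative of that polynomial, n + 1, times s^n. The
  logarithm in the final residual comes from the size of this correction.\<close>

lemma approximate_solution:
  obtains c c1 K where "\<And>i. smooth_on_open (c i) W" "smooth_on_open c1 W" "K \<ge> 0"
    "smooth_on_open (\<lambda>x. expand c (CARD('n) - 1) x + c1 (proj x) * (s x ^ CARD('n) * ln (s x))) S"
    "\<And>x. x \<in> T \<Longrightarrow> jet_bound K (\<lambda>x. expand c (CARD('n) - 1) x + c1 (proj x) * (s x ^ CARD('n) * ln (s x))) x"
    "\<And>x. x \<in> T \<Longrightarrow> \<bar>R (\<lambda>x. expand c (CARD('n) - 1) x + c1 (proj x) * (s x ^ CARD('n) * ln (s x))) x\<bar> \<le> K * s x ^ Suc CARD('n) * (1 + \<bar>ln (s x)\<bar>)"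
proof -
  obtain j where j: "CARD('n) = Suc (Suc j)" using n2 by (metis add_2_eq_Suc le_Suc_ex)
  have j1: "CARD('n) - 1 = Suc j" using j by simp
  obtain c K where c: "\<And>i. smooth_on_open (c i) W" and K: "K \<ge> 0"
    "\<And>x. x \<in> T \<Longrightarrow> jet_bound K (expand c (Suc j)) x" "\<And>x. x \<in> T \<Longrightarrow> \<bar>R (expand c (Suc j)) x\<bar> \<le> K * s x ^ Suc (Suc j)"
    using expansion_exists[of "Suc j"] j by (metis lessI)
  obtain g K1 where g: "smooth_on_open g W" and K1: "K1 \<ge> 0"
    "\<And>x. x \<in> T \<Longrightarrow> \<bar>R (expand c (Suc j)) x - g (proj x) * s x ^ Suc (Suc j)\<bar> \<le> K1 * s x ^ Suc (Suc (Suc j))"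
    using taylor_normal[OF smooth_R[OF smooth_expand[OF c]] K(3) K(1)] by blast
  \<comment> \<open>Here n = j + 2, so j + 3 is n + 1.\<close>
  define l where "l = kap CARD('n) k * (real j + 3)"
  have l: "l \<noteq> 0" using kap0 by (simp add: l_def)
  define b where "b x = - g x / l" for x
  have b: "smooth_on_open b W" unfolding b_def by (intro smooth_divide smooth_uminus g smooth_const open_W) (use l in auto)
  define \<Lambda> where "\<Lambda> = 2 * (real j + 2)\<^sup>2"
  define K2 where "K2 = max K (2 * \<Lambda>)"
  have \<Lambda>: "\<Lambda> \<ge> 0" by (simp add: \<Lambda>_def)
  have K2: "K2 \<ge> 0" "K \<le> K2" "2 * \<Lambda> \<le> K2" using K by (auto simp: K2_def)
  define g1 where "g1 t = real (Suc (Suc j)) * t ^ Suc j * ln t + t ^ Suc j" for t :: real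
  define g2 where "g2 t = real (Suc (Suc j)) * (real (Suc j) * t ^ j * ln t + t ^ j) + real (Suc j) * t ^ j" for t :: real
  obtain C where C: "C \<ge> 0" "\<And>\<phi> g g1 g2 x \<sigma>. x \<in> T \<Longrightarrow> smooth_on_open \<phi> S \<Longrightarrow> jet_bound K2 \<phi> x \<Longrightarrow>
     smooth_on_open (\<lambda>x. g (s x)) S \<Longrightarrow> (\<forall>t. 0 < t \<longrightarrow> (g has_real_derivative g1 t) (at t)) \<Longrightarrow>
     (\<forall>t. 0 < t \<longrightarrow> (g1 has_real_derivative g2 t) (at t)) \<Longrightarrow>
     \<bar>g (s x)\<bar> \<le> \<sigma> \<Longrightarrow> s x * \<bar>g1 (s x)\<bar> \<le> \<sigma> \<Longrightarrow> (s x)\<^sup>2 * \<bar>g2 (s x)\<bar> \<le> \<sigma> \<Longrightarrow> \<sigma> \<le> K2 * s x \<Longrightarrow>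
     jet_bound C (\<lambda>x. \<phi> x + b (proj x) * g (s x)) x \<and>
     \<bar>R (\<lambda>x. \<phi> x + b (proj x) * g (s x)) x - R \<phi> x
       - kap CARD('n) k * (b (proj x) * ((s x)\<^sup>2 * g2 (s x) - (real CARD('n) - 2) * (s x * g1 (s x)) - real CARD('n) * g (s x)))\<bar> \<le> C * s x * \<sigma>"
    using residual_add[OF smooth_comp_proj[OF b] K2(1)] by blast
  have ln_s: "smooth_on_open (\<lambda>x. s x ^ Suc (Suc j) * ln (s x)) S"
    by (intro smooth_mult smooth_power smooth_ln smooth_s_S) (auto simp: S_def)
  have eS: "smooth_on_open (expand c (Suc j)) S" by (rule smooth_subset[OF smooth_expand[OF c] open_S subs(1)])
  have pt: "jet_bound C (\<lambda>x. expand c (Suc j) x + b (proj x) * (s x ^ Suc (Suc j) * ln (s x))) x \<and>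
      \<bar>R (\<lambda>x. expand c (Suc j) x + b (proj x) * (s x ^ Suc (Suc j) * ln (s x))) x\<bar> \<le> (C * \<Lambda> + K1) * s x ^ Suc (Suc (Suc j)) * (1 + \<bar>ln (s x)\<bar>)"
    if x: "x \<in> T" for x
  proof -
    note px = proj_T[OF x]
    define t where "t = s x"
    have t: "0 < t" "t \<le> 1" using px by (auto simp: t_def)
    define \<sigma> where "\<sigma> = \<Lambda> * (t ^ Suc (Suc j) * (1 + \<bar>ln t\<bar>))"
    have tg1: "t * g1 t = t ^ Suc (Suc j) * ((real j + 2) * ln t + 1)" by (simp add: g1_def algebra_simps)
    have tg2: "t\<^sup>2 * g2 t = t ^ Suc (Suc j) * ((real j + 2) * (real j + 1) * ln t + (2 * real j + 3))"
      by (simp add: g2_def power2_eq_square algebra_simps)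
    have tp: "0 \<le> t ^ Suc (Suc j)" using t by simp
    have est: "\<bar>t ^ Suc (Suc j) * (a * ln t + d)\<bar> \<le> \<sigma>" if "0 \<le> a" "a \<le> \<Lambda>" "0 \<le> d" "d \<le> \<Lambda>" for a d
    proof -
      have "\<bar>a * ln t + d\<bar> \<le> a * \<bar>ln t\<bar> + d" using that by (auto intro: order_trans[OF abs_triangle_ineq] simp: abs_mult)
      also have "\<dots> \<le> \<Lambda> * \<bar>ln t\<bar> + \<Lambda>" using that by (intro add_mono mult_right_mono) auto
      finally have "t ^ Suc (Suc j) * \<bar>a * ln t + d\<bar> \<le> t ^ Suc (Suc j) * (\<Lambda> * \<bar>ln t\<bar> + \<Lambda>)" by (rule mult_left_mono[OF _ tp])
      also have "\<dots> = \<sigma>" by (simp add: \<sigma>_def algebra_simps)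
      finally show ?thesis using tp by (simp only: abs_mult abs_of_nonneg)
    qed
    have \<Lambda>s: "1 \<le> \<Lambda>" "real j + 2 \<le> \<Lambda>" "(real j + 2) * (real j + 1) \<le> \<Lambda>" "2 * real j + 3 \<le> \<Lambda>"
      by (auto simp: \<Lambda>_def power2_eq_square algebra_simps)
    have main: "jet_bound C (\<lambda>x. expand c (Suc j) x + b (proj x) * (s x ^ Suc (Suc j) * ln (s x))) x \<and>
     \<bar>R (\<lambda>x. expand c (Suc j) x + b (proj x) * (s x ^ Suc (Suc j) * ln (s x))) x - R (expand c (Suc j)) x
       - kap CARD('n) k * (b (proj x) * ((s x)\<^sup>2 * g2 (s x) - (real CARD('n) - 2) * (s x * g1 (s x)) - real CARD('n) * (s x ^ Suc (Suc j) * ln (s x))))\<bar> \<le> C * s x * \<sigma>"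
    proof (rule C(2)[OF x eS _ ln_s])
      show "jet_bound K2 (expand c (Suc j)) x" using jet_bound_mono[OF K(2)[OF x] K2(2) x] .
      show "\<forall>t>0. ((\<lambda>t. t ^ Suc (Suc j) * ln t) has_real_derivative g1 t) (at t)"
        using power_log_derivative[of _ "Suc j"] by (simp only: g1_def) simp
      show "\<forall>t>0. (g1 has_real_derivative g2 t) (at t)"
      proof (intro allI impI)
        fix t :: real assume "0 < t"
        have "((\<lambda>t. real (Suc (Suc j)) * (t ^ Suc j * ln t) + t ^ Suc j) has_real_derivative g2 t) (at t)"
          unfolding g2_def using DERIV_pow[of "Suc j" t]
          by (intro DERIV_add DERIV_cmult power_log_derivative \<open>0 < t\<close>) simp
        then show "(g1 has_real_derivative g2 t) (at t)" by (simp add: g1_def[abs_def] mult.assoc)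
      qed
      show "\<bar>s x ^ Suc (Suc j) * ln (s x)\<bar> \<le> \<sigma>" using est[of 1 0] \<Lambda>s by (simp add: t_def)
      have "\<bar>t * g1 t\<bar> \<le> \<sigma>" unfolding tg1 using \<Lambda>s by (intro est) auto
      then show "s x * \<bar>g1 (s x)\<bar> \<le> \<sigma>" using t by (simp add: t_def abs_mult)
      have "\<bar>t\<^sup>2 * g2 t\<bar> \<le> \<sigma>" unfolding tg2 using \<Lambda>s by (intro est) auto
      then show "(s x)\<^sup>2 * \<bar>g2 (s x)\<bar> \<le> \<sigma>" by (simp add: t_def abs_mult)
      have "t ^ Suc (Suc j) * (1 + \<bar>ln t\<bar>) \<le> t * 2"
      proof -
        have "t ^ Suc j \<le> t ^ 1" using t by (intro power_decreasing) auto
        then have "t ^ Suc j * (1 + \<bar>ln t\<bar>) \<le> t * (1 + \<bar>ln t\<bar>)" by (intro mult_right_mono) auto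
        also have "\<dots> = t + t * \<bar>ln t\<bar>" by (simp add: distrib_left)
        also have "\<dots> \<le> 2" using t_abs_ln_le[OF t] t by linarith
        finally show ?thesis using t by (simp add: mult.assoc)
      qed
      then have "\<sigma> \<le> \<Lambda> * (t * 2)" unfolding \<sigma>_def by (rule mult_left_mono[OF _ \<Lambda>])
      also have "\<dots> \<le> K2 * t" using mult_right_mono[OF K2(3), of t] t by (simp add: mult_ac)
      finally show "\<sigma> \<le> K2 * s x" by (simp add: t_def)
    qed
    have "t\<^sup>2 * g2 t - (real CARD('n) - 2) * (t * g1 t) - real CARD('n) * (t ^ Suc (Suc j) * ln t) = (real j + 3) * t ^ Suc (Suc j)"
      unfolding tg1 tg2 j by (simp add: algebra_simps)
    then have "kap CARD('n) k * (b (proj x) * (t\<^sup>2 * g2 t - (real CARD('n) - 2) * (t * g1 t) - real CARD('n) * (t ^ Suc (Suc j) * ln t))) = - (g (proj x) * t ^ Suc (Suc j))"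
      using l by (simp add: b_def) (simp add: l_def field_simps)
    with main have jb: "jet_bound C (\<lambda>x. expand c (Suc j) x + b (proj x) * (s x ^ Suc (Suc j) * ln (s x))) x"
      and "\<bar>R (\<lambda>x. expand c (Suc j) x + b (proj x) * (s x ^ Suc (Suc j) * ln (s x))) x - R (expand c (Suc j)) x + g (proj x) * s x ^ Suc (Suc j)\<bar> \<le> C * s x * \<sigma>"
      by (auto simp: t_def)
    then have "\<bar>R (\<lambda>x. expand c (Suc j) x + b (proj x) * (s x ^ Suc (Suc j) * ln (s x))) x\<bar> \<le> C * s x * \<sigma> + K1 * s x ^ Suc (Suc (Suc j))"
      using K1(2)[OF x] by linarith
    also have "K1 * s x ^ Suc (Suc (Suc j)) \<le> K1 * s x ^ Suc (Suc (Suc j)) * (1 + \<bar>ln (s x)\<bar>)"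
      using mult_left_mono[of 1 "1 + \<bar>ln (s x)\<bar>" "K1 * s x ^ Suc (Suc (Suc j))"] K1(1) px by simp
    also have "C * s x * \<sigma> = C * \<Lambda> * s x ^ Suc (Suc (Suc j)) * (1 + \<bar>ln (s x)\<bar>)" by (simp add: \<sigma>_def t_def)
    finally show ?thesis using jb by (simp add: algebra_simps)
  qed
  show ?thesis
  proof (rule that[OF c b, of "C + (C * \<Lambda> + K1)"])
    show 0: "C + (C * \<Lambda> + K1) \<ge> 0" using C K1 \<Lambda> by auto
    have "smooth_on_open (\<lambda>x. b (proj x)) S" by (rule smooth_subset[OF smooth_comp_proj[OF b] open_S subs(1)])
    then show "smooth_on_open (\<lambda>x. expand c (CARD('n) - 1) x + b (proj x) * (s x ^ CARD('n) * ln (s x))) S"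
      unfolding j1 unfolding j by (intro smooth_add smooth_mult[OF _ ln_s] eS)
    fix x assume x: "x \<in> T"
    show "jet_bound (C + (C * \<Lambda> + K1)) (\<lambda>x. expand c (CARD('n) - 1) x + b (proj x) * (s x ^ CARD('n) * ln (s x))) x"
      unfolding j1 unfolding j by (rule jet_bound_mono[OF conjunct1[OF pt[OF x]] _ x]) (use C K1 \<Lambda> in auto)
    have "0 \<le> s x ^ Suc (Suc (Suc j)) * (1 + \<bar>ln (s x)\<bar>)" using proj_T(3)[OF x] by (intro mult_nonneg_nonneg) auto
    then have "(C * \<Lambda> + K1) * (s x ^ Suc (Suc (Suc j)) * (1 + \<bar>ln (s x)\<bar>)) \<le> (C + (C * \<Lambda> + K1)) * (s x ^ Suc (Suc (Suc j)) * (1 + \<bar>ln (s x)\<bar>))"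
      by (rule mult_right_mono[rotated]) (use C in simp)
    then show "\<bar>R (\<lambda>x. expand c (CARD('n) - 1) x + b (proj x) * (s x ^ CARD('n) * ln (s x))) x\<bar> \<le> (C + (C * \<Lambda> + K1)) * s x ^ Suc CARD('n) * (1 + \<bar>ln (s x)\<bar>)"
      unfolding j1 unfolding j using conjunct2[OF pt[OF x]] by (simp only: mult.assoc)
  qed
qed

text \<open>The radial operator annihilates s^n and multiplies s^(n+1/2) by (1/2) (n + 3/2), so only
  the half-integer power leaves a trace, of a definite sign. \<open>C\<close> is bound before
  \<open>M\<close>, and the smallness of M s^n relative to s is what makes this possible.\<close>

lemma barrier_residual:
  assumes w: "smooth_on_open w S" and jet: "\<And>x. x \<in> T \<Longrightarrow> jet_bound K w x" and K: "0 \<le> K"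
  shows "\<exists>C\<ge>0. \<forall>x M \<epsilon>. x \<in> T \<longrightarrow> 0 \<le> M \<longrightarrow> (\<epsilon> = 1 \<or> \<epsilon> = -1) \<longrightarrow> 2 * (real CARD('n) + 1)\<^sup>2 * (M * s x powr real CARD('n)) \<le> K * s x \<longrightarrow>
    \<bar>R (\<lambda>x. w x + \<epsilon> * (M * (s x powr real CARD('n) - s x powr (real CARD('n) + 1/2)))) x - R w x
       + \<epsilon> * (kap CARD('n) k * (M * ((real CARD('n) + 3/2) / 2 * s x powr (real CARD('n) + 1/2))))\<bar> \<le> C * s x * (M * s x powr real CARD('n))
    \<and> jet_bound C (\<lambda>x. w x + \<epsilon> * (M * (s x powr real CARD('n) - s x powr (real CARD('n) + 1/2)))) x"
proof -
  define N' where "N' = real CARD('n)"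
  define a where "a = N' + 1/2"
  define \<Lambda> where "\<Lambda> = 2 * (N' + 1)\<^sup>2"
  have N': "N' \<ge> 2" using n2 by (simp add: N'_def)
  have \<Lambda>0: "\<Lambda> \<ge> 0" by (simp add: \<Lambda>_def)
  have one: "smooth_on_open (\<lambda>x :: real^'n. 1) W" by (rule smooth_const[OF open_W])
  obtain C where C: "C \<ge> 0" "\<And>\<phi> g g1 g2 x \<sigma>. x \<in> T \<Longrightarrow> smooth_on_open \<phi> S \<Longrightarrow> jet_bound K \<phi> x \<Longrightarrow>
     smooth_on_open (\<lambda>x. g (s x)) S \<Longrightarrow> (\<forall>t. 0 < t \<longrightarrow> (g has_real_derivative g1 t) (at t)) \<Longrightarrow>
     (\<forall>t. 0 < t \<longrightarrow> (g1 has_real_derivative g2 t) (at t)) \<Longrightarrow>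
     \<bar>g (s x)\<bar> \<le> \<sigma> \<Longrightarrow> s x * \<bar>g1 (s x)\<bar> \<le> \<sigma> \<Longrightarrow> (s x)\<^sup>2 * \<bar>g2 (s x)\<bar> \<le> \<sigma> \<Longrightarrow> \<sigma> \<le> K * s x \<Longrightarrow>
     jet_bound C (\<lambda>x. \<phi> x + 1 * g (s x)) x \<and>
     \<bar>R (\<lambda>x. \<phi> x + 1 * g (s x)) x - R \<phi> x
       - kap CARD('n) k * (1 * ((s x)\<^sup>2 * g2 (s x) - (real CARD('n) - 2) * (s x * g1 (s x)) - real CARD('n) * g (s x)))\<bar> \<le> C * s x * \<sigma>"
    using residual_add[OF one K] by blast
  show ?thesis unfolding N'_def[symmetric] a_def[symmetric] \<Lambda>_def[symmetric]
  proof (intro exI[of _ "C + C * \<Lambda>"] conjI[of "0 \<le> _"] allI impI)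
    show "0 \<le> C + C * \<Lambda>" using C \<Lambda>0 by auto
    fix x M \<epsilon> assume x: "x \<in> T" and M: "0 \<le> M" and \<epsilon>: "\<epsilon> = 1 \<or> \<epsilon> = (-1::real)" and small: "\<Lambda> * (M * s x powr N') \<le> K * s x"
    define g where "g t = \<epsilon> * (M * (t powr N' - t powr a))" for t
    define g1 where "g1 t = \<epsilon> * (M * (N' * t powr (N' - 1) - a * t powr (a - 1)))" for t
    define g2 where "g2 t = \<epsilon> * (M * (N' * ((N' - 1) * t powr (N' - 2)) - a * ((a - 1) * t powr (a - 2))))" for t
    define t where "t = s x"
    have t: "0 < t" "t \<le> 1" using proj_T[OF x] by (auto simp: t_def)
    have a2: "a \<ge> 2" "a \<le> N' + 1" using N' by (auto simp: a_def)
    have pw: "t * t powr (e - 1) = t powr e" "t\<^sup>2 * t powr (e - 2) = t powr e" for e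
      using t powr_add[of t 1 "e - 1"] powr_add[of t 2 "e - 2"] by (auto simp: powr_numeral)
    have ta: "t powr a \<le> t powr N'" using t by (intro powr_mono') (auto simp: a_def)
    have tN: "0 \<le> t powr N'" "0 \<le> t powr a" by auto
    have est: "\<bar>\<epsilon> * (M * (c * t powr N' - d * t powr a))\<bar> \<le> \<Lambda> * (M * t powr N')" if "0 \<le> c" "0 \<le> d" "c + d \<le> \<Lambda>" for c d
    proof -
      have "\<bar>c * t powr N' - d * t powr a\<bar> \<le> c * t powr N' + d * t powr a" using that tN by (auto simp: abs_le_iff add_nonneg_nonneg) 
      also have "\<dots> \<le> c * t powr N' + d * t powr N'" using that ta by (intro add_mono mult_left_mono) auto
      also have "\<dots> \<le> \<Lambda> * t powr N'" using mult_right_mono[OF that(3) tN(1)] by (simp add: distrib_right)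
      finally have "M * \<bar>c * t powr N' - d * t powr a\<bar> \<le> M * (\<Lambda> * t powr N')" by (rule mult_left_mono[OF _ M])
      then show ?thesis using \<epsilon> M by (auto simp: abs_mult mult_ac)
    qed
    have tg1: "t * g1 t = \<epsilon> * (M * (N' * t powr N' - a * t powr a))"
      unfolding g1_def pw(1)[of N', symmetric] pw(1)[of a, symmetric] by (simp add: algebra_simps)
    have tg2: "t\<^sup>2 * g2 t = \<epsilon> * (M * (N' * (N' - 1) * t powr N' - a * (a - 1) * t powr a))"
      unfolding g2_def pw(2)[of N', symmetric] pw(2)[of a, symmetric] by (simp add: algebra_simps)
    have main: "jet_bound C (\<lambda>x. w x + 1 * g (s x)) x \<and>
     \<bar>R (\<lambda>x. w x + 1 * g (s x)) x - R w x
       - kap CARD('n) k * (1 * ((s x)\<^sup>2 * g2 (s x) - (real CARD('n) - 2) * (s x * g1 (s x)) - real CARD('n) * g (s x)))\<bar> \<le> C * s x * (\<Lambda> * (M * t powr N'))"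
    proof (rule C(2)[OF x w jet[OF x]])
      show "smooth_on_open (\<lambda>x. g (s x)) S" unfolding g_def
        by (intro smooth_mult smooth_const smooth_diff smooth_powr open_S smooth_s_S) (auto simp: S_def)
      show "\<forall>t>0. (g has_real_derivative g1 t) (at t)"
        unfolding g_def[abs_def] g1_def by (auto intro!: DERIV_cmult DERIV_diff has_real_derivative_powr)
      show "\<forall>t>0. (g1 has_real_derivative g2 t) (at t)"
      proof (intro allI impI)
        fix t :: real assume "0 < t"
        then have "((\<lambda>t. t powr (e - 1)) has_real_derivative (e - 1) * t powr (e - 2)) (at t)" for e
          using has_real_derivative_powr[of t "e - 1"] by simp
        then show "(g1 has_real_derivative g2 t) (at t)"
          unfolding g1_def[abs_def] g2_def by (intro DERIV_cmult DERIV_diff)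
      qed
      show "\<bar>g (s x)\<bar> \<le> \<Lambda> * (M * t powr N')" using est[of 1 1] N' by (simp add: g_def t_def \<Lambda>_def power2_eq_square algebra_simps)
      have "N' + a \<le> \<Lambda>" using N' by (simp add: \<Lambda>_def a_def power2_eq_square algebra_simps)
      then have "\<bar>t * g1 t\<bar> \<le> \<Lambda> * (M * t powr N')" unfolding tg1 using N' a2 by (intro est) auto
      then show "s x * \<bar>g1 (s x)\<bar> \<le> \<Lambda> * (M * t powr N')" using t by (simp add: t_def abs_mult)
      have "N' * (N' - 1) + a * (a - 1) \<le> \<Lambda>" using N' by (simp add: \<Lambda>_def a_def power2_eq_square algebra_simps)
      then have "\<bar>t\<^sup>2 * g2 t\<bar> \<le> \<Lambda> * (M * t powr N')" unfolding tg2 using N' a2 by (intro est) auto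
      then show "(s x)\<^sup>2 * \<bar>g2 (s x)\<bar> \<le> \<Lambda> * (M * t powr N')" by (simp add: t_def abs_mult)
      show "\<Lambda> * (M * t powr N') \<le> K * s x" using small by (simp add: t_def)
    qed
    have "t\<^sup>2 * g2 t - (N' - 2) * (t * g1 t) - N' * g t = - (\<epsilon> * (M * ((N' + 3/2) / 2 * t powr a)))"
      unfolding tg1 tg2 unfolding g_def a_def by (simp add: field_simps)
    then have rad: "kap CARD('n) k * (1 * ((s x)\<^sup>2 * g2 (s x) - (real CARD('n) - 2) * (s x * g1 (s x)) - real CARD('n) * g (s x)))
        = - (\<epsilon> * (kap CARD('n) k * (M * ((N' + 3/2) / 2 * s x powr a))))"
      unfolding N'_def[symmetric] t_def[symmetric] by (simp add: mult_ac)
    have "\<bar>R (\<lambda>x. w x + g (s x)) x - R w x + \<epsilon> * (kap CARD('n) k * (M * ((N' + 3/2) / 2 * s x powr a)))\<bar> \<le> C * \<Lambda> * s x * (M * t powr N')"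
      using conjunct2[OF main] unfolding rad by (simp add: mult_ac)
    also have "\<dots> \<le> (C + C * \<Lambda>) * s x * (M * t powr N')"
      using C M t by (intro mult_right_mono) (auto simp: t_def)
    finally show "\<bar>R (\<lambda>x. w x + \<epsilon> * (M * (s x powr N' - s x powr a))) x - R w x + \<epsilon> * (kap CARD('n) k * (M * ((N' + 3/2) / 2 * s x powr a)))\<bar>
         \<le> (C + C * \<Lambda>) * s x * (M * s x powr N') \<and> jet_bound (C + C * \<Lambda>) (\<lambda>x. w x + \<epsilon> * (M * (s x powr N' - s x powr a))) x"
      using jet_bound_mono[OF conjunct1[OF main], of "C + C * \<Lambda>"] C \<Lambda>0 x by (simp add: g_def t_def)
  qed
qed

end

subsection \<open>Comparison\<close>

lemma transpose_A_of:
  assumes "smooth_on_open u S" "x \<in> S"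
  shows "transpose (A_of u x) = A_of u x"
proof -
  have "hess u x $ j $ i = hess u x $ i $ j" for i j
    using arg_cong[OF transpose_hess[OF assms], of "\<lambda>A. A $ i $ j"] by (simp add: transpose_def)
  then show ?thesis by (simp add: A_of_def vec_eq_iff transpose_def outer_def mat_def mult.commute)
qed

text \<open>At a maximum of u - v the gradients agree and the Hessian difference D is nonpositive.
  The two matrices then differ by (n - 2) D plus trace D times the identity, which is nonpositive
  too.\<close>

lemma sigma_comparison:
  fixes u v :: "real^'n::finite \<Rightarrow> real"
  assumes u: "smooth_on_open u S" and v: "smooth_on_open v S" and x: "x \<in> S"
    and mx: "\<And>y. y \<in> S \<Longrightarrow> u y - v y \<le> u x - v x"
    and n: "2 \<le> CARD('n)" and k: "k \<le> CARD('n)" and cone: "in_cone k (eigvals (A_of u x))"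
  shows "sigma k (A_of u x) \<le> sigma k (A_of v x)"
proof (rule sigma_mono[OF transpose_A_of[OF u x] transpose_A_of[OF v x] _ k cone])
  have uv: "smooth_on_open (\<lambda>x. u x - v x) S" by (rule smooth_diff[OF u v])
  have g: "grad u x = grad v x" using local_max_grad_hess(1)[OF uv x mx] grad_diff[OF u v x] by simp
  define D where "D = hess u x - hess v x"
  have D: "\<xi> \<bullet> (D *v \<xi>) \<le> 0" for \<xi> using local_max_grad_hess(2)[OF uv x mx] hess_diff[OF u v x] by (simp add: D_def)
  have "D $ i $ i \<le> 0" for i
    using D[of "axis i 1"] by (simp add: inner_axis' matrix_vector_mult_basis column_def)
  then have trD: "trace D \<le> 0" unfolding trace_def by (intro sum_nonpos) auto
  fix \<xi> :: "real^'n"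
  have lap: "laplacian u x = laplacian v x + trace D" by (simp add: laplacian_def D_def trace_sub)
  have hu: "hess u x = hess v x + D" by (simp add: D_def)
  have "A_of u x = A_of v x + ((real CARD('n) - 2) *\<^sub>R D + trace D *\<^sub>R mat 1)"
    unfolding A_of_def g lap hu by (simp add: algebra_simps)
  then have "\<xi> \<bullet> (A_of u x *v \<xi>) = \<xi> \<bullet> (A_of v x *v \<xi>) + ((real CARD('n) - 2) * (\<xi> \<bullet> (D *v \<xi>)) + trace D * (\<xi> \<bullet> \<xi>))"
    by (simp add: matrix_vector_mult_add_rdistrib scaleR_matrix_vector_assoc[symmetric] inner_add_right)
  moreover have "(real CARD('n) - 2) * (\<xi> \<bullet> (D *v \<xi>)) \<le> 0" using D n by (intro mult_nonneg_nonpos) auto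
  moreover have "trace D * (\<xi> \<bullet> \<xi>) \<le> 0" using trD by (intro mult_nonpos_nonneg) auto
  ultimately show "\<xi> \<bullet> (A_of u x *v \<xi>) \<le> \<xi> \<bullet> (A_of v x *v \<xi>)" by linarith
qed

section \<open>Hyperbolic metrics of balls and of their exteriors\<close>

lemma A_of_neg_log:
  fixes f :: "real^'n::finite \<Rightarrow> real"
  assumes f: "smooth_on_open f S" and x: "x \<in> S" and pos: "\<And>x. x \<in> S \<Longrightarrow> f x > 0"
  shows "A_of (\<lambda>x. - ln (f x)) x = inverse ((f x)\<^sup>2) *\<^sub>R
    (((real CARD('n) - 1) * (grad f x \<bullet> grad f x)) *\<^sub>R mat 1 - f x *\<^sub>R ((real CARD('n) - 2) *\<^sub>R hess f x + laplacian f x *\<^sub>R mat 1))"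
proof -
  define a where "a = inverse (f x)"
  define p where "p = grad f x" define H where "H = hess f x"
  have af: "a * f x = 1" using pos[OF x] by (simp add: a_def)
  have g: "grad (\<lambda>x. - ln (f x)) x = (- a) *\<^sub>R p"
    unfolding p_def by (rule grad_comp_real[OF f x]) (use DERIV_minus[OF DERIV_ln[OF pos[OF x]]] in \<open>simp add: a_def\<close>)
  have h: "hess (\<lambda>x. - ln (f x)) x = (- a) *\<^sub>R H + (a * a) *\<^sub>R outer p p"
    unfolding p_def H_def a_def
  proof (rule hess_comp_real[OF f x, where T = "{0<..}" and ?h1.0 = "\<lambda>t. - inverse t" and ?h2.0 = "\<lambda>t. inverse t * inverse t"])
    show "f ` S \<subseteq> {0<..}" using pos by auto
    show "((\<lambda>t. - ln t) has_real_derivative - inverse t) (at t)" if "t \<in> {0<..}" for t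
      using DERIV_minus[OF DERIV_ln[of t]] that by simp
    show "((\<lambda>t. - inverse t) has_real_derivative inverse t * inverse t) (at t)" if "t \<in> {0<..}" for t
      using that by (auto intro!: derivative_eq_intros)
  qed
  have l: "laplacian (\<lambda>x. - ln (f x)) x = a * a * (p \<bullet> p) - a * laplacian f x"
    by (simp add: laplacian_def h trace_add trace_sub H_def)
  have n2: "(norm ((- a) *\<^sub>R p))\<^sup>2 = a * a * (p \<bullet> p)" unfolding power2_norm_eq_inner by simp
  define c where "c = real CARD('n) - 2"
  have n1: "real CARD('n) - 1 = c + 1" by (simp add: c_def)
  have key: "c * (- (a * h) + a * a * (pi * pj)) + (a * a * pp - a * l) * \<delta> + c * (a * a * pp * \<delta> - (a * pi) * (a * pj))
     = a * a * ((c + 1) * pp * \<delta> - d * (c * h + l * \<delta>))" if "a * d = 1" for h pi pj pp l \<delta> d :: real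
    using that by algebra
  have "inverse ((f x)\<^sup>2) = a * a" by (simp add: a_def power2_eq_square)
  then show ?thesis
    unfolding A_of_def g h l n2 p_def[symmetric] H_def[symmetric] c_def[symmetric] n1 vec_eq_iff
    using key[OF af] by (auto simp: outer_def mat_def)
qed

text \<open>The Poincare metrics of a ball (\<open>\<epsilon> = 1\<close>) and of the exterior of a ball (\<open>\<epsilon> = -1\<close>) are
  \<open>exp (-2 log f) g\<^sub>0\<close> for this \<open>f\<close>.\<close>
definition ball_fun :: "real \<Rightarrow> real^'n::finite \<Rightarrow> real \<Rightarrow> real^'n \<Rightarrow> real" where
  "ball_fun \<epsilon> c \<rho> x = \<epsilon> / (2 * \<rho>) * (\<rho>\<^sup>2 - (x - c) \<bullet> (x - c))"

lemma smooth_ball_fun: "open S \<Longrightarrow> smooth_on_open (ball_fun \<epsilon> c \<rho>) S"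
  unfolding ball_fun_def[abs_def]
  by (intro smooth_mult smooth_diff smooth_const smooth_inner) (auto intro: smooth_diff smooth_nth smooth_const)

text \<open>The Hessian of \<open>ball_fun\<close> is a multiple of the identity and its squared
  gradient is |x - c|^2 / \<rho>^2; together they make the matrix exactly (n - 1) / f^2 times the
  identity, so these are exact admissible solutions.\<close>

lemma ball_fun_hyperbolic:
  fixes c :: "real^'n::finite"
  assumes \<epsilon>: "\<epsilon> = 1 \<or> \<epsilon> = -1" and \<rho>: "\<rho> > 0" and S: "open S" and pos: "\<And>x. x \<in> S \<Longrightarrow> ball_fun \<epsilon> c \<rho> x > 0" and x: "x \<in> S"
    and n: "2 \<le> CARD('n)" and k: "k \<le> CARD('n)"
  shows "smooth_on_open (\<lambda>x. - ln (ball_fun \<epsilon> c \<rho> x)) S"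
    and "sigma k (A_of (\<lambda>x. - ln (ball_fun \<epsilon> c \<rho> x)) x) = Qzero CARD('n) k * exp (2 * real k * - ln (ball_fun \<epsilon> c \<rho> x))"
    and "in_cone k (eigvals (A_of (\<lambda>x. - ln (ball_fun \<epsilon> c \<rho> x)) x))"
proof -
  let ?f = "ball_fun \<epsilon> c \<rho>"
  have sf: "smooth_on_open ?f S" by (rule smooth_ball_fun[OF S])
  then show "smooth_on_open (\<lambda>x. - ln (?f x)) S" by (intro smooth_uminus smooth_ln pos)
  have gr: "grad ?f z = (- \<epsilon> / \<rho>) *\<^sub>R (z - c)" for z
  proof (rule has_derivative_imp_grad)
    have "(?f has_derivative (\<lambda>h. \<epsilon> / (2 * \<rho>) * (0 - ((z - c) \<bullet> (h - 0) + (h - 0) \<bullet> (z - c))))) (at z)"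
      unfolding ball_fun_def[abs_def] by (intro derivative_intros)
    moreover have "\<epsilon> / (2 * \<rho>) * (0 - ((z - c) \<bullet> (h - 0) + (h - 0) \<bullet> (z - c))) = (- \<epsilon> / \<rho>) *\<^sub>R (z - c) \<bullet> h" for h
    proof -
      have "\<epsilon> / (2 * \<rho>) * (0 - (m + m)) = (- \<epsilon> / \<rho>) * m" for m using \<rho> by (simp add: field_simps)
      from this[of "(z - c) \<bullet> h"] show ?thesis by (simp only: diff_zero inner_scaleR_left inner_commute[of h])
    qed
    ultimately show "(?f has_derivative (\<lambda>h. (- \<epsilon> / \<rho>) *\<^sub>R (z - c) \<bullet> h)) (at z)" by simp
  qed
  have pd: "partial_deriv j ?f = (\<lambda>z. (- \<epsilon> / \<rho>) * (z $ j - c $ j))" for j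
    using gr by (auto simp: grad_def vec_eq_iff fun_eq_iff)
  have he: "hess ?f z = (- \<epsilon> / \<rho>) *\<^sub>R mat 1" for z
  proof -
    have "partial_deriv i (partial_deriv j ?f) z = (- \<epsilon> / \<rho>) * (if i = j then 1 else 0)" for i j
    proof -
      have "((\<lambda>z. (- \<epsilon> / \<rho>) * (z $ j - c $ j)) has_derivative (\<lambda>h. (- \<epsilon> / \<rho>) * (h $ j - 0))) (at z)"
        by (intro derivative_intros bounded_linear_imp_has_derivative bounded_linear_vec_nth)
      from has_derivative_imp_partial_deriv[OF this, of i] show ?thesis unfolding pd by (simp add: axis_def eq_commute)
    qed
    then show ?thesis by (simp add: hess_def vec_eq_iff mat_def)
  qed
  have fx: "?f x > 0" by (rule pos[OF x])
  define lam where "lam = (real CARD('n) - 1) * inverse ((?f x)\<^sup>2)"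
  have \<epsilon>2: "\<epsilon> * \<epsilon> = 1" using \<epsilon> by auto
  have A: "A_of (\<lambda>x. - ln (?f x)) x = lam *\<^sub>R mat 1"
  proof -
    define z where "z = (x - c) \<bullet> (x - c)"
    have gg: "grad ?f x \<bullet> grad ?f x = z / \<rho>\<^sup>2" 
    proof -
      have "(- \<epsilon> / \<rho>) * ((- \<epsilon> / \<rho>) * z) = (\<epsilon> * \<epsilon>) * (z / \<rho>\<^sup>2)" by (simp add: power2_eq_square)
      then show ?thesis by (simp only: gr inner_scaleR_left inner_scaleR_right z_def[symmetric] \<epsilon>2 mult_1)
    qed
    have lap: "laplacian ?f x = - \<epsilon> / \<rho> * real CARD('n)" by (simp add: laplacian_def he)
    have f\<epsilon>: "?f x * (\<epsilon> / \<rho>) = (1 - z / \<rho>\<^sup>2) / 2"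
    proof -
      have "?f x * (\<epsilon> / \<rho>) = (\<epsilon> * \<epsilon>) * ((\<rho>\<^sup>2 - z) / (2 * \<rho>\<^sup>2))" using \<rho> by (simp add: ball_fun_def z_def power2_eq_square field_simps)
      then show ?thesis using \<rho> \<epsilon>2 by (simp add: field_simps)
    qed
    have "((real CARD('n) - 1) * (z / \<rho>\<^sup>2)) *\<^sub>R mat 1 - ?f x *\<^sub>R ((real CARD('n) - 2) *\<^sub>R ((- \<epsilon> / \<rho>) *\<^sub>R mat 1) + (- \<epsilon> / \<rho> * real CARD('n)) *\<^sub>R mat 1)
       = ((real CARD('n) - 1) * (z / \<rho>\<^sup>2) + (?f x * (\<epsilon> / \<rho>)) * (2 * real CARD('n) - 2)) *\<^sub>R (mat 1 :: real^'n^'n)"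
    proof -
      have "a *\<^sub>R mat 1 - f *\<^sub>R (b *\<^sub>R ((- e) *\<^sub>R mat 1) + (- e * m) *\<^sub>R mat 1) = (a + f * e * (b + m)) *\<^sub>R (mat 1 :: real^'n^'n)" for a b e f m
        by (auto simp: vec_eq_iff mat_def algebra_simps)
      from this[of _ _ "real CARD('n) - 2" "\<epsilon> / \<rho>" "real CARD('n)"] show ?thesis by simp
    qed
    also have "(real CARD('n) - 1) * (z / \<rho>\<^sup>2) + (?f x * (\<epsilon> / \<rho>)) * (2 * real CARD('n) - 2) = real CARD('n) - 1"
    proof -
      have "(m - 1) * y + (1 - y) / 2 * (2 * m - 2) = m - 1" for m y :: real by (simp add: field_simps)
      then show ?thesis unfolding f\<epsilon> .
    qed
    finally have "inverse ((?f x)\<^sup>2) *\<^sub>R (((real CARD('n) - 1) * (grad ?f x \<bullet> grad ?f x)) *\<^sub>R mat 1 - ?f x *\<^sub>R ((real CARD('n) - 2) *\<^sub>R hess ?f x + laplacian ?f x *\<^sub>R mat 1))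
      = inverse ((?f x)\<^sup>2) *\<^sub>R ((real CARD('n) - 1) *\<^sub>R mat 1)"
      unfolding gg he lap by (simp only:)
    moreover have "A_of (\<lambda>x. - ln (?f x)) x = inverse ((?f x)\<^sup>2) *\<^sub>R (((real CARD('n) - 1) * (grad ?f x \<bullet> grad ?f x)) *\<^sub>R mat 1 - ?f x *\<^sub>R ((real CARD('n) - 2) *\<^sub>R hess ?f x + laplacian ?f x *\<^sub>R mat 1))"
      by (rule A_of_neg_log[OF sf x pos])
    ultimately have "A_of (\<lambda>x. - ln (?f x)) x = inverse ((?f x)\<^sup>2) *\<^sub>R ((real CARD('n) - 1) *\<^sub>R mat 1)"
      by (rule trans[rotated])
    then show ?thesis by (simp add: lam_def mult.commute)
  qed
  have "exp (2 * real k * - ln (?f x)) = inverse ((?f x)\<^sup>2) ^ k"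
  proof -
    have "2 * real k * - ln (?f x) = real k * ln (inverse ((?f x)\<^sup>2))" using fx by (simp add: ln_inverse ln_realpow)
    then have "exp (2 * real k * - ln (?f x)) = exp (ln (inverse ((?f x)\<^sup>2))) ^ k" by (simp only: exp_of_nat_mult)
    then show ?thesis using fx by simp
  qed
  then show "sigma k (A_of (\<lambda>x. - ln (?f x)) x) = Qzero CARD('n) k * exp (2 * real k * - ln (?f x))"
    unfolding A using k by (simp add: sigma_scalar Qzero_def lam_def power_mult_distrib)
  have "lam > 0" using fx n by (simp add: lam_def)
  then have "lam *\<^sub>R (mat 1 :: real^'n^'n) \<in> posdef_matrices"
    by (auto simp: posdef_matrices_def sym_matrices_def transpose_scaleR scaleR_matrix_vector_assoc[symmetric])
  then show "in_cone k (eigvals (A_of (\<lambda>x. - ln (?f x)) x))" unfolding A using in_cone_posdef k by blast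
qed

text \<open>Blow-up at each boundary point keeps the sublevel set away from the frontier. This
  replaces boundary values when a maximum has to be attained.\<close>

lemma compact_sublevel:
  fixes u :: "'a::heine_borel \<Rightarrow> real"
  assumes op: "open \<Omega>" and bd: "bounded \<Omega>" and u: "continuous_on \<Omega> u"
    and blow: "\<And>p. p \<in> frontier \<Omega> \<Longrightarrow> filterlim u at_top (at p within \<Omega>)"
  shows "compact {x \<in> \<Omega>. u x \<le> L}"
proof -
  let ?K = "{x \<in> \<Omega>. u x \<le> L}"
  have "x \<in> ?K" if x: "x \<in> closure ?K" for x
  proof (rule ccontr)
    assume nK: "x \<notin> ?K"
    have "\<exists>U. open U \<and> x \<in> U \<and> U \<inter> ?K = {}"
    proof (cases "x \<in> \<Omega>")
      case True
      then have "x \<in> \<Omega> \<inter> u -` {L<..}" using nK by auto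
      moreover have "open (\<Omega> \<inter> u -` {L<..})" by (rule continuous_open_preimage[OF u op]) auto
      ultimately show ?thesis by (intro exI[of _ "\<Omega> \<inter> u -` {L<..}"]) auto
    next
      case False
      have "x \<in> closure \<Omega>" using x closure_mono[of ?K \<Omega>] by auto
      then have "x \<in> frontier \<Omega>" using False op by (simp add: frontier_def interior_open)
      then have "eventually (\<lambda>y. L < u y) (at x within \<Omega>)" using blow filterlim_at_top_dense by blast
      then obtain U where "open U" "x \<in> U" "\<And>y. y \<in> U \<Longrightarrow> y \<noteq> x \<Longrightarrow> y \<in> \<Omega> \<Longrightarrow> L < u y"
        unfolding eventually_at_topological by blast
      then show ?thesis using False by (intro exI[of _ U]) force
    qed
    then show False using x open_Int_closure_eq_empty by blast
  qed
  then have "closed ?K" using closure_subset_eq by blast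
  moreover have "bounded ?K" by (rule bounded_subset[OF bd]) auto
  ultimately show ?thesis by (simp add: compact_eq_bounded_closed)
qed

section \<open>Comparison of a solution with explicit functions\<close>

lemma Qzero_pos: "2 \<le> n \<Longrightarrow> k \<le> n \<Longrightarrow> Qzero n k > 0"
  by (simp add: Qzero_def)

context
  fixes \<Omega> :: "(real^'n::finite) set" and u k
  assumes sol: "is_solution k \<Omega> u" and n: "2 \<le> CARD('n)" and k: "1 \<le> k" "k \<le> CARD('n)"
    and op: "open \<Omega>" and bd: "bounded \<Omega>"
begin

lemma solution_smooth: "smooth_on_open u \<Omega>" using sol by (simp add: is_solution_def)

lemma solution_sigma: "x \<in> \<Omega> \<Longrightarrow> sigma k (A_of u x) = Qzero CARD('n) k * exp (2 * real k * u x)"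
  using sol by (simp add: is_solution_def Qzero_def)

lemma solution_cone: "x \<in> \<Omega> \<Longrightarrow> in_cone k (eigvals (A_of u x))"
  using sol Gamma_plus_in_cone(2)[OF _ k(2)] by (auto simp: is_solution_def)

text \<open>The right-hand side is strictly increasing in u, so the inequality between the
  \<open>\<sigma>_k\<close> at the maximum becomes one between the values. The supersolution
  property is asked only at that point.\<close>

lemma solution_le_at_max:
  assumes S: "S \<subseteq> \<Omega>" and v: "smooth_on_open v S" and x: "x \<in> S" and mx: "\<And>y. y \<in> S \<Longrightarrow> u y - v y \<le> u x - v x"
    and sup: "sigma k (A_of v x) \<le> Qzero CARD('n) k * exp (2 * real k * v x)"
  shows "u x \<le> v x"
proof -
  have "open S" using v by (simp add: smooth_on_open_def)
  have "sigma k (A_of u x) \<le> sigma k (A_of v x)"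
    by (rule sigma_comparison[OF smooth_subset[OF solution_smooth \<open>open S\<close> S] v x mx n k(2)]) (use x S solution_cone in auto)
  then have "Qzero CARD('n) k * exp (2 * real k * u x) \<le> Qzero CARD('n) k * exp (2 * real k * v x)"
    using solution_sigma x S sup by (metis order_trans subsetD)
  then show ?thesis using Qzero_pos[OF n k(2)] k(1) by simp
qed

lemma solution_ge_at_min:
  assumes S: "S \<subseteq> \<Omega>" and v: "smooth_on_open v S" and x: "x \<in> S" and mx: "\<And>y. y \<in> S \<Longrightarrow> v y - u y \<le> v x - u x"
    and sub: "sigma k (A_of v x) \<ge> Qzero CARD('n) k * exp (2 * real k * v x)" and cone: "in_cone k (eigvals (A_of v x))"
  shows "v x \<le> u x"
proof -
  have "open S" using v by (simp add: smooth_on_open_def)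
  have "sigma k (A_of v x) \<le> sigma k (A_of u x)"
    by (rule sigma_comparison[OF v smooth_subset[OF solution_smooth \<open>open S\<close> S] x mx n k(2) cone])
  then have "Qzero CARD('n) k * exp (2 * real k * v x) \<le> Qzero CARD('n) k * exp (2 * real k * u x)"
    using solution_sigma x S sub by (metis order_trans subsetD)
  then show ?thesis using Qzero_pos[OF n k(2)] k(1) by simp
qed

text \<open>Instead of u + log f its exponential is maximised: it is continuous on the closed ball
  and vanishes on the sphere, so a value above 1 is maximal at an interior point.\<close>

lemma solution_interior_ball:
  assumes \<rho>: "\<rho> > 0" and sub: "cball c \<rho> \<subseteq> \<Omega>" and x: "x \<in> ball c \<rho>"
  shows "exp (u x) * ball_fun 1 c \<rho> x \<le> 1"
proof (rule ccontr)
  assume big: "\<not> ?thesis"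
  let ?f = "ball_fun 1 c \<rho>"
  have f_iff: "?f z > 0 \<longleftrightarrow> z \<in> ball c \<rho>" for z
  proof -
    have "?f z > 0 \<longleftrightarrow> (norm (z - c))\<^sup>2 < \<rho>\<^sup>2" using \<rho> by (simp add: ball_fun_def power2_norm_eq_inner zero_less_divide_iff zero_less_mult_iff)
    also have "\<dots> \<longleftrightarrow> norm (z - c) < \<rho>"
      using \<rho> power_strict_mono[of "norm (z - c)" \<rho> 2] power2_less_imp_less[of "norm (z - c)" \<rho>] by auto
    finally show ?thesis by (simp add: dist_norm norm_minus_commute)
  qed
  have "continuous_on (cball c \<rho>) (\<lambda>x. exp (u x) * ?f x)"
    using smooth_continuous[OF solution_smooth] continuous_on_subset[OF _ sub] smooth_continuous[OF smooth_ball_fun[OF open_UNIV, of 1 c \<rho>]]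
    by (intro continuous_intros) (auto intro: continuous_on_subset)
  moreover have "cball c \<rho> \<noteq> {}" using \<rho> by auto
  ultimately obtain z where z: "z \<in> cball c \<rho>" and mx: "\<And>y. y \<in> cball c \<rho> \<Longrightarrow> exp (u y) * ?f y \<le> exp (u z) * ?f z"
    using continuous_attains_sup[OF compact_cball, of c \<rho> "\<lambda>x. exp (u x) * ?f x"] by blast
  have zb: "exp (u z) * ?f z > 1" using mx[of x] x big by (auto simp: not_le)
  then have fz: "?f z > 0" by (smt (verit) exp_gt_zero mult_nonneg_nonpos)
  have lnf: "u y - (- ln (?f y)) = ln (exp (u y) * ?f y)" if "y \<in> ball c \<rho>" for y
    using f_iff[of y] that by (simp add: ln_mult)
  have "u z \<le> - ln (?f z)"
  proof (rule solution_le_at_max[of "ball c \<rho>"])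
    show "ball c \<rho> \<subseteq> \<Omega>" using sub by auto
    show zS: "z \<in> ball c \<rho>" using f_iff fz by simp
    show "smooth_on_open (\<lambda>x. - ln (?f x)) (ball c \<rho>)"
      by (rule ball_fun_hyperbolic(1)[OF _ \<rho> open_ball _ zS n k(2)]) (use f_iff in auto)
    have "sigma k (A_of (\<lambda>x. - ln (?f x)) z) = Qzero CARD('n) k * exp (2 * real k * - ln (?f z))"
      by (rule ball_fun_hyperbolic(2)[OF _ \<rho> open_ball _ zS n k(2)]) (use f_iff in auto)
    then show "sigma k (A_of (\<lambda>x. - ln (?f x)) z) \<le> Qzero CARD('n) k * exp (2 * real k * - ln (?f z))" by simp
    show "u y - - ln (?f y) \<le> u z - - ln (?f z)" if "y \<in> ball c \<rho>" for y
      unfolding lnf[OF that] lnf[OF zS] using mx[of y] that f_iff[of y] by (intro ln_mono) (auto intro: mult_pos_pos)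
  qed
  then have "ln (exp (u z) * ?f z) \<le> 0" using fz by (simp add: ln_mult)
  then show False using zb by simp
qed

text \<open>The quotient exp (- u) / f tends to 0 at the frontier because u blows up and f stays
  positive, so a value above 1 forces an interior maximum.\<close>

lemma solution_exterior_ball:
  assumes \<rho>: "\<rho> > 0" and sep: "\<And>z. z \<in> closure \<Omega> \<Longrightarrow> \<rho> < dist c z" and x: "x \<in> \<Omega>"
  shows "exp (- u x) \<le> ball_fun (-1) c \<rho> x"
proof (rule ccontr)
  assume big: "\<not> ?thesis"
  let ?f = "ball_fun (-1) c \<rho>"
  have fpos: "?f z > 0" if "z \<in> closure \<Omega>" for z
  proof -
    have "\<rho> < norm (z - c)" using sep[OF that] by (simp add: dist_norm norm_minus_commute)
    then have "\<rho>\<^sup>2 < (norm (z - c))\<^sup>2" using \<rho> by (intro power_strict_mono) auto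
    then show ?thesis using \<rho> by (simp add: ball_fun_def power2_norm_eq_inner divide_simps)
  qed
  have fc: "continuous_on A ?f" for A
    using smooth_continuous[OF smooth_ball_fun[OF open_UNIV, of "-1" c \<rho>]] continuous_on_subset by blast
  have "compact (closure \<Omega>)" using bd by (simp add: compact_closure)
  moreover have "closure \<Omega> \<noteq> {}" using x by auto
  ultimately obtain z0 where z0: "z0 \<in> closure \<Omega>" and mn: "\<And>z. z \<in> closure \<Omega> \<Longrightarrow> ?f z0 \<le> ?f z"
    using continuous_attains_inf[OF _ _ fc[of "closure \<Omega>"]] by blast
  \<comment> \<open>Where the quotient exceeds 1, u is below - log f, hence at most
    \<open>L\<close>; such points lie in a compact sublevel set.\<close>
  define L where "L = - ln (?f z0)"
  define K where "K = {x \<in> \<Omega>. u x \<le> L}"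
  have uc: "continuous_on \<Omega> u" by (rule smooth_continuous[OF solution_smooth])
  have cK: "compact K" unfolding K_def by (rule compact_sublevel[OF op bd uc]) (use sol in \<open>auto simp: is_solution_def\<close>)
  have K\<Omega>: "K \<subseteq> \<Omega>" by (auto simp: K_def)
  have bigK: "y \<in> K" if "y \<in> \<Omega>" "exp (- u y) / ?f y > 1" for y
  proof -
    have "y \<in> closure \<Omega>" using that closure_subset by auto
    then have "?f y < exp (- u y)" "?f z0 \<le> ?f y" using that fpos mn by (auto simp: less_divide_eq)
    then have "ln (?f z0) \<le> ln (exp (- u y))" using fpos[OF z0] by (intro ln_mono) auto
    then have "ln (?f z0) \<le> - u y" by simp
    then show ?thesis using that by (simp add: K_def L_def)
  qed
  have x1: "exp (- u x) / ?f x > 1" using big fpos[of x] subsetD[OF closure_subset x] by (auto simp: less_divide_eq not_le)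
  then have "K \<noteq> {}" using bigK x by auto
  moreover have "continuous_on K (\<lambda>x. exp (- u x) / ?f x)"
    using continuous_on_subset[OF uc K\<Omega>] fc fpos K\<Omega> closure_subset by (intro continuous_intros) (auto, fastforce)
  ultimately obtain z where z: "z \<in> K" and mx: "\<And>y. y \<in> K \<Longrightarrow> exp (- u y) / ?f y \<le> exp (- u z) / ?f z"
    using continuous_attains_sup[OF cK, of "\<lambda>x. exp (- u x) / ?f x"] by blast
  have zb: "exp (- u z) / ?f z > 1" using mx[OF bigK[OF x x1]] x1 by linarith
  have all: "exp (- u y) / ?f y \<le> exp (- u z) / ?f z" if "y \<in> \<Omega>" for y
    using mx[of y] bigK[OF that] zb by (cases "exp (- u y) / ?f y > 1") auto
  have z\<Omega>: "z \<in> \<Omega>" using z K\<Omega> by auto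
  have pos: "?f y > 0" if "y \<in> \<Omega>" for y using fpos that closure_subset by auto
  have lnf: "- ln (?f y) - u y = ln (exp (- u y) / ?f y)" if "y \<in> \<Omega>" for y
    using pos[OF that] by (simp add: ln_div)
  note hyp = ball_fun_hyperbolic[OF _ \<rho> op pos z\<Omega> n k(2)]
  have "- ln (?f z) \<le> u z"
  proof (rule solution_ge_at_min[of \<Omega>, OF _ _ z\<Omega>])
    show "smooth_on_open (\<lambda>x. - ln (?f x)) \<Omega>" by (rule hyp(1)) auto
    show "Qzero CARD('n) k * exp (2 * real k * - ln (?f z)) \<le> sigma k (A_of (\<lambda>x. - ln (?f x)) z)" by (subst hyp(2)) auto
    show "in_cone k (eigvals (A_of (\<lambda>x. - ln (?f x)) z))" by (rule hyp(3)) auto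
    show "- ln (?f y) - u y \<le> - ln (?f z) - u z" if "y \<in> \<Omega>" for y
      unfolding lnf[OF that] lnf[OF z\<Omega>] using all[OF that] pos[OF that] by (intro ln_mono) auto
  qed auto
  then have "ln (exp (- u z) / ?f z) \<le> 0" using lnf[OF z\<Omega>] by simp
  then show False using zb by simp
qed

end

subsection \<open>Barriers near the boundary\<close>

text \<open>Lets the radii of balls at positive distance from the frontier increase to that of the
  touching ball.\<close>

lemma le_one_limit:
  fixes f :: "real \<Rightarrow> real"
  assumes ab: "a < b" and f: "isCont f b" and le: "\<And>t. a < t \<Longrightarrow> t < b \<Longrightarrow> f t \<le> L"
  shows "f b \<le> L"
proof (rule tendsto_upperbound[of f _ "at_left b"])
  show "(f \<longlongrightarrow> f b) (at_left b)" using f by (simp add: isCont_def filterlim_at_split)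
  show "\<forall>\<^sub>F t in at_left b. f t \<le> L" using eventually_at_left_real[OF ab] by eventually_elim (use le in auto)
qed simp

lemma scaled_posdef:
  fixes E :: "real^'n::finite^'n"
  assumes E: "transpose E = E" "norm E < c" and a: "0 < a"
  shows "a *\<^sub>R (c *\<^sub>R mat 1 + E) \<in> posdef_matrices"
  unfolding posdef_matrices_def sym_matrices_def
proof (intro CollectI conjI allI impI)
  show "transpose (a *\<^sub>R (c *\<^sub>R mat 1 + E)) = a *\<^sub>R (c *\<^sub>R mat 1 + E)" using E by (simp add: transpose_scaleR transpose_add)
  fix v :: "real^'n" assume v: "v \<noteq> 0"
  have "\<bar>v \<bullet> (E *v v)\<bar> \<le> norm E * (norm v)\<^sup>2" by (rule quadratic_form_bound)
  also have "\<dots> < c * (norm v)\<^sup>2" using E v by (intro mult_strict_right_mono) auto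
  finally have "0 < c * (v \<bullet> v) + v \<bullet> (E *v v)" by (simp add: dot_square_norm)
  then show "0 < v \<bullet> ((a *\<^sub>R (c *\<^sub>R mat 1 + E)) *v v)"
    using a by (simp add: scaleR_matrix_vector_assoc[symmetric] matrix_add_scalar_vector inner_add_right)
qed

section \<open>The linear bound and the final comparison\<close>

context smooth_collar
begin

lemma T_\<Omega>: "x \<in> T \<Longrightarrow> x \<in> \<Omega>" using s_nonpos[of x] by (force simp: T_def)

text \<open>Compares with the interior touching ball at the nearest boundary point. On the normal
  its function is d (1 - d / (2 r)), which deviates from d only to second order.\<close>

lemma rough_upper:
  assumes u: "is_solution k \<Omega> u" and x: "x \<in> \<Omega>" "s x \<le> r / 2"
  shows "u x + ln (s x) \<le> s x / r"
proof -
  define d where "d = s x"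
  have d: "0 < d" "d \<le> r / 2" using s_pos x by (auto simp: d_def)
  obtain y where y: "y \<in> F" "dist x y = \<bar>s x\<bar>" by (rule nearest)
  have eq: "x = y + d *\<^sub>R N y" using nearest_eq[OF y] by (simp add: d_def)
  define c where "c = y + r *\<^sub>R N y"
  have sub: "ball c r \<subseteq> \<Omega>" using touch[OF y(1)] by (simp add: touching_normal_def c_def)
  have "x - c = (d - r) *\<^sub>R N y" by (simp add: eq c_def algebra_simps)
  then have xc: "norm (x - c) = r - d" using norm_N[OF y(1)] d by simp
  then have xc2: "(x - c) \<bullet> (x - c) = (r - d)\<^sup>2" by (simp add: dot_square_norm)
  define g where "g \<rho> = exp (u x) * (1 / (2 * \<rho>) * (\<rho>\<^sup>2 - (r - d)\<^sup>2))" for \<rho>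
  have "g r \<le> 1"
  proof (rule le_one_limit[of "r - d" r g])
    show "isCont g r" unfolding g_def[abs_def] using r by (auto intro!: continuous_intros)
    fix \<rho> assume \<rho>: "r - d < \<rho>" "\<rho> < r"
    have "exp (u x) * ball_fun 1 c \<rho> x \<le> 1"
    proof (rule solution_interior_ball[OF u n2 k1 kn op bounded])
      show "\<rho> > 0" using \<rho> d r by auto
      show "cball c \<rho> \<subseteq> \<Omega>" using sub \<rho> by (auto simp: subset_iff)
      show "x \<in> ball c \<rho>" using xc \<rho> by (simp add: dist_norm norm_minus_commute)
    qed
    then show "g \<rho> \<le> 1" by (simp add: ball_fun_def xc2 g_def)
  qed (use d in simp)
  moreover have "1 / (2 * r) * (r\<^sup>2 - (r - d)\<^sup>2) = d * (1 - d / (2 * r))" using r by (simp add: power2_eq_square field_simps)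
  ultimately have le: "exp (u x) * d * (1 - d / (2 * r)) \<le> 1" by (simp only: g_def mult.assoc)
  define z where "z = d / (2 * r)"
  have z: "0 \<le> z" "z \<le> 1 / 4" using d r by (auto simp: z_def field_simps)
  \<comment> \<open>The factor 1 + 2 z compensates 1 - z for z up to 1/2, and 2 z is d / r.\<close>
  have "exp (u x) * d \<le> exp (u x) * d * ((1 - z) * (1 + 2 * z))"
  proof -
    have "1 \<le> (1 - z) * (1 + 2 * z)" using z mult_left_mono[of z "1/2" z] by (simp add: algebra_simps)
    then have "exp (u x) * d * 1 \<le> exp (u x) * d * ((1 - z) * (1 + 2 * z))" by (rule mult_left_mono) (use d in simp)
    then show ?thesis by (simp only: mult_1_right)
  qed
  also have "\<dots> = (exp (u x) * d * (1 - z)) * (1 + 2 * z)" by (simp only: mult.assoc)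
  also have "\<dots> \<le> 1 * (1 + 2 * z)" using le z by (intro mult_right_mono) (auto simp: z_def)
  also have "\<dots> \<le> exp (2 * z)" using exp_ge_add_one_self[of "2 * z"] by simp
  finally have "ln (exp (u x) * d) \<le> ln (exp (2 * z))" using d by (intro ln_mono) auto
  then show ?thesis using d by (simp add: ln_mult z_def d_def)
qed

text \<open>The mirror image with the exterior touching ball, where the function is d (1 + d / (2
  r)); smaller concentric balls are strictly separated from the closure.\<close>

lemma rough_lower:
  assumes u: "is_solution k \<Omega> u" and x: "x \<in> \<Omega>" "s x \<le> r / 2"
  shows "- (s x / r) \<le> u x + ln (s x)"
proof -
  define d where "d = s x"
  have d: "0 < d" "d \<le> r / 2" using s_pos x by (auto simp: d_def)
  obtain y where y: "y \<in> F" "dist x y = \<bar>s x\<bar>" by (rule nearest)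
  have eq: "x = y + d *\<^sub>R N y" using nearest_eq[OF y] by (simp add: d_def)
  define c where "c = y - r *\<^sub>R N y"
  have "ball c r \<inter> \<Omega> = {}" using touch[OF y(1)] by (simp add: touching_normal_def c_def)
  then have "ball c r \<inter> closure \<Omega> = {}" by (simp add: open_Int_closure_eq_empty)
  then have sep: "r \<le> dist c z" if "z \<in> closure \<Omega>" for z using that by (auto simp: disjoint_iff not_less)
  have "x - c = (d + r) *\<^sub>R N y" by (simp add: eq c_def algebra_simps)
  then have xc: "norm (x - c) = r + d" using norm_N[OF y(1)] d r by simp
  then have xc2: "(x - c) \<bullet> (x - c) = (r + d)\<^sup>2" by (simp add: dot_square_norm)
  define g where "g \<rho> = exp (- u x) - (- 1 / (2 * \<rho>) * (\<rho>\<^sup>2 - (r + d)\<^sup>2))" for \<rho>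
  have "g r \<le> 0"
  proof (rule le_one_limit[of 0 r g])
    show "isCont g r" unfolding g_def[abs_def] using r by (auto intro!: continuous_intros)
    fix \<rho> assume \<rho>: "0 < \<rho>" "\<rho> < r"
    have "exp (- u x) \<le> ball_fun (-1) c \<rho> x"
      by (rule solution_exterior_ball[OF u n2 k1 kn op bounded \<rho>(1) _ x(1)]) (use sep \<rho> in force)
    then show "g \<rho> \<le> 0" by (simp add: ball_fun_def xc2 g_def)
  qed (use r in simp)
  moreover have "- 1 / (2 * r) * (r\<^sup>2 - (r + d)\<^sup>2) = d * (1 + d / (2 * r))" using r by (simp add: power2_eq_square field_simps)
  ultimately have "exp (- u x) \<le> d * (1 + d / (2 * r))" unfolding g_def by linarith
  also have "\<dots> \<le> d * exp (d / (2 * r))" using exp_ge_add_one_self[of "d / (2 * r)"] d by (intro mult_left_mono) auto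
  finally have "ln (exp (- u x)) \<le> ln (d * exp (d / (2 * r)))" by (intro ln_mono) auto
  then have "- u x \<le> ln d + d / (2 * r)" using d by (simp add: ln_mult)
  moreover have "d / (2 * r) \<le> d / r" using d r by (simp add: frac_le)
  ultimately show ?thesis by (simp add: d_def)
qed

text \<open>Replaces boundary values on the outer side: since h is at most C s, the points where h
  reaches its value at \<open>x0\<close> stay at a fixed distance from the frontier, so they lie in
  a compact set. On the inner edge h is not positive.\<close>

lemma collar_max:
  assumes \<delta>: "0 < \<delta>" "\<delta> \<le> q1" and h: "continuous_on T h" and C: "C > 0"
    and le: "\<And>x. x \<in> T \<Longrightarrow> s x \<le> \<delta> \<Longrightarrow> h x \<le> C * s x" and bd: "\<And>x. x \<in> T \<Longrightarrow> s x = \<delta> \<Longrightarrow> h x \<le> 0"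
    and x0: "x0 \<in> T" "s x0 \<le> \<delta>" "h x0 > 0"
  obtains z where "0 < s z" "s z < \<delta>" "h z > 0" "\<And>y. 0 < s y \<Longrightarrow> s y < \<delta> \<Longrightarrow> h y \<le> h z"
proof -
  define K where "K = {x \<in> Tc. h x0 / C \<le> s x \<and> s x \<le> \<delta>}"
  have K: "K = Tc \<inter> {x. h x0 / C \<le> s x \<and> s x \<le> \<delta>}" by (auto simp: K_def)
  have "closed {x. h x0 / C \<le> s x \<and> s x \<le> \<delta>}" by (intro closed_Collect_conj closed_Collect_le continuous_intros continuous_s)
  then have "compact K" unfolding K using compact_Tc by (rule compact_Int_closed[rotated])
  have pos: "h x0 / C > 0" using x0 C by simp
  have KT: "K \<subseteq> T" using pos by (force simp: K_def T_def Tc_def)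
  have in_K: "x \<in> K" if "0 < s x" "s x \<le> \<delta>" "h x0 \<le> h x" for x
  proof -
    have "x \<in> T" using that \<delta> by (auto simp: T_def)
    then have "h x0 \<le> C * s x" using le that by fastforce
    then show ?thesis using that C \<delta> by (simp add: K_def Tc_def pos_divide_le_eq mult.commute)
  qed
  have "x0 \<in> K" using in_K[of x0] x0 by (auto simp: T_def)
  then obtain z where z: "z \<in> K" and mx: "\<And>y. y \<in> K \<Longrightarrow> h y \<le> h z"
    using continuous_attains_sup[OF \<open>compact K\<close>, of h] continuous_on_subset[OF h KT] by blast
  have hz: "h x0 \<le> h z" using mx \<open>x0 \<in> K\<close> by auto
  show ?thesis
  proof (rule that[of z])
    show "0 < s z" using z KT by (auto simp: T_def)
    show "h z > 0" using hz x0 by simp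
    then show "s z < \<delta>" using bd[of z] z KT by (force simp: K_def)
    show "h y \<le> h z" if "0 < s y" "s y < \<delta>" for y
      using mx[of y] in_K[of y] that hz by (cases "h x0 \<le> h y") auto
  qed
qed

lemma sigma_residual:
  assumes \<phi>: "smooth_on_open \<phi> S" and x: "x \<in> S"
  shows "sigma k (A_of (\<lambda>x. \<phi> x - ln (s x)) x) - Qzero CARD('n) k * exp (2 * real k * (\<phi> x - ln (s x))) = inverse ((s x)\<^sup>2) ^ k * R \<phi> x"
    and "A_of (\<lambda>x. \<phi> x - ln (s x)) x = inverse ((s x)\<^sup>2) *\<^sub>R
      ((real CARD('n) - 1) *\<^sub>R mat 1 + Emat (s x) (grad s x) (hess s x) (grad \<phi> x) (hess \<phi> x))"
proof -
  have sx: "0 < s x" and xW: "x \<in> W" using x subs by (auto simp: S_def)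
  show A: "A_of (\<lambda>x. \<phi> x - ln (s x)) x = inverse ((s x)\<^sup>2) *\<^sub>R
      ((real CARD('n) - 1) *\<^sub>R mat 1 + Emat (s x) (grad s x) (hess s x) (grad \<phi> x) (hess \<phi> x))"
    by (rule A_of_log[OF \<phi> smooth_s_S x _ norm_grad_W[OF xW]]) (simp add: S_def)
  have "transpose ((real CARD('n) - 1) *\<^sub>R mat 1 + Emat (s x) (grad s x) (hess s x) (grad \<phi> x) (hess \<phi> x))
     = (real CARD('n) - 1) *\<^sub>R mat 1 + Emat (s x) (grad s x) (hess s x) (grad \<phi> x) (hess \<phi> x)"
    by (simp add: transpose_add transpose_scaleR transpose_Emat transpose_hess[OF smooth_s_S x] transpose_hess[OF \<phi> x])
  then have "sigma k (A_of (\<lambda>x. \<phi> x - ln (s x)) x) = inverse ((s x)\<^sup>2) ^ k *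
      sigma k ((real CARD('n) - 1) *\<^sub>R mat 1 + Emat (s x) (grad s x) (hess s x) (grad \<phi> x) (hess \<phi> x))"
    unfolding A by (rule sigma_scale[OF _ kn])
  moreover have "exp (2 * real k * (\<phi> x - ln (s x))) = inverse ((s x)\<^sup>2) ^ k * exp (2 * real k * \<phi> x)"
  proof -
    have "2 * real k * (\<phi> x - ln (s x)) = real k * ln (inverse ((s x)\<^sup>2)) + 2 * real k * \<phi> x"
      using sx by (simp add: ln_inverse ln_realpow algebra_simps)
    then have "exp (2 * real k * (\<phi> x - ln (s x))) = exp (ln (inverse ((s x)\<^sup>2))) ^ k * exp (2 * real k * \<phi> x)"
      by (simp only: exp_add exp_of_nat_mult)
    then show ?thesis using sx by simp
  qed
  ultimately show "sigma k (A_of (\<lambda>x. \<phi> x - ln (s x)) x) - Qzero CARD('n) k * exp (2 * real k * (\<phi> x - ln (s x))) = inverse ((s x)\<^sup>2) ^ k * R \<phi> x"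
    by (simp add: R_def Res_def right_diff_distrib)
qed

text \<open>The constants are fixed in the order K, C, \<delta>, M, all before any solution is
  considered. Thus \<delta> must not depend on M, although M grows as \<delta> shrinks.\<close>

lemma asymptotic_expansion:
  obtains c c1 M \<delta> where "\<And>i. smooth_on_open (c i) W" "smooth_on_open c1 W" "M > 0" "0 < \<delta>" "\<delta> \<le> q1"
    "\<And>u x. is_solution k \<Omega> u \<Longrightarrow> x \<in> T \<Longrightarrow> s x \<le> \<delta> \<Longrightarrow>
       \<bar>u x + ln (s x) - (expand c (CARD('n) - 1) x + c1 (proj x) * (s x ^ CARD('n) * ln (s x)))\<bar> \<le> M * s x ^ CARD('n)"
proof -
  obtain c c1 K where c: "\<And>i. smooth_on_open (c i) W" "smooth_on_open c1 W" and K: "K \<ge> 0"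
    and wS0: "smooth_on_open (\<lambda>x. expand c (CARD('n) - 1) x + c1 (proj x) * (s x ^ CARD('n) * ln (s x))) S"
    and wj0: "\<And>x. x \<in> T \<Longrightarrow> jet_bound K (\<lambda>x. expand c (CARD('n) - 1) x + c1 (proj x) * (s x ^ CARD('n) * ln (s x))) x"
    and wR0: "\<And>x. x \<in> T \<Longrightarrow> \<bar>R (\<lambda>x. expand c (CARD('n) - 1) x + c1 (proj x) * (s x ^ CARD('n) * ln (s x))) x\<bar> \<le> K * s x ^ Suc CARD('n) * (1 + \<bar>ln (s x)\<bar>)"
    by (rule approximate_solution) blast
  define w where "w x = expand c (CARD('n) - 1) x + c1 (proj x) * (s x ^ CARD('n) * ln (s x))" for x
  note wS = wS0[folded w_def] and wj = wj0[folded w_def] and wR = wR0[folded w_def]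
  define n' where "n' = real CARD('n)"
  have n': "n' \<ge> 3" using n3 by (simp add: n'_def)
  \<comment> \<open>The linear bound on u + log s contributes 1 / r, the approximate solution
    contributes K, and 1 is spare.\<close>
  define C1 where "C1 = 1 / r + K + 1"
  have C1: "C1 > 0" using r K by (simp add: C1_def add_pos_nonneg)
  define \<Lambda> where "\<Lambda> = 2 * (n' + 1)\<^sup>2"
  \<comment> \<open>Made so that M s^n at most 2 C1 s, the only size restriction M will satisfy,
    implies the smallness hypothesis of \<open>barrier_residual\<close>.\<close>
  define K' where "K' = K + \<Lambda> * (2 * C1)"
  have K': "K' \<ge> 0" "K \<le> K'" using K C1 by (auto simp: K'_def \<Lambda>_def)
  obtain C where C: "C \<ge> 0" "\<And>x M \<epsilon>. x \<in> T \<Longrightarrow> 0 \<le> M \<Longrightarrow> (\<epsilon> = 1 \<or> \<epsilon> = -1) \<Longrightarrow> \<Lambda> * (M * s x powr n') \<le> K' * s x \<Longrightarrow>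
    \<bar>R (\<lambda>x. w x + \<epsilon> * (M * (s x powr n' - s x powr (n' + 1/2)))) x - R w x
       + \<epsilon> * (kap CARD('n) k * (M * ((n' + 3/2) / 2 * s x powr (n' + 1/2))))\<bar> \<le> C * s x * (M * s x powr n')
    \<and> jet_bound C (\<lambda>x. w x + \<epsilon> * (M * (s x powr n' - s x powr (n' + 1/2)))) x"
    using barrier_residual[OF wS jet_bound_mono[OF wj K'(2)] K'(1)] unfolding n'_def[symmetric] \<Lambda>_def[symmetric] by blast
  obtain KH where KH: "KH \<ge> 0" "\<And>x. x \<in> Tc \<Longrightarrow> norm (hess s x) \<le> KH" by (rule smooth_W_bound[OF sW]) blast
  define CE where "CE = (real CARD('n) + 2) * (C + KH + (C\<^sup>2 + 2 * C) * norm (mat 1 :: real^'n^'n) + 2 * C + C\<^sup>2)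
       + real CARD('n) * (C + KH) * norm (mat 1 :: real^'n^'n)"
  have CE: "CE \<ge> 0" using C KH by (simp add: CE_def)
  define \<kappa> where "\<kappa> = kap CARD('n) k"
  have \<kappa>: "\<kappa> > 0" unfolding \<kappa>_def by (rule kap0)
  \<comment> \<open>A bound for the fourth root of s. One entry absorbs the residual of the
    approximate solution, the other the nonlinear error of the barrier, each into half of the good
    term.\<close>
  define \<zeta> where "\<zeta> = min 1 (min (\<kappa> * C1 / (5 * (K + 1))) (\<kappa> / (2 * (C + 1))))"
  have \<zeta>: "0 < \<zeta>" "\<zeta> \<le> 1" "5 * K * \<zeta> \<le> \<kappa> * C1" "C * \<zeta> \<le> \<kappa> / 2"
  proof -
    show "0 < \<zeta>" "\<zeta> \<le> 1" using \<kappa> C1 C K by (auto simp: \<zeta>_def)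
    have "\<zeta> \<le> \<kappa> * C1 / (5 * (K + 1))" by (simp add: \<zeta>_def)
    then have "\<zeta> * (5 * (K + 1)) \<le> \<kappa> * C1" using K by (simp add: pos_le_divide_eq)
    then show "5 * K * \<zeta> \<le> \<kappa> * C1" using \<open>0 < \<zeta>\<close> by (simp add: algebra_simps)
    have "\<zeta> \<le> \<kappa> / (2 * (C + 1))" by (simp add: \<zeta>_def)
    then have "\<zeta> * (2 * (C + 1)) \<le> \<kappa>" using C by (simp add: pos_le_divide_eq)
    then show "C * \<zeta> \<le> \<kappa> / 2" using \<open>0 < \<zeta>\<close> by (simp add: algebra_simps)
  qed
  \<comment> \<open>The entry with \<open>CE\<close> keeps the matrix of the lower barrier positive
    definite.\<close>
  define \<delta> where "\<delta> = min q1 (min (\<zeta> ^ 4) (1 / (CE + 1)))"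
  have \<delta>: "0 < \<delta>" "\<delta> \<le> q1" "\<delta> \<le> \<zeta> ^ 4" "\<delta> \<le> 1 / 4" "\<delta> \<le> 1 / (CE + 1)" using q1 \<zeta> CE by (auto simp: \<delta>_def)
  have CE\<delta>: "CE * \<delta> < 1"
  proof -
    have "CE * \<delta> \<le> CE * (1 / (CE + 1))" using \<delta> CE by (intro mult_left_mono) auto
    also have "\<dots> < 1" using CE by (simp add: field_simps)
    finally show ?thesis .
  qed
  \<comment> \<open>Then M t^n is at most 2 C1 t up to \<delta>, with equality at \<delta>. Since
    the square root of \<delta> is at most 1/2, the barrier there is at least C1 \<delta>, which
    beats the linear bound.\<close>
  define M where "M = 2 * C1 * \<delta> powr (1 - n')"
  have M0: "M > 0" using C1 \<delta> by (simp add: M_def)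
  have MC1: "2 * C1 \<le> M"
  proof -
    have "1 powr (1 - n') \<le> \<delta> powr (1 - n')" using \<delta> n' by (intro powr_mono2') auto
    then show ?thesis using C1 by (simp add: M_def)
  qed
  have Ms: "M * t powr n' \<le> 2 * C1 * t" if "0 < t" "t \<le> \<delta>" for t
  proof -
    have "t powr n' = t * t powr (n' - 1)" using that powr_add[of t 1 "n' - 1"] by simp
    also have "\<dots> \<le> t * \<delta> powr (n' - 1)" using that n' by (intro mult_left_mono powr_mono2) auto
    finally have "M * t powr n' \<le> M * (t * \<delta> powr (n' - 1))" using M0 by (intro mult_left_mono) auto
    also have "\<dots> = 2 * C1 * t * (\<delta> powr (1 - n') * \<delta> powr (n' - 1))" by (simp add: M_def)
    also have "\<delta> powr (1 - n') * \<delta> powr (n' - 1) = 1" using \<delta> by (simp add: powr_add[symmetric])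
    finally show ?thesis by simp
  qed
  have M\<delta>: "M * \<delta> powr n' = 2 * C1 * \<delta>"
  proof -
    have "\<delta> powr (1 - n') * \<delta> powr n' = \<delta>" using \<delta> by (simp add: powr_add[symmetric])
    then show ?thesis by (simp add: M_def mult.assoc)
  qed
  define \<psi> where "\<psi> t = M * (t powr n' - t powr (n' + 1/2))" for t
  have half: "t powr (n' + 1/2) = t powr n' * sqrt t" if "0 < t" for t
    using that by (simp add: powr_add powr_half_sqrt)
  have \<psi>0: "0 \<le> \<psi> t" if "0 < t" "t \<le> 1" for t
  proof -
    have "t powr (n' + 1/2) \<le> t powr n'" using that by (intro powr_mono') auto
    then show ?thesis using M0 by (simp add: \<psi>_def)
  qed
  have \<psi>\<delta>: "C1 * \<delta> \<le> \<psi> \<delta>"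
  proof -
    have "sqrt \<delta> \<le> sqrt (1 / 4)" using \<delta> by (intro real_sqrt_le_mono) auto
    then have sq: "sqrt \<delta> \<le> 1 / 2" by (simp add: real_sqrt_divide)
    have "\<psi> \<delta> = (M * \<delta> powr n') * (1 - sqrt \<delta>)" using half[OF \<delta>(1)] by (simp add: \<psi>_def algebra_simps)
    also have "\<dots> = 2 * C1 * \<delta> * (1 - sqrt \<delta>)" by (simp only: M\<delta>)
    finally show ?thesis using sq C1 \<delta> mult_left_mono[of "1/2" "1 - sqrt \<delta>" "2 * C1 * \<delta>"] by simp
  qed
  define v where "v \<epsilon> x = w x + \<epsilon> * \<psi> (s x) - ln (s x)" for \<epsilon> x
  define S' where "S' = {x. 0 < s x \<and> s x < \<delta>}"
  have oS': "open S'" unfolding S'_def by (intro open_Collect_conj open_Collect_less continuous_intros continuous_s)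
  have S'T: "S' \<subseteq> T" "S' \<subseteq> S" "S' \<subseteq> \<Omega>" using \<delta> q1 T_\<Omega> by (auto simp: S'_def T_def S_def)
  have \<phi>S: "smooth_on_open (\<lambda>x. w x + \<epsilon> * \<psi> (s x)) S" for \<epsilon>
    unfolding \<psi>_def by (intro smooth_add wS smooth_mult smooth_const open_S smooth_diff smooth_powr smooth_s_S) (auto simp: S_def)
  have vS: "smooth_on_open (v \<epsilon>) S" for \<epsilon>
    unfolding v_def[abs_def] by (intro smooth_diff \<phi>S smooth_ln smooth_s_S) (auto simp: S_def)
  have vS': "smooth_on_open (v \<epsilon>) S'" for \<epsilon> by (rule smooth_subset[OF vS oS' S'T(2)])
  \<comment> \<open>Both barriers at once: \<epsilon> = 1 gives the supersolution and \<epsilon> =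
    -1 the subsolution.\<close>
  have bar: "\<epsilon> * R (\<lambda>x. w x + \<epsilon> * \<psi> (s x)) x \<le> 0 \<and> jet_bound C (\<lambda>x. w x + \<epsilon> * \<psi> (s x)) x"
    if x: "x \<in> S'" and \<epsilon>: "\<epsilon> = 1 \<or> \<epsilon> = -1" for x \<epsilon>
  proof -
    define t where "t = s x"
    have t: "0 < t" "t \<le> \<delta>" "t \<le> 1" using x \<delta> by (auto simp: S'_def t_def)
    have xT: "x \<in> T" using x S'T by auto
    have "M * t powr n' \<le> 2 * C1 * t" by (rule Ms[OF t(1,2)])
    then have "\<Lambda> * (M * t powr n') \<le> \<Lambda> * (2 * C1 * t)" by (intro mult_left_mono) (auto simp: \<Lambda>_def)
    also have "\<dots> \<le> K' * t" using K t by (simp add: K'_def algebra_simps)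
    finally have "\<Lambda> * (M * s x powr n') \<le> K' * s x" by (simp add: t_def)
    from C(2)[OF xT less_imp_le[OF M0] \<epsilon> this]
    have main: "\<bar>R (\<lambda>x. w x + \<epsilon> * \<psi> (s x)) x - R w x + \<epsilon> * (\<kappa> * (M * ((n' + 3/2) / 2 * t powr (n' + 1/2))))\<bar> \<le> C * t * (M * t powr n')"
      and jb: "jet_bound C (\<lambda>x. w x + \<epsilon> * \<psi> (s x)) x"
      unfolding \<psi>_def t_def \<kappa>_def by auto
    define Rv where "Rv = R (\<lambda>x. w x + \<epsilon> * \<psi> (s x)) x"
    have "\<epsilon> * Rv \<le> \<bar>R w x\<bar> - \<kappa> * (M * ((n' + 3/2) / 2 * t powr (n' + 1/2))) + C * t * (M * t powr n')"
      using main \<epsilon> unfolding Rv_def[symmetric] by auto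
    moreover have "\<bar>R w x\<bar> \<le> t powr n' * (K * t * (1 + \<bar>ln t\<bar>))"
    proof -
      have "t powr n' = t ^ CARD('n)" using t by (simp add: n'_def powr_realpow)
      then show ?thesis using wR[OF xT] by (simp add: t_def mult_ac)
    qed
    moreover have "\<kappa> * (M * ((n' + 3/2) / 2 * t powr (n' + 1/2))) \<ge> t powr n' * (\<kappa> * M * sqrt t)"
    proof -
      have "1 * (\<kappa> * M * (t powr n' * sqrt t)) \<le> (n' + 3/2) / 2 * (\<kappa> * M * (t powr n' * sqrt t))"
        using n' \<kappa> M0 t by (intro mult_right_mono) auto
      then show ?thesis unfolding half[OF t(1)] by (simp add: mult_ac)
    qed
    moreover have "C * t * (M * t powr n') = t powr n' * (C * t * M)" by simp
    ultimately have "\<epsilon> * Rv \<le> t powr n' * (K * t * (1 + \<bar>ln t\<bar>)) - t powr n' * (\<kappa> * M * sqrt t) + t powr n' * (C * t * M)"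
      by linarith
    also have "\<dots> = t powr n' * (K * t * (1 + \<bar>ln t\<bar>) - \<kappa> * M * sqrt t + C * t * M)" by (simp only: distrib_left right_diff_distrib)
    also have "\<dots> \<le> 0"
    proof (rule mult_nonneg_nonpos)
      \<comment> \<open>After division by the square root of t the residual contains z^2 (1 + 4 |log
        z|), which is at most 5 z; a fourth root thus suffices to absorb the logarithm.\<close>
      define z where "z = sqrt (sqrt t)"
      have z: "0 < z" "z * z = sqrt t" "z \<le> 1" using t by (auto simp: z_def)
      have tz: "t = z ^ 4" "t = sqrt t * (z * z)"
        using t z(2) real_sqrt_mult_self[of t] by (auto simp: power4_eq_xxxx mult.assoc)
      have "z ^ 4 \<le> \<zeta> ^ 4" using t \<delta> tz by simp
      then have z\<zeta>: "z \<le> \<zeta>" using \<zeta> z by (intro power_le_imp_le_base[of z 3 \<zeta>]) auto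
      have lnt: "\<bar>ln t\<bar> = 4 * \<bar>ln z\<bar>" unfolding tz(1) using z by (simp add: ln_realpow abs_mult)
      have zz: "z * z * (1 + \<bar>ln t\<bar>) \<le> 5 * z"
      proof -
        have "z * z * (1 + \<bar>ln t\<bar>) = z * (z + 4 * (z * \<bar>ln z\<bar>))" unfolding lnt by (simp add: algebra_simps)
        also have "\<dots> \<le> z * (1 + 4 * 1)" using z t_abs_ln_le[OF z(1,3)] by (intro mult_left_mono add_mono) auto
        finally show ?thesis by simp
      qed
      have "K * (z * z * (1 + \<bar>ln t\<bar>)) \<le> K * (5 * z)" using zz K by (rule mult_left_mono)
      also have "\<dots> \<le> 5 * K * \<zeta>" using z\<zeta> K by (simp add: mult_left_mono)
      also have "\<dots> \<le> \<kappa> * C1" by (rule \<zeta>(3))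
      also have "\<dots> \<le> \<kappa> * (M / 2)" using MC1 \<kappa> by (intro mult_left_mono) auto
      finally have 1: "K * (z * z * (1 + \<bar>ln t\<bar>)) \<le> \<kappa> * M / 2" by simp
      have "C * (z * z) \<le> C * (\<zeta> * 1)" using z z\<zeta> C \<zeta> by (intro mult_left_mono mult_mono) auto
      then have "C * (z * z) * M \<le> \<kappa> / 2 * M" using \<zeta>(4) M0 by (intro mult_right_mono) auto
      then have 2: "C * (z * z) * M \<le> \<kappa> * M / 2" by simp
      have "K * t * (1 + \<bar>ln t\<bar>) - \<kappa> * M * sqrt t + C * t * M = sqrt t * (K * (z * z * (1 + \<bar>ln t\<bar>)) + C * (z * z) * M - \<kappa> * M)"
      proof -
        have "K * (y * a) * b - \<kappa> * M * y + C * (y * a) * M = y * (K * (a * b) + C * a * M - \<kappa> * M)" for y a b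
          by (simp add: algebra_simps)
        from this[of "sqrt t" "z * z" "1 + \<bar>ln t\<bar>"] show ?thesis using tz(2) by simp
      qed
      also have "\<dots> \<le> 0" using 1 2 t by (intro mult_nonneg_nonpos) auto
      finally show "K * t * (1 + \<bar>ln t\<bar>) - \<kappa> * M * sqrt t + C * t * M \<le> 0" .
    qed simp
    finally show ?thesis using jb by (simp add: Rv_def)
  qed
  have sgn: "\<epsilon> * (sigma k (A_of (v \<epsilon>) x) - Qzero CARD('n) k * exp (2 * real k * v \<epsilon> x)) \<le> 0"
    if x: "x \<in> S'" and \<epsilon>: "\<epsilon> = 1 \<or> \<epsilon> = -1" for x \<epsilon>
  proof -
    have "x \<in> S" using x S'T by auto
    have "\<epsilon> * (sigma k (A_of (v \<epsilon>) x) - Qzero CARD('n) k * exp (2 * real k * v \<epsilon> x)) = inverse ((s x)\<^sup>2) ^ k * (\<epsilon> * R (\<lambda>x. w x + \<epsilon> * \<psi> (s x)) x)"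
      using sigma_residual(1)[OF \<phi>S \<open>x \<in> S\<close>, of \<epsilon>] by (simp add: v_def[abs_def])
    also have "\<dots> \<le> 0" by (rule mult_nonneg_nonpos) (use bar[OF x \<epsilon>] in auto)
    finally show ?thesis .
  qed
  \<comment> \<open>In the lower comparison the barrier has the smaller matrix, so its admissibility
    must be checked; it is near a positive multiple of the identity.\<close>
  have cone: "in_cone k (eigvals (A_of (v (-1)) x))" if x: "x \<in> S'" for x
  proof (rule in_cone_posdef[OF _ kn])
    have xS: "x \<in> S" and xT: "x \<in> T" using x S'T by auto
    let ?\<phi> = "\<lambda>x. w x + (-1) * \<psi> (s x)"
    have sx: "0 < s x" "s x \<le> 1" "s x < \<delta>" using x \<delta> by (auto simp: S'_def)
    have jb: "jet_bound C ?\<phi> x" using bar[OF x, of "-1"] by auto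
    have "norm (Emat (s x) (grad s x) (hess s x) (grad ?\<phi> x) (hess ?\<phi> x)) \<le> CE * s x"
      unfolding CE_def
      by (rule Emat_bound[OF sx(1,2) _ _ C(1)]) (use norm_grad_W[of x] KH(2)[of x] xT subs jb in \<open>auto simp: jet_bound_def\<close>)
    also have "\<dots> \<le> CE * \<delta>" using sx CE by (intro mult_left_mono) auto
    also have "\<dots> < real CARD('n) - 1" using CE\<delta> n' by (simp add: n'_def)
    finally have small: "norm (Emat (s x) (grad s x) (hess s x) (grad ?\<phi> x) (hess ?\<phi> x)) < real CARD('n) - 1" .
    have "A_of (v (-1)) x = inverse ((s x)\<^sup>2) *\<^sub>R ((real CARD('n) - 1) *\<^sub>R mat 1 + Emat (s x) (grad s x) (hess s x) (grad ?\<phi> x) (hess ?\<phi> x))"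
      using sigma_residual(2)[OF \<phi>S xS, of "-1"] by (simp add: v_def[abs_def])
    moreover have "transpose (Emat (s x) (grad s x) (hess s x) (grad ?\<phi> x) (hess ?\<phi> x)) = Emat (s x) (grad s x) (hess s x) (grad ?\<phi> x) (hess ?\<phi> x)"
      by (intro transpose_Emat transpose_hess[OF smooth_s_S xS] transpose_hess[OF \<phi>S xS])
    ultimately show "A_of (v (-1)) x \<in> posdef_matrices" using scaled_posdef[OF _ small] sx by simp
  qed
  show ?thesis
  proof (rule that[OF c M0 \<delta>(1,2)])
    fix u x assume u: "is_solution k \<Omega> u" and x: "x \<in> T" "s x \<le> \<delta>"
    note sol = u n2 k1 kn op bounded
    have uS: "smooth_on_open u \<Omega>" by (rule solution_smooth[OF sol])
    have T\<Omega>: "T \<subseteq> \<Omega>" using T_\<Omega> by auto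
    have close: "\<bar>u y + ln (s y) - w y\<bar> \<le> C1 * s y" if y: "y \<in> T" for y
    proof -
      have sy: "0 < s y" "s y \<le> r / 2" "y \<in> \<Omega>" using y q1 T_\<Omega> by (auto simp: T_def)
      have "\<bar>u y + ln (s y)\<bar> \<le> s y / r" using rough_upper[OF u sy(3,2)] rough_lower[OF u sy(3,2)] by (simp add: abs_le_iff)
      moreover have "\<bar>w y\<bar> \<le> K * s y" using wj[OF y] by (simp add: jet_bound_def)
      moreover have "C1 * s y = s y / r + K * s y + s y" by (simp add: C1_def algebra_simps)
      ultimately show ?thesis using sy(1) by linarith
    qed
    have contT: "continuous_on T (\<lambda>y. \<epsilon> * (u y - v \<epsilon> y))" for \<epsilon>
      using smooth_continuous[OF uS] smooth_continuous[OF vS] T\<Omega> subs(2)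
      by (intro continuous_intros) (auto intro: continuous_on_subset)
    \<comment> \<open>Near the frontier the linear bound controls the difference, on the inner edge
      the choice of M does, and in between the comparison at an extremum contradicts a positive
      value.\<close>
    have main: "\<epsilon> * (u x - v \<epsilon> x) \<le> 0" if \<epsilon>: "\<epsilon> = 1 \<or> \<epsilon> = -1" for \<epsilon>
    proof (rule ccontr)
      assume "\<not> ?thesis"
      then have h0: "\<epsilon> * (u x - v \<epsilon> x) > 0" by simp
      have \<epsilon>2: "\<epsilon> * (\<epsilon> * a) = a" for a using \<epsilon> by auto
      have heq: "\<epsilon> * (u y - v \<epsilon> y) = \<epsilon> * (u y + ln (s y) - w y) - \<psi> (s y)" for y
        using \<epsilon>2[of "\<psi> (s y)"] by (simp add: v_def algebra_simps)
      have hle: "\<epsilon> * (u y - v \<epsilon> y) \<le> C1 * s y - \<psi> (s y)" if "y \<in> T" for y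
        unfolding heq using close[OF that] \<epsilon> by auto
      obtain z where z: "0 < s z" "s z < \<delta>" "\<epsilon> * (u z - v \<epsilon> z) > 0" "\<And>y. 0 < s y \<Longrightarrow> s y < \<delta> \<Longrightarrow> \<epsilon> * (u y - v \<epsilon> y) \<le> \<epsilon> * (u z - v \<epsilon> z)"
      proof (rule collar_max[OF \<delta>(1,2) contT[of \<epsilon>] C1 _ _ x h0])
        show "\<epsilon> * (u y - v \<epsilon> y) \<le> C1 * s y" if "y \<in> T" "s y \<le> \<delta>" for y
          using hle[OF that(1)] \<psi>0[of "s y"] that \<delta> by (auto simp: T_def)
        show "\<epsilon> * (u y - v \<epsilon> y) \<le> 0" if "y \<in> T" "s y = \<delta>" for y
          using hle[OF that(1)] \<psi>\<delta> that by simp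
      qed blast
      have zS: "z \<in> S'" using z by (simp add: S'_def)
      from \<epsilon> show False
      proof
        assume e: "\<epsilon> = 1"
        have "u z \<le> v \<epsilon> z"
          by (rule solution_le_at_max[OF sol S'T(3) vS' zS]) (use z(4) sgn[OF zS \<epsilon>] e in \<open>auto simp: S'_def\<close>)
        then show False using z(3) e by simp
      next
        assume e: "\<epsilon> = -1"
        have "v \<epsilon> z \<le> u z"
          by (rule solution_ge_at_min[OF sol S'T(3) vS' zS]) (use z(4) sgn[OF zS \<epsilon>] e cone[OF zS] in \<open>auto simp: S'_def\<close>)
        then show False using z(3) e by simp
      qed
    qed
    have sx: "0 < s x" using x by (simp add: T_def)
    have "\<bar>u x + ln (s x) - w x\<bar> \<le> \<psi> (s x)" using main[of 1] main[of "-1"] by (auto simp: v_def abs_le_iff)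
    also have "\<dots> \<le> M * s x powr n'" using M0 by (simp add: \<psi>_def)
    also have "s x powr n' = s x ^ CARD('n)" using sx by (simp add: n'_def powr_realpow)
    finally show "\<bar>u x + ln (s x) - (expand c (CARD('n) - 1) x + c1 (proj x) * (s x ^ CARD('n) * ln (s x)))\<bar> \<le> M * s x ^ CARD('n)"
      by (simp add: w_def)
  qed
qed

end

text \<open>That the constants depend only on the domain, n and k is expressed by binding them
  before \<open>u\<close>. Uniqueness of the nearest point is included so that \<open>bproj\<close>
  is the coordinate x'.\<close>

theorem theorem1p1:
  fixes \<Omega> :: "(real^'n::finite) set" and k :: nat
  assumes "3 \<le> CARD('n)" and "1 \<le> k" and "k \<le> CARD('n)"
    and "bounded_smooth_domain \<Omega>"
  shows "\<exists>(c :: nat \<Rightarrow> real^'n \<Rightarrow> real) (cn1 :: real^'n \<Rightarrow> real) (C::real) (\<delta>\<^sub>2::real).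
     (\<forall>i\<in>{1..CARD('n) - 1}. smooth_on_subset (c i) (frontier \<Omega>)) \<and>
     smooth_on_subset cn1 (frontier \<Omega>) \<and>
     C > 0 \<and> \<delta>\<^sub>2 > 0 \<and>
     (\<forall>x\<in>collar \<Omega> \<delta>\<^sub>2. unique_nearest \<Omega> x) \<and>
     (\<forall>u. is_solution k \<Omega> u \<longrightarrow>
       (\<forall>x\<in>collar \<Omega> \<delta>\<^sub>2.
          \<bar>u x + ln (bdist \<Omega> x)
           - (\<Sum>i=1..CARD('n) - 1. c i (bproj \<Omega> x) * bdist \<Omega> x ^ i)
           - cn1 (bproj \<Omega> x) * bdist \<Omega> x ^ CARD('n) * ln (bdist \<Omega> x)\<bar>
          \<le> C * bdist \<Omega> x ^ CARD('n)))"
proof -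
  obtain r N q where td: "touching_domain \<Omega> r N" and q: "0 < q" "q \<le> r / 2" "smooth_on_open (sdist \<Omega>) {x. \<bar>sdist \<Omega> x\<bar> < q}"
    using signed_distance_smooth[OF assms(4)] by metis
  interpret touching_domain \<Omega> r N by (rule td)
  interpret smooth_collar \<Omega> r N q k
    using q assms by unfold_locales (auto simp: bounded_smooth_domain_def)
  obtain c c1 M \<delta> where c: "\<And>i. smooth_on_open (c i) W" "smooth_on_open c1 W" and M: "M > 0" and \<delta>: "0 < \<delta>" "\<delta> \<le> q1"
    and est: "\<And>u x. is_solution k \<Omega> u \<Longrightarrow> x \<in> T \<Longrightarrow> s x \<le> \<delta> \<Longrightarrow>
       \<bar>u x + ln (s x) - (expand c (CARD('n) - 1) x + c1 (proj x) * (s x ^ CARD('n) * ln (s x)))\<bar> \<le> M * s x ^ CARD('n)"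
    by (rule asymptotic_expansion) blast
  \<comment> \<open>\<open>W\<close> is an open neighbourhood of the frontier, so a single ambient
    function serves as extension at every point.\<close>
  have restrict: "smooth_on_subset g F" if "smooth_on_open g W" for g :: "real^'n \<Rightarrow> real"
    using that F_W unfolding smooth_on_subset_def by blast
  have col: "x \<in> T \<and> s x \<le> \<delta> \<and> bdist \<Omega> x = s x \<and> unique_nearest \<Omega> x \<and> bproj \<Omega> x = proj x" if x: "x \<in> collar \<Omega> \<delta>" for x
  proof -
    have x\<Omega>: "x \<in> \<Omega>" and bd: "bdist \<Omega> x \<le> \<delta>" using x by (auto simp: collar_def)
    have b: "bdist \<Omega> x = s x" using x\<Omega> by (simp add: bdist_def sdist_def)
    have sx: "0 < s x" by (rule s_pos[OF x\<Omega>])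
    have xT: "x \<in> T" using sx b bd \<delta> by (simp add: T_def)
    have srt: "\<bar>s x\<bar> \<le> r / 2" "0 \<le> s x" "s x < r" using sx b bd \<delta> q1 r by auto
    note p = proj(1,2)[OF srt(1)]
    have uniq: "y = proj x" if "y \<in> F" "dist x y = bdist \<Omega> x" for y
      using nearest_unique[OF srt(2,3) p that(1)] that(2) b sx by simp
    have un: "unique_nearest \<Omega> x" unfolding unique_nearest_def
    proof (rule ex1I[of _ "proj x"])
      show "proj x \<in> F \<and> dist x (proj x) = bdist \<Omega> x" using p b sx by simp
      show "y = proj x" if "y \<in> F \<and> dist x y = bdist \<Omega> x" for y using uniq that by blast
    qed
    have "dist x (closest_point F x) = bdist \<Omega> x"
    proof (rule antisym)
      show "dist x (closest_point F x) \<le> bdist \<Omega> x"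
        using closest_point_le[OF frontier_closed p(1), of x] p(2) b sx by simp
      show "bdist \<Omega> x \<le> dist x (closest_point F x)"
        unfolding bdist_def by (intro infdist_le closest_point_in_set frontier_closed ne)
    qed
    \<comment> \<open>\<open>closest_point\<close> chooses some minimiser; uniqueness identifies it
      with the foot point.\<close>
    then have "bproj \<Omega> x = proj x" unfolding bproj_def by (intro uniq closest_point_in_set frontier_closed ne)
    then show ?thesis using xT b bd un by simp
  qed
  show ?thesis
  proof (rule exI[of _ c], rule exI[of _ c1], rule exI[of _ M], rule exI[of _ \<delta>], intro conjI ballI allI impI)
    fix u x assume u: "is_solution k \<Omega> u" and x: "x \<in> collar \<Omega> \<delta>"
    show "\<bar>u x + ln (bdist \<Omega> x) - (\<Sum>i=1..CARD('n) - 1. c i (bproj \<Omega> x) * bdist \<Omega> x ^ i)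
           - c1 (bproj \<Omega> x) * bdist \<Omega> x ^ CARD('n) * ln (bdist \<Omega> x)\<bar> \<le> M * bdist \<Omega> x ^ CARD('n)"
      using est[OF u, of x] col[OF x] by (simp add: expand_def diff_diff_eq mult.assoc)
  qed (use c restrict M \<delta> col in auto)
qed

end
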